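(* Let $n\ge1$, let $\Omega\subset\mathbb{H}^{n+1}$ be a smooth uniformly h-convex bounded domain, and for $\rho\ge0$ let $\Omega_\rho=\{X\in\mathbb{H}^{n+1}:d_{\mathbb{H}^{n+1}}(X,\Omega)\le\rho\}$. Then for $k=0,1,\dots,n$, $$\widetilde W_k(\Omega_\rho)-\widetilde W_k(\Omega)=\sum_{i=k}^n\binom{n-k}{i-k}\left(\int_{\partial\Omega}p_i(\tilde\kappa)\,d\mu\right)\int_0^\rho e^{(n-k-i)t}\sinh^{i-k}t\,dt .$$
   Context: A smooth bounded domain in $\mathbb{H}^{n+1}$ (compact, connected, nonempty interior, smooth boundary) is uniformly h-convex if for some $\delta>0$ all principal curvatures $\kappa_i$ of its boundary (outward unit normal; positive for geodesic spheres) exceed $1+\delta$. $\tilde\kappa=(\kappa_1-1,\dots,\kappa_n-1)$ are the shifted principal curvatures, $d\mu$ is the area element of the boundary, and $p_m=\binom nm^{-1}\sigma_m$ is the normalized elementary symmetric function, $p_0=1$. The modified quermassintegrals of a smooth domain are defined by $$\widetilde W_0(\Omega)=\mathrm{Vol}(\Omega),\quad\widetilde W_1(\Omega)=\frac1n|\partial\Omega|-\mathrm{Vol}(\Omega),\quad\widetilde W_{k+1}(\Omega)=\frac1{n-k}\int_{\partial\Omega}p_k(\tilde\kappa)\,d\mu-\frac{n-2k}{n-k}\widetilde W_k(\Omega),\ k=1,\dots,n-1.$$ *)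

theory Defs
  imports "HOL-Analysis.Analysis"
begin

section \<open>Smooth maps on open subsets of a Euclidean space\<close>

text \<open>Both predicates are meant for open \<open>S\<close>.\<close>

primrec Ck_on :: "nat \<Rightarrow> 'a::euclidean_space set \<Rightarrow> ('a \<Rightarrow> 'b::real_normed_vector) \<Rightarrow> bool" where
  "Ck_on 0 S f \<longleftrightarrow> continuous_on S f"
| "Ck_on (Suc k) S f \<longleftrightarrow>
     (\<forall>x\<in>S. f differentiable (at x)) \<and> (\<forall>v. Ck_on k S (\<lambda>x. frechet_derivative f (at x) v))"

definition smooth_on :: "'a::euclidean_space set \<Rightarrow> ('a \<Rightarrow> 'b::real_normed_vector) \<Rightarrow> bool" where
  "smooth_on S f \<longleftrightarrow> (\<forall>k. Ck_on k S f)"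

section \<open>The hyperboloid model of hyperbolic space\<close>

text \<open>With \<open>n = CARD('n)\<close>, the index type \<open>'n option\<close> has \<open>n + 1\<close> elements, so
  \<open>'n minkowski\<close> is the Minkowski space of signature \<open>(n + 1, 1)\<close>, its last component being
  time, and \<open>hyp\<close> is the \<open>(n + 1)\<close>-dimensional hyperbolic space.\<close>

type_synonym 'n minkowski = "(real ^ ('n option)) \<times> real"

definition lor :: "('a::real_inner \<times> real) \<Rightarrow> ('a \<times> real) \<Rightarrow> real" where
  "lor X Y = fst X \<bullet> fst Y - snd X * snd Y"

definition hyp :: "('n::finite) minkowski set" where
  "hyp = {X. lor X X = -1 \<and> snd X > 0}"

definition hdist :: "('n::finite) minkowski \<Rightarrow> 'n minkowski \<Rightarrow> real" where
  "hdist X Y = arcosh (- lor X Y)"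

definition hdist_set :: "('n::finite) minkowski \<Rightarrow> 'n minkowski set \<Rightarrow> real" where
  "hdist_set X \<Omega> = (INF Y\<in>\<Omega>. hdist X Y)"

definition parallel_body :: "('n::finite) minkowski set \<Rightarrow> real \<Rightarrow> 'n minkowski set" where
  "parallel_body \<Omega> \<rho> = {X \<in> hyp. hdist_set X \<Omega> \<le> \<rho>}"

definition hyp_tangent :: "('n::finite) minkowski \<Rightarrow> 'n minkowski set" where
  "hyp_tangent p = {v. lor v p = 0}"

text \<open>The projection of Minkowski space onto \<open>hyp_tangent p\<close>, orthogonal for \<open>lor\<close>
  (recall \<open>lor p p = -1\<close>).\<close>

definition hyp_proj :: "('n::finite) minkowski \<Rightarrow> 'n minkowski \<Rightarrow> 'n minkowski" where
  "hyp_proj p w = w + lor w p *\<^sub>R p"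

text \<open>For unit \<open>v \<in> hyp_tangent p\<close>, the unit speed geodesic leaving \<open>p\<close> in direction \<open>v\<close>.\<close>

definition hyp_geodesic :: "('n::finite) minkowski \<Rightarrow> 'n minkowski \<Rightarrow> real \<Rightarrow> 'n minkowski" where
  "hyp_geodesic p v t = cosh t *\<^sub>R p + sinh t *\<^sub>R v"

section \<open>Riemannian volume\<close>

text \<open>The volume density \<open>sqrt (det g)\<close> of a parametrization \<open>\<phi>\<close>, where \<open>g\<close> is the
  pull-back of the Minkowski form.\<close>

definition gram :: "(real ^ 'd \<Rightarrow> ('n::finite) minkowski) \<Rightarrow> real ^ 'd \<Rightarrow> real ^ 'd ^ 'd" where
  "gram \<phi> u = (\<chi> i j. lor (frechet_derivative \<phi> (at u) (axis i 1))
                         (frechet_derivative \<phi> (at u) (axis j 1)))"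

definition vol_density :: "(real ^ 'd \<Rightarrow> ('n::finite) minkowski) \<Rightarrow> real ^ 'd \<Rightarrow> real" where
  "vol_density \<phi> u = sqrt (det (gram \<phi> u))"

text \<open>The vertical projection of the hyperboloid gives a global chart; its inverse is\<close>

definition hyp_chart :: "real ^ ('n option) \<Rightarrow> ('n::finite) minkowski" where
  "hyp_chart x = (x, sqrt (1 + x \<bullet> x))"

definition hvol :: "('n::finite) minkowski set \<Rightarrow> real" where
  "hvol \<Omega> = (LINT x:{x. hyp_chart x \<in> \<Omega>}|lborel. vol_density hyp_chart x)"

section \<open>Domains and their boundary hypersurfaces\<close>

text \<open>Boundary and interior are taken relative to hyperbolic space, whose subspace topology is the
  one induced by \<open>hdist\<close>.\<close>

abbreviation hbd :: "('n::finite) minkowski set \<Rightarrow> 'n minkowski set" where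
  "hbd \<Omega> \<equiv> (top_of_set hyp) frontier_of \<Omega>"

text \<open>Near each of its boundary points a domain with smooth boundary is a sublevel set of a smooth
  function whose differential does not vanish on the tangent space of hyperbolic space.\<close>

definition smooth_boundary :: "('n::finite) minkowski set \<Rightarrow> bool" where
  "smooth_boundary \<Omega> \<longleftrightarrow>
     (\<forall>p\<in>hbd \<Omega>. \<exists>V (f :: 'n minkowski \<Rightarrow> real).
        open V \<and> p \<in> V \<and> smooth_on V f \<and> \<Omega> \<inter> V = {X \<in> hyp \<inter> V. f X \<le> 0} \<and>
        (\<exists>v\<in>hyp_tangent p. frechet_derivative f (at p) v \<noteq> 0))"

definition smooth_bounded_domain :: "('n::finite) minkowski set \<Rightarrow> bool" where
  "smooth_bounded_domain \<Omega> \<longleftrightarrow>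
     \<Omega> \<subseteq> hyp \<and> compact \<Omega> \<and> connected \<Omega> \<and> (top_of_set hyp) interior_of \<Omega> \<noteq> {} \<and>
     smooth_boundary \<Omega>"

definition tangent_space :: "('n::finite) minkowski set \<Rightarrow> 'n minkowski \<Rightarrow> 'n minkowski set" where
  "tangent_space M p =
     {v. \<exists>\<epsilon> \<gamma>. \<epsilon> > 0 \<and> smooth_on {-\<epsilon><..<\<epsilon>} \<gamma> \<and> \<gamma> ` {-\<epsilon><..<\<epsilon>} \<subseteq> M \<and> \<gamma> 0 = p \<and>
            (\<gamma> has_vector_derivative v) (at (0::real))}"

text \<open>The local parametrizations of an \<open>n\<close>-dimensional submanifold \<open>M\<close>, and its Riemannian
  measure (the area element): the Borel measure on \<open>M\<close> which is \<open>sqrt (det g) du\<close> in each of them.\<close>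

definition local_param ::
    "('n::finite) minkowski set \<Rightarrow> (real ^ 'n) set \<Rightarrow> (real ^ 'n \<Rightarrow> 'n minkowski) \<Rightarrow> bool" where
  "local_param M U \<phi> \<longleftrightarrow>
     open U \<and> smooth_on U \<phi> \<and> openin (top_of_set M) (\<phi> ` U) \<and>
     (\<exists>\<psi>. homeomorphism U (\<phi> ` U) \<phi> \<psi>) \<and> (\<forall>u\<in>U. inj (frechet_derivative \<phi> (at u)))"

definition area_measure :: "('n::finite) minkowski set \<Rightarrow> 'n minkowski measure" where
  "area_measure M =
     (THE \<mu>. sets \<mu> = sets (restrict_space borel M) \<and>
        (\<forall>U \<phi> B. local_param M U \<phi> \<longrightarrow> B \<in> sets borel \<longrightarrow> B \<subseteq> U \<longrightarrow>
           emeasure \<mu> (\<phi> ` B) = (\<integral>\<^sup>+u\<in>B. ennreal (vol_density \<phi> u) \<partial>lborel)))"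

section \<open>Principal curvatures\<close>

definition outward_normal :: "('n::finite) minkowski set \<Rightarrow> 'n minkowski \<Rightarrow> 'n minkowski" where
  "outward_normal \<Omega> p =
     (THE \<nu>. \<nu> \<in> hyp_tangent p \<and> lor \<nu> \<nu> = 1 \<and> (\<forall>v\<in>tangent_space (hbd \<Omega>) p. lor \<nu> v = 0) \<and>
        (\<exists>\<epsilon>>0. \<forall>t\<in>{0<..<\<epsilon>}. hyp_geodesic p \<nu> t \<notin> \<Omega>))"

text \<open>The shape operator maps a tangent vector \<open>v\<close> of the boundary to the covariant derivative of
  the outward unit normal in direction \<open>v\<close>. The Levi-Civita connection of the hyperboloid is the
  tangential part of the flat derivative. The normal is only defined along the boundary, and the
  derivative within the boundary is determined only on the tangent space of the boundary. With this
  sign a geodesic sphere of radius \<open>r\<close> has principal curvatures \<open>coth r\<close>.\<close>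

definition shape_operator ::
    "('n::finite) minkowski set \<Rightarrow> 'n minkowski \<Rightarrow> 'n minkowski \<Rightarrow> 'n minkowski" where
  "shape_operator \<Omega> p v =
     hyp_proj p (frechet_derivative (outward_normal \<Omega>) (at p within hbd \<Omega>) v)"

text \<open>The eigenvalues of the shape operator, listed with multiplicity along an orthonormal basis
  of eigenvectors. Their order is left unspecified; they only enter through symmetric expressions.\<close>

definition principal_curvatures :: "('n::finite) minkowski set \<Rightarrow> 'n minkowski \<Rightarrow> real ^ 'n" where
  "principal_curvatures \<Omega> p =
     (SOME \<kappa>. \<exists>e :: 'n \<Rightarrow> 'n minkowski.
        (\<forall>i. e i \<in> tangent_space (hbd \<Omega>) p) \<and>
        (\<forall>i j. lor (e i) (e j) = (if i = j then 1 else 0)) \<and>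
        (\<forall>i. shape_operator \<Omega> p (e i) = (\<kappa> $ i) *\<^sub>R e i))"

definition shifted_curvatures :: "('n::finite) minkowski set \<Rightarrow> 'n minkowski \<Rightarrow> real ^ 'n" where
  "shifted_curvatures \<Omega> p = (\<chi> i. principal_curvatures \<Omega> p $ i - 1)"

definition uniformly_h_convex :: "('n::finite) minkowski set \<Rightarrow> bool" where
  "uniformly_h_convex \<Omega> \<longleftrightarrow>
     (\<exists>\<delta>>0. \<forall>p\<in>hbd \<Omega>. \<forall>i. principal_curvatures \<Omega> p $ i > 1 + \<delta>)"

section \<open>Modified quermassintegrals\<close>

definition elem_sym :: "nat \<Rightarrow> real ^ ('n::finite) \<Rightarrow> real" where
  "elem_sym m x = (\<Sum>S | card S = m. \<Prod>i\<in>S. x $ i)"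

definition norm_elem_sym :: "nat \<Rightarrow> real ^ ('n::finite) \<Rightarrow> real" where
  "norm_elem_sym m x = elem_sym m x / real (CARD('n) choose m)"

definition curv_integral :: "nat \<Rightarrow> ('n::finite) minkowski set \<Rightarrow> real" where
  "curv_integral m \<Omega> =
     (\<integral>p. norm_elem_sym m (shifted_curvatures \<Omega> p) \<partial>area_measure (hbd \<Omega>))"

text \<open>Meaningful for indices up to \<open>CARD('n)\<close>; in the last equation \<open>k\<close> is
  at least 1.\<close>

fun quermass :: "nat \<Rightarrow> ('n::finite) minkowski set \<Rightarrow> real" where
  "quermass 0 \<Omega> = hvol \<Omega>"
| "quermass (Suc 0) \<Omega> =
     measure (area_measure (hbd \<Omega>)) (hbd \<Omega>) / real CARD('n) - hvol \<Omega>"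
| "quermass (Suc (Suc j)) \<Omega> =
     (let n = real CARD('n); k = Suc j
      in curv_integral k \<Omega> / (n - real k) - (n - 2 * real k) / (n - real k) * quermass k \<Omega>)"

end

theory Submission
  imports Defs
begin

text \<open>Uniform h-convexity makes \<open>\<Omega>\<close> geodesically convex with supporting hyperplanes at the boundary
  \<open>M\<close>, so the nearest point in \<open>\<Omega>\<close> to an outside point is unique and
  \<open>(t, p) \<mapsto> \<Phi> t p = cosh t p + sinh t \<nu> p\<close> maps \<open>{0<..\<rho>} \<times> M\<close> bijectively onto
  \<open>\<Omega>\<^sub>\<rho> - \<Omega>\<close>. The map \<open>\<Phi> t\<close> multiplies the area element by
  \<open>\<Prod>\<^sub>i (cosh t + \<kappa>\<^sub>i sinh t) = \<Prod>\<^sub>i (exp t + (\<kappa>\<^sub>i - 1) sinh t)\<close>, and the shifted curvatures of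
  \<open>\<Phi> t ` M\<close> are \<open>(\<kappa>\<^sub>i - 1) exp (- t) / (exp t + (\<kappa>\<^sub>i - 1) sinh t)\<close>. Expanding in elementary symmetric
  functions of \<open>\<kappa>\<^sub>i - 1\<close> gives the curvature integral of \<open>\<Omega>\<^sub>\<rho>\<close> of order \<open>k\<close> as an explicit combination
  \<open>steiner k \<rho>\<close> of the curvature integrals of \<open>\<Omega>\<close>. Integrating the area element over the collar settles
  \<open>k = 0\<close>. Since \<open>steiner k\<close> has derivative \<open>(n - 2 k) steiner k + (n - k) steiner (k + 1)\<close>, the recursion
  of the quermassintegrals then carries the formula from \<open>k\<close> to \<open>k + 1\<close>.\<close>

section \<open>Calculus of smooth maps\<close>

text \<open>Three objects are given only by description, which shapes the proof.
  \<open>principal_curvatures\<close> is a \<open>SOME\<close> choice whose dependence on the point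
  is uncontrolled, so different choices are compared only through products of
  \<open>c + s * \<kappa> p $ i\<close>, and measurability is read off from the way volume densities
  change with the distance. \<open>area_measure\<close> is a \<open>THE\<close> over all charts,
  made concrete by cutting the compact boundary into finitely many Borel pieces of charts and
  checking that transition maps preserve area. \<open>outward_normal\<close> is a \<open>THE\<close>
  as well; a \<open>normal_chart\<close> carries a smooth formula for it. Parallel bodies are not
  given defining functions: \<open>normal_chart_parallel\<close> transports the charts of the
  original boundary, with the velocity of the normal geodesics as new normal. Curvatures above 1 act
  twice: positivity gives strict convexity, which a connectedness argument turns into global
  supporting hyperplanes; and shifted curvatures are nonnegative, so expansions are integrated as
  nonnegative functions first and finiteness is settled afterwards from the area of the hypersurface
  at distance 1.\<close>

lemma frechet_derivative_eq:
  assumes "(f has_derivative f') (at x)"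
  shows "frechet_derivative f (at x) = f'"
  using frechet_derivative_at[OF assms] by simp

lemma has_derivative_frechet:
  assumes "f differentiable (at x)"
  shows "(f has_derivative frechet_derivative f (at x)) (at x)"
  using assms frechet_derivative_works by blast

lemma frechet_derivative_cong:
  assumes "open S" "x \<in> S" and eq: "\<And>y. y \<in> S \<Longrightarrow> f y = g y"
  shows "frechet_derivative f (at x) = frechet_derivative g (at x)"
proof -
  have "(f has_derivative D) (at x) \<longleftrightarrow> (g has_derivative D) (at x)" for D
    using has_derivative_transform_within_open[OF _ assms(1,2), of f D UNIV g]
      has_derivative_transform_within_open[OF _ assms(1,2), of g D UNIV f] eq by auto
  then show ?thesis unfolding frechet_derivative_def by simp
qed

lemma Ck_on_cong_imp:
  assumes "open S" "\<And>x. x \<in> S \<Longrightarrow> f x = g x" "Ck_on k S f"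
  shows "Ck_on k S g"
  using assms(2,3)
proof (induction k arbitrary: f g)
  case 0
  then show ?case by (simp cong: continuous_on_cong)
next
  case (Suc k)
  have fd: "frechet_derivative f (at x) = frechet_derivative g (at x)" if "x \<in> S" for x
    using frechet_derivative_cong[OF \<open>open S\<close> that] Suc.prems(1) by blast
  have "g differentiable (at x)" if "x \<in> S" for x
    using has_derivative_transform_within_open[OF has_derivative_frechet \<open>open S\<close> that, of f g]
      Suc.prems that unfolding differentiable_def by (metis Ck_on.simps(2) differentiable_def)
  moreover have "Ck_on k S (\<lambda>x. frechet_derivative g (at x) v)" for v
    by (rule Suc.IH[of "\<lambda>x. frechet_derivative f (at x) v"]) (use Suc.prems fd in auto)
  ultimately show ?case by simp
qed

text \<open>\<open>Ck_on\<close> is phrased with \<open>frechet_derivative\<close>. On an open set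
  any formula for the derivative may take its place, so each closure rule below is one
  differentiation rule plus the induction hypothesis.\<close>

lemma Ck_on_SucI:
  assumes "open S" "\<And>x. x \<in> S \<Longrightarrow> (f has_derivative f' x) (at x)" "\<And>v. Ck_on k S (\<lambda>x. f' x v)"
  shows "Ck_on (Suc k) S f"
proof -
  have "Ck_on k S (\<lambda>x. frechet_derivative f (at x) v)" for v
    by (rule Ck_on_cong_imp[OF \<open>open S\<close> _ assms(3)])
      (use assms(2) frechet_derivative_eq in fastforce)
  moreover have "f differentiable (at x)" if "x \<in> S" for x
    using assms(2)[OF that] unfolding differentiable_def by blast
  ultimately show ?thesis by simp
qed

lemma Ck_on_has_derivative:
  assumes "Ck_on (Suc k) S f" "x \<in> S"
  shows "(f has_derivative frechet_derivative f (at x)) (at x)"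
  using assms has_derivative_frechet by auto

lemma Ck_on_lower:
  assumes "Ck_on (Suc k) S f"
  shows "Ck_on k S f"
  using assms
proof (induction k arbitrary: f)
  case 0
  have "f differentiable_on S"
    unfolding differentiable_on_def
  proof
    fix x assume "x \<in> S"
    with 0 have "f differentiable (at x)" by simp
    then show "f differentiable (at x within S)" by (rule differentiable_at_withinI)
  qed
  then have "continuous_on S f" by (rule differentiable_imp_continuous_on)
  then show ?case by simp
next
  case (Suc k)
  then show ?case by simp
qed

lemma Ck_on_mono:
  assumes "Ck_on k S f" "j \<le> k"
  shows "Ck_on j S f"
  using assms(2,1) by (induction rule: inc_induct) (auto intro: Ck_on_lower)

lemma Ck_on_continuous: "Ck_on k S f \<Longrightarrow> continuous_on S f"
  using Ck_on_mono[of k S f 0] by simp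

lemma Ck_on_subset:
  assumes "Ck_on k S f" "T \<subseteq> S"
  shows "Ck_on k T f"
  using assms(1) by (induction k arbitrary: f) (use assms(2) continuous_on_subset in auto)

lemma Ck_on_const: "open S \<Longrightarrow> Ck_on k S (\<lambda>x. c)"
proof (induction k arbitrary: c)
  case (Suc k)
  show ?case
    by (rule Ck_on_SucI[OF Suc.prems has_derivative_const]) (use Suc in auto)
qed simp

lemma Ck_on_bounded_linear:
  assumes "bounded_linear h" "open S" "Ck_on k S f"
  shows "Ck_on k S (\<lambda>x. h (f x))"
  using assms(3)
proof (induction k arbitrary: f)
  case 0
  then show ?case
    using continuous_on_compose2[OF linear_continuous_on[OF assms(1)], of S f UNIV] by simp
next
  case (Suc k)
  show ?case
    by (rule Ck_on_SucI[OF \<open>open S\<close> bounded_linear.has_derivative[OF assms(1) Ck_on_has_derivative[OF Suc.prems]]])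
      (use Suc in auto)
qed

lemma Ck_on_id: "open S \<Longrightarrow> Ck_on k S (\<lambda>x. x)"
proof (cases k)
  case (Suc j)
  assume "open S"
  then show ?thesis unfolding Suc
    by (intro Ck_on_SucI[of S _ "\<lambda>x v. v"]) (auto intro: Ck_on_const)
qed (auto)

lemma Ck_on_linear: "bounded_linear h \<Longrightarrow> open S \<Longrightarrow> Ck_on k S h"
  using Ck_on_bounded_linear[of h S k "\<lambda>x. x"] Ck_on_id by auto

lemma Ck_on_add:
  assumes "open S" "Ck_on k S f" "Ck_on k S g"
  shows "Ck_on k S (\<lambda>x. f x + g x)"
  using assms(2,3)
proof (induction k arbitrary: f g)
  case 0
  then show ?case by (auto intro: continuous_intros)
next
  case (Suc k)
  show ?case
    by (rule Ck_on_SucI[OF \<open>open S\<close> has_derivative_add[OF Ck_on_has_derivative[OF Suc.prems(1)]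
            Ck_on_has_derivative[OF Suc.prems(2)]]])
      (use Suc in auto)
qed

lemma Ck_on_minus: "open S \<Longrightarrow> Ck_on k S f \<Longrightarrow> Ck_on k S (\<lambda>x. - f x)"
  using Ck_on_bounded_linear[OF bounded_linear_minus[OF bounded_linear_ident]] by blast

lemma Ck_on_diff:
  "open S \<Longrightarrow> Ck_on k S f \<Longrightarrow> Ck_on k S g \<Longrightarrow> Ck_on k S (\<lambda>x. f x - g x)"
  using Ck_on_add[of S k f "\<lambda>x. - g x"] Ck_on_minus[of S k g] by simp

lemma Ck_on_sum:
  assumes "open S" "finite A" "\<And>i. i \<in> A \<Longrightarrow> Ck_on k S (f i)"
  shows "Ck_on k S (\<lambda>x. \<Sum>i\<in>A. f i x)"
  using assms(2,3) by (induction A rule: finite_induct) (auto intro: Ck_on_add Ck_on_const assms(1))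

lemma (in bounded_bilinear) Ck_on:
  assumes "open S" "Ck_on k S f" "Ck_on k S g"
  shows "Ck_on k S (\<lambda>x. prod (f x) (g x))"
  using assms(2,3)
proof (induction k arbitrary: f g)
  case 0
  then show ?case by (auto intro: continuous_on)
next
  case (Suc k)
  show ?case
    by (rule Ck_on_SucI[OF \<open>open S\<close> FDERIV[OF Ck_on_has_derivative[OF Suc.prems(1)]
            Ck_on_has_derivative[OF Suc.prems(2)]]])
      (use Suc.prems Suc.prems[THEN Ck_on_lower] in \<open>auto intro!: Ck_on_add \<open>open S\<close> Suc.IH simp del: Ck_on.simps(1)\<close>)
qed

lemmas Ck_on_mult = bounded_bilinear.Ck_on[OF bounded_bilinear_mult]
lemmas Ck_on_scaleR = bounded_bilinear.Ck_on[OF bounded_bilinear_scaleR]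
lemmas Ck_on_inner = bounded_bilinear.Ck_on[OF bounded_bilinear_inner]

lemma Ck_on_prod:
  fixes f :: "'i \<Rightarrow> 'a::euclidean_space \<Rightarrow> real"
  assumes "open S" "finite A" "\<And>i. i \<in> A \<Longrightarrow> Ck_on k S (f i)"
  shows "Ck_on k S (\<lambda>x. \<Prod>i\<in>A. f i x)"
  using assms(2,3)
  by (induction A rule: finite_induct) (auto intro: Ck_on_mult Ck_on_const assms(1))

text \<open>In the chain rule the direction fed to the derivative of the outer map varies with the
  point, while \<open>Ck_on\<close> controls derivatives only in fixed directions. The expansion
  separates the two.\<close>

lemma derivative_basis_expansion:
  fixes v :: "'a::euclidean_space"
  assumes "(f has_derivative f') F"
  shows "f' v = (\<Sum>b\<in>Basis. (v \<bullet> b) *\<^sub>R f' b)"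
proof -
  have "linear f'" using assms has_derivative_linear by blast
  then have "f' (\<Sum>b\<in>Basis. (v \<bullet> b) *\<^sub>R b) = (\<Sum>b\<in>Basis. (v \<bullet> b) *\<^sub>R f' b)"
    by (simp add: linear_sum linear_scale)
  then show ?thesis by (simp add: euclidean_representation)
qed

text \<open>By the chain rule in a basis, the derivative is a sum of components of the derivative of
  \<open>f\<close> times partial derivatives of \<open>g\<close> taken at \<open>f x\<close>. The
  latter are composites of order one lower, hence the induction is over \<open>g\<close> with
  \<open>f\<close> kept fixed.\<close>

lemma Ck_on_compose:
  fixes f :: "'a::euclidean_space \<Rightarrow> 'b::euclidean_space"
  assumes "open S" "open T" "f ` S \<subseteq> T" "Ck_on k T g" "Ck_on k S f"
  shows "Ck_on k S (\<lambda>x. g (f x))"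
  using assms(4,5)
proof (induction k arbitrary: g)
  case 0
  then show ?case using assms(3) continuous_on_compose2 by fastforce
next
  case (Suc k)
  have df: "(f has_derivative frechet_derivative f (at x)) (at x)" if "x \<in> S" for x
    using Ck_on_has_derivative[OF Suc.prems(2) that] .
  have dg: "(g has_derivative frechet_derivative g (at y)) (at y)" if "y \<in> T" for y
    using Ck_on_has_derivative[OF Suc.prems(1) that] .
  show ?case
  proof (rule Ck_on_SucI[OF \<open>open S\<close>])
    show "((\<lambda>x. g (f x)) has_derivative
       (\<lambda>v. \<Sum>b\<in>Basis. (frechet_derivative f (at x) v \<bullet> b) *\<^sub>R frechet_derivative g (at (f x)) b)) (at x)"
      if "x \<in> S" for x
    proof -
      have "f x \<in> T" using that assms(3) by auto
      from has_derivative_compose[OF df[OF that] dg[OF this]]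
      show ?thesis
        by (subst (asm) derivative_basis_expansion[OF dg[OF \<open>f x \<in> T\<close>]])
    qed
    show "Ck_on k S (\<lambda>x. \<Sum>b\<in>Basis. (frechet_derivative f (at x) v \<bullet> b) *\<^sub>R frechet_derivative g (at (f x)) b)" for v
    proof (intro Ck_on_sum Ck_on_scaleR Ck_on_inner Ck_on_const \<open>open S\<close> finite_Basis)
      show "Ck_on k S (\<lambda>x. frechet_derivative f (at x) v)" using Suc.prems(2) by simp
      show "Ck_on k S (\<lambda>x. frechet_derivative g (at (f x)) b)" for b
        by (rule Suc.IH) (use Suc.prems Ck_on_lower in auto)
    qed
  qed
qed

lemma Ck_on_inverse_real: "Ck_on k {x::real. x \<noteq> 0} inverse"
proof (induction k)
  case 0
  then show ?case by (auto intro!: continuous_intros)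
next
  case (Suc k)
  have op: "open {x::real. x \<noteq> 0}" by (simp add: open_Collect_neq)
  show ?case
    by (rule Ck_on_SucI[OF op has_derivative_inverse'])
      (auto intro!: Ck_on_minus Ck_on_mult Ck_on_const op Suc)
qed

lemma Ck_on_inverse:
  fixes f :: "'a::euclidean_space \<Rightarrow> real"
  assumes "open S" "Ck_on k S f" "\<And>x. x \<in> S \<Longrightarrow> f x \<noteq> 0"
  shows "Ck_on k S (\<lambda>x. inverse (f x))"
  by (rule Ck_on_compose[OF assms(1) _ _ Ck_on_inverse_real assms(2)]) (use assms in \<open>auto simp: open_Collect_neq\<close>)

lemma Ck_on_sqrt_real: "Ck_on k {0<..} sqrt"
proof (induction k)
  case 0
  then show ?case by (auto intro!: continuous_intros)
next
  case (Suc k)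
  have op: "open {0::real<..}" by simp
  show ?case
  proof (rule Ck_on_SucI[OF op])
    show "(sqrt has_derivative (\<lambda>v. v * (inverse (sqrt x) / 2))) (at x)" if "x \<in> {0<..}" for x
      using DERIV_real_sqrt[of x] that unfolding has_field_derivative_def
      by (auto simp: mult.commute elim!: has_derivative_eq_rhs)
    show "Ck_on k {0<..} (\<lambda>x. v * (inverse (sqrt x) / 2))" for v
      using Ck_on_mult[OF op Ck_on_const[OF op, of k "v/2"] Ck_on_inverse[OF op Suc]]
      by (auto simp: algebra_simps)
  qed
qed

lemma Ck_on_sqrt:
  fixes f :: "'a::euclidean_space \<Rightarrow> real"
  assumes "open S" "Ck_on k S f" "\<And>x. x \<in> S \<Longrightarrow> f x > 0"
  shows "Ck_on k S (\<lambda>x. sqrt (f x))"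
  by (rule Ck_on_compose[OF assms(1) _ _ Ck_on_sqrt_real assms(2)]) (use assms in auto)

lemma Ck_on_Pair:
  assumes "open S" "Ck_on k S f" "Ck_on k S g"
  shows "Ck_on k S (\<lambda>x. (f x, g x))"
proof -
  have l: "bounded_linear (\<lambda>a. (a, 0))" "bounded_linear (\<lambda>a. (0, a))"
    by (auto intro!: bounded_linear_Pair bounded_linear_ident bounded_linear_zero)
  show ?thesis
    using Ck_on_add[OF assms(1) Ck_on_bounded_linear[OF l(1) assms(1,2)] Ck_on_bounded_linear[OF l(2) assms(1,3)]]
    by simp
qed

lemma Ck_on_componentwise:
  fixes f :: "'a::euclidean_space \<Rightarrow> 'b::euclidean_space"
  assumes "open S" "\<And>b. b \<in> Basis \<Longrightarrow> Ck_on k S (\<lambda>x. f x \<bullet> b)"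
  shows "Ck_on k S f"
proof -
  have "Ck_on k S (\<lambda>x. \<Sum>b\<in>Basis. (f x \<bullet> b) *\<^sub>R b)"
    by (intro Ck_on_sum Ck_on_scaleR Ck_on_const assms finite_Basis)
  then show ?thesis by (simp add: euclidean_representation)
qed

lemma Ck_on_vec:
  fixes f :: "'a::euclidean_space \<Rightarrow> real^'n"
  assumes "open S" "\<And>i. Ck_on k S (\<lambda>x. f x $ i)"
  shows "Ck_on k S f"
proof (rule Ck_on_componentwise[OF assms(1)])
  fix b :: "real^'n" assume "b \<in> Basis"
  then obtain i where "b = axis i 1" by (auto simp: Basis_vec_def)
  then show "Ck_on k S (\<lambda>x. f x \<bullet> b)" using assms(2)[of i] by (simp add: inner_axis)
qed

lemma smooth_on_Ck: "smooth_on S f \<Longrightarrow> Ck_on k S f"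
  by (simp add: smooth_on_def)

lemma smooth_on_deriv: "smooth_on S f \<Longrightarrow> smooth_on S (\<lambda>x. frechet_derivative f (at x) v)"
  unfolding smooth_on_def by (metis Ck_on.simps(2))

lemma smooth_on_has_derivative:
  "smooth_on S f \<Longrightarrow> x \<in> S \<Longrightarrow> (f has_derivative frechet_derivative f (at x)) (at x)"
  unfolding smooth_on_def using Ck_on_has_derivative by blast

lemma smooth_on_continuous: "smooth_on S f \<Longrightarrow> continuous_on S f"
  unfolding smooth_on_def using Ck_on_continuous by blast

lemma smooth_on_subset: "smooth_on S f \<Longrightarrow> T \<subseteq> S \<Longrightarrow> smooth_on T f"
  unfolding smooth_on_def using Ck_on_subset by blast

lemma smooth_on_compose:
  fixes f :: "'a::euclidean_space \<Rightarrow> 'b::euclidean_space"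
  assumes "open S" "open T" "f ` S \<subseteq> T" "smooth_on T g" "smooth_on S f"
  shows "smooth_on S (\<lambda>x. g (f x))"
  using assms unfolding smooth_on_def by (blast intro: Ck_on_compose)

lemma smooth_on_linear: "linear h \<Longrightarrow> open S \<Longrightarrow> smooth_on S h"
  for h :: "'a::euclidean_space \<Rightarrow> 'b::euclidean_space"
  unfolding smooth_on_def using Ck_on_linear linear_conv_bounded_linear by blast

section \<open>Linear systems and local inverses\<close>

lemma det_Ck_on:
  fixes A :: "'a::euclidean_space \<Rightarrow> real^'n^'n"
  assumes "open S" "\<And>i j. Ck_on k S (\<lambda>x. A x $ i $ j)"
  shows "Ck_on k S (\<lambda>x. det (A x))"
  unfolding det_def
  by (intro Ck_on_sum Ck_on_mult Ck_on_prod Ck_on_const assms) (auto simp: finite_permutations)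

lemma matrix_mult_linear:
  fixes f :: "real^'n \<Rightarrow> real^'m"
  assumes "linear f"
  shows "matrix f *v x = f x"
proof -
  have "Vector_Spaces.linear (*s) (*s) f"
    using assms unfolding linear_def by (simp add: scalar_mult_eq_scaleR[abs_def])
  then show ?thesis by (rule matrix_works)
qed

text \<open>By Cramer's rule.\<close>

lemma Ck_on_linear_solve:
  fixes A :: "'a::euclidean_space \<Rightarrow> real^'n \<Rightarrow> real^'n"
  assumes "open S" and lin: "\<And>x. x \<in> S \<Longrightarrow> linear (A x)" and inj: "\<And>x. x \<in> S \<Longrightarrow> inj (A x)"
    and A: "\<And>v. Ck_on k S (\<lambda>x. A x v)" and b: "Ck_on k S b"
    and w: "\<And>x. x \<in> S \<Longrightarrow> A x (w x) = b x"
  shows "Ck_on k S w"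
proof -
  let ?M = "\<lambda>x. matrix (A x)"
  have M: "Ck_on k S (\<lambda>x. ?M x $ i $ j)" for i j
    unfolding matrix_def by (simp add: Ck_on_bounded_linear[OF bounded_linear_vec_nth \<open>open S\<close> A])
  have b': "Ck_on k S (\<lambda>x. b x $ i)" for i
    by (rule Ck_on_bounded_linear[OF bounded_linear_vec_nth \<open>open S\<close> b])
  have det: "det (?M x) \<noteq> 0" if "x \<in> S" for x
    using inj[OF that] det_nz_iff_inj[OF lin[OF that]] by blast
  let ?w = "\<lambda>x. \<chi> k. det (\<chi> i j. if j = k then b x $ i else ?M x $ i $ j) * inverse (det (?M x))"
  have "Ck_on k S (\<lambda>x. ?w x $ l)" for l
  proof -
    have "Ck_on k S (\<lambda>x. det (\<chi> i j. if j = l then b x $ i else ?M x $ i $ j))"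
    proof (rule det_Ck_on[OF \<open>open S\<close>])
      show "Ck_on k S (\<lambda>x. (\<chi> i j. if j = l then b x $ i else ?M x $ i $ j) $ i $ j)" for i j
        using M b' by (cases "j = l") auto
    qed
    then show ?thesis
      by (simp add: Ck_on_mult[OF \<open>open S\<close>] Ck_on_inverse[OF \<open>open S\<close> det_Ck_on[OF \<open>open S\<close> M] det])
  qed
  then have "Ck_on k S ?w"
    by (rule Ck_on_vec[OF \<open>open S\<close>])
  moreover have "?w x = w x" if "x \<in> S" for x
  proof -
    have "?M x *v w x = b x" using w[OF that] matrix_mult_linear[OF lin[OF that]] by metis
    with cramer[OF det[OF that], of "w x" "b x"] show ?thesis
      by (simp add: divide_inverse)
  qed
  ultimately show ?thesis using Ck_on_cong_imp[OF \<open>open S\<close>, of ?w w] by blast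
qed

text \<open>Bootstrapping: \<open>inv (?D (G y)) v\<close> is the solution \<open>w\<close> of the
  linear system \<open>?D (G y) w = v\<close>, whose coefficients are as regular as \<open>G\<close>
  itself. Cramer's rule therefore makes the derivative of \<open>G\<close> as regular as
  \<open>G\<close>, which gains one order at each induction step.\<close>

lemma smooth_on_local_inverse:
  fixes F :: "real^'n \<Rightarrow> real^'n"
  assumes "open S" "open T" and F: "smooth_on S F" and hom: "homeomorphism S T F G"
    and inj: "\<And>x. x \<in> S \<Longrightarrow> inj (frechet_derivative F (at x))"
  shows "smooth_on T G"
    and "\<And>y. y \<in> T \<Longrightarrow> (G has_derivative inv (frechet_derivative F (at (G y)))) (at y)"
proof -
  let ?D = "\<lambda>x. frechet_derivative F (at x)"
  have GT: "G y \<in> S" "F (G y) = y" if "y \<in> T" for y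
    using hom that by (auto simp: homeomorphism_def)
  have dF: "(F has_derivative ?D x) (at x)" if "x \<in> S" for x
    using smooth_on_has_derivative[OF F that] .
  have lin: "linear (?D x)" if "x \<in> S" for x using dF[OF that] has_derivative_linear by blast
  have surj: "surj (?D x)" if "x \<in> S" for x
    using linear_injective_imp_surjective[OF lin[OF that] inj[OF that]] by simp
  have linv: "linear (inv (?D x))" if x: "x \<in> S" for x
  proof -
    obtain h where h: "linear h" "h \<circ> ?D x = id"
      using real_vector.linear_injective_left_inverse[OF lin[OF x] inj[OF x]] by blast
    have "h y = inv (?D x) y" for y
      using h(2) surj_f_inv_f[OF surj[OF that], of y] by (metis comp_apply id_apply)
    then have "h = inv (?D x)" by blast
    then show ?thesis using h(1) by simp
  qed
  have der: "(G has_derivative inv (?D (G y))) (at y)" if "y \<in> T" for y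
  proof (rule has_derivative_inverse_basic[where f = F and g = G, OF dF[OF GT(1)[OF that]] _ _ _ \<open>open T\<close> that])
    show "bounded_linear (inv (?D (G y)))"
      using linv GT(1)[OF that] linear_conv_bounded_linear by blast
    show "inv (?D (G y)) \<circ> ?D (G y) = id" using inj GT(1)[OF that] by simp
    show "continuous (at y) G"
      using hom that \<open>open T\<close> by (auto simp: homeomorphism_def continuous_on_eq_continuous_at)
  qed (use GT in auto)
  then show "\<And>y. y \<in> T \<Longrightarrow> (G has_derivative inv (?D (G y))) (at y)" .
  have "Ck_on k T G" for k
  proof (induction k)
    case 0
    then show ?case using hom by (simp add: homeomorphism_def)
  next
    case (Suc k)
    show ?case
    proof (rule Ck_on_SucI[OF \<open>open T\<close> der])
      fix v
      show "Ck_on k T (\<lambda>y. inv (?D (G y)) v)"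
      proof (rule Ck_on_linear_solve[OF \<open>open T\<close>, where A = "\<lambda>y. ?D (G y)" and b = "\<lambda>y. v"])
        show "Ck_on k T (\<lambda>y. ?D (G y) u)" for u
          by (rule Ck_on_compose[OF \<open>open T\<close> \<open>open S\<close> _ smooth_on_Ck[OF smooth_on_deriv[OF F]] Suc])
            (use GT in auto)
        show "?D (G y) (inv (?D (G y)) v) = v" if "y \<in> T" for y
          using surj_f_inv_f[OF surj[OF GT(1)[OF that]]] .
      qed (use GT lin inj in \<open>auto intro: Ck_on_const \<open>open T\<close>\<close>)
    qed
  qed
  then show "smooth_on T G" by (simp add: smooth_on_def)
qed

text \<open>The mean value theorem is applied twice, first along \<open>v\<close> to the difference
  in direction \<open>w\<close>, then along \<open>w\<close> to the derivative. The left side is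
  symmetric in \<open>v\<close> and \<open>w\<close> while the right side shows one order of
  differentiation; this is the core of the symmetry argument.\<close>

lemma mixed_difference:
  fixes f :: "'a::euclidean_space \<Rightarrow> real"
  assumes f: "smooth_on S f" and "s > 0"
    and sub: "\<And>a b. 0 \<le> a \<Longrightarrow> a \<le> s \<Longrightarrow> 0 \<le> b \<Longrightarrow> b \<le> s \<Longrightarrow> x + a *\<^sub>R v + b *\<^sub>R w \<in> S"
  obtains a b where "0 \<le> a" "a \<le> s" "0 \<le> b" "b \<le> s"
    "f (x + s *\<^sub>R v + s *\<^sub>R w) - f (x + s *\<^sub>R v) - f (x + s *\<^sub>R w) + f x =
      s * s * frechet_derivative (\<lambda>y. frechet_derivative f (at y) v) (at (x + a *\<^sub>R v + b *\<^sub>R w)) w"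
proof -
  let ?D = "\<lambda>y. frechet_derivative f (at y) v"
  have df: "(f has_derivative frechet_derivative f (at y)) (at y)" if "y \<in> S" for y
    using smooth_on_has_derivative[OF f that] .
  have dD: "(?D has_derivative frechet_derivative ?D (at y)) (at y)" if "y \<in> S" for y
    using smooth_on_has_derivative[OF smooth_on_deriv[OF f] that] .
  have 1: "((\<lambda>a. f (x + a *\<^sub>R v + b *\<^sub>R w)) has_real_derivative ?D (x + a *\<^sub>R v + b *\<^sub>R w)) (at a)"
    if "0 \<le> a" "a \<le> s" "0 \<le> b" "b \<le> s" for a b
  proof -
    have *: "((\<lambda>a. x + a *\<^sub>R v + b *\<^sub>R w) has_derivative (\<lambda>h. h *\<^sub>R v)) (at a)"
      by (auto intro!: derivative_eq_intros)
    have "linear (frechet_derivative f (at (x + a *\<^sub>R v + b *\<^sub>R w)))"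
      using df[OF sub[OF that]] has_derivative_linear by blast
    then show ?thesis
      using has_derivative_compose[OF * df[OF sub[OF that]]]
      unfolding has_field_derivative_def
      by (auto simp: linear_scale mult.commute elim!: has_derivative_eq_rhs)
  qed
  have 2: "((\<lambda>b. ?D (x + a *\<^sub>R v + b *\<^sub>R w)) has_real_derivative
      frechet_derivative ?D (at (x + a *\<^sub>R v + b *\<^sub>R w)) w) (at b)"
    if "0 \<le> a" "a \<le> s" "0 \<le> b" "b \<le> s" for a b
  proof -
    have *: "((\<lambda>b. x + a *\<^sub>R v + b *\<^sub>R w) has_derivative (\<lambda>h. h *\<^sub>R w)) (at b)"
      by (auto intro!: derivative_eq_intros)
    have "linear (frechet_derivative ?D (at (x + a *\<^sub>R v + b *\<^sub>R w)))"
      using dD[OF sub[OF that]] has_derivative_linear by blast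
    then show ?thesis
      using has_derivative_compose[OF * dD[OF sub[OF that]]]
      unfolding has_field_derivative_def
      by (auto simp: linear_scale mult.commute elim!: has_derivative_eq_rhs)
  qed
  have 3: "((\<lambda>a. f (x + a *\<^sub>R v + s *\<^sub>R w) - f (x + a *\<^sub>R v + 0 *\<^sub>R w)) has_real_derivative
      ?D (x + a *\<^sub>R v + s *\<^sub>R w) - ?D (x + a *\<^sub>R v + 0 *\<^sub>R w)) (at a)" if "0 \<le> a" "a \<le> s" for a
    using that \<open>s > 0\<close> by (intro DERIV_diff 1) auto
  obtain a where a: "0 < a" "a < s"
    "f (x + s *\<^sub>R v + s *\<^sub>R w) - f (x + s *\<^sub>R v) - (f (x + s *\<^sub>R w) - f x) =
      s * (?D (x + a *\<^sub>R v + s *\<^sub>R w) - ?D (x + a *\<^sub>R v + 0 *\<^sub>R w))"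
    using MVT2[OF \<open>s > 0\<close> 3] by auto
  obtain b where b: "0 < b" "b < s"
    "?D (x + a *\<^sub>R v + s *\<^sub>R w) - ?D (x + a *\<^sub>R v + 0 *\<^sub>R w) =
     s * frechet_derivative ?D (at (x + a *\<^sub>R v + b *\<^sub>R w)) w"
    using MVT2[OF \<open>s > 0\<close> 2, of a] a by auto
  show thesis
    using that[of a b] a b by auto
qed

lemma smooth_on_mixed_limit:
  fixes f :: "'a::euclidean_space \<Rightarrow> real"
  assumes "open S" "x \<in> S" "smooth_on S f"
  shows "((\<lambda>s. (f (x + s *\<^sub>R v + s *\<^sub>R w) - f (x + s *\<^sub>R v) - f (x + s *\<^sub>R w) + f x) / (s * s)) \<longlongrightarrow>
    frechet_derivative (\<lambda>y. frechet_derivative f (at y) v) (at x) w) (at_right 0)"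
proof (rule tendstoI)
  fix e :: real assume "e > 0"
  let ?E = "\<lambda>y. frechet_derivative (\<lambda>y. frechet_derivative f (at y) v) (at y) w"
  have "continuous_on S ?E"
    by (intro smooth_on_continuous smooth_on_deriv assms)
  then have "isCont ?E x" using assms continuous_on_eq_continuous_at by blast
  then obtain d where d: "d > 0" "\<And>y. dist y x < d \<Longrightarrow> dist (?E y) (?E x) < e"
    using \<open>e > 0\<close> unfolding continuous_at_eps_delta by blast
  obtain d' where d': "d' > 0" "ball x d' \<subseteq> S"
    using assms openE by blast
  \<comment> \<open>Chosen so that every point \<open>x + a v + b w\<close> with \<open>a\<close>
    and \<open>b\<close> below \<open>m\<close> is closer to \<open>x\<close> than both
    \<open>d\<close> and \<open>d'\<close>; the summand 1 keeps the denominator positive.\<close>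
  define m where "m = min d d' / (norm v + norm w + 1)"
  have "m > 0" unfolding m_def using d(1) d'(1) by (simp add: add_nonneg_pos)
  have near: "dist (x + a *\<^sub>R v + b *\<^sub>R w) x < min d d'"
    if "0 \<le> a" "a \<le> s" "0 \<le> b" "b \<le> s" "s < m" for a b s
  proof -
    have "norm (a *\<^sub>R v + b *\<^sub>R w) \<le> a * norm v + b * norm w"
      using norm_triangle_ineq[of "a *\<^sub>R v" "b *\<^sub>R w"] that by simp
    also have "\<dots> \<le> s * norm v + s * norm w"
      using that by (intro add_mono mult_right_mono) auto
    also have "\<dots> \<le> s * (norm v + norm w + 1)" using that by (simp add: algebra_simps)
    also have "\<dots> < m * (norm v + norm w + 1)"
      using that by (intro mult_strict_right_mono) (auto simp: add_nonneg_pos)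
    also have "\<dots> = min d d'"
      unfolding m_def using add_nonneg_pos[of "norm v + norm w" 1] by simp
    finally show ?thesis by (simp add: dist_norm add.assoc)
  qed
  have "dist ((f (x + s *\<^sub>R v + s *\<^sub>R w) - f (x + s *\<^sub>R v) - f (x + s *\<^sub>R w) + f x) / (s * s)) (?E x) < e"
    if "0 < s" "s < m" for s
  proof -
    have "x + a *\<^sub>R v + b *\<^sub>R w \<in> S" if "0 \<le> a" "a \<le> s" "0 \<le> b" "b \<le> s" for a b
      using near[OF that \<open>s < m\<close>] d'(2) by (auto simp: dist_commute)
    from mixed_difference[OF assms(3) \<open>0 < s\<close> this]
    obtain a b where ab: "0 \<le> a" "a \<le> s" "0 \<le> b" "b \<le> s"
      "f (x + s *\<^sub>R v + s *\<^sub>R w) - f (x + s *\<^sub>R v) - f (x + s *\<^sub>R w) + f x =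
        s * s * ?E (x + a *\<^sub>R v + b *\<^sub>R w)" by blast
    then have "(f (x + s *\<^sub>R v + s *\<^sub>R w) - f (x + s *\<^sub>R v) - f (x + s *\<^sub>R w) + f x) / (s * s)
        = ?E (x + a *\<^sub>R v + b *\<^sub>R w)" using \<open>0 < s\<close> by simp
    then show ?thesis using d(2)[of "x + a *\<^sub>R v + b *\<^sub>R w"] near[OF ab(1-4) \<open>s < m\<close>] by simp
  qed
  then show "\<forall>\<^sub>F s in at_right 0. dist ((f (x + s *\<^sub>R v + s *\<^sub>R w) - f (x + s *\<^sub>R v) - f (x + s *\<^sub>R w) + f x) / (s * s)) (?E x) < e"
    unfolding eventually_at_right_field using \<open>m > 0\<close> by blast
qed

text \<open>Both iterated derivatives are limits of the same second difference quotient. The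
  self-adjointness of the shape operator rests on this.\<close>

theorem smooth_on_second_derivative_symmetric:
  fixes f :: "'a::euclidean_space \<Rightarrow> 'b::euclidean_space"
  assumes "open S" "x \<in> S" and f: "smooth_on S f"
  shows "frechet_derivative (\<lambda>y. frechet_derivative f (at y) v) (at x) w =
    frechet_derivative (\<lambda>y. frechet_derivative f (at y) w) (at x) v"
proof (rule euclidean_eqI)
  fix b :: 'b assume "b \<in> Basis"
  let ?g = "\<lambda>y. f y \<bullet> b"
  have g: "smooth_on S ?g"
    using f unfolding smooth_on_def by (auto intro: Ck_on_bounded_linear[OF bounded_linear_inner_left \<open>open S\<close>])
  have D: "frechet_derivative (\<lambda>y. h y \<bullet> b) (at y) u = frechet_derivative h (at y) u \<bullet> b"
    if "smooth_on S h" "y \<in> S" for u y and h :: "'a \<Rightarrow> 'b"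
    using frechet_derivative_eq[OF bounded_linear.has_derivative[OF bounded_linear_inner_left
          smooth_on_has_derivative[OF that]]] by simp
  have *: "frechet_derivative (\<lambda>y. frechet_derivative ?g (at y) v) (at x) w =
      frechet_derivative (\<lambda>y. frechet_derivative f (at y) v) (at x) w \<bullet> b" for v w
  proof -
    have "frechet_derivative (\<lambda>y. frechet_derivative ?g (at y) v) (at x) =
      frechet_derivative (\<lambda>y. frechet_derivative f (at y) v \<bullet> b) (at x)"
      by (rule frechet_derivative_cong[OF assms(1,2)]) (use D[OF f] in blast)
    then show ?thesis using D[OF smooth_on_deriv[OF f] \<open>x \<in> S\<close>] by simp
  qed
  have "((\<lambda>s. (?g (x + s *\<^sub>R v + s *\<^sub>R w) - ?g (x + s *\<^sub>R v) - ?g (x + s *\<^sub>R w) + ?g x) / (s * s)) \<longlongrightarrow>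
    frechet_derivative (\<lambda>y. frechet_derivative ?g (at y) v) (at x) w) (at_right 0)"
    by (rule smooth_on_mixed_limit[OF assms(1,2) g])
  moreover have "((\<lambda>s. (?g (x + s *\<^sub>R v + s *\<^sub>R w) - ?g (x + s *\<^sub>R v) - ?g (x + s *\<^sub>R w) + ?g x) / (s * s)) \<longlongrightarrow>
    frechet_derivative (\<lambda>y. frechet_derivative ?g (at y) w) (at x) v) (at_right 0)"
    using smooth_on_mixed_limit[OF assms(1,2) g, of w v] by (simp add: algebra_simps)
  ultimately have "frechet_derivative (\<lambda>y. frechet_derivative ?g (at y) v) (at x) w =
      frechet_derivative (\<lambda>y. frechet_derivative ?g (at y) w) (at x) v"
    by (rule tendsto_unique[OF trivial_limit_at_right_real])
  then show "frechet_derivative (\<lambda>y. frechet_derivative f (at y) v) (at x) w \<bullet> b =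
      frechet_derivative (\<lambda>y. frechet_derivative f (at y) w) (at x) v \<bullet> b"
    unfolding * .
qed

section \<open>Linear algebra\<close>

text \<open>A linear term dominated by a quadratic one on both sides of 0 must vanish; the test
  value \<open>a / (\<bar>b\<bar> + 1)\<close> makes the quadratic side too small unless
  \<open>a\<close> is 0.\<close>

lemma nonpos_quadratic_linear_coeff:
  fixes a b :: real
  assumes "\<And>t. t * a \<le> t\<^sup>2 * b"
  shows "a = 0"
proof (rule ccontr)
  assume "a \<noteq> 0"
  let ?K = "\<bar>b\<bar> + 1"
  have K: "?K > 0" by linarith
  have "a / ?K * a \<le> (a / ?K)\<^sup>2 * b" by (rule assms)
  then have "a / ?K * a * ?K\<^sup>2 \<le> (a / ?K)\<^sup>2 * b * ?K\<^sup>2"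
    by (rule mult_right_mono) simp
  moreover have "a / ?K * a * ?K\<^sup>2 = a\<^sup>2 * ?K" "(a / ?K)\<^sup>2 * b * ?K\<^sup>2 = a\<^sup>2 * b"
    using K by (simp_all add: power2_eq_square)
  ultimately have "?K \<le> b" using \<open>a \<noteq> 0\<close> by simp
  then show False by linarith
qed

text \<open>First variation of the Rayleigh quotient: moving from \<open>v\<close> to
  \<open>v + t w\<close> with \<open>w\<close> orthogonal to \<open>v\<close> cannot raise the
  quotient, so the term linear in \<open>t\<close>, which is \<open>2 (w \<bullet> S v)\<close>,
  vanishes.\<close>

lemma self_adjoint_maximum_eigenvector:
  fixes S :: "'a::euclidean_space \<Rightarrow> 'a"
  assumes "linear S" and adj: "\<And>x y. S x \<bullet> y = x \<bullet> S y"
    and W: "subspace W" "S ` W \<subseteq> W" "v \<in> W" "norm v = 1"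
    and max: "\<And>w. w \<in> W \<Longrightarrow> norm w = 1 \<Longrightarrow> w \<bullet> S w \<le> v \<bullet> S v"
  shows "S v = (v \<bullet> S v) *\<^sub>R v"
proof -
  let ?l = "v \<bullet> S v"
  have Q: "w \<bullet> S w \<le> ?l * (norm w)\<^sup>2" if "w \<in> W" for w
  proof (cases "w = 0")
    case True
    then show ?thesis using linear_0[OF \<open>linear S\<close>] by simp
  next
    case False
    have "(w /\<^sub>R norm w) \<bullet> S (w /\<^sub>R norm w) \<le> ?l"
      using False that W by (intro max) (auto simp: subspace_scale)
    then show ?thesis using False
      by (simp add: linear_scale[OF \<open>linear S\<close>] field_simps power2_eq_square)
  qed
  have orth: "w \<bullet> S v = 0" if w: "w \<in> W" "v \<bullet> w = 0" for w
  proof -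
    have "t * (2 * (w \<bullet> S v)) \<le> t\<^sup>2 * (?l * (norm w)\<^sup>2 - w \<bullet> S w)" for t
    proof -
      have "v + t *\<^sub>R w \<in> W" using W w by (simp add: subspace_add subspace_scale)
      then have "(v + t *\<^sub>R w) \<bullet> S (v + t *\<^sub>R w) \<le> ?l * (norm (v + t *\<^sub>R w))\<^sup>2" by (rule Q)
      moreover have "(norm (v + t *\<^sub>R w))\<^sup>2 = 1 + t\<^sup>2 * (norm w)\<^sup>2"
        using W w unfolding power2_norm_eq_inner by (simp add: inner_simps inner_commute norm_eq_1 power2_eq_square)
      moreover have "v \<bullet> S w = w \<bullet> S v" using adj[of v w] by (simp add: inner_commute)
      ultimately show ?thesis
        by (simp add: linear_add[OF \<open>linear S\<close>] linear_scale[OF \<open>linear S\<close>] inner_simps algebra_simps power2_eq_square)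
    qed
    from nonpos_quadratic_linear_coeff[OF this] show ?thesis by simp
  qed
  \<comment> \<open>\<open>?r\<close> is the part of \<open>S v\<close> orthogonal to
    \<open>v\<close>; the first variation makes it orthogonal to \<open>S v\<close> too, hence to
    itself.\<close>
  let ?r = "S v - ?l *\<^sub>R v"
  have "?r \<in> W" using W by (auto simp: subspace_diff subspace_scale)
  moreover have vr: "v \<bullet> ?r = 0" using W by (simp add: inner_simps norm_eq_1)
  ultimately have "?r \<bullet> S v = 0" by (rule orth)
  then have "?r \<bullet> ?r = 0" using vr by (simp add: inner_simps inner_commute)
  then show ?thesis by simp
qed

text \<open>Spectral theorem by induction on the dimension. A maximizer of the Rayleigh quotient on
  the unit sphere of \<open>W\<close> is an eigenvector, and its orthogonal complement in
  \<open>W\<close> is again invariant because \<open>S\<close> is self-adjoint.\<close>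

lemma self_adjoint_eigenbasis_subspace:
  fixes S :: "'a::euclidean_space \<Rightarrow> 'a"
  assumes lin: "linear S" and adj: "\<And>x y. S x \<bullet> y = x \<bullet> S y"
    and "subspace W" "S ` W \<subseteq> W"
  shows "\<exists>B \<subseteq> W. finite B \<and> card B = dim W \<and> pairwise orthogonal B \<and>
    (\<forall>b\<in>B. norm b = 1 \<and> (\<exists>l. S b = l *\<^sub>R b))"
  using assms(3,4)
proof (induction "dim W" arbitrary: W)
  case 0
  then show ?case by (intro exI[of _ "{}"]) auto
next
  case (Suc m)
  let ?K = "sphere 0 1 \<inter> W"
  obtain w where w: "w \<in> W" "w \<noteq> 0"
    using Suc.hyps(2) by (metis dim_eq_0 nat.distinct(1) singletonI subsetI)
  then have "w /\<^sub>R norm w \<in> ?K" using Suc.prems by (auto simp: subspace_scale)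
  moreover have "compact ?K" by (intro compact_Int_closed closed_subspace Suc.prems) simp
  moreover have "continuous_on ?K (\<lambda>x. x \<bullet> S x)"
    by (intro continuous_intros linear_continuous_on) (use lin linear_conv_bounded_linear in blast)
  ultimately obtain v where v: "v \<in> ?K" "\<forall>y\<in>?K. y \<bullet> S y \<le> v \<bullet> S v"
    using continuous_attains_sup[of ?K "\<lambda>x. x \<bullet> S x"] by blast
  have Sv: "S v = (v \<bullet> S v) *\<^sub>R v"
    by (rule self_adjoint_maximum_eigenvector[OF lin adj Suc.prems]) (use v in auto)
  define W' where "W' = {y \<in> W. \<forall>x\<in>span {v}. orthogonal x y}"
  have W': "W' = {y \<in> W. v \<bullet> y = 0}"
    unfolding W'_def by (auto simp: orthogonal_def span_singleton)
  have "dim W' + dim (span {v}) = dim W"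
    unfolding W'_def
    by (rule dim_subspace_orthogonal_to_vectors)
      (use Suc.prems v in \<open>auto simp: span_minimal\<close>)
  moreover have "v \<noteq> 0" using v by auto
  ultimately have dimW': "m = dim W'" using Suc.hyps(2) by simp
  have sub: "subspace W'" unfolding W' subspace_def using Suc.prems(1)
    by (auto simp: subspace_def inner_simps)
  have "v \<bullet> S y = 0" if "v \<bullet> y = 0" for y
    using adj[of v y] that Sv by (metis inner_scaleR_left mult_zero_right)
  then have inv: "S ` W' \<subseteq> W'" using Suc.prems(2) unfolding W' by auto
  obtain B where B: "B \<subseteq> W'" "finite B" "card B = m" "pairwise orthogonal B"
    "\<forall>b\<in>B. norm b = 1 \<and> (\<exists>l. S b = l *\<^sub>R b)"
    using Suc.hyps(1)[OF dimW' sub inv] dimW' by auto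
  have "v \<notin> B" using B(1) v unfolding W' by auto
  moreover have "pairwise orthogonal (insert v B)"
    using B(1,4) unfolding W' pairwise_insert by (auto simp: orthogonal_def inner_commute)
  ultimately show ?case
    using B v Sv Suc.hyps(2) unfolding W' by (intro exI[of _ "insert v B"]) auto
qed

theorem self_adjoint_eigenbasis:
  fixes S :: "real^'n \<Rightarrow> real^'n"
  assumes "linear S" "\<And>x y. S x \<bullet> y = x \<bullet> S y"
  obtains v :: "'n \<Rightarrow> real^'n" and l :: "'n \<Rightarrow> real"
  where "\<And>i j. v i \<bullet> v j = (if i = j then 1 else 0)" "\<And>i. S (v i) = l i *\<^sub>R v i"
proof -
  obtain B where B: "finite B" "card B = DIM(real^'n)" "pairwise orthogonal B"
    "\<forall>b\<in>B. norm b = 1 \<and> (\<exists>l. S b = l *\<^sub>R b)"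
    using self_adjoint_eigenbasis_subspace[OF assms, of UNIV] by auto
  then obtain v :: "'n \<Rightarrow> real^'n" where v: "bij_betw v UNIV B"
    using finite_same_card_bij[of "UNIV :: 'n set" B] by auto
  then have vB: "v i \<in> B" for i by (auto simp: bij_betw_def)
  have "v i \<bullet> v j = (if i = j then 1 else 0)" for i j
  proof (cases "i = j")
    case True
    then show ?thesis using B(4) vB[of i] by (auto simp: norm_eq_1)
  next
    case False
    then have "v i \<noteq> v j" using v by (auto simp: bij_betw_def inj_def)
    then show ?thesis using B(3) vB False by (auto simp: pairwise_def orthogonal_def)
  qed
  moreover have "\<forall>i. \<exists>l. S (v i) = l *\<^sub>R v i" using B(4) vB by blast
  from choice[OF this] obtain l where "\<forall>i. S (v i) = l i *\<^sub>R v i" by blast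
  ultimately show thesis using that[of v l] by blast
qed

section \<open>Determinants of definite, reindexed and bordered matrices\<close>

lemma det_diagonal_matrix:
  fixes d :: "'n::finite \<Rightarrow> real"
  shows "det (\<chi> i j. if i = j then d i else 0) = (\<Prod>i\<in>UNIV. d i)"
  by (subst det_diagonal) auto

text \<open>In an orthonormal eigenbasis the determinant is the product of the eigenvalues, and each
  eigenvalue is the value of the quadratic form at a unit eigenvector.\<close>

lemma
  fixes G :: "real^'n^'n"
  assumes sym: "\<And>i j. G $ i $ j = G $ j $ i"
  shows det_nonneg_if_semidefinite: "(\<And>x. 0 \<le> x \<bullet> (G *v x)) \<Longrightarrow> 0 \<le> det G"
    and det_pos_if_definite: "(\<And>x. x \<noteq> 0 \<Longrightarrow> 0 < x \<bullet> (G *v x)) \<Longrightarrow> 0 < det G"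
proof -
  have tr: "transpose G = G" using sym by (simp add: transpose_def vec_eq_iff)
  have "(G *v x) \<bullet> y = x \<bullet> (G *v y)" for x y
    using dot_lmul_matrix[of x G y] tr by (metis inner_commute dot_lmul_matrix transpose_matrix_vector)
  then obtain v :: "'n \<Rightarrow> real^'n" and l where v: "\<And>i j. v i \<bullet> v j = (if i = j then 1 else 0)"
    "\<And>i. G *v v i = l i *\<^sub>R v i"
    using self_adjoint_eigenbasis[OF matrix_vector_mul_linear] by blast
  let ?Q = "\<chi> i. v i" and ?D = "\<chi> i j. if i = j then l i else 0"
  have Q: "?Q ** transpose ?Q = mat 1"
    using v(1) by (simp add: matrix_matrix_mult_def transpose_def vec_eq_iff mat_def inner_vec_def)
  have "G ** transpose ?Q = transpose ?Q ** ?D"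
  proof -
    have "(\<Sum>k\<in>UNIV. G $ i $ k * v j $ k) = v j $ i * l j" for i j
      using arg_cong[OF v(2)[of j], of "\<lambda>x. x $ i"] by (simp add: matrix_vector_mult_def)
    then show ?thesis
      by (simp add: matrix_matrix_mult_def transpose_def vec_eq_iff if_distrib cong: if_cong)
  qed
  from arg_cong[OF this, of det] have "det G * det ?Q = det ?Q * det ?D"
    by (simp only: det_mul det_transpose)
  moreover have "det ?Q \<noteq> 0" using arg_cong[OF Q, of det] by (auto simp only: det_I det_mul)
  ultimately have det: "det G = (\<Prod>i\<in>UNIV. l i)" by (simp add: det_diagonal_matrix)
  have l: "l i = v i \<bullet> (G *v v i)" for i using v by simp
  have "v i \<noteq> 0" for i using v(1)[of i i] by auto
  then show "(\<And>x. 0 \<le> x \<bullet> (G *v x)) \<Longrightarrow> 0 \<le> det G"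
    "(\<And>x. x \<noteq> 0 \<Longrightarrow> 0 < x \<bullet> (G *v x)) \<Longrightarrow> 0 < det G"
    unfolding det by (auto intro!: prod_nonneg prod_pos simp: l)
qed

text \<open>A relabelling of rows and columns acts on permutations by conjugation, which keeps the
  sign. It moves determinants to the well-ordered copy of the index type.\<close>

lemma det_reindex:
  fixes A :: "real^'d^'d" and b :: "'m::finite \<Rightarrow> 'd"
  assumes b: "bij b"
  shows "det (\<chi> i j. A $ b i $ b j) = det A"
proof -
  let ?h = "map_permutation UNIV b"
  have inj: "inj b" using b by (rule bij_is_inj)
  have perm: "bij_betw ?h {p. p permutes UNIV} {p. p permutes UNIV}"
  proof (rule bij_betw_byWitness[where f' = "map_permutation UNIV (inv b)"])
    show "\<forall>p\<in>{p. p permutes UNIV}. map_permutation UNIV (inv b) (?h p) = p"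
      using map_permutation_compose_inv[of b UNIV UNIV _ "inv b"] b inj by auto
    show "\<forall>p\<in>{p. p permutes UNIV}. ?h (map_permutation UNIV (inv b) p) = p"
      using map_permutation_compose_inv[of "inv b" UNIV UNIV _ b] b
      by (auto simp: bij_imp_bij_inv surj_f_inv_f[OF bij_is_surj])
  qed (use map_permutation_permutes b bij_imp_bij_inv in blast)+
  have "det A = (\<Sum>p | p permutes UNIV. of_int (sign (?h p)) * (\<Prod>i\<in>UNIV. A $ i $ (?h p) i))"
    unfolding det_def using sum.reindex_bij_betw[OF perm, symmetric] by simp
  also have "\<dots> = (\<Sum>p | p permutes UNIV. of_int (sign p) * (\<Prod>i\<in>UNIV. A $ b i $ b (p i)))"
  proof (rule sum.cong[OF refl])
    fix p :: "'m \<Rightarrow> 'm" assume "p \<in> {p. p permutes UNIV}"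
    then have "sign (?h p) = sign p" using sign_map_permutation[OF inj] by auto
    moreover have "(\<Prod>i\<in>UNIV. A $ i $ (?h p) i) = (\<Prod>i\<in>UNIV. A $ b i $ b (p i))"
      using prod.reindex_bij_betw[OF b, of "\<lambda>i. A $ i $ (?h p) i"]
      by (simp add: map_permutation_apply[OF inj])
    ultimately show "of_int (sign (?h p)) * (\<Prod>i\<in>UNIV. A $ i $ (?h p) i) =
      of_int (sign p) * (\<Prod>i\<in>UNIV. A $ b i $ b (p i))" by simp
  qed
  finally show ?thesis by (simp add: det_def)
qed

text \<open>Only permutations fixing \<open>None\<close> survive in the Leibniz sum, since the row
  \<open>None\<close> is a unit vector; they correspond to the permutations of \<open>'n\<close>
  through \<open>Some\<close>. The collar map produces such matrices, \<open>None\<close> being the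
  normal direction.\<close>

lemma det_option_block:
  fixes A :: "real^('n::finite option)^('n option)"
  assumes N: "\<And>j. A $ None $ Some j = 0" "A $ None $ None = 1"
  shows "det A = det (\<chi> i j. A $ Some i $ Some j)"
proof -
  let ?h = "map_permutation (UNIV :: 'n set) Some"
  have inj: "inj (Some :: 'n \<Rightarrow> 'n option)" by simp
  have bS: "bij_betw Some (UNIV :: 'n set) (range Some)" by (simp add: bij_betw_def)
  have bT: "bij_betw the (range Some) (UNIV :: 'n set)" by (auto simp: bij_betw_def inj_on_def)
  have bij: "bij_betw ?h {p. p permutes UNIV} {p. p permutes range Some}"
  proof (rule bij_betw_byWitness[where f' = "map_permutation (range Some) the"])
    show "\<forall>p\<in>{p. p permutes UNIV}. map_permutation (range Some) the (?h p) = p"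
      using map_permutation_compose_inv[OF bS, of _ the] by auto
    show "\<forall>p\<in>{p. p permutes range Some}. ?h (map_permutation (range Some) the p) = p"
    proof
      fix p :: "'n option \<Rightarrow> 'n option" assume "p \<in> {p. p permutes range Some}"
      then show "?h (map_permutation (range Some) the p) = p"
        by (intro map_permutation_compose_inv[OF bT]) auto
    qed
  qed (use map_permutation_permutes[OF bS] map_permutation_permutes[OF bT] in blast)+
  let ?t = "\<lambda>p. of_int (sign p) * (\<Prod>i\<in>UNIV. A $ i $ p i)"
  have UN: "(UNIV :: 'n option set) = insert None (range Some)" by (auto simp: UNIV_option_conv)
  have "det A = (\<Sum>p | p permutes (UNIV :: 'n option set). ?t p)" by (simp add: det_def)
  also have "\<dots> = (\<Sum>p | p permutes range Some. ?t p)"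
  proof (rule sum.mono_neutral_right)
    show "{p. p permutes range Some} \<subseteq> {p. p permutes (UNIV :: 'n option set)}"
      using permutes_subset by blast
    show "\<forall>p\<in>{p. p permutes UNIV} - {p. p permutes range Some}. ?t p = 0"
    proof
      fix p :: "'n option \<Rightarrow> 'n option"
      assume p: "p \<in> {p. p permutes UNIV} - {p. p permutes range Some}"
      have "p None \<noteq> None"
      proof
        assume "p None = None"
        then have "p permutes range Some"
          using p UN by (intro permutes_superset[of p UNIV "range Some"]) auto
        with p show False by simp
      qed
      then obtain j where "p None = Some j" by auto
      then have "A $ None $ p None = 0" using N by simp
      then have "(\<Prod>i\<in>UNIV. A $ i $ p i) = 0" by (intro prod_zero) auto
      then show "?t p = 0" by simp
    qed
  qed (auto simp: finite_permutations)
  also have "\<dots> = (\<Sum>p | p permutes (UNIV :: 'n set). ?t (?h p))"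
    using sum.reindex_bij_betw[OF bij, symmetric] by simp
  also have "\<dots> = (\<Sum>p | p permutes UNIV. of_int (sign p) * (\<Prod>i\<in>UNIV. A $ Some i $ Some (p i)))"
  proof (rule sum.cong[OF refl])
    fix p :: "'n \<Rightarrow> 'n" assume p: "p \<in> {p. p permutes UNIV}"
    have sg: "sign (?h p) = sign p" using sign_map_permutation[OF inj] p by auto
    have "?h p permutes range Some" using map_permutation_permutes[OF bS] p by blast
    then have "?h p None = None" by (simp add: permutes_not_in)
    then have "(\<Prod>i\<in>UNIV. A $ i $ ?h p i) = (\<Prod>i\<in>range Some. A $ i $ ?h p i)"
      unfolding UN by (subst prod.insert) (auto simp: N)
    also have "\<dots> = (\<Prod>i\<in>UNIV. A $ Some i $ Some (p i))"
      by (subst prod.reindex) (auto simp: map_permutation_apply[OF inj])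
    finally show "?t (?h p) = of_int (sign p) * (\<Prod>i\<in>UNIV. A $ Some i $ Some (p i))"
      using sg by simp
  qed
  finally show ?thesis by (simp add: det_def)
qed

text \<open>Expanding the product chooses a subset of factors; sorting the subsets by size produces
  the elementary symmetric functions. The curvature computations are all done on this generating
  polynomial.\<close>

lemma prod_linear_elem_sym:
  fixes x :: "real^'n"
  shows "(\<Prod>i\<in>UNIV. a + s * x $ i) = (\<Sum>m\<le>CARD('n). elem_sym m x * s ^ m * a ^ (CARD('n) - m))"
proof -
  have "(\<Prod>i\<in>UNIV. a + s * x $ i) = (\<Prod>i\<in>UNIV. s * x $ i + a)" by (simp add: add.commute)
  also have "\<dots> = (\<Sum>X\<in>Pow UNIV. (\<Prod>i\<in>X. s * x $ i) * (\<Prod>i\<in>UNIV - X. a))"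
    by (rule prod_add) simp
  also have "\<dots> = (\<Sum>X\<in>UNIV. s ^ card X * (\<Prod>i\<in>X. x $ i) * a ^ (CARD('n) - card X))"
    by (simp add: prod.distrib card_Diff_subset)
  also have "\<dots> = (\<Sum>m\<le>CARD('n). \<Sum>X | X \<in> UNIV \<and> card X = m. s ^ card X * (\<Prod>i\<in>X. x $ i) * a ^ (CARD('n) - card X))"
    by (rule sum.group[symmetric]) (auto simp: card_mono)
  also have "\<dots> = (\<Sum>m\<le>CARD('n). elem_sym m x * s ^ m * a ^ (CARD('n) - m))"
    unfolding elem_sym_def by (intro sum.cong refl) (simp add: sum_distrib_right sum_distrib_left mult_ac)
  finally show ?thesis .
qed

section \<open>The Lorentz form\<close>

lemma bounded_bilinear_lor: "bounded_bilinear (lor :: 'a::real_inner \<times> real \<Rightarrow> 'a \<times> real \<Rightarrow> real)"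
proof (rule bounded_bilinear.intro)
  have "norm (lor X Y) \<le> norm X * norm Y * 2" for X Y :: "'a \<times> real"
  proof -
    have "\<bar>fst X \<bullet> fst Y\<bar> \<le> norm X * norm Y"
      using Cauchy_Schwarz_ineq2[of "fst X" "fst Y"] mult_mono[OF norm_fst_le[of "fst X" "snd X"] norm_fst_le[of "fst Y" "snd Y"]] by simp
    moreover have "\<bar>snd X * snd Y\<bar> \<le> norm X * norm Y"
      using mult_mono[OF norm_snd_le[of "snd X" "fst X"] norm_snd_le[of "snd Y" "fst Y"]] by (simp add: abs_mult)
    ultimately show ?thesis unfolding lor_def real_norm_def by linarith
  qed
  then show "\<exists>K. \<forall>X Y :: 'a \<times> real. norm (lor X Y) \<le> norm X * norm Y * K" by blast
qed (auto simp: lor_def inner_simps algebra_simps)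

lemma lor_sym: "lor X Y = lor Y X"
  by (simp add: lor_def inner_commute mult.commute)

lemma lor_simps [simp]:
  "lor (X + Y) Z = lor X Z + lor Y Z" "lor Z (X + Y) = lor Z X + lor Z Y"
  "lor (X - Y) Z = lor X Z - lor Y Z" "lor Z (X - Y) = lor Z X - lor Z Y"
  "lor (c *\<^sub>R X) Z = c * lor X Z" "lor Z (c *\<^sub>R X) = c * lor Z X"
  "lor (- X) Z = - lor X Z" "lor Z (- X) = - lor Z X" "lor 0 Z = 0" "lor Z 0 = 0"
  by (auto simp: lor_def inner_simps algebra_simps)

lemma lor_sum_left: "lor (\<Sum>i\<in>A. f i) Z = (\<Sum>i\<in>A. lor (f i) Z)"
  by (induction A rule: infinite_finite_induct) auto

lemma lor_sum_right: "lor Z (\<Sum>i\<in>A. f i) = (\<Sum>i\<in>A. lor Z (f i))"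
  by (induction A rule: infinite_finite_induct) auto

lemma hypD: "p \<in> hyp \<Longrightarrow> lor p p = -1" "p \<in> hyp \<Longrightarrow> snd p > 0"
  by (auto simp: hyp_def)

text \<open>Tangency says that the spatial parts of \<open>v\<close> and \<open>p\<close> have inner
  product \<open>?b * ?s\<close>, and the spatial part of \<open>p\<close> has square
  \<open>?s^2 - 1\<close>. Cauchy-Schwarz then gives \<open>?a \<le> (?a - ?b^2) * ?s^2\<close>,
  where the left side is positive.\<close>

lemma lor_pos_tangent:
  assumes "p \<in> hyp" "lor v p = 0" "v \<noteq> 0"
  shows "lor v v > 0"
proof -
  let ?a = "fst v \<bullet> fst v" and ?b = "snd v" and ?s = "snd p"
  have p: "fst p \<bullet> fst p = ?s\<^sup>2 - 1" "?s > 0"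
    using assms(1) by (auto simp: hyp_def lor_def power2_eq_square)
  have vp: "fst v \<bullet> fst p = ?b * ?s" using assms(2) by (simp add: lor_def)
  have "fst v \<noteq> 0"
  proof
    assume 0: "fst v = 0"
    then have "?b = 0" using vp p by auto
    with 0 assms(3) show False by (simp add: prod_eq_iff)
  qed
  then have a: "?a > 0" by simp
  have "(?b * ?s)\<^sup>2 \<le> ?a * (?s\<^sup>2 - 1)" using Cauchy_Schwarz_ineq[of "fst v" "fst p"] p vp by simp
  then have "?a \<le> (?a - ?b\<^sup>2) * ?s\<^sup>2" by (simp add: algebra_simps power_mult_distrib)
  then have "0 < (?a - ?b\<^sup>2) * ?s\<^sup>2" using a by linarith
  then have "0 < ?a - ?b\<^sup>2" by (simp add: zero_less_mult_iff)
  then show ?thesis by (simp add: lor_def power2_eq_square)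
qed

lemma lor_tangent_nonneg: "p \<in> hyp \<Longrightarrow> lor v p = 0 \<Longrightarrow> lor v v \<ge> 0"
  using lor_pos_tangent[of p v] by (cases "v = 0") auto

text \<open>Reverse Cauchy-Schwarz. The projection \<open>?w\<close> of \<open>X\<close> to the
  tangent space at \<open>Y\<close> has square \<open>(lor X Y)^2 - 1\<close>, which is nonnegative
  and vanishes only for \<open>?w = 0\<close>; the sign comes from the positive time
  components.\<close>

lemma lor_hyp_le:
  assumes "X \<in> hyp" "Y \<in> hyp"
  shows "1 \<le> - lor X Y" and "lor X Y = -1 \<Longrightarrow> X = Y"
proof -
  let ?c = "- lor X Y" and ?w = "X + lor X Y *\<^sub>R Y"
  note X = hypD[OF assms(1)] and Y = hypD[OF assms(2)]
  have w: "lor ?w Y = 0" using Y by simp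
  have ww: "lor ?w ?w = ?c\<^sup>2 - 1" using X Y by (simp add: lor_sym[of Y X] power2_eq_square)
  have "norm (fst Z) < snd Z" if "lor Z Z = -1" "snd Z > 0" for Z :: "'a minkowski"
  proof (rule power2_less_imp_less)
    show "(norm (fst Z))\<^sup>2 < (snd Z)\<^sup>2"
      using that by (simp add: lor_def power2_norm_eq_inner power2_eq_square[of "snd Z"])
  qed (use that in simp)
  with X Y have "norm (fst X) < snd X" "norm (fst Y) < snd Y" by auto
  then have "norm (fst X) * norm (fst Y) < snd X * snd Y"
    by (intro mult_strict_mono') auto
  then have c: "?c > 0" using norm_cauchy_schwarz[of "fst X" "fst Y"] by (simp add: lor_def)
  have "1\<^sup>2 \<le> ?c\<^sup>2" using lor_tangent_nonneg[OF assms(2) w] ww by simp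
  then show "1 \<le> ?c" using c power2_le_imp_le[of 1 ?c] by simp
  assume 1: "lor X Y = -1"
  then have "?w = 0" using lor_pos_tangent[OF assms(2) w] ww by fastforce
  then show "X = Y" using 1 by simp
qed

text \<open>\<open>A\<close> plays the role of the differential of a parametrization.\<close>

lemma lor_orthonormalize:
  fixes A :: "real^'n \<Rightarrow> 'b::real_inner \<times> real"
  assumes "linear A" and pos: "\<And>x. x \<noteq> 0 \<Longrightarrow> lor (A x) (A x) > 0"
  obtains P :: "real^'n \<Rightarrow> real^'n" where "linear P" "bij P" "\<And>x y. lor (A (P x)) (A (P y)) = x \<bullet> y"
proof -
  let ?G = "\<chi> i j. lor (A (axis i 1)) (A (axis j 1))"
  have G: "x \<bullet> (?G *v y) = lor (A x) (A y)" for x y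
  proof -
    have Az: "A z = (\<Sum>i\<in>UNIV. (z $ i) *\<^sub>R A (axis i 1))" for z
    proof -
      have "A (\<Sum>i\<in>UNIV. (z $ i) *\<^sub>R axis i 1) = (\<Sum>i\<in>UNIV. (z $ i) *\<^sub>R A (axis i 1))"
        using assms(1) by (simp add: linear_sum linear_scale)
      then show ?thesis using basis_expansion[of z] by (simp add: scalar_mult_eq_scaleR)
    qed
    have "lor (A x) (A y) = (\<Sum>i\<in>UNIV. \<Sum>j\<in>UNIV. x $ i * (y $ j * lor (A (axis i 1)) (A (axis j 1))))"
      unfolding Az[of x] Az[of y] lor_sum_left lor_sum_right lor_simps sum_distrib_left
      by (subst sum.swap) (simp add: mult.left_commute)
    then show ?thesis
      by (simp add: inner_vec_def matrix_vector_mult_def sum_distrib_left mult_ac)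
  qed
  have "(?G *v x) \<bullet> y = x \<bullet> (?G *v y)" for x y
    using inner_commute[of "?G *v x" y] G[of y x] lor_sym[of "A x" "A y"] G[of x y] by argo
  then obtain v :: "'n \<Rightarrow> real^'n" and l where v: "\<And>i j. v i \<bullet> v j = (if i = j then 1 else 0)"
    "\<And>i. ?G *v v i = l i *\<^sub>R v i"
    using self_adjoint_eigenbasis[OF matrix_vector_mul_linear] by blast
  have l: "l i > 0" for i
  proof -
    have "v i \<noteq> 0" using v(1)[of i i] by auto
    then show ?thesis using G[of "v i" "v i"] v pos by simp
  qed
  \<comment> \<open>The columns of \<open>P\<close> are eigenvectors of the Gram matrix divided by
    the square roots of their eigenvalues, which turns the pulled back form into the Euclidean
    one.\<close>
  define P where "P x = (\<Sum>i\<in>UNIV. (x $ i / sqrt (l i)) *\<^sub>R v i)" for x :: "real^'n"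
  have lin: "linear P"
    unfolding P_def
    by (rule linearI) (auto simp: sum.distrib scaleR_sum_right add_divide_distrib scaleR_add_left)
  have AP: "lor (A (P x)) (A (P y)) = x \<bullet> y" for x y
  proof -
    have APx: "A (P x) = (\<Sum>i\<in>UNIV. (x $ i / sqrt (l i)) *\<^sub>R A (v i))" for x
      unfolding P_def using assms(1) by (simp add: linear_sum linear_scale)
    have vv: "lor (A (v i)) (A (v j)) = (if i = j then l i else 0)" for i j
      using G[of "v i" "v j"] unfolding v inner_scaleR_right by (cases "i = j") simp_all
    have "lor (A (P x)) (A (P y)) =
      (\<Sum>i\<in>UNIV. \<Sum>j\<in>UNIV. if i = j then x $ i / sqrt (l i) * (y $ i / sqrt (l i) * l i) else 0)"
      unfolding APx lor_sum_left lor_sum_right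
      by (intro sum.cong refl) (auto simp: vv)
    also have "\<dots> = (\<Sum>i\<in>UNIV. x $ i * y $ i)"
    proof -
      have "x $ i / sqrt (l i) * (y $ i / sqrt (l i) * l i) = x $ i * y $ i" for i
        using l[of i] by (simp add: field_simps) 
      then show ?thesis by simp
    qed
    finally show ?thesis by (simp add: inner_vec_def)
  qed
  have "inj P"
  proof (rule linear_injective_0[OF lin, THEN iffD2], intro allI impI)
    fix x assume "P x = 0"
    then have "x \<bullet> x = 0" using AP[of x x] linear_0[OF assms(1)] by simp
    then show "x = 0" by simp
  qed
  then have "bij P" using linear_injective_imp_surjective[OF lin] by (simp add: bij_def)
  with lin AP that show thesis by blast
qed

text \<open>The form pulled back by \<open>A\<close> is positive definite, so after \<open>P\<close>
  it is Euclidean and \<open>D\<close> becomes the self-adjoint map \<open>T\<close>. The range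
  inclusion lets an eigenvector of \<open>T\<close> be traced back to one of \<open>D\<close>: the
  defect is \<open>A (P y)\<close> with \<open>y\<close> orthogonal to itself.\<close>

lemma lor_self_adjoint_eigenbasis:
  fixes A D :: "real^'n \<Rightarrow> 'b::real_inner \<times> real"
  assumes "linear A" and pos: "\<And>x. x \<noteq> 0 \<Longrightarrow> lor (A x) (A x) > 0"
    and "linear D" and range: "range D \<subseteq> range A"
    and adj: "\<And>x y. lor (D x) (A y) = lor (A x) (D y)"
  obtains a :: "'n \<Rightarrow> real^'n" and \<kappa> :: "'n \<Rightarrow> real"
  where "\<And>i j. lor (A (a i)) (A (a j)) = (if i = j then 1 else 0)" "\<And>i. D (a i) = \<kappa> i *\<^sub>R A (a i)"
proof -
  obtain P :: "real^'n \<Rightarrow> real^'n" where P: "linear P" "bij P" "\<And>x y. lor (A (P x)) (A (P y)) = x \<bullet> y"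
    using lor_orthonormalize[OF assms(1) pos] by blast
  define T where "T x = (\<chi> i. lor (D (P x)) (A (P (axis i 1))))" for x
  have "linear T"
    unfolding T_def using P(1) assms(1,3)
    by (intro linearI) (auto simp: vec_eq_iff linear_add linear_scale)
  have T: "T x \<bullet> y = lor (D (P x)) (A (P y))" for x y
  proof -
    have "A (P (\<Sum>i\<in>UNIV. (y $ i) *\<^sub>R axis i 1)) = (\<Sum>i\<in>UNIV. (y $ i) *\<^sub>R A (P (axis i 1)))"
      using assms(1) P(1) by (simp add: linear_sum linear_scale)
    then have "A (P y) = (\<Sum>i\<in>UNIV. (y $ i) *\<^sub>R A (P (axis i 1)))"
      using basis_expansion[of y] by (simp add: scalar_mult_eq_scaleR)
    then show ?thesis unfolding T_def by (simp add: lor_sum_right inner_vec_def mult.commute)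
  qed
  have "T x \<bullet> y = x \<bullet> T y" for x y
    using T[of x y] T[of y x] adj[of "P x" "P y"] lor_sym[of "A (P x)" "D (P y)"] inner_commute[of x "T y"]
    by argo
  then obtain v :: "'n \<Rightarrow> real^'n" and l where v: "\<And>i j. v i \<bullet> v j = (if i = j then 1 else 0)"
    "\<And>i. T (v i) = l i *\<^sub>R v i"
    using self_adjoint_eigenbasis[OF \<open>linear T\<close>] by blast
  have "D (P (v i)) = l i *\<^sub>R A (P (v i))" for i
  proof -
    obtain z where z: "D (P (v i)) = A z" using range by blast
    obtain y where y: "z - l i *\<^sub>R P (v i) = P y" using P(2) by (metis bij_pointE)
    have Ay: "A (P y) = D (P (v i)) - l i *\<^sub>R A (P (v i))"
      using z y assms(1) by (metis linear_diff linear_scale)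
    have "y \<bullet> y = lor (A (P y)) (A (P y))" using P(3) by simp
    also have "\<dots> = T (v i) \<bullet> y - l i * (v i \<bullet> y)"
      by (subst (1) Ay) (simp add: T P(3))
    also have "\<dots> = 0" using v(2) by simp
    finally have "y = 0" by simp
    then show ?thesis using Ay P(1) assms(1) by (simp add: linear_0)
  qed
  then show thesis using that[of "\<lambda>i. P (v i)" l] v(1) P(3) by simp
qed

text \<open>The coefficient map \<open>?C\<close> is injective by orthonormality, hence surjective
  for dimension reasons, so the given vectors span the range of \<open>A\<close>.\<close>

lemma lor_orthonormal_expansion:
  fixes A :: "real^'n \<Rightarrow> 'b::real_inner \<times> real"
  assumes "linear A" and on: "\<And>i j :: 'n. lor (A (a i)) (A (a j)) = (if i = j then 1 else 0)"
  shows "A x = (\<Sum>i\<in>UNIV. lor (A x) (A (a i)) *\<^sub>R A (a i))"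
proof -
  let ?C = "\<lambda>c :: real^'n. \<Sum>i\<in>UNIV. (c $ i) *\<^sub>R a i"
  have lin: "linear ?C"
    by (rule linearI) (auto simp: sum.distrib scaleR_sum_right scaleR_add_left)
  have AC: "A (?C c) = (\<Sum>i\<in>UNIV. (c $ i) *\<^sub>R A (a i))" for c
    using assms(1) by (simp add: linear_sum linear_scale)
  have c: "lor (A (?C c)) (A (a j)) = c $ j" for c j
    unfolding AC lor_sum_left by (simp add: on if_distrib cong: if_cong)
  have "inj ?C"
  proof (rule linear_injective_0[OF lin, THEN iffD2], intro allI impI)
    fix c assume "?C c = 0"
    then have "lor (A (?C c)) (A (a j)) = 0" for j using linear_0[OF assms(1)] by simp
    then show "c = 0" unfolding c by (simp add: vec_eq_iff)
  qed
  then have "surj ?C" by (intro linear_injective_imp_surjective[OF lin]) auto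
  then obtain c where x: "x = ?C c" by (blast dest: surjD)
  have cj: "c $ j = lor (A x) (A (a j))" for j using c[of c j] x by simp
  show ?thesis using AC[of c, folded x] unfolding cj .
qed

text \<open>Two orthonormal eigenbases of the same operator differ by an orthogonal matrix
  \<open>?Q\<close> that intertwines the diagonal matrices of eigenvalues, so determinants agree.
  With \<open>principal_curvatures\<close> fixed only by choice, this is how its symmetric functions
  are computed from any convenient eigenbasis.\<close>

lemma prod_eigenvalues_unique:
  fixes A D :: "real^'n \<Rightarrow> 'b::real_inner \<times> real" and a a' :: "'n \<Rightarrow> real^'n"
  assumes "linear A" "linear D"
    and on: "\<And>i j. lor (A (a i)) (A (a j)) = (if i = j then 1 else 0)"
    and on': "\<And>i j. lor (A (a' i)) (A (a' j)) = (if i = j then 1 else 0)"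
    and eig: "\<And>i. D (a i) = \<kappa> i *\<^sub>R A (a i)" and eig': "\<And>i. D (a' i) = \<kappa>' i *\<^sub>R A (a' i)"
    and inj: "inj A"
  shows "(\<Prod>i\<in>UNIV. c + s * \<kappa> i) = (\<Prod>i\<in>UNIV. c + s * \<kappa>' i)"
proof -
  let ?Q = "\<chi> i j. lor (A (a' i)) (A (a j))"
  have exp: "a' i = (\<Sum>j\<in>UNIV. ?Q $ i $ j *\<^sub>R a j)" for i
  proof -
    have "A (a' i) = A (\<Sum>j\<in>UNIV. ?Q $ i $ j *\<^sub>R a j)"
      using lor_orthonormal_expansion[OF assms(1) on, of "a' i"] assms(1)
      by (simp add: linear_sum linear_scale)
    then show ?thesis using inj by (simp add: inj_eq)
  qed
  have "?Q ** transpose ?Q = mat 1"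
  proof -
    have "(\<Sum>k\<in>UNIV. lor (A (a' i)) (A (a k)) * lor (A (a' j)) (A (a k))) = (if i = j then 1 else 0)" for i j
      using arg_cong[OF lor_orthonormal_expansion[OF assms(1) on, of "a' i"], of "\<lambda>z. lor z (A (a' j))"]
      by (simp add: lor_sum_left lor_sym[of "A (a _)" "A (a' j)"] on')
    then show ?thesis by (simp add: matrix_matrix_mult_def transpose_def vec_eq_iff mat_def)
  qed
  from arg_cong[OF this, of det] have det: "det ?Q \<noteq> 0" by (auto simp only: det_I det_mul)
  have eq: "\<kappa>' i * ?Q $ i $ j = ?Q $ i $ j * \<kappa> j" for i j
  proof -
    have "D (a' i) = (\<Sum>k\<in>UNIV. ?Q $ i $ k *\<^sub>R D (a k))"
      by (subst exp) (use assms(2) in \<open>simp add: linear_sum linear_scale\<close>)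
    then have "lor (D (a' i)) (A (a j)) = (\<Sum>k\<in>UNIV. ?Q $ i $ k * (\<kappa> k * lor (A (a k)) (A (a j))))"
      by (simp add: lor_sum_left eig mult.assoc)
    then show ?thesis by (simp add: eig' on if_distrib cong: if_cong)
  qed
  have "?Q ** (\<chi> i j. if i = j then c + s * \<kappa> i else 0) = (\<chi> i j. if i = j then c + s * \<kappa>' i else 0) ** ?Q"
    using eq by (simp add: matrix_matrix_mult_def vec_eq_iff if_distrib if_distribR algebra_simps cong: if_cong)
      metis
  from arg_cong[OF this, of det]
  have "det ?Q * (\<Prod>i\<in>UNIV. c + s * \<kappa> i) = (\<Prod>i\<in>UNIV. c + s * \<kappa>' i) * det ?Q"
    by (simp only: det_mul det_diagonal_matrix)
  then show ?thesis using det by simp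
qed

section \<open>Change of variables\<close>

text \<open>The library proves the change of variables formula only for well-ordered index types;
  \<open>'n ix\<close> is a well-ordered copy of the finite type \<open>'n\<close>.\<close>

typedef (overloaded) ('n::finite) ix = "{..<CARD('n)}"
  by (rule exI[of _ 0]) simp

lemma card_UNIV_ix: "CARD(('n::finite) ix) = CARD('n)"
  by (simp add: type_definition.card[OF type_definition_ix])

instance ix :: (finite) finite
proof
  have "finite (Rep_ix ` (UNIV :: 'a ix set))"
    by (rule finite_subset[of _ "{..<CARD('a)}"]) (use Rep_ix in auto)
  then show "finite (UNIV :: 'a ix set)"
    by (rule finite_imageD) (simp add: inj_on_def Rep_ix_inject)
qed

instantiation ix :: (finite) wellorder
begin

definition less_eq_ix :: "'a ix \<Rightarrow> 'a ix \<Rightarrow> bool" where "less_eq_ix x y \<longleftrightarrow> Rep_ix x \<le> Rep_ix y"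
definition less_ix :: "'a ix \<Rightarrow> 'a ix \<Rightarrow> bool" where "less_ix x y \<longleftrightarrow> Rep_ix x < Rep_ix y"

instance
proof
  fix P :: "'a ix \<Rightarrow> bool" and a :: "'a ix"
  assume step: "\<And>x. (\<And>y. y < x \<Longrightarrow> P y) \<Longrightarrow> P x"
  show "P a"
    by (induction "Rep_ix a" arbitrary: a rule: less_induct) (rule step, simp add: less_ix_def)
qed (auto simp: less_eq_ix_def less_ix_def Rep_ix_inject)

end

text \<open>A bijection of the basis vectors sends boxes to boxes with the same side lengths, and
  boxes determine Lebesgue measure.\<close>

lemma distr_lborel_basis_bij:
  fixes f :: "'a::euclidean_space \<Rightarrow> 'b::euclidean_space"
  assumes lin: "linear f" and bij: "bij_betw f Basis Basis"
  shows "distr lborel borel f = lborel"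
proof (rule lborel_eqI[symmetric])
  have f[measurable]: "f \<in> borel_measurable borel"
    using lin linear_conv_bounded_linear linear_continuous_on by (intro borel_measurable_continuous_onI) blast
  have fb: "f x \<bullet> f b = x \<bullet> b" if "b \<in> Basis" for x b
  proof -
    have "f x = (\<Sum>c\<in>Basis. (x \<bullet> c) *\<^sub>R f c)"
      using lin by (subst euclidean_representation[of x, symmetric]) (simp add: linear_sum linear_scale)
    then have "f x \<bullet> f b = (\<Sum>c\<in>Basis. (x \<bullet> c) * (f c \<bullet> f b))" by (simp add: inner_sum_left)
    also have "\<dots> = (\<Sum>c\<in>Basis. if c = b then x \<bullet> c else 0)"
    proof (intro sum.cong refl)
      fix c :: 'a assume c: "c \<in> Basis"
      have "f c \<in> Basis" "f b \<in> Basis" "f c = f b \<longleftrightarrow> c = b"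
        using c that bij by (auto simp: bij_betw_def inj_on_def)
      then show "(x \<bullet> c) * (f c \<bullet> f b) = (if c = b then x \<bullet> c else 0)" by (simp add: inner_Basis)
    qed
    finally show ?thesis using that by simp
  qed
  fix l u :: 'b assume lu: "\<And>b. b \<in> Basis \<Longrightarrow> l \<bullet> b \<le> u \<bullet> b"
  define g where "g y = (\<Sum>b\<in>Basis. (y \<bullet> f b) *\<^sub>R b)" for y
  have g: "g y \<bullet> b = y \<bullet> f b" if "b \<in> Basis" for y b
    unfolding g_def using that by (simp add: inner_sum_left inner_Basis if_distrib cong: if_cong)
  have B: "Basis = f ` Basis" using bij by (simp add: bij_betw_def)
  have "f -` box l u = box (g l) (g u)"
    unfolding box_def using fb g by (subst B) auto
  then have "emeasure (distr lborel borel f) (box l u) = emeasure lborel (box (g l) (g u))"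
    by (simp add: emeasure_distr)
  also have "\<dots> = (\<Prod>b\<in>Basis. (g u - g l) \<bullet> b)"
    using lu bij by (intro emeasure_lborel_box) (auto simp: g bij_betw_def)
  also have "(\<Prod>b\<in>Basis. (g u - g l) \<bullet> b) = (\<Prod>b\<in>Basis. (u - l) \<bullet> b)"
    using prod.reindex_bij_betw[OF bij, of "\<lambda>b. (u - l) \<bullet> b"]
    by (simp add: g inner_diff_left)
  finally show "emeasure (distr lborel borel f) (box l u) = (\<Prod>b\<in>Basis. (u - l) \<bullet> b)" .
qed simp

text \<open>Simple functions below \<open>h\<close> are measurable and can be transported, whether
  or not \<open>h\<close> is. For a map and its inverse the two inequalities combine into an
  equality for arbitrary integrands.\<close>

lemma nn_integral_distr_le:
  assumes T: "T \<in> measurable M N"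
  shows "(\<integral>\<^sup>+x. h x \<partial>distr M N T) \<le> (\<integral>\<^sup>+x. h (T x) \<partial>M)"
  unfolding nn_integral_def[of "distr M N T"]
proof (rule SUP_least, clarify)
  fix s assume s: "simple_function (distr M N T) s" "s \<le> h"
  have "integral\<^sup>S (distr M N T) s = (\<integral>\<^sup>+x. s x \<partial>distr M N T)"
    by (rule nn_integral_eq_simple_integral[OF s(1), symmetric])
  also have "\<dots> = (\<integral>\<^sup>+x. s (T x) \<partial>M)"
    using borel_measurable_simple_function[OF s(1)] by (intro nn_integral_distr[OF T]) simp
  also have "\<dots> \<le> (\<integral>\<^sup>+x. h (T x) \<partial>M)"
    using s(2) by (intro nn_integral_mono) (auto simp: le_fun_def)
  finally show "integral\<^sup>S (distr M N T) s \<le> (\<integral>\<^sup>+x. h (T x) \<partial>M)" .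
qed

text \<open>The bridge between the Henstock-Kurzweil formulation of the change of variables and
  nonnegative integrals, including the case of an infinite value.\<close>

lemma absolutely_integrable_iff_nn_integral:
  fixes F :: "'a::euclidean_space \<Rightarrow> real"
  assumes S: "S \<in> sets lebesgue" and F: "F \<in> borel_measurable (lebesgue_on S)" "\<And>x. x \<in> S \<Longrightarrow> 0 \<le> F x"
  shows "F absolutely_integrable_on S \<longleftrightarrow> (\<integral>\<^sup>+x\<in>S. ennreal (F x) \<partial>lborel) < \<infinity>"
    and "F absolutely_integrable_on S \<Longrightarrow> ennreal (integral S F) = (\<integral>\<^sup>+x\<in>S. ennreal (F x) \<partial>lborel)"
proof -
  have nn: "(\<integral>\<^sup>+x\<in>S. ennreal (F x) \<partial>lborel) = (\<integral>\<^sup>+x. ennreal (F x) \<partial>lebesgue_on S)"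
    using S by (simp add: nn_integral_restrict_space nn_integral_completion)
  have space: "space (lebesgue_on S) = S" by simp
  have iff: "F absolutely_integrable_on S \<longleftrightarrow> integrable (lebesgue_on S) F"
  proof -
    have "integrable (lebesgue_on S) (\<lambda>x. \<bar>F x\<bar>) \<longleftrightarrow> integrable (lebesgue_on S) F"
      by (intro Bochner_Integration.integrable_cong refl) (use F(2) in auto)
    then show ?thesis using absolutely_integrable_measurable_real[OF S, of F] F by simp
  qed
  have eq: "(\<integral>\<^sup>+x. ennreal (norm (F x)) \<partial>lebesgue_on S) = (\<integral>\<^sup>+x. ennreal (F x) \<partial>lebesgue_on S)"
    by (intro nn_integral_cong) (use F(2) in auto)
  show "F absolutely_integrable_on S \<longleftrightarrow> (\<integral>\<^sup>+x\<in>S. ennreal (F x) \<partial>lborel) < \<infinity>"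
    unfolding iff integrable_iff_bounded nn eq using F(1) by simp
  assume "F absolutely_integrable_on S"
  then have int: "integrable (lebesgue_on S) F" using iff by simp
  have "integral S F = integral\<^sup>L (lebesgue_on S) F"
    using lebesgue_integral_eq_integral[OF int S] by simp
  then show "ennreal (integral S F) = (\<integral>\<^sup>+x\<in>S. ennreal (F x) \<partial>lborel)"
    unfolding nn by (subst nn_integral_eq_integral[OF int]) (auto intro!: AE_I2 F(2))
qed

text \<open>The change of variables theorem is applied to vector-valued integrands, so real ones
  pass through the one-dimensional space \<open>real^1\<close>.\<close>

lemma absolutely_integrable_on_vec1:
  fixes F :: "'a::euclidean_space \<Rightarrow> real"
  shows "(\<lambda>x. vec (F x) :: real^1) absolutely_integrable_on S \<longleftrightarrow> F absolutely_integrable_on S"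
    and "F absolutely_integrable_on S \<Longrightarrow> integral S (\<lambda>x. vec (F x) :: real^1) = vec (integral S F)"
proof -
  show *: "(\<lambda>x. vec (F x) :: real^1) absolutely_integrable_on S \<longleftrightarrow> F absolutely_integrable_on S"
    by (subst absolutely_integrable_componentwise_iff) (auto simp: Basis_vec_def inner_axis)
  assume "F absolutely_integrable_on S"
  then have "(\<lambda>x. vec (F x) :: real^1) integrable_on S"
    using * set_lebesgue_integral_eq_integral(1) by blast
  then show "integral S (\<lambda>x. vec (F x) :: real^1) = vec (integral S F)"
    by (simp add: vec_eq_iff integral_component_eq_cart[symmetric])
qed

text \<open>Integrability on the two sides is equivalent: if it holds the integrals agree, and
  otherwise both nonnegative integrals are infinite.\<close>

lemma nn_integral_change_of_variables_wellorder:
  fixes g :: "real^'m::{finite,wellorder} \<Rightarrow> real^'m::_" and f :: "real^'m::_ \<Rightarrow> real"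
  assumes S: "S \<in> sets borel" and gS: "g ` S \<in> sets borel"
    and der: "\<And>x. x \<in> S \<Longrightarrow> (g has_derivative g' x) (at x within S)"
    and inj: "inj_on g S" and f: "f \<in> borel_measurable borel" "\<And>y. y \<in> g ` S \<Longrightarrow> 0 \<le> f y"
  shows "(\<integral>\<^sup>+y\<in>g ` S. ennreal (f y) \<partial>lborel) = (\<integral>\<^sup>+x\<in>S. ennreal (\<bar>det (matrix (g' x))\<bar> * f (g x)) \<partial>lborel)"
proof -
  let ?F = "\<lambda>x. \<bar>det (matrix (g' x))\<bar> * f (g x)"
  have S': "S \<in> sets lebesgue" and gS': "g ` S \<in> sets lebesgue"
    using S gS sets_completionI_sets[of _ lborel] by auto
  have f': "f \<in> borel_measurable (lebesgue_on (g ` S))"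
    using f(1) by (intro measurable_restrict_space1) (simp add: measurable_completion)
  have "continuous_on S g"
    using der has_derivative_continuous continuous_on_eq_continuous_within by blast
  then have "g \<in> borel_measurable (lebesgue_on S)"
    using S' continuous_imp_measurable_on_sets_lebesgue by blast
  then have "(\<lambda>x. f (g x)) \<in> borel_measurable (lebesgue_on S)"
    using measurable_compose[OF _ f(1)] by blast
  then have F: "?F \<in> borel_measurable (lebesgue_on S)"
    using borel_measurable_det_Jacobian[OF S' der] by (intro borel_measurable_times borel_measurable_abs)
  have F0: "0 \<le> ?F x" if "x \<in> S" for x using f(2) that by simp
  note 1 = absolutely_integrable_iff_nn_integral[OF S' F F0]
  note 2 = absolutely_integrable_iff_nn_integral[OF gS' f' f(2)]
  have "(\<lambda>x. vec (?F x) :: real^1) = (\<lambda>x. \<bar>det (matrix (g' x))\<bar> *\<^sub>R vec (f (g x)))"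
    by (simp add: vec_eq_iff fun_eq_iff)
  then have cov: "(\<lambda>x. vec (?F x) :: real^1) absolutely_integrable_on S \<and> integral S (\<lambda>x. vec (?F x) :: real^1) = b \<longleftrightarrow>
      (\<lambda>y. vec (f y) :: real^1) absolutely_integrable_on g ` S \<and> integral (g ` S) (\<lambda>y. vec (f y) :: real^1) = b" for b
    using has_absolute_integral_change_of_variables[OF S' der inj, of "\<lambda>y. vec (f y) :: real^1"] by simp
  have iff: "?F absolutely_integrable_on S \<longleftrightarrow> f absolutely_integrable_on g ` S"
  proof -
    have "(\<lambda>x. vec (?F x) :: real^1) absolutely_integrable_on S \<longleftrightarrow> (\<lambda>y. vec (f y) :: real^1) absolutely_integrable_on g ` S"
      using cov by blast
    then show ?thesis unfolding absolutely_integrable_on_vec1(1) .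
  qed
  show ?thesis
  proof (cases "f absolutely_integrable_on g ` S")
    case True
    with iff have T: "?F absolutely_integrable_on S" by simp
    have "integral S (\<lambda>x. vec (?F x) :: real^1) = integral (g ` S) (\<lambda>y. vec (f y) :: real^1)"
      using cov[of "integral (g ` S) (\<lambda>y. vec (f y) :: real^1)"] True absolutely_integrable_on_vec1(1)[where F = f and S = "g ` S"] by simp
    then have "vec (integral S ?F) = (vec (integral (g ` S) f) :: real^1)"
      unfolding absolutely_integrable_on_vec1(2)[OF T] absolutely_integrable_on_vec1(2)[OF True] .
    then have "integral S ?F = integral (g ` S) f" by (simp add: vec_eq_iff)
    then show ?thesis using 1(2)[OF _ T] 2(2)[OF _ True] by simp
  next
    case False
    then have "\<not> ?F absolutely_integrable_on S" using iff by simp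
    then show ?thesis using False 1(1) 2(1) by (simp add: less_top[symmetric])
  qed
qed

text \<open>Conjugation of \<open>g\<close> with the relabelling \<open>P\<close> of coordinates and
  its inverse \<open>Q\<close> moves the problem to the well-ordered index type; Lebesgue measure is
  invariant under both maps and \<open>det_reindex\<close> keeps the Jacobian.\<close>

lemma nn_integral_change_of_variables:
  fixes g :: "real^'d \<Rightarrow> real^'d" and f :: "real^'d \<Rightarrow> real"
  assumes S: "S \<in> sets borel" and gS: "g ` S \<in> sets borel"
    and der: "\<And>x. x \<in> S \<Longrightarrow> (g has_derivative g' x) (at x within S)"
    and inj: "inj_on g S" and f: "f \<in> borel_measurable borel" "\<And>y. y \<in> g ` S \<Longrightarrow> 0 \<le> f y"
  shows "(\<integral>\<^sup>+y\<in>g ` S. ennreal (f y) \<partial>lborel) = (\<integral>\<^sup>+x\<in>S. ennreal (\<bar>det (matrix (g' x))\<bar> * f (g x)) \<partial>lborel)"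
proof -
  obtain b :: "'d ix \<Rightarrow> 'd" where b: "bij b"
    using finite_same_card_bij[of "UNIV :: 'd ix set" "UNIV :: 'd set"] card_UNIV_ix by auto
  define P :: "real^'d \<Rightarrow> real^('d ix)" where "P x = (\<chi> i. x $ b i)" for x
  define Q :: "real^('d ix) \<Rightarrow> real^'d" where "Q y = (\<chi> j. y $ inv b j)" for y
  have PQ[simp]: "P (Q y) = y" "Q (P x) = x" for x y
    using b by (auto simp: P_def Q_def vec_eq_iff inv_f_f[OF bij_is_inj] surj_f_inv_f[OF bij_is_surj])
  have lin: "linear P" "linear Q"
    by (auto intro!: linearI simp: P_def Q_def vec_eq_iff)
  have Qax: "Q (axis i 1) = axis (b i) 1" for i
    using b by (auto simp: Q_def vec_eq_iff axis_def inv_f_f[OF bij_is_inj] surj_f_inv_f[OF bij_is_surj])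
  have "bij_betw Q Basis Basis"
  proof (rule bij_betw_imageI)
    show "inj_on Q Basis" by (metis PQ(1) inj_onI)
    show "Q ` Basis = Basis"
      using b by (auto simp: Basis_vec_def Qax image_iff) (metis bij_pointE Qax)
  qed
  note bQ = this
  then have dQ: "distr lborel borel Q = lborel" by (rule distr_lborel_basis_bij[OF lin(2)])
  have "bij_betw P Basis Basis"
  proof (rule bij_betw_byWitness[where f' = Q])
    have QB: "Q ` Basis = Basis" using bQ by (simp add: bij_betw_def)
    have "P ` Basis = P ` Q ` Basis" unfolding QB ..
    then show "P ` Basis \<subseteq> Basis" by (auto simp: image_image)
    show "Q ` Basis \<subseteq> Basis" using QB by simp
  qed simp_all
  then have dP: "distr lborel borel P = lborel" by (rule distr_lborel_basis_bij[OF lin(1)])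
  have cont: "continuous_on T P" "continuous_on T' Q" for T T'
    using lin linear_conv_bounded_linear linear_continuous_on by blast+
  have meas[measurable]: "P \<in> borel_measurable borel" "Q \<in> borel_measurable borel"
    using cont by (auto intro: borel_measurable_continuous_onI)
  have bl: "bounded_linear P" "bounded_linear Q" using lin linear_conv_bounded_linear by auto
  have img: "P ` T = Q -` T" for T by (force simp: image_iff)
  have imgb: "P ` T \<in> sets borel" if "T \<in> sets borel" for T
    unfolding img using measurable_sets[OF meas(2) that] by simp
  let ?g = "\<lambda>y. P (g (Q y))" and ?g' = "\<lambda>y v. P (g' (Q y) (Q v))"
  have ing: "?g ` P ` S = P ` g ` S" by (auto simp: image_iff)
  have "(\<integral>\<^sup>+y\<in>?g ` P ` S. ennreal (f (Q y)) \<partial>lborel) =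
     (\<integral>\<^sup>+x\<in>P ` S. ennreal (\<bar>det (matrix (?g' x))\<bar> * f (Q (?g x))) \<partial>lborel)"
  proof (rule nn_integral_change_of_variables_wellorder)
    show "P ` S \<in> sets borel" "?g ` P ` S \<in> sets borel" unfolding ing using imgb S gS by auto
    show "(?g has_derivative ?g' y) (at y within P ` S)" if "y \<in> P ` S" for y
    proof -
      have "Q y \<in> S" using that by auto
      then have "(g has_derivative g' (Q y)) (at (Q y) within Q ` P ` S)"
        using der by (simp add: image_image)
      from diff_chain_within[OF bounded_linear_imp_has_derivative[OF bl(2)] this]
      have "((\<lambda>y. g (Q y)) has_derivative (\<lambda>v. g' (Q y) (Q v))) (at y within P ` S)" by (simp add: o_def)
      then show ?thesis by (rule bounded_linear.has_derivative[OF bl(1)])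
    qed
    show "inj_on ?g (P ` S)" using inj by (auto simp: inj_on_def) (metis PQ(2))
    show "(\<lambda>y. f (Q y)) \<in> borel_measurable borel" using f(1) by measurable
    show "0 \<le> f (Q y)" if "y \<in> ?g ` P ` S" for y using that f(2) by auto
  qed
  moreover have "det (matrix (?g' y)) = det (matrix (g' (Q y)))" for y
  proof -
    have "matrix (?g' y) = (\<chi> i j. matrix (g' (Q y)) $ b i $ b j)"
      by (simp add: matrix_def vec_eq_iff P_def Qax)
    then show ?thesis using det_reindex[OF b, of "matrix (g' (Q y))"] by simp
  qed
  ultimately have *: "(\<integral>\<^sup>+y. ennreal (f (Q y)) * indicator (g ` S) (Q y) \<partial>lborel) =
     (\<integral>\<^sup>+y. ennreal (\<bar>det (matrix (g' (Q y)))\<bar> * f (g (Q y))) * indicator S (Q y) \<partial>lborel)"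
    unfolding ing by (simp add: img indicator_def)
  \<comment> \<open>Stated for arbitrary \<open>h\<close>, because the Jacobian factor of an
    arbitrary \<open>g'\<close> is not known to be Borel measurable.\<close>
  have Qint: "(\<integral>\<^sup>+y. h (Q y) \<partial>lborel) = (\<integral>\<^sup>+x. h x \<partial>lborel)" for h :: "real^'d \<Rightarrow> ennreal"
  proof (rule antisym)
    show "(\<integral>\<^sup>+y. h (Q y) \<partial>lborel) \<le> (\<integral>\<^sup>+x. h x \<partial>lborel)"
      using nn_integral_distr_le[of P lborel borel "\<lambda>y. h (Q y)"] by (simp add: dP)
    show "(\<integral>\<^sup>+x. h x \<partial>lborel) \<le> (\<integral>\<^sup>+y. h (Q y) \<partial>lborel)"
      using nn_integral_distr_le[of Q lborel borel h] by (simp add: dQ)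
  qed
  show ?thesis
    using * unfolding Qint[of "\<lambda>y. ennreal (f y) * indicator (g ` S) y"]
      Qint[of "\<lambda>y. ennreal (\<bar>det (matrix (g' y))\<bar> * f (g y)) * indicator S y"] .
qed

text \<open>By invariance of domain \<open>g\<close> is a homeomorphism onto an open set, so Borel
  sets have Borel images. The density \<open>f\<close> is continuous only on \<open>V\<close> and is
  extended by 0 to a Borel function.\<close>

theorem nn_integral_change_of_variables_open:
  fixes g :: "real^'d \<Rightarrow> real^'d" and f :: "real^'d \<Rightarrow> real"
  assumes "open U" and der: "\<And>x. x \<in> U \<Longrightarrow> (g has_derivative g' x) (at x)" and inj: "inj_on g U"
    and "open V" "g ` U \<subseteq> V" "continuous_on V f" "\<And>y. y \<in> V \<Longrightarrow> 0 \<le> f y"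
    and S: "S \<in> sets borel" "S \<subseteq> U"
  shows "g ` S \<in> sets borel"
    and "(\<integral>\<^sup>+y\<in>g ` S. ennreal (f y) \<partial>lborel) = (\<integral>\<^sup>+x\<in>S. ennreal (\<bar>det (matrix (g' x))\<bar> * f (g x)) \<partial>lborel)"
proof -
  have cont: "continuous_on U g"
    using der has_derivative_continuous continuous_at_imp_continuous_on by blast
  obtain h where h: "homeomorphism U (g ` U) g h"
    using invariance_of_domain_homeomorphism[OF \<open>open U\<close> cont _ inj] by blast
  have op: "open (g ` U)" using invariance_of_domain[OF cont \<open>open U\<close> inj] .
  have hg: "h (g x) = x" if "x \<in> U" for x using h that by (auto simp: homeomorphism_def)
  have "g ` S = h -` S \<inter> g ` U"
  proof (intro equalityI subsetI)
    fix y assume "y \<in> g ` S"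
    then show "y \<in> h -` S \<inter> g ` U" using hg S(2) by auto
  next
    fix y assume "y \<in> h -` S \<inter> g ` U"
    then show "y \<in> g ` S" using hg by auto
  qed
  moreover have "h -` S \<inter> space (restrict_space borel (g ` U)) \<in> sets (restrict_space borel (g ` U))"
    using h S(1) by (intro measurable_sets[OF borel_measurable_continuous_on_restrict])
      (auto simp: homeomorphism_def)
  ultimately show gS: "g ` S \<in> sets borel"
    using op by (simp add: space_restrict_space sets_restrict_space_iff)
  let ?f = "\<lambda>y. indicator V y *\<^sub>R f y"
  have "(\<integral>\<^sup>+y\<in>g ` S. ennreal (?f y) \<partial>lborel) = (\<integral>\<^sup>+x\<in>S. ennreal (\<bar>det (matrix (g' x))\<bar> * ?f (g x)) \<partial>lborel)"
  proof (rule nn_integral_change_of_variables[OF S(1) gS])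
    show "(g has_derivative g' x) (at x within S)" if "x \<in> S" for x
      using der S(2) that has_derivative_at_withinI by blast
    show "inj_on g S" using inj S(2) inj_on_subset by blast
    show "?f \<in> borel_measurable borel"
      using assms by (intro borel_measurable_continuous_on_indicator) auto
    show "0 \<le> ?f y" if "y \<in> g ` S" for y
      using assms that by (auto simp: indicator_def)
  qed
  moreover have "(\<integral>\<^sup>+y\<in>g ` S. ennreal (?f y) \<partial>lborel) = (\<integral>\<^sup>+y\<in>g ` S. ennreal (f y) \<partial>lborel)"
    using assms(5) S(2) by (intro nn_integral_cong) (auto simp: indicator_def)
  moreover have "(\<integral>\<^sup>+x\<in>S. ennreal (\<bar>det (matrix (g' x))\<bar> * ?f (g x)) \<partial>lborel) =
      (\<integral>\<^sup>+x\<in>S. ennreal (\<bar>det (matrix (g' x))\<bar> * f (g x)) \<partial>lborel)"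
    using assms(5) S(2) by (intro nn_integral_cong) (auto simp: indicator_def)
  ultimately show "(\<integral>\<^sup>+y\<in>g ` S. ennreal (f y) \<partial>lborel) = (\<integral>\<^sup>+x\<in>S. ennreal (\<bar>det (matrix (g' x))\<bar> * f (g x)) \<partial>lborel)"
    by simp
qed

text \<open>Collar coordinates: the components \<open>Some j\<close> hold a point of a boundary
  chart, the component \<open>None\<close> the distance from the boundary.\<close>

definition append_coord :: "(real^'n) \<times> real \<Rightarrow> real^('n option)" where
  "append_coord z = (\<chi> i. case i of None \<Rightarrow> snd z | Some j \<Rightarrow> fst z $ j)"

lemma append_coord_simps [simp]:
  "append_coord z $ None = snd z" "append_coord z $ Some j = fst z $ j"
  by (auto simp: append_coord_def)

lemma linear_append_coord: "linear append_coord"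
  by (rule linearI) (auto simp: append_coord_def vec_eq_iff split: option.split)

lemma append_coord_axis:
  "append_coord (axis j 1, 0) = axis (Some j) 1" "append_coord (0, 1) = axis None 1"
  unfolding vec_eq_iff by (auto simp: append_coord_def axis_def split: option.split)

lemma distr_append_coord:
  "distr (lborel \<Otimes>\<^sub>M lborel) borel append_coord = (lborel :: (real^('n::finite option)) measure)"
proof -
  have "bij_betw append_coord (Basis :: ((real^'n) \<times> real) set) Basis"
  proof (rule bij_betw_imageI)
    show "inj_on append_coord (Basis :: ((real^'n) \<times> real) set)"
    proof (rule inj_onI)
      fix x y :: "(real^'n) \<times> real" assume "append_coord x = append_coord y"
      then have "append_coord x $ i = append_coord y $ i" for i by simp
      then have "fst x = fst y" "snd x = snd y"
        unfolding vec_eq_iff by (metis append_coord_simps)+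
      then show "x = y" by (simp add: prod_eq_iff)
    qed
    have "b \<in> append_coord ` (Basis :: ((real^'n) \<times> real) set)" if "b \<in> Basis" for b
    proof -
      obtain i where "b = axis i 1" using \<open>b \<in> Basis\<close> by (auto simp: Basis_vec_def)
      then show ?thesis
        by (cases i) (auto simp: append_coord_axis[symmetric] Basis_prod_def Basis_vec_def image_iff)
    qed
    moreover have "append_coord b \<in> Basis" if "b \<in> (Basis :: ((real^'n) \<times> real) set)" for b
      using that by (auto simp: Basis_prod_def Basis_vec_def append_coord_axis)
    ultimately show "append_coord ` (Basis :: ((real^'n) \<times> real) set) = Basis" by blast
  qed
  from distr_lborel_basis_bij[OF linear_append_coord this] show ?thesis by (simp add: lborel_prod)
qed

section \<open>Boundary charts\<close>

lemma hyp_chart_in_hyp: "hyp_chart x \<in> hyp"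
proof -
  have "1 + x \<bullet> x > 0" by (simp add: add_pos_nonneg)
  then show ?thesis by (auto simp: hyp_def hyp_chart_def lor_def)
qed

lemma fst_hyp_chart [simp]: "fst (hyp_chart x) = x"
  by (simp add: hyp_chart_def)

lemma hyp_chart_fst: "X \<in> hyp \<Longrightarrow> hyp_chart (fst X) = X"
proof -
  assume X: "X \<in> hyp"
  then have "(snd X)\<^sup>2 = 1 + fst X \<bullet> fst X" by (simp add: hyp_def lor_def power2_eq_square)
  then have "sqrt (1 + fst X \<bullet> fst X) = snd X"
    using hypD(2)[OF X] by (metis less_imp_le real_sqrt_unique)
  then show ?thesis by (simp add: hyp_chart_def)
qed

lemma smooth_hyp_chart: "smooth_on UNIV (hyp_chart :: real^('n::finite option) \<Rightarrow> _)"
proof -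
  have "Ck_on k UNIV (\<lambda>x :: real^('n::finite option). (x, sqrt (1 + x \<bullet> x)))" for k
    by (intro Ck_on_Pair Ck_on_id Ck_on_sqrt Ck_on_add Ck_on_const Ck_on_inner open_UNIV)
      (simp add: add_pos_nonneg)
  then show ?thesis unfolding smooth_on_def hyp_chart_def[abs_def] by simp
qed

lemma continuous_on_hyp_chart: "continuous_on S hyp_chart"
  using continuous_on_subset[OF smooth_on_continuous[OF smooth_hyp_chart]] by blast

text \<open>A point with \<open>lor X X = -1\<close> cannot have time component 0, so the strict
  sign condition may be relaxed to a closed one.\<close>

lemma closed_hyp: "closed (hyp :: ('n::finite) minkowski set)"
proof -
  have "hyp = {X :: 'n minkowski. lor X X = -1 \<and> 0 \<le> snd X}"
  proof -
    have "snd X \<noteq> 0" if "lor X X = -1" for X :: "'n minkowski"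
    proof
      assume "snd X = 0"
      then have "lor X X \<ge> 0" by (simp add: lor_def)
      with that show False by simp
    qed
    then show ?thesis unfolding hyp_def by (metis less_eq_real_def)
  qed
  moreover have "closed {X :: 'n minkowski. lor X X = -1 \<and> 0 \<le> snd X}"
    unfolding lor_def by (intro closed_Collect_conj closed_Collect_eq closed_Collect_le continuous_intros)
  ultimately show ?thesis by simp
qed

text \<open>Differentiation of the constant \<open>lor (\<phi> v) (\<phi> v) = -1\<close>.\<close>

lemma derivative_in_hyp_tangent:
  assumes "(\<phi> has_derivative D) (at u)" "open U" "u \<in> U" "\<And>v. v \<in> U \<Longrightarrow> \<phi> v \<in> hyp"
  shows "lor (D w) (\<phi> u) = 0"
proof -
  have "((\<lambda>v. lor (\<phi> v) (\<phi> v)) has_derivative (\<lambda>w. lor (\<phi> u) (D w) + lor (D w) (\<phi> u))) (at u)"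
    by (rule bounded_bilinear.FDERIV[OF bounded_bilinear_lor assms(1,1)])
  moreover have "((\<lambda>v. lor (\<phi> v) (\<phi> v)) has_derivative (\<lambda>w. 0)) (at u)"
    by (rule has_derivative_transform_within_open[OF has_derivative_const[of "-1"] assms(2,3)])
      (simp add: hypD(1)[OF assms(4)])
  ultimately have "(\<lambda>w. lor (\<phi> u) (D w) + lor (D w) (\<phi> u)) = (\<lambda>w. 0)"
    by (rule has_derivative_unique)
  from fun_cong[OF this, of w] show ?thesis by (simp add: lor_sym[of "\<phi> u"])
qed

lemma in_interior_of_hyp:
  assumes "open V" "X \<in> V" "X \<in> hyp" "\<And>Y. Y \<in> hyp \<inter> V \<Longrightarrow> Y \<in> \<Omega>"
  shows "X \<in> (top_of_set hyp) interior_of \<Omega>"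
  unfolding interior_of_def using assms
  by (auto intro!: exI[of _ "hyp \<inter> V"] simp: openin_open_Int)

lemma interior_of_hyp_iff:
  "X \<in> (top_of_set hyp) interior_of \<Omega> \<longleftrightarrow> X \<in> hyp \<and> (\<exists>V. open V \<and> X \<in> V \<and> hyp \<inter> V \<subseteq> \<Omega>)"
proof
  assume "X \<in> (top_of_set hyp) interior_of \<Omega>"
  then obtain T where "openin (top_of_set hyp) T" "X \<in> T" "T \<subseteq> \<Omega>" by (auto simp: interior_of_def)
  then show "X \<in> hyp \<and> (\<exists>V. open V \<and> X \<in> V \<and> hyp \<inter> V \<subseteq> \<Omega>)" by (auto simp: openin_open)
next
  assume "X \<in> hyp \<and> (\<exists>V. open V \<and> X \<in> V \<and> hyp \<inter> V \<subseteq> \<Omega>)"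
  then show "X \<in> (top_of_set hyp) interior_of \<Omega>" using in_interior_of_hyp by blast
qed

lemma hbd_iff:
  assumes "\<Omega> \<subseteq> hyp" "closed \<Omega>"
  shows "X \<in> hbd \<Omega> \<longleftrightarrow> X \<in> \<Omega> \<and> X \<notin> (top_of_set hyp) interior_of \<Omega>"
proof -
  have "(top_of_set hyp) closure_of \<Omega> = \<Omega>"
    by (rule closure_of_closedin[OF closed_subset[OF assms]])
  then show ?thesis by (simp add: frontier_of_def)
qed

text \<open>The classical theorem supplies the homeomorphism and invertible derivatives nearby;
  \<open>smooth_on_local_inverse\<close> upgrades the inverse to all orders.\<close>

theorem smooth_inverse_function_theorem:
  fixes F :: "real^'m \<Rightarrow> real^'m"
  assumes "open O'" "x0 \<in> O'" and F: "smooth_on O' F" and inj0: "inj (frechet_derivative F (at x0))"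
  obtains U V G where "open U" "U \<subseteq> O'" "x0 \<in> U" "open V" "F x0 \<in> V" "homeomorphism U V F G"
    "smooth_on V G" "\<And>x. x \<in> U \<Longrightarrow> inj (frechet_derivative F (at x))"
proof -
  let ?D = "\<lambda>x. frechet_derivative F (at x)"
  have dF: "(F has_derivative ?D x) (at x)" if "x \<in> O'" for x
    using smooth_on_has_derivative[OF F that] .
  have lin: "linear (?D x)" if "x \<in> O'" for x using dF[OF that] has_derivative_linear by blast
  define f' where "f' x = Blinfun (?D x)" for x
  have f': "blinfun_apply (f' x) = ?D x" if "x \<in> O'" for x
    unfolding f'_def using lin[OF that] by (simp add: bounded_linear_Blinfun_apply linear_conv_bounded_linear)
  have contf: "continuous_on O' f'"
  proof (rule continuous_on_blinfun_componentwise)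
    fix i :: "real^'m"
    have "continuous_on O' (\<lambda>x. ?D x i)" by (intro smooth_on_continuous smooth_on_deriv F)
    then show "continuous_on O' (\<lambda>x. blinfun_apply (f' x) i)"
      by (rule continuous_on_eq) (simp add: f')
  qed
  obtain L where L: "linear L" "L \<circ> ?D x0 = id"
    using real_vector.linear_injective_left_inverse[OF lin[OF \<open>x0 \<in> O'\<close>] inj0] by blast
  have invf: "Blinfun L o\<^sub>L f' x0 = id_blinfun"
  proof (rule blinfun_eqI)
    fix i
    show "blinfun_apply (Blinfun L o\<^sub>L f' x0) i = blinfun_apply id_blinfun i"
      using L f'[OF \<open>x0 \<in> O'\<close>] fun_cong[OF L(2), of i, unfolded comp_apply id_apply]
      by (simp add: bounded_linear_Blinfun_apply linear_conv_bounded_linear)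
  qed
  have derf: "(F has_derivative blinfun_apply (f' x)) (at x)" if "x \<in> O'" for x
    using dF[OF that] f'[OF that] by simp
  obtain U' V' G G' where U': "open U'" "U' \<subseteq> O'" "x0 \<in> U'" and V': "open V'" "F x0 \<in> V'"
    and hom: "homeomorphism U' V' F G"
    and bij: "\<And>y. y \<in> V' \<Longrightarrow> bij (blinfun_apply (f' (G y)))"
    using inverse_function_theorem[OF \<open>open O'\<close> derf contf \<open>x0 \<in> O'\<close> invf] by metis
  have inj: "inj (?D x)" if "x \<in> U'" for x
  proof -
    have "F x \<in> V'" "G (F x) = x" using hom that by (auto simp: homeomorphism_def)
    then show ?thesis using bij[of "F x"] f'[of x] that U'(2) by (auto simp: bij_def)
  qed
  have smG: "smooth_on V' G"
    by (rule smooth_on_local_inverse(1)[OF U'(1) V'(1) smooth_on_subset[OF F U'(2)] hom inj])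
  show thesis using that[OF U'(1,2,3) V' hom smG inj] by blast
qed

text \<open>In the chart \<open>hyp_chart\<close>, the map \<open>F\<close> straightens the boundary: it replaces the coordinate
  in a direction \<open>a\<close> transversal to the boundary by the defining function \<open>g\<close>.\<close>

lemma straightening_inverse:
  fixes g :: "real^'m \<Rightarrow> real"
  assumes "open O'" and x0: "x0 \<in> O'" and g: "smooth_on O' g" and "g x0 = 0"
    and a: "norm a = 1" "frechet_derivative g (at x0) a \<noteq> 0"
  defines "F \<equiv> \<lambda>x. x - ((x - x0) \<bullet> a) *\<^sub>R a + g x *\<^sub>R a"
  obtains r G where "r > 0" "homeomorphism (G ` ball x0 r) (ball x0 r) F G" "open (G ` ball x0 r)"
    "G ` ball x0 r \<subseteq> O'" "x0 \<in> G ` ball x0 r" "smooth_on (ball x0 r) G"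
    "\<And>y. y \<in> ball x0 r \<Longrightarrow> g (G y) = (y - x0) \<bullet> a"
    "\<And>x. x \<in> G ` ball x0 r \<Longrightarrow> frechet_derivative g (at x) a \<noteq> 0"
proof -
  have F: "smooth_on O' F"
    unfolding smooth_on_def F_def using smooth_on_Ck[OF g]
    by (auto intro!: Ck_on_add Ck_on_diff Ck_on_scaleR Ck_on_inner Ck_on_const Ck_on_id \<open>open O'\<close>)
  let ?D = "\<lambda>x. frechet_derivative F (at x)"
  have dF: "(F has_derivative ?D x) (at x)" if "x \<in> O'" for x
    using smooth_on_has_derivative[OF F that] .
  have DF: "?D x h = h - (h \<bullet> a) *\<^sub>R a + frechet_derivative g (at x) h *\<^sub>R a" if "x \<in> O'" for x h
  proof -
    have "(F has_derivative (\<lambda>h. h - (h \<bullet> a) *\<^sub>R a + frechet_derivative g (at x) h *\<^sub>R a)) (at x)"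
      unfolding F_def using smooth_on_has_derivative[OF g that]
      by (auto intro!: derivative_eq_intros)
    then show ?thesis by (simp add: frechet_derivative_eq)
  qed
  have lin: "linear (?D x)" if "x \<in> O'" for x using dF[OF that] has_derivative_linear by blast
  have lg: "linear (frechet_derivative g (at x0))"
    using smooth_on_has_derivative[OF g \<open>x0 \<in> O'\<close>] has_derivative_linear by blast
  \<comment> \<open>The component of \<open>?D x0 h\<close> along \<open>a\<close> is the derivative
    of \<open>g\<close> along \<open>h\<close>. If \<open>?D x0 h = 0\<close>, then this derivative
    vanishes and \<open>h\<close> is a multiple of \<open>a\<close>; transversality of
    \<open>a\<close> leaves only 0.\<close>
  have inj0: "inj (?D x0)"
  proof (rule linear_injective_0[OF lin[OF \<open>x0 \<in> O'\<close>], THEN iffD2], intro allI impI)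
    fix h assume h: "?D x0 h = 0"
    then have "?D x0 h \<bullet> a = 0" by simp
    then have g0: "frechet_derivative g (at x0) h = 0"
      using a(1) by (simp add: DF[OF \<open>x0 \<in> O'\<close>] inner_simps norm_eq_1)
    then have ha: "h = (h \<bullet> a) *\<^sub>R a" using h by (simp add: DF[OF \<open>x0 \<in> O'\<close>])
    then have "(h \<bullet> a) * frechet_derivative g (at x0) a = 0"
      using g0 lg by (metis linear_scale real_scaleR_def)
    then show "h = 0" using a(2) ha by auto
  qed
  obtain U' V' G where U': "open U'" "U' \<subseteq> O'" "x0 \<in> U'" and V': "open V'" "F x0 \<in> V'"
    and hom: "homeomorphism U' V' F G" and smG: "smooth_on V' G"
    and inj: "\<And>x. x \<in> U' \<Longrightarrow> inj (?D x)"
    using smooth_inverse_function_theorem[OF \<open>open O'\<close> x0 F inj0] by blast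
  have Fx0: "F x0 = x0" unfolding F_def using \<open>g x0 = 0\<close> by simp
  obtain r where r: "r > 0" "ball x0 r \<subseteq> V'" using V' Fx0 openE by metis
  have FG: "F (G y) = y" if "y \<in> ball x0 r" for y
    using hom r that by (auto simp: homeomorphism_def)
  then have "F ` G ` ball x0 r = ball x0 r" by (simp add: image_image)
  then have hom': "homeomorphism (G ` ball x0 r) (ball x0 r) F G"
    by (intro homeomorphism_of_subsets[OF hom])
      (use r hom in \<open>auto simp: homeomorphism_def image_subset_iff\<close>)
  have "openin (top_of_set U') (G ` ball x0 r)"
    using homeomorphism_imp_open_map[OF homeomorphism_symD[OF hom], of "ball x0 r"] r V'(1)
    by (simp add: open_openin_trans)
  then have opn: "open (G ` ball x0 r)" using U'(1) openin_open_trans by blast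
  have sub: "G ` ball x0 r \<subseteq> U'" using r hom by (auto simp: homeomorphism_def)
  have gG: "g (G y) = (y - x0) \<bullet> a" if "y \<in> ball x0 r" for y
  proof -
    have "F (G y) = y" using hom that r by (auto simp: homeomorphism_def)
    then have "(F (G y) - x0) \<bullet> a = (y - x0) \<bullet> a" by simp
    then show ?thesis using a(1) unfolding F_def by (simp add: inner_simps norm_eq_1)
  qed
  \<comment> \<open>Transversality of \<open>a\<close> persists: where the derivative of
    \<open>g\<close> along \<open>a\<close> vanished, \<open>?D x\<close> would send
    \<open>a\<close> to 0.\<close>
  have "frechet_derivative g (at x) a \<noteq> 0" if "x \<in> G ` ball x0 r" for x
  proof
    assume "frechet_derivative g (at x) a = 0"
    then have "?D x a = 0" using DF[of x a] that sub U'(2) a(1) by (auto simp: norm_eq_1)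
    moreover have "x \<in> U'" using that sub by blast
    ultimately have "a = 0" using inj[of x] lin[of x] U'(2) by (metis linear_0 injD subsetD)
    then show False using a(1) by simp
  qed
  moreover have "x0 \<in> G ` ball x0 r"
  proof -
    have "G x0 = x0" using hom U'(3) Fx0 by (metis homeomorphism_apply1)
    then show ?thesis using r(1) by (metis centre_in_ball imageI)
  qed
  ultimately show thesis
    using that[OF r(1) hom' opn _ _ smooth_on_subset[OF smG r(2)] gG] sub U'(2) by blast
qed

text \<open>A tangent vector at \<open>p\<close> is determined by its spatial part, since
  orthogonality to \<open>p\<close> and \<open>snd p > 0\<close> fix the time component. Transversal
  directions for a defining function thus yield transversal directions in the vertical
  chart.\<close>

lemma hyp_chart_derivative_onto:
  assumes "p \<in> hyp" "v \<in> hyp_tangent p"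
  shows "frechet_derivative hyp_chart (at (fst p)) (fst v) = v"
proof -
  let ?D = "frechet_derivative hyp_chart (at (fst p))"
  have D: "(hyp_chart has_derivative ?D) (at (fst p))"
    using smooth_on_has_derivative[OF smooth_hyp_chart] by simp
  have f: "fst (?D h) = h" for h
  proof -
    have "((\<lambda>x. fst (hyp_chart x)) has_derivative (\<lambda>h. fst (?D h))) (at (fst p))"
      by (rule bounded_linear.has_derivative[OF bounded_linear_fst D])
    then have "(\<lambda>h. fst (?D h)) = (\<lambda>h. h)" by (auto intro: has_derivative_unique)
    then show ?thesis by meson
  qed
  let ?w = "?D (fst v) - v"
  have "lor (?D (fst v)) p = 0"
    using derivative_in_hyp_tangent[OF D open_UNIV UNIV_I hyp_chart_in_hyp] hyp_chart_fst[OF assms(1)] by simp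
  then have "lor ?w p = 0" using assms(2) by (simp add: hyp_tangent_def)
  moreover have "fst ?w = 0" using f by simp
  ultimately have "snd ?w = 0" using hypD(2)[OF assms(1)] by (auto simp: lor_def)
  then show ?thesis using \<open>fst ?w = 0\<close> by (simp add: prod_eq_iff)
qed

lemma smooth_bounded_domainD:
  assumes "smooth_bounded_domain \<Omega>"
  shows "\<Omega> \<subseteq> hyp" "compact \<Omega>" "connected \<Omega>" "closed \<Omega>" "(top_of_set hyp) interior_of \<Omega> \<noteq> {}"
  using assms compact_imp_closed by (auto simp: smooth_bounded_domain_def)

text \<open>In the vertical chart the straightening map turns the defining function into a linear
  coordinate, so the boundary becomes a hyperplane slice of a ball and the interior a half ball. The
  slice gives \<open>\<phi>\<close>; the half ball gives the last two conclusions, which later show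
  that the whole interior is connected and dense in \<open>\<Omega>\<close>.\<close>

theorem boundary_chart:
  fixes \<Omega> :: "('n::finite) minkowski set"
  assumes \<Omega>: "smooth_bounded_domain \<Omega>" and p: "p \<in> hbd \<Omega>" and Y: "open Y" "p \<in> Y"
  obtains V U \<phi> and f :: "'n minkowski \<Rightarrow> real" where "open V" "p \<in> V" "V \<subseteq> Y" "smooth_on V f"
    "\<And>X. X \<in> hyp \<inter> V \<Longrightarrow> X \<in> \<Omega> \<longleftrightarrow> f X \<le> 0"
    "\<And>X. X \<in> hyp \<inter> V \<Longrightarrow> X \<in> hbd \<Omega> \<longleftrightarrow> f X = 0"
    "\<And>X. X \<in> hyp \<inter> V \<Longrightarrow> \<exists>v\<in>hyp_tangent X. frechet_derivative f (at X) v \<noteq> 0"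
    "local_param (hbd \<Omega>) U \<phi>" "p \<in> \<phi> ` U" "\<phi> ` U \<subseteq> V"
    "connected (V \<inter> (top_of_set hyp) interior_of \<Omega>)"
    "p \<in> closure (V \<inter> (top_of_set hyp) interior_of \<Omega>)"
proof -
  note dom = smooth_bounded_domainD[OF \<Omega>]
  note hbd = hbd_iff[OF dom(1,4)]
  have ph: "p \<in> hyp" and pO: "p \<in> \<Omega>" using p dom(1) hbd by auto
  have "smooth_boundary \<Omega>" using \<Omega> by (simp add: smooth_bounded_domain_def)
  from bspec[OF this[unfolded smooth_boundary_def] p]
  obtain V0 and f :: "'n minkowski \<Rightarrow> real" where V0f: "open V0 \<and> p \<in> V0 \<and> smooth_on V0 f \<and> \<Omega> \<inter> V0 = {X \<in> hyp \<inter> V0. f X \<le> 0} \<and>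
    (\<exists>v\<in>hyp_tangent p. frechet_derivative f (at p) v \<noteq> 0)" by (elim exE) (rule that)
  then have V0: "open V0" "p \<in> V0" and f: "smooth_on V0 f"
    and lev: "\<Omega> \<inter> V0 = {X \<in> hyp \<inter> V0. f X \<le> 0}"
    and df: "\<exists>v\<in>hyp_tangent p. frechet_derivative f (at p) v \<noteq> 0"
    by - (elim conjE, assumption)+
  have lev': "Y \<in> \<Omega> \<longleftrightarrow> f Y \<le> 0" if "Y \<in> hyp \<inter> V0" for Y
    using that eqset_imp_iff[OF lev, of Y] by simp
  have int: "X \<in> (top_of_set hyp) interior_of \<Omega>" if "X \<in> hyp \<inter> V0" "f X < 0" for X
  proof -
    have "open (V0 \<inter> f -` {..<0})"
      using continuous_open_preimage[OF smooth_on_continuous[OF f] V0(1)] by simp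
    then show ?thesis
    proof (rule in_interior_of_hyp)
      fix Y assume "Y \<in> hyp \<inter> (V0 \<inter> f -` {..<0})"
      then show "Y \<in> \<Omega>" by (subst lev') auto
    qed (use that in auto)
  qed
  have hbd0: "f X = 0" if "X \<in> hyp \<inter> V0" "X \<in> hbd \<Omega>" for X
  proof (rule ccontr)
    have X: "X \<in> \<Omega>" "X \<notin> (top_of_set hyp) interior_of \<Omega>" using that(2) hbd[of X] by auto
    then have "f X \<le> 0" using lev'[OF that(1)] by simp
    moreover assume "f X \<noteq> 0"
    ultimately show False using int[OF that(1)] X(2) by simp
  qed
  define O' where "O' = hyp_chart -` (V0 \<inter> Y)"
  have "open O'" unfolding O'_def
    by (rule open_vimage) (use V0 Y continuous_on_hyp_chart in auto)
  let ?x0 = "fst p"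
  have x0: "?x0 \<in> O'" unfolding O'_def using hyp_chart_fst[OF ph] V0 Y by simp
  define g where "g x = f (hyp_chart x)" for x
  have g: "smooth_on O' g" unfolding g_def[abs_def]
    by (rule smooth_on_compose[OF \<open>open O'\<close> V0(1) _ f smooth_on_subset[OF smooth_hyp_chart]])
      (auto simp: O'_def)
  have g0: "g ?x0 = 0" unfolding g_def hyp_chart_fst[OF ph] using hbd0 p ph V0 by blast
  have dg: "frechet_derivative g (at x) h =
      frechet_derivative f (at (hyp_chart x)) (frechet_derivative hyp_chart (at x) h)" if "x \<in> O'" for x h
  proof -
    have "hyp_chart x \<in> V0" using that by (simp add: O'_def)
    from has_derivative_compose[OF smooth_on_has_derivative[OF smooth_hyp_chart UNIV_I]
        smooth_on_has_derivative[OF f this]]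
    show ?thesis unfolding g_def[abs_def] by (simp add: frechet_derivative_eq)
  qed
  obtain v where v: "v \<in> hyp_tangent p" "frechet_derivative f (at p) v \<noteq> 0" using df by blast
  let ?h = "fst v"
  have dgh: "frechet_derivative g (at ?x0) ?h \<noteq> 0"
    using v hyp_chart_derivative_onto[OF ph v(1)] dg[OF x0] hyp_chart_fst[OF ph] by simp
  have lg: "linear (frechet_derivative g (at ?x0))"
    using smooth_on_has_derivative[OF g x0] has_derivative_linear by blast
  then have "?h \<noteq> 0" using dgh linear_0 by metis
  define a where "a = ?h /\<^sub>R norm ?h"
  have a: "norm a = 1" "frechet_derivative g (at ?x0) a \<noteq> 0"
    using \<open>?h \<noteq> 0\<close> dgh unfolding a_def by (auto simp: linear_scale[OF lg])
  define F where "F = (\<lambda>x. x - ((x - ?x0) \<bullet> a) *\<^sub>R a + g x *\<^sub>R a)"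
  obtain r G where r: "r > 0" and hom: "homeomorphism (G ` ball ?x0 r) (ball ?x0 r) F G"
    and opn: "open (G ` ball ?x0 r)" and sub: "G ` ball ?x0 r \<subseteq> O'" and x0G: "?x0 \<in> G ` ball ?x0 r"
    and smG: "smooth_on (ball ?x0 r) G"
    and gG: "\<And>y. y \<in> ball ?x0 r \<Longrightarrow> g (G y) = (y - ?x0) \<bullet> a"
    and dga: "\<And>x. x \<in> G ` ball ?x0 r \<Longrightarrow> frechet_derivative g (at x) a \<noteq> 0"
    using straightening_inverse[OF \<open>open O'\<close> x0 g g0 a] unfolding F_def by blast
  let ?W = "G ` ball ?x0 r"
  have FG: "F (G y) = y" if "y \<in> ball ?x0 r" for y using hom that by (auto simp: homeomorphism_def)
  have FW: "F x \<in> ball ?x0 r" "G (F x) = x" if "x \<in> ?W" for x using hom that by (auto simp: homeomorphism_def)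
  define V where "V = V0 \<inter> Y \<inter> fst -` ?W"
  have V: "open V" unfolding V_def using V0 Y opn open_vimage[OF opn, of fst] continuous_on_fst[OF continuous_on_id]
    by (intro open_Int) auto
  have pV: "p \<in> V" unfolding V_def using V0 Y x0G by simp
  have chartV: "hyp_chart x \<in> V" if "x \<in> ?W" for x
    using that sub unfolding V_def O'_def by auto
  have fX: "f X = g (fst X)" if "X \<in> hyp" for X using hyp_chart_fst[OF that] by (simp add: g_def)
  have levV: "X \<in> \<Omega> \<longleftrightarrow> f X \<le> 0" if "X \<in> hyp \<inter> V" for X
    using lev'[of X] that unfolding V_def by blast
  have lim: "((\<lambda>t. hyp_chart (G (y + t *\<^sub>R a))) \<longlongrightarrow> hyp_chart (G y)) (at_right 0)"
    "\<forall>\<^sub>F t in at_right 0. y + t *\<^sub>R a \<in> ball ?x0 r"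
    "((\<lambda>t. hyp_chart (G (y - t *\<^sub>R a))) \<longlongrightarrow> hyp_chart (G y)) (at_right 0)"
    "\<forall>\<^sub>F t in at_right 0. y - t *\<^sub>R a \<in> ball ?x0 r" if y: "y \<in> ball ?x0 r" for y
  proof -
    have cont: "isCont (\<lambda>y. hyp_chart (G y)) y"
      using continuous_on_compose2[OF continuous_on_hyp_chart smooth_on_continuous[OF smG], of UNIV] y
      by (simp add: continuous_on_eq_continuous_at)
    have t1: "((\<lambda>t. y + t *\<^sub>R a) \<longlongrightarrow> y) (at_right 0)" "((\<lambda>t. y - t *\<^sub>R a) \<longlongrightarrow> y) (at_right 0)"
      by (auto intro!: tendsto_eq_intros)
    show "((\<lambda>t. hyp_chart (G (y + t *\<^sub>R a))) \<longlongrightarrow> hyp_chart (G y)) (at_right 0)"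
      "((\<lambda>t. hyp_chart (G (y - t *\<^sub>R a))) \<longlongrightarrow> hyp_chart (G y)) (at_right 0)"
      using isCont_tendsto_compose[OF cont] t1 by auto
    show "\<forall>\<^sub>F t in at_right 0. y + t *\<^sub>R a \<in> ball ?x0 r" "\<forall>\<^sub>F t in at_right 0. y - t *\<^sub>R a \<in> ball ?x0 r"
      using topological_tendstoD[OF t1(1) open_ball y] topological_tendstoD[OF t1(2) open_ball y] by auto
  qed
  have hbdV: "X \<in> hbd \<Omega> \<longleftrightarrow> f X = 0" if X: "X \<in> hyp \<inter> V" for X
  proof
    show "f X = 0" if "X \<in> hbd \<Omega>" using hbd0 X that unfolding V_def by blast
    assume f0: "f X = 0"
    let ?y = "F (fst X)"
    have y: "?y \<in> ball ?x0 r" "hyp_chart (G ?y) = X"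
      using FW[of "fst X"] hyp_chart_fst[of X] X unfolding V_def by auto
    have ya: "(?y - ?x0) \<bullet> a = 0" using gG[OF y(1)] f0 y(2) by (simp add: g_def)
    \<comment> \<open>The zero level is approached from outside: moving from \<open>?y\<close> by
      \<open>t\<close> along \<open>a\<close> gives \<open>g\<close> the value
      \<open>t > 0\<close>.\<close>
    have "X \<notin> (top_of_set hyp) interior_of \<Omega>"
    proof
      assume "X \<in> (top_of_set hyp) interior_of \<Omega>"
      then obtain T where T: "open T" "X \<in> T" "hyp \<inter> T \<subseteq> \<Omega>" unfolding interior_of_hyp_iff by blast
      have "\<forall>\<^sub>F t in at_right 0. hyp_chart (G (?y + t *\<^sub>R a)) \<in> T"
        using topological_tendstoD[OF lim(1)[OF y(1)] T(1)] y(2) T(2) by simp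
      then have "\<forall>\<^sub>F t in at_right (0::real). False"
        using lim(2)[OF y(1)] eventually_at_right_less
      proof eventually_elim
        case (elim t)
        let ?z = "?y + t *\<^sub>R a"
        have "g (G ?z) = t" using gG[OF elim(2)] ya a(1) by (simp add: inner_simps norm_eq_1)
        moreover have "hyp_chart (G ?z) \<in> \<Omega>" using elim T hyp_chart_in_hyp by blast
        then have "g (G ?z) \<le> 0"
          using levV[of "hyp_chart (G ?z)"] chartV[of "G ?z"] elim(2) hyp_chart_in_hyp by (auto simp: g_def)
        ultimately show False using elim by simp
      qed
      then show False by simp
    qed
    then show "X \<in> hbd \<Omega>" using hbd levV[OF X] f0 by simp
  qed
  have intV: "X \<in> (top_of_set hyp) interior_of \<Omega> \<longleftrightarrow> f X < 0" if X: "X \<in> hyp \<inter> V" for X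
    using hbdV[OF X] levV[OF X] hbd[of X] subsetD[OF interior_of_subset, of X "top_of_set hyp" \<Omega>]
    by (cases "X \<in> (top_of_set hyp) interior_of \<Omega>"; cases "X \<in> \<Omega>") auto
  let ?I = "V \<inter> (top_of_set hyp) interior_of \<Omega>"
  \<comment> \<open>By \<open>gG\<close>, the sign of \<open>f\<close> in straightened coordinates
    is that of the coordinate along \<open>a\<close>, so the interior corresponds to a half ball,
    which is convex.\<close>
  let ?H = "ball ?x0 r \<inter> {y. a \<bullet> y < a \<bullet> ?x0}"
  have Ieq: "?I = (\<lambda>y. hyp_chart (G y)) ` ?H"
  proof (intro equalityI subsetI)
    fix X assume X: "X \<in> ?I"
    then have Xh: "X \<in> hyp \<inter> V" by (simp add: interior_of_hyp_iff)
    let ?y = "F (fst X)"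
    have y: "?y \<in> ball ?x0 r" "hyp_chart (G ?y) = X"
      using FW[of "fst X"] hyp_chart_fst[of X] Xh unfolding V_def by auto
    have "(?y - ?x0) \<bullet> a < 0" using gG[OF y(1)] y(2) intV[OF Xh] X by (simp add: g_def)
    then show "X \<in> (\<lambda>y. hyp_chart (G y)) ` ?H"
      using y by (intro image_eqI[of _ _ ?y]) (auto simp: inner_simps inner_commute)
  next
    fix X assume "X \<in> (\<lambda>y. hyp_chart (G y)) ` ?H"
    then obtain y where y: "X = hyp_chart (G y)" "y \<in> ball ?x0 r" "a \<bullet> y < a \<bullet> ?x0" by auto
    then have "f X < 0" using gG[OF y(2)] by (simp add: g_def inner_simps inner_commute)
    moreover have "X \<in> hyp \<inter> V" using y chartV hyp_chart_in_hyp by auto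
    ultimately show "X \<in> ?I" using intV by blast
  qed
  have conn: "connected ?I" unfolding Ieq
  proof (rule connected_continuous_image)
    show "continuous_on ?H (\<lambda>y. hyp_chart (G y))"
      by (rule continuous_on_compose2[OF continuous_on_hyp_chart[of UNIV]])
        (use continuous_on_subset[OF smooth_on_continuous[OF smG]] in auto)
    show "connected ?H" by (intro convex_connected convex_Int convex_ball convex_halfspace_lt)
  qed
  have "p = hyp_chart (G ?x0)"
  proof -
    have "F ?x0 = ?x0" unfolding F_def using g0 by simp
    then show ?thesis using FW(2)[OF x0G] hyp_chart_fst[OF ph] by simp
  qed
  then have "((\<lambda>t. hyp_chart (G (?x0 - t *\<^sub>R a))) \<longlongrightarrow> p) (at_right 0)"
    using lim(3)[of ?x0] r by simp
  moreover have "\<forall>\<^sub>F t in at_right 0. hyp_chart (G (?x0 - t *\<^sub>R a)) \<in> ?I"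
    unfolding Ieq using lim(4)[OF centre_in_ball[THEN iffD2, OF r]] eventually_at_right_less[of 0]
  proof eventually_elim
    case (elim t)
    have "a \<bullet> (?x0 - t *\<^sub>R a) < a \<bullet> ?x0" using a(1) elim(2) by (simp add: inner_simps norm_eq_1)
    then show ?case using elim(1) by blast
  qed
  then have "\<forall>\<^sub>F t in at_right 0. hyp_chart (G (?x0 - t *\<^sub>R a)) \<in> closure ?I"
    by (rule eventually_mono) (rule subsetD[OF closure_subset])
  ultimately have clos: "p \<in> closure ?I"
    by (rule Lim_in_closed_set[OF closed_closure _ trivial_limit_at_right_real, rotated])
  have tang: "\<exists>v\<in>hyp_tangent X. frechet_derivative f (at X) v \<noteq> 0" if X: "X \<in> hyp \<inter> V" for X
  proof
    have x: "fst X \<in> ?W" using X by (simp add: V_def)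
    let ?v = "frechet_derivative hyp_chart (at (fst X)) a"
    have Xc: "hyp_chart (fst X) = X" using X hyp_chart_fst by blast
    show "frechet_derivative f (at X) ?v \<noteq> 0" using dga[OF x] dg[of "fst X" a] x sub Xc by auto
    show "?v \<in> hyp_tangent X"
      using derivative_in_hyp_tangent[OF smooth_on_has_derivative[OF smooth_hyp_chart UNIV_I] open_UNIV UNIV_I
          hyp_chart_in_hyp, of "fst X" a] Xc
      by (simp add: hyp_tangent_def)
  qed
  have "a \<noteq> 0" using a(1) by auto
  \<comment> \<open>The hyperplane orthogonal to \<open>a\<close> in dimension \<open>n + 1\<close>
    has dimension \<open>n\<close>, so there is a linear isometry \<open>B\<close> from
    \<open>real^'n\<close> onto it; the chart domain is then simply a ball.\<close>
  have "dim (UNIV :: (real^'n) set) = dim {x. a \<bullet> x = 0}"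
    using dim_hyperplane[OF \<open>a \<noteq> 0\<close>] by simp
  then obtain B B' where B: "linear B" "linear B'" "range B = {x. a \<bullet> x = 0}"
    "\<And>u :: real^'n. norm (B u) = norm u" "\<And>u. B' (B u) = u"
    by (rule isometries_subspaces[OF subspace_UNIV subspace_hyperplane, of a]) auto
  have blB: "bounded_linear B" "bounded_linear B'" using B linear_conv_bounded_linear by auto
  define \<phi> where "\<phi> u = hyp_chart (G (?x0 + B u))" for u
  define \<psi> where "\<psi> X = B' (F (fst X) - ?x0)" for X :: "'n minkowski"
  let ?U = "ball (0 :: real^'n) r"
  have Bball: "?x0 + B u \<in> ball ?x0 r" if "u \<in> ?U" for u
    using that B(4) by (simp add: dist_norm)
  have \<psi>\<phi>: "\<psi> (\<phi> u) = u" if "u \<in> ?U" for u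
    unfolding \<psi>_def \<phi>_def using FG[OF Bball[OF that]] B(5) by simp
  have sm\<phi>: "smooth_on ?U \<phi>"
  proof -
    have 1: "smooth_on ?U (\<lambda>u. ?x0 + B u)"
      unfolding smooth_on_def by (intro allI Ck_on_add Ck_on_const Ck_on_linear blB open_ball)
    have 2: "smooth_on ?U (\<lambda>u. G (?x0 + B u))"
      by (rule smooth_on_compose[OF open_ball open_ball _ smG 1]) (use Bball in auto)
    show ?thesis unfolding \<phi>_def
      by (rule smooth_on_compose[OF open_ball open_UNIV _ smooth_hyp_chart 2]) auto
  qed
  have img: "\<phi> ` ?U = hbd \<Omega> \<inter> V"
  proof (intro equalityI subsetI)
    fix X assume "X \<in> \<phi> ` ?U"
    then obtain u where u: "u \<in> ?U" "X = \<phi> u" by auto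
    have "X \<in> hyp \<inter> V" using u Bball[OF u(1)] chartV hyp_chart_in_hyp unfolding \<phi>_def by auto
    moreover have "f X = B u \<bullet> a" using gG[OF Bball[OF u(1)]] u by (simp add: \<phi>_def g_def)
    moreover have "B u \<bullet> a = 0" using B(3) by (auto simp: inner_commute)
    ultimately show "X \<in> hbd \<Omega> \<inter> V" using hbdV by auto
  next
    fix X assume X: "X \<in> hbd \<Omega> \<inter> V"
    then have Xh: "X \<in> hyp \<inter> V" using hbd[of X] dom(1) by auto
    let ?y = "F (fst X)"
    have y: "?y \<in> ball ?x0 r" "hyp_chart (G ?y) = X"
      using FW[of "fst X"] hyp_chart_fst[of X] Xh unfolding V_def by auto
    have "(?y - ?x0) \<bullet> a = 0" using gG[OF y(1)] y(2) hbdV[OF Xh] X by (simp add: g_def)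
    then obtain u where u: "?y - ?x0 = B u" using B(3) by (metis (mono_tags) inner_commute mem_Collect_eq rangeE)
    then have "?x0 + B u = ?y" by (simp add: algebra_simps)
    moreover have "u \<in> ?U" using y(1) B(4)[of u] unfolding u[symmetric] by (simp add: dist_norm norm_minus_commute)
    ultimately show "X \<in> \<phi> ` ?U" using y(2) unfolding \<phi>_def by force
  qed
  have contF: "continuous_on ?W F" using hom by (simp add: homeomorphism_def)
  have cont\<psi>: "continuous_on (\<phi> ` ?U) \<psi>"
  proof -
    have "continuous_on (\<phi> ` ?U) (\<lambda>X. F (fst X))"
      by (rule continuous_on_compose2[OF contF continuous_on_fst[OF continuous_on_id]])
        (auto simp: img V_def)
    then have "continuous_on (\<phi> ` ?U) (\<lambda>X. F (fst X) - ?x0)" by (intro continuous_intros)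
    then show ?thesis unfolding \<psi>_def
      by (rule continuous_on_compose2[OF linear_continuous_on[OF blB(2), of UNIV]]) simp
  qed
  have hom\<phi>: "homeomorphism ?U (\<phi> ` ?U) \<phi> \<psi>"
    unfolding homeomorphism_def
    using \<psi>\<phi> cont\<psi> smooth_on_continuous[OF sm\<phi>] by (auto simp: image_image)
  \<comment> \<open>\<open>F\<close> composed with \<open>fst\<close> and \<open>\<phi>\<close> is
    the affine isometry \<open>?x0 + B u\<close>, so the derivative of \<open>\<phi>\<close> must be
    injective.\<close>
  have inj\<phi>: "inj (frechet_derivative \<phi> (at u))" if u: "u \<in> ?U" for u
  proof -
    note d\<phi> = smooth_on_has_derivative[OF sm\<phi> u]
    let ?z = "G (?x0 + B u)"
    have x: "?z \<in> O'" "fst (\<phi> u) = ?z" using Bball[OF u] sub by (auto simp: \<phi>_def)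
    define DF where "DF h = h - (h \<bullet> a) *\<^sub>R a + frechet_derivative g (at ?z) h *\<^sub>R a" for h
    have DF: "(F has_derivative DF) (at ?z)"
      unfolding F_def DF_def[abs_def] using smooth_on_has_derivative[OF g x(1)]
      by (auto intro!: derivative_eq_intros)
    have 1: "((\<lambda>u. F (fst (\<phi> u))) has_derivative (\<lambda>w. DF (fst (frechet_derivative \<phi> (at u) w)))) (at u)"
      using has_derivative_compose[OF bounded_linear.has_derivative[OF bounded_linear_fst d\<phi>], of F DF] DF x by simp
    have "((\<lambda>u. ?x0 + B u) has_derivative B) (at u)"
      using has_derivative_add[OF has_derivative_const bounded_linear_imp_has_derivative[OF blB(1)]] by simp
    then have 2: "((\<lambda>u. F (fst (\<phi> u))) has_derivative B) (at u)"
    proof (rule has_derivative_transform_within_open[OF _ open_ball u])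
      fix w assume "w \<in> ?U"
      from FG[OF Bball[OF this]] show "?x0 + B w = F (fst (\<phi> w))" by (simp add: \<phi>_def)
    qed
    have eq: "DF (fst (frechet_derivative \<phi> (at u) w)) = B w" for w
      using has_derivative_unique[OF 1 2] by meson
    show ?thesis
    proof (rule injI)
      fix v w assume "frechet_derivative \<phi> (at u) v = frechet_derivative \<phi> (at u) w"
      then have "B v = B w" using eq by metis
      then show "v = w" using B(5) by metis
    qed
  qed
  have lp: "local_param (hbd \<Omega>) ?U \<phi>"
    unfolding local_param_def
    using sm\<phi> hom\<phi> inj\<phi> V by (auto simp: img openin_open)
  have "p \<in> \<phi> ` ?U" unfolding img using p pV by blast
  then show thesis
    using that[OF V pV _ smooth_on_subset[OF f] levV hbdV tang lp _ _ conn clos] img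
    unfolding V_def by blast
qed

section \<open>Hypersurfaces and their area measure\<close>

lemma local_paramD:
  assumes "local_param M U \<phi>"
  shows "open U" "smooth_on U \<phi>" "\<phi> ` U \<subseteq> M" "inj_on \<phi> U"
    and "u \<in> U \<Longrightarrow> inj (frechet_derivative \<phi> (at u))"
    and "u \<in> U \<Longrightarrow> (\<phi> has_derivative frechet_derivative \<phi> (at u)) (at u)"
    and "u \<in> U \<Longrightarrow> linear (frechet_derivative \<phi> (at u))"
proof -
  show *: "open U" "smooth_on U \<phi>" "\<phi> ` U \<subseteq> M"
    using assms by (auto simp: local_param_def openin_open)
  show "inj_on \<phi> U" using assms by (auto simp: local_param_def homeomorphism_def intro: inj_on_inverseI)
  show "u \<in> U \<Longrightarrow> inj (frechet_derivative \<phi> (at u))" using assms by (auto simp: local_param_def)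
  show "u \<in> U \<Longrightarrow> (\<phi> has_derivative frechet_derivative \<phi> (at u)) (at u)"
    by (rule smooth_on_has_derivative[OF *(2)])
  then show "u \<in> U \<Longrightarrow> linear (frechet_derivative \<phi> (at u))" using has_derivative_linear by blast
qed

lemma local_param_tangent:
  assumes "local_param M U \<phi>" "M \<subseteq> hyp" "u \<in> U"
  shows "lor (frechet_derivative \<phi> (at u) w) (\<phi> u) = 0" "\<phi> u \<in> hyp"
    and "w \<noteq> 0 \<Longrightarrow> 0 < lor (frechet_derivative \<phi> (at u) w) (frechet_derivative \<phi> (at u) w)"
proof -
  note lp = local_paramD[OF assms(1)]
  show *: "\<phi> u \<in> hyp" using lp(3) assms by blast
  show t: "lor (frechet_derivative \<phi> (at u) w) (\<phi> u) = 0"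
    by (rule derivative_in_hyp_tangent[OF lp(6)[OF assms(3)] lp(1) assms(3)]) (use lp(3) assms(2) in blast)
  assume "w \<noteq> 0"
  then have "frechet_derivative \<phi> (at u) w \<noteq> 0"
    using lp(5,7)[OF assms(3)] linear_injective_0 by blast
  then show "0 < lor (frechet_derivative \<phi> (at u) w) (frechet_derivative \<phi> (at u) w)"
    using lor_pos_tangent[OF * t] by blast
qed

text \<open>Functions on a hypersurface that are smooth in a chart extend smoothly to a neighbourhood in
  Minkowski space, by composition with \<open>R\<close>.\<close>

lemma chart_retraction:
  fixes \<phi> :: "real^'n \<Rightarrow> ('n::finite) minkowski"
  assumes lp: "local_param M U \<phi>" and u: "u \<in> U"
  obtains N R where "open N" "\<phi> u \<in> N" "smooth_on N R"
    "\<And>X. X \<in> M \<inter> N \<Longrightarrow> R X \<in> U \<and> \<phi> (R X) = X" "\<And>w. w \<in> U \<Longrightarrow> \<phi> w \<in> N \<Longrightarrow> R (\<phi> w) = w"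
proof -
  note lpD = local_paramD[OF lp]
  obtain L where L: "linear L" "L \<circ> frechet_derivative \<phi> (at u) = id"
    using real_vector.linear_injective_left_inverse[OF lpD(7)[OF u] lpD(5)[OF u]] by blast
  have blL: "bounded_linear L" using L(1) linear_conv_bounded_linear by blast
  \<comment> \<open>\<open>L\<close> is a left inverse of the derivative of \<open>\<phi>\<close> at
    \<open>u\<close>, so \<open>L \<circ> \<phi>\<close> has identity derivative there and a smooth
    local inverse \<open>G\<close>; the extension is \<open>R = G \<circ> L\<close>, near points
    where \<open>M\<close> coincides with the chart image.\<close>
  define F where "F w = L (\<phi> w)" for w
  have F: "smooth_on U F"
    unfolding F_def[abs_def] smooth_on_def
    using Ck_on_bounded_linear[OF blL lpD(1) smooth_on_Ck[OF lpD(2)]] by blast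
  have "(F has_derivative (\<lambda>w. L (frechet_derivative \<phi> (at u) w))) (at u)"
    unfolding F_def[abs_def] by (rule bounded_linear.has_derivative[OF blL lpD(6)[OF u]])
  then have "frechet_derivative F (at u) = (\<lambda>w. L (frechet_derivative \<phi> (at u) w))"
    by (rule frechet_derivative_eq)
  then have "frechet_derivative F (at u) = id" using L(2) by (simp add: o_def)
  then have "inj (frechet_derivative F (at u))" by simp
  then obtain U' V G where UV: "open U'" "U' \<subseteq> U" "u \<in> U'" "open V" "F u \<in> V"
    and hom: "homeomorphism U' V F G" and G: "smooth_on V G"
    by (rule smooth_inverse_function_theorem[OF lpD(1) u F]) (rule that)
  obtain \<psi> where \<psi>: "homeomorphism U (\<phi> ` U) \<phi> \<psi>" "openin (top_of_set M) (\<phi> ` U)"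
    using lp by (auto simp: local_param_def)
  have "openin (top_of_set (\<phi> ` U)) (\<phi> ` U')"
    using homeomorphism_imp_open_map[OF \<psi>(1)] UV by (simp add: open_subset)
  then have "openin (top_of_set M) (\<phi> ` U')" using openin_trans \<psi>(2) by blast
  then obtain N0 where N0: "open N0" "\<phi> ` U' = M \<inter> N0" by (auto simp: openin_open)
  define N where "N = N0 \<inter> L -` V"
  define R where "R X = G (L X)" for X
  have opV: "open (L -` V)"
    using UV(4) by (intro open_vimage linear_continuous_on blL)
  have GF: "G (F w) = w" if "w \<in> U'" for w using hom that by (auto simp: homeomorphism_def)
  show thesis
  proof (rule that[of N R])
    show "open N" unfolding N_def using N0 opV by auto
    show "\<phi> u \<in> N" using N0 UV unfolding N_def F_def by auto
    show "smooth_on N R"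
      unfolding R_def[abs_def]
      by (rule smooth_on_compose[OF _ UV(4) _ G smooth_on_linear[OF L(1)]])
        (use \<open>open N\<close> in \<open>auto simp: N_def\<close>)
    show "R X \<in> U \<and> \<phi> (R X) = X" if X: "X \<in> M \<inter> N" for X
    proof -
      have "X \<in> \<phi> ` U'" using X N0 by (auto simp: N_def)
      then obtain w where w: "w \<in> U'" "X = \<phi> w" by blast
      then have "R X = w" using GF[of w] by (simp add: R_def F_def)
      then show ?thesis using w UV by auto
    qed
    show "R (\<phi> w) = w" if w: "w \<in> U" "\<phi> w \<in> N" for w
    proof -
      have "\<phi> w \<in> M" using w lpD(3) by blast
      then have "\<phi> w \<in> \<phi> ` U'" using w N0 by (auto simp: N_def)
      then have "w \<in> U'" using inj_onD[OF lpD(4)] w UV(2) by blast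
      then show ?thesis using GF[of w] by (simp add: R_def F_def)
    qed
  qed
qed

text \<open>A curve in \<open>M\<close> equals \<open>\<phi> (R (\<gamma> t))\<close> near 0, so its
  velocity is in the range. Conversely, straight lines in \<open>U\<close> map to curves with
  prescribed velocity; \<open>\<epsilon>\<close> keeps them in a ball inside
  \<open>U\<close>.\<close>

lemma tangent_space_eq_range:
  assumes lp: "local_param M U \<phi>" and u: "u \<in> U"
  shows "tangent_space M (\<phi> u) = range (frechet_derivative \<phi> (at u))"
proof (intro equalityI subsetI)
  note lpD = local_paramD[OF lp]
  fix v assume "v \<in> tangent_space M (\<phi> u)"
  then obtain \<epsilon> \<gamma> where \<gamma>: "\<epsilon> > 0" "smooth_on {-\<epsilon><..<\<epsilon>} \<gamma>" "\<gamma> ` {-\<epsilon><..<\<epsilon>} \<subseteq> M" "\<gamma> 0 = \<phi> u"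
    "(\<gamma> has_vector_derivative v) (at (0::real))" unfolding tangent_space_def by blast
  obtain N R where N: "open N" "\<phi> u \<in> N" "smooth_on N R"
    "\<And>X. X \<in> M \<inter> N \<Longrightarrow> R X \<in> U \<and> \<phi> (R X) = X" "\<And>w. w \<in> U \<Longrightarrow> \<phi> w \<in> N \<Longrightarrow> R (\<phi> w) = w"
    using chart_retraction[OF lp u] by blast
  have Ru: "R (\<phi> u) = u" using N(2,5) u by blast
  have d\<gamma>: "(\<gamma> has_derivative (\<lambda>t. t *\<^sub>R v)) (at 0)" using \<gamma>(5) by (simp add: has_vector_derivative_def)
  have dR: "(R has_derivative frechet_derivative R (at (\<phi> u))) (at (\<gamma> 0))"
    using smooth_on_has_derivative[OF N(3,2)] \<gamma>(4) by simp
  note d1 = has_derivative_compose[OF d\<gamma> dR]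
  have d2: "((\<lambda>t. \<phi> (R (\<gamma> t))) has_derivative
      (\<lambda>t. frechet_derivative \<phi> (at u) (frechet_derivative R (at (\<phi> u)) (t *\<^sub>R v)))) (at 0)"
    by (rule has_derivative_compose[OF d1]) (use lpD(6)[OF u] \<gamma>(4) Ru in simp)
  let ?T = "{-\<epsilon><..<\<epsilon>} \<inter> \<gamma> -` N"
  have opT: "open ?T"
    using continuous_open_preimage[OF smooth_on_continuous[OF \<gamma>(2)] _ N(1)] by simp
  have 0: "0 \<in> ?T" using \<gamma> N(2) by auto
  have "(\<gamma> has_derivative (\<lambda>t. frechet_derivative \<phi> (at u) (frechet_derivative R (at (\<phi> u)) (t *\<^sub>R v)))) (at 0)"
    by (rule has_derivative_transform_within_open[OF d2 opT 0]) (use N(4) \<gamma>(3) in blast)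
  from has_derivative_unique[OF this d\<gamma>]
  have "frechet_derivative \<phi> (at u) (frechet_derivative R (at (\<phi> u)) (1 *\<^sub>R v)) = 1 *\<^sub>R v" by meson
  then show "v \<in> range (frechet_derivative \<phi> (at u))" by (metis rangeI scaleR_one)
next
  note lpD = local_paramD[OF lp]
  fix v assume "v \<in> range (frechet_derivative \<phi> (at u))"
  then obtain w where w: "v = frechet_derivative \<phi> (at u) w" by blast
  obtain r where r: "r > 0" "ball u r \<subseteq> U" using lpD(1) u openE by blast
  define \<epsilon> where "\<epsilon> = r / (norm w + 1)"
  have \<epsilon>: "\<epsilon> > 0" unfolding \<epsilon>_def using r by (simp add: add_nonneg_pos)
  have inU: "u + t *\<^sub>R w \<in> U" if "t \<in> {-\<epsilon><..<\<epsilon>}" for t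
  proof -
    have "\<bar>t\<bar> * norm w \<le> \<bar>t\<bar> * (norm w + 1)" by (intro mult_left_mono) auto
    also have "\<dots> < \<epsilon> * (norm w + 1)" using that by (intro mult_strict_right_mono) (auto simp: add_nonneg_pos)
    also have "\<dots> = r" unfolding \<epsilon>_def using add_nonneg_pos[of "norm w" 1] by simp
    finally show ?thesis using r(2) by (auto simp: dist_norm)
  qed
  let ?\<gamma> = "\<lambda>t. \<phi> (u + t *\<^sub>R w)"
  have l: "bounded_linear (\<lambda>t. t *\<^sub>R w)" by (rule bounded_linear_scaleR_left)
  have "smooth_on {-\<epsilon><..<\<epsilon>} (\<lambda>t. u + t *\<^sub>R w)"
    unfolding smooth_on_def by (intro allI Ck_on_add Ck_on_const Ck_on_linear l) auto
  then have "smooth_on {-\<epsilon><..<\<epsilon>} ?\<gamma>"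
    by (intro smooth_on_compose[OF _ lpD(1) _ lpD(2)]) (use inU in auto)
  moreover have "?\<gamma> ` {-\<epsilon><..<\<epsilon>} \<subseteq> M" using inU lpD(3) by blast
  moreover have "(?\<gamma> has_vector_derivative v) (at 0)"
  proof -
    have 1: "((\<lambda>t. u + t *\<^sub>R w) has_derivative (\<lambda>t. t *\<^sub>R w)) (at 0)"
      using has_derivative_add[OF has_derivative_const bounded_linear_imp_has_derivative[OF l]] by simp
    have "(?\<gamma> has_derivative (\<lambda>t. frechet_derivative \<phi> (at u) (t *\<^sub>R w))) (at 0)"
      by (rule has_derivative_compose[OF 1]) (use lpD(6)[OF u] in simp)
    then show ?thesis unfolding has_vector_derivative_def w
      using linear_scale[OF lpD(7)[OF u]] by simp
  qed
  ultimately show "v \<in> tangent_space M (\<phi> u)"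
    unfolding tangent_space_def using \<epsilon> by (intro CollectI exI[of _ \<epsilon>] exI[of _ ?\<gamma>]) auto
qed

text \<open>A derivative within \<open>M\<close> is not unique as a linear map on the ambient space.
  The smooth extension by \<open>R\<close> shows that one exists, and the chain rule along
  \<open>\<phi>\<close> pins down its values on tangent vectors whichever is selected.\<close>

lemma derivative_along_hypersurface:
  fixes h :: "('n::finite) minkowski \<Rightarrow> 'b::euclidean_space"
  assumes lp: "local_param M U \<phi>" and u: "u \<in> U" and h: "((\<lambda>w. h (\<phi> w)) has_derivative D) (at u)"
  shows "h differentiable (at (\<phi> u) within M)"
    and "frechet_derivative h (at (\<phi> u) within M) (frechet_derivative \<phi> (at u) w) = D w"
proof -
  note lpD = local_paramD[OF lp]
  obtain N R where N: "open N" "\<phi> u \<in> N" "smooth_on N R"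
    "\<And>X. X \<in> M \<inter> N \<Longrightarrow> R X \<in> U \<and> \<phi> (R X) = X" "\<And>w. w \<in> U \<Longrightarrow> \<phi> w \<in> N \<Longrightarrow> R (\<phi> w) = w"
    using chart_retraction[OF lp u] by blast
  have Ru: "R (\<phi> u) = u" using N(2,5) u by blast
  have "((\<lambda>X. h (\<phi> (R X))) has_derivative (\<lambda>X. D (frechet_derivative R (at (\<phi> u)) X))) (at (\<phi> u))"
    by (rule has_derivative_compose[OF smooth_on_has_derivative[OF N(3,2)]]) (use h Ru in simp)
  then have "((\<lambda>X. h (\<phi> (R X))) has_derivative (\<lambda>X. D (frechet_derivative R (at (\<phi> u)) X))) (at (\<phi> u) within M \<inter> N)"
    by (rule has_derivative_at_withinI)
  then have "(h has_derivative (\<lambda>X. D (frechet_derivative R (at (\<phi> u)) X))) (at (\<phi> u) within M \<inter> N)"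
    by (rule has_derivative_transform[rotated 2]) (use N u lpD(3) in auto)
  then have "(h has_derivative (\<lambda>X. D (frechet_derivative R (at (\<phi> u)) X))) (at (\<phi> u) within M)"
    using at_within_nhd[OF N(2,1), of M "M \<inter> N"] by (simp add: Int_assoc)
  then show "h differentiable (at (\<phi> u) within M)" unfolding differentiable_def by blast
  then have E: "(h has_derivative frechet_derivative h (at (\<phi> u) within M)) (at (\<phi> u) within M)"
    using frechet_derivative_works by blast
  have "((\<lambda>w. h (\<phi> w)) has_derivative
     (\<lambda>w. frechet_derivative h (at (\<phi> u) within M) (frechet_derivative \<phi> (at u) w))) (at u within U)"
    by (rule has_derivative_in_compose[OF has_derivative_at_withinI[OF lpD(6)[OF u]]])
      (rule has_derivative_subset[OF E lpD(3)])
  then have "((\<lambda>w. h (\<phi> w)) has_derivative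
     (\<lambda>w. frechet_derivative h (at (\<phi> u) within M) (frechet_derivative \<phi> (at u) w))) (at u)"
    using at_within_open[OF u lpD(1)] by simp
  from has_derivative_unique[OF this h]
  show "frechet_derivative h (at (\<phi> u) within M) (frechet_derivative \<phi> (at u) w) = D w" by meson
qed

section \<open>Volume densities and Borel sets in charts\<close>

lemma gram_eq:
  assumes "(\<phi> has_derivative A) (at u)"
  shows "gram \<phi> u = (\<chi> i j. lor (A (axis i 1)) (A (axis j 1)))"
  unfolding gram_def frechet_derivative_eq[OF assms] ..

text \<open>The Gram matrix is multiplied by the matrix of \<open>B\<close> on the right and by its
  transpose on the left, so its determinant acquires the square of
  \<open>det (matrix B)\<close>.\<close>

lemma vol_density_compose:
  fixes \<tau> :: "real^'d \<Rightarrow> real^'d"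
  assumes \<phi>: "(\<phi> has_derivative A) (at (\<tau> u))" and \<tau>: "(\<tau> has_derivative B) (at u)"
  shows "vol_density (\<lambda>w. \<phi> (\<tau> w)) u = \<bar>det (matrix B)\<bar> * vol_density \<phi> (\<tau> u)"
proof -
  have c: "((\<lambda>w. \<phi> (\<tau> w)) has_derivative (\<lambda>w. A (B w))) (at u)"
    by (rule has_derivative_compose[OF \<tau> \<phi>])
  have lA: "linear A" using \<phi> has_derivative_linear by blast
  have exp: "A (B (axis i 1)) = (\<Sum>k\<in>UNIV. matrix B $ k $ i *\<^sub>R A (axis k 1))" for i
  proof -
    have "B (axis i 1) = (\<Sum>k\<in>UNIV. matrix B $ k $ i *\<^sub>R axis k 1)"
      using basis_expansion[of "B (axis i 1)"] by (simp add: scalar_mult_eq_scaleR matrix_def)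
    then show ?thesis using lA by (simp add: linear_sum linear_scale)
  qed
  have "gram (\<lambda>w. \<phi> (\<tau> w)) u = transpose (matrix B) ** (gram \<phi> (\<tau> u) ** matrix B)"
    unfolding gram_eq[OF c] gram_eq[OF \<phi>] exp
    by (simp add: vec_eq_iff matrix_matrix_mult_def transpose_def lor_sum_left lor_sum_right sum_distrib_left mult_ac)
      (intro allI, subst sum.swap, simp add: mult_ac)
  then have "det (gram (\<lambda>w. \<phi> (\<tau> w)) u) = (det (matrix B))\<^sup>2 * det (gram \<phi> (\<tau> u))"
    by (simp add: det_mul power2_eq_square)
  then show ?thesis unfolding vol_density_def by (simp add: real_sqrt_mult)
qed

lemma vol_density_cong:
  assumes "open S" "u \<in> S" "\<And>w. w \<in> S \<Longrightarrow> \<phi> w = \<phi>' w"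
  shows "vol_density \<phi> u = vol_density \<phi>' u"
proof -
  have "frechet_derivative \<phi> (at u) = frechet_derivative \<phi>' (at u)"
    by (rule frechet_derivative_cong[OF assms])
  then show ?thesis unfolding vol_density_def gram_def by simp
qed

lemma continuous_on_vol_density:
  fixes \<phi> :: "real^'d \<Rightarrow> ('n::finite) minkowski"
  assumes "open U" "smooth_on U \<phi>"
  shows "continuous_on U (vol_density \<phi>)"
proof -
  have c: "continuous_on U (\<lambda>u. frechet_derivative \<phi> (at u) v)" for v
    using smooth_on_continuous[OF smooth_on_deriv[OF assms(2)]] .
  have "continuous_on U (\<lambda>u. gram \<phi> u $ i $ j)" for i j
    unfolding gram_def lor_def by (simp, intro continuous_intros c)
  then show ?thesis unfolding vol_density_def[abs_def] det_def
    by (intro continuous_on_real_sqrt continuous_on_sum continuous_on_mult continuous_on_const continuous_on_prod)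
qed

lemma vol_density_pos:
  fixes A :: "real^'d \<Rightarrow> ('n::finite) minkowski"
  assumes "(\<phi> has_derivative A) (at u)"
  shows "(\<And>w. w \<noteq> 0 \<Longrightarrow> 0 < lor (A w) (A w)) \<Longrightarrow> 0 < vol_density \<phi> u"
    and "(\<And>w. 0 \<le> lor (A w) (A w)) \<Longrightarrow> 0 \<le> vol_density \<phi> u"
proof -
  have lA: "linear A" using assms has_derivative_linear by blast
  let ?G = "gram \<phi> u"
  have sym: "?G $ i $ j = ?G $ j $ i" for i j unfolding gram_def by (simp add: lor_sym)
  have G: "x \<bullet> (?G *v x) = lor (A x) (A x)" for x
  proof -
    have "A (\<Sum>i\<in>UNIV. (x $ i) *\<^sub>R axis i 1) = (\<Sum>i\<in>UNIV. (x $ i) *\<^sub>R A (axis i 1))"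
      using lA by (simp add: linear_sum linear_scale)
    then have Ax: "A x = (\<Sum>i\<in>UNIV. (x $ i) *\<^sub>R A (axis i 1))"
      using basis_expansion[of x] by (simp add: scalar_mult_eq_scaleR)
    have "lor (A x) (A x) = (\<Sum>i\<in>UNIV. \<Sum>j\<in>UNIV. x $ i * (x $ j * lor (A (axis j 1)) (A (axis i 1))))"
      by (subst (1 2) Ax) (simp add: lor_sum_left lor_sum_right sum_distrib_left)
    then show ?thesis unfolding gram_eq[OF assms]
      by (simp add: inner_vec_def matrix_vector_mult_def sum_distrib_left mult_ac lor_sym)
  qed
  show "(\<And>w. w \<noteq> 0 \<Longrightarrow> 0 < lor (A w) (A w)) \<Longrightarrow> 0 < vol_density \<phi> u"
    unfolding vol_density_def using det_pos_if_definite[OF sym] G by simp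
  show "(\<And>w. 0 \<le> lor (A w) (A w)) \<Longrightarrow> 0 \<le> vol_density \<phi> u"
    unfolding vol_density_def using det_nonneg_if_semidefinite[OF sym] G by simp
qed

lemma local_param_vol_density_pos:
  assumes "local_param M U \<phi>" "M \<subseteq> hyp" "u \<in> U"
  shows "0 < vol_density \<phi> u"
  using vol_density_pos(1)[OF local_paramD(6)[OF assms(1,3)]] local_param_tangent(3)[OF assms] by blast

text \<open>A chart is a homeomorphism onto a relatively open subset of a closed set, so its inverse
  is Borel on a Borel set and images are preimages under it.\<close>

lemma local_param_Borel_image:
  assumes lp: "local_param M U \<phi>" and "closed M" and B: "B \<in> sets borel" "B \<subseteq> U"
  shows "\<phi> ` B \<in> sets borel"
proof -
  obtain \<psi> where \<psi>: "homeomorphism U (\<phi> ` U) \<phi> \<psi>" "openin (top_of_set M) (\<phi> ` U)"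
    using lp by (auto simp: local_param_def)
  obtain O' where O': "open O'" "\<phi> ` U = M \<inter> O'" using \<psi>(2) by (auto simp: openin_open)
  then have b: "\<phi> ` U \<in> sets borel" using \<open>closed M\<close> by auto
  have inv: "\<psi> (\<phi> u) = u" if "u \<in> U" for u using \<psi>(1) that by (auto simp: homeomorphism_def)
  have "\<phi> ` B = \<psi> -` B \<inter> \<phi> ` U"
  proof (intro equalityI subsetI)
    fix y assume "y \<in> \<phi> ` B"
    then show "y \<in> \<psi> -` B \<inter> \<phi> ` U" using inv B(2) by auto
  next
    fix y assume "y \<in> \<psi> -` B \<inter> \<phi> ` U"
    then show "y \<in> \<phi> ` B" using inv by auto
  qed
  moreover have "\<psi> -` B \<inter> space (restrict_space borel (\<phi> ` U)) \<in> sets (restrict_space borel (\<phi> ` U))"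
    using \<psi>(1) B(1) by (intro measurable_sets[OF borel_measurable_continuous_on_restrict])
      (auto simp: homeomorphism_def)
  ultimately show ?thesis using b by (simp add: space_restrict_space sets_restrict_space_iff)
qed

lemma local_param_Borel_vimage:
  fixes \<phi> :: "real^'n \<Rightarrow> ('n::finite) minkowski"
  assumes lp: "local_param M U \<phi>" and B: "B \<in> sets borel" "B \<subseteq> U" and C: "C \<in> sets borel"
  shows "{u \<in> B. \<phi> u \<in> C} \<in> sets borel"
proof -
  note lpD = local_paramD[OF lp]
  have "\<phi> -` C \<inter> space (restrict_space borel U) \<in> sets (restrict_space borel U)"
    using C by (intro measurable_sets[OF borel_measurable_continuous_on_restrict[OF smooth_on_continuous[OF lpD(2)]]])
  then have "\<phi> -` C \<inter> U \<in> sets borel"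
    using lpD(1) by (simp add: space_restrict_space sets_restrict_space_iff)
  moreover have "{u \<in> B. \<phi> u \<in> C} = B \<inter> (\<phi> -` C \<inter> U)" using B by auto
  ultimately show ?thesis using B(1) by auto
qed

text \<open>Both integrals compute the area of \<open>\<phi> ` B \<inter> \<phi>' ` B'\<close>.\<close>

lemma area_chart_transition:
  fixes \<phi> \<phi>' :: "real^'n \<Rightarrow> ('n::finite) minkowski"
  assumes lp: "local_param M U \<phi>" and lp': "local_param M U' \<phi>'" and "M \<subseteq> hyp" "closed M"
    and B: "B \<in> sets borel" "B \<subseteq> U" and B': "B' \<in> sets borel" "B' \<subseteq> U'"
  shows "(\<integral>\<^sup>+u\<in>{u\<in>B. \<phi> u \<in> \<phi>' ` B'}. ennreal (vol_density \<phi> u) \<partial>lborel) =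
    (\<integral>\<^sup>+v\<in>{v\<in>B'. \<phi>' v \<in> \<phi> ` B}. ennreal (vol_density \<phi>' v) \<partial>lborel)"
proof -
  note lpD = local_paramD[OF lp] and lpD' = local_paramD[OF lp']
  let ?U = "{u \<in> U. \<phi> u \<in> \<phi>' ` U'}"
  define \<tau> where "\<tau> u = inv_into U' \<phi>' (\<phi> u)" for u
  have \<tau>: "\<tau> u \<in> U'" "\<phi>' (\<tau> u) = \<phi> u" if "u \<in> ?U" for u
    unfolding \<tau>_def using that by (auto intro: inv_into_into f_inv_into_f)
  have \<tau>I: "\<tau> u = v" if "v \<in> U'" "\<phi> u = \<phi>' v" for u v
    unfolding \<tau>_def using that inv_into_f_f[OF lpD'(4)] by simp
  obtain O' where O': "open O'" "\<phi>' ` U' = M \<inter> O'" using lp' by (auto simp: local_param_def openin_open)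
  have "?U = U \<inter> \<phi> -` O'" using O'(2) lpD(3) by auto
  then have opU: "open ?U"
    using continuous_open_preimage[OF smooth_on_continuous[OF lpD(2)] lpD(1) O'(1)] by simp
  \<comment> \<open>Near \<open>u\<close> the transition map equals \<open>R \<circ> \<phi>\<close>
    with the smooth retraction \<open>R\<close> of the second chart; the inverse chart by itself is
    only known to be continuous on \<open>M\<close>.\<close>
  have d\<tau>: "\<exists>D. (\<tau> has_derivative D) (at u)" if u: "u \<in> ?U" for u
  proof -
    obtain N R where N: "open N" "\<phi>' (\<tau> u) \<in> N" "smooth_on N R"
      "\<And>X. X \<in> M \<inter> N \<Longrightarrow> R X \<in> U' \<and> \<phi>' (R X) = X" "\<And>w. w \<in> U' \<Longrightarrow> \<phi>' w \<in> N \<Longrightarrow> R (\<phi>' w) = w"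
      using chart_retraction[OF lp' \<tau>(1)[OF u]] by blast
    have pN: "\<phi> u \<in> N" using N(2) \<tau>(2)[OF u] by simp
    have uU: "u \<in> U" using u by blast
    have d: "((\<lambda>w. R (\<phi> w)) has_derivative (\<lambda>w. frechet_derivative R (at (\<phi> u)) (frechet_derivative \<phi> (at u) w))) (at u)"
      by (rule has_derivative_compose[OF lpD(6)[OF uU] smooth_on_has_derivative[OF N(3) pN]])
    have "open (?U \<inter> (U \<inter> \<phi> -` N))"
      using opU continuous_open_preimage[OF smooth_on_continuous[OF lpD(2)] lpD(1) N(1)] by blast
    then have "(\<tau> has_derivative (\<lambda>w. frechet_derivative R (at (\<phi> u)) (frechet_derivative \<phi> (at u) w))) (at u)"
    proof (rule has_derivative_transform_within_open[OF d])
      show "u \<in> ?U \<inter> (U \<inter> \<phi> -` N)" using u uU pN by blast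
      show "R (\<phi> w) = \<tau> w" if "w \<in> ?U \<inter> (U \<inter> \<phi> -` N)" for w
        using N(5)[of "\<tau> w"] \<tau>[of w] that by simp
    qed
    then show ?thesis by blast
  qed
  then have "\<forall>u. \<exists>D. u \<in> ?U \<longrightarrow> (\<tau> has_derivative D) (at u)" by blast
  from choice[OF this] obtain D where D: "\<And>u. u \<in> ?U \<Longrightarrow> (\<tau> has_derivative D u) (at u)" by blast
  have inj: "inj_on \<tau> ?U"
  proof (rule inj_onI)
    fix u v assume uv: "u \<in> ?U" "v \<in> ?U" "\<tau> u = \<tau> v"
    then have "\<phi> u = \<phi> v" using \<tau>(2)[OF uv(1)] \<tau>(2)[OF uv(2)] by simp
    then show "u = v" using inj_onD[OF lpD(4)] uv by blast
  qed
  let ?S = "{u\<in>B. \<phi> u \<in> \<phi>' ` B'}"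
  have S: "?S \<in> sets borel" "?S \<subseteq> ?U"
    using local_param_Borel_vimage[OF lp B local_param_Borel_image[OF lp' \<open>closed M\<close> B']] B B' by auto
  have img: "\<tau> ` ?S = {v\<in>B'. \<phi>' v \<in> \<phi> ` B}"
  proof (intro equalityI subsetI)
    fix v assume "v \<in> \<tau> ` ?S"
    then obtain u w where uw: "u \<in> B" "w \<in> B'" "\<phi> u = \<phi>' w" "v = \<tau> u" by auto
    then have "v = w" using \<tau>I[of w u] B'(2) by auto
    moreover have "\<phi>' w \<in> \<phi> ` B" using uw by (metis imageI)
    ultimately show "v \<in> {v\<in>B'. \<phi>' v \<in> \<phi> ` B}" using uw(2) by simp
  next
    fix v assume "v \<in> {v\<in>B'. \<phi>' v \<in> \<phi> ` B}"
    then obtain u where u: "u \<in> B" "v \<in> B'" "\<phi> u = \<phi>' v" by auto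
    then have "v = \<tau> u" using \<tau>I[of v u] B'(2) by auto
    moreover have "u \<in> ?S" using u by (auto intro: image_eqI[of _ _ v])
    ultimately show "v \<in> \<tau> ` ?S" by (rule image_eqI)
  qed
  have nonneg: "0 \<le> vol_density \<phi>' v" if "v \<in> U'" for v
    using local_param_vol_density_pos[OF lp' \<open>M \<subseteq> hyp\<close> that] by simp
  have "(\<integral>\<^sup>+v\<in>\<tau> ` ?S. ennreal (vol_density \<phi>' v) \<partial>lborel) =
    (\<integral>\<^sup>+u\<in>?S. ennreal (\<bar>det (matrix (D u))\<bar> * vol_density \<phi>' (\<tau> u)) \<partial>lborel)"
    by (rule nn_integral_change_of_variables_open(2)[OF opU D inj lpD'(1) _
          continuous_on_vol_density[OF lpD'(1,2)] nonneg S]) (use \<tau> in auto)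
  also have "\<dots> = (\<integral>\<^sup>+u\<in>?S. ennreal (vol_density \<phi> u) \<partial>lborel)"
  proof (rule nn_integral_cong)
    fix u
    show "ennreal (\<bar>det (matrix (D u))\<bar> * vol_density \<phi>' (\<tau> u)) * indicator ?S u =
      ennreal (vol_density \<phi> u) * indicator ?S u"
    proof (cases "u \<in> ?S")
      case True
      then have u: "u \<in> ?U" using S(2) by blast
      have "vol_density (\<lambda>w. \<phi>' (\<tau> w)) u = \<bar>det (matrix (D u))\<bar> * vol_density \<phi>' (\<tau> u)"
        by (rule vol_density_compose[OF lpD'(6)[OF \<tau>(1)[OF u]] D[OF u]])
      moreover have "vol_density (\<lambda>w. \<phi>' (\<tau> w)) u = vol_density \<phi> u"
        by (rule vol_density_cong[OF opU u \<tau>(2)])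
      ultimately show ?thesis by simp
    qed simp
  qed
  finally show ?thesis unfolding img by simp
qed

text \<open>Borel pieces of charts take the place of a partition of unity. The compact set around
  each piece keeps the density bounded on it, hence the area finite.\<close>

definition chart_partition ::
    "('n::finite) minkowski set \<Rightarrow> nat \<Rightarrow> (nat \<Rightarrow> (real^'n) set) \<Rightarrow> (nat \<Rightarrow> real^'n \<Rightarrow> 'n minkowski) \<Rightarrow>
      (nat \<Rightarrow> (real^'n) set) \<Rightarrow> bool" where
  "chart_partition M m U \<phi> B \<longleftrightarrow>
     (\<forall>i<m. local_param M (U i) (\<phi> i) \<and> B i \<in> sets borel \<and> B i \<subseteq> U i \<and>
        (\<exists>K. compact K \<and> B i \<subseteq> K \<and> K \<subseteq> U i)) \<and>
     disjoint_family_on (\<lambda>i. \<phi> i ` B i) {..<m} \<and> (\<Union>i<m. \<phi> i ` B i) = M"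

lemma chart_partitionD:
  assumes "chart_partition M m U \<phi> B"
  shows "i < m \<Longrightarrow> local_param M (U i) (\<phi> i)" "i < m \<Longrightarrow> B i \<in> sets borel" "i < m \<Longrightarrow> B i \<subseteq> U i"
    "i < m \<Longrightarrow> \<exists>K. compact K \<and> B i \<subseteq> K \<and> K \<subseteq> U i"
    "disjoint_family_on (\<lambda>i. \<phi> i ` B i) {..<m}" "(\<Union>i<m. \<phi> i ` B i) = M"
  using assms unfolding chart_partition_def by auto

text \<open>Finitely many images of balls with closure inside a chart domain cover \<open>M\<close>;
  each piece drops the points already covered by earlier ones. The parameter \<open>P\<close> lets
  charts with extra structure be requested.\<close>

lemma chart_partition_exists:
  fixes M :: "('n::finite) minkowski set"
  assumes "compact M" "M \<subseteq> hyp"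
    and ch: "\<And>p. p \<in> M \<Longrightarrow> \<exists>U \<phi>. local_param M U \<phi> \<and> p \<in> \<phi> ` U \<and> P U \<phi>"
  obtains m U \<phi> B where "chart_partition M m U \<phi> B" "\<And>i. i < m \<Longrightarrow> P (U i) (\<phi> i)"
proof -
  define Q where "Q p U \<phi> u r O' \<longleftrightarrow> local_param M U \<phi> \<and> P U \<phi> \<and> p = \<phi> u \<and> r > 0 \<and> cball u r \<subseteq> U \<and>
      open O' \<and> \<phi> ` ball u r = M \<inter> O'" for p U \<phi> u O' and r :: real
  have "\<exists>U \<phi> u r O'. Q p U \<phi> u r O'" if p: "p \<in> M" for p
  proof -
    obtain U \<phi> u where lp: "local_param M U \<phi>" and u: "u \<in> U" "p = \<phi> u" "P U \<phi>" using ch[OF p] by blast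
    obtain r where r: "r > 0" "cball u r \<subseteq> U" using local_paramD(1)[OF lp] u(1) open_contains_cball by blast
    obtain \<psi> where \<psi>: "homeomorphism U (\<phi> ` U) \<phi> \<psi>" "openin (top_of_set M) (\<phi> ` U)"
      using lp by (auto simp: local_param_def)
    have "openin (top_of_set (\<phi> ` U)) (\<phi> ` ball u r)"
      using homeomorphism_imp_open_map[OF \<psi>(1)] r(2) ball_subset_cball by (metis open_ball open_subset subset_trans)
    then have "openin (top_of_set M) (\<phi> ` ball u r)" using openin_trans \<psi>(2) by blast
    then obtain O' where "open O'" "\<phi> ` ball u r = M \<inter> O'" by (auto simp: openin_open)
    then have "Q p U \<phi> u r O'" unfolding Q_def using lp u r by blast
    then show ?thesis by blast
  qed
  then obtain U \<phi> u r O' where Q: "\<And>p. p \<in> M \<Longrightarrow> Q p (U p) (\<phi> p) (u p) (r p) (O' p)" by metis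
  then have c: "\<And>p. p \<in> M \<Longrightarrow> local_param M (U p) (\<phi> p)" "\<And>p. p \<in> M \<Longrightarrow> P (U p) (\<phi> p)"
    "\<And>p. p \<in> M \<Longrightarrow> p = \<phi> p (u p)" "\<And>p. p \<in> M \<Longrightarrow> r p > 0" "\<And>p. p \<in> M \<Longrightarrow> cball (u p) (r p) \<subseteq> U p"
    "\<And>p. p \<in> M \<Longrightarrow> open (O' p)" "\<And>p. p \<in> M \<Longrightarrow> \<phi> p ` ball (u p) (r p) = M \<inter> O' p"
    unfolding Q_def by simp_all
  have "M \<subseteq> (\<Union>p\<in>M. O' p)"
  proof
    fix p assume p: "p \<in> M"
    then have "p \<in> \<phi> p ` ball (u p) (r p)" using c(3)[OF p] c(4)[OF p] by (metis centre_in_ball imageI)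
    then show "p \<in> (\<Union>p\<in>M. O' p)" using c(7)[OF p] p by blast
  qed
  then obtain I where I: "I \<subseteq> M" "finite I" "M \<subseteq> (\<Union>p\<in>I. O' p)"
    using compactE_image[OF \<open>compact M\<close>, of M O'] c(6) by auto
  obtain h where h: "bij_betw h {0..<card I} I" using ex_bij_betw_nat_finite[OF I(2)] by blast
  let ?m = "card I"
  have hI: "h i \<in> M" if "i < ?m" for i using h I(1) that by (auto simp: bij_betw_def)
  let ?B = "\<lambda>i. {v \<in> ball (u (h i)) (r (h i)). \<phi> (h i) v \<in> - (\<Union>j<i. O' (h j))}"
  have img: "\<phi> (h i) ` ?B i = M \<inter> O' (h i) - (\<Union>j<i. O' (h j))" if "i < ?m" for i
  proof -
    have "\<phi> (h i) ` ?B i = \<phi> (h i) ` ball (u (h i)) (r (h i)) - (\<Union>j<i. O' (h j))" by auto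
    then show ?thesis unfolding c(7)[OF hI[OF that]] .
  qed
  have "chart_partition M ?m (\<lambda>i. U (h i)) (\<lambda>i. \<phi> (h i)) ?B"
    unfolding chart_partition_def
  proof (intro conjI allI impI)
    fix i assume i: "i < ?m"
    show lp: "local_param M (U (h i)) (\<phi> (h i))" using c(1) hI i by blast
    have sub: "ball (u (h i)) (r (h i)) \<subseteq> U (h i)" using c(5)[OF hI[OF i]] ball_subset_cball by blast
    then show "?B i \<subseteq> U (h i)" by auto
    have "open (\<Union>j<i. O' (h j))" by (intro open_UN ballI c(6) hI) (use i in auto)
    then have "- (\<Union>j<i. O' (h j)) \<in> sets borel" by (intro borel_closed) (simp only: closed_Compl)
    then show "?B i \<in> sets borel" by (rule local_param_Borel_vimage[OF lp _ sub, rotated]) simp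
    show "\<exists>K. compact K \<and> ?B i \<subseteq> K \<and> K \<subseteq> U (h i)"
      using c(5)[OF hI[OF i]] by (intro exI[of _ "cball (u (h i)) (r (h i))"]) auto
  next
    show "disjoint_family_on (\<lambda>i. \<phi> (h i) ` ?B i) {..<?m}"
      unfolding disjoint_family_on_def
    proof (intro ballI impI)
      fix i j assume ij: "i \<in> {..<?m}" "j \<in> {..<?m}" "i \<noteq> j"
      show "\<phi> (h i) ` ?B i \<inter> \<phi> (h j) ` ?B j = {}"
      proof -
        have I: "i < ?m" and J: "j < ?m" and "i < j \<or> j < i" using ij by auto
        then show ?thesis unfolding img[OF I] img[OF J] by auto
      qed
    qed
    show "(\<Union>i<?m. \<phi> (h i) ` ?B i) = M"
    proof (intro equalityI subsetI)
      fix p assume "p \<in> (\<Union>i<?m. \<phi> (h i) ` ?B i)"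
      then show "p \<in> M" using img by auto
    next
      fix p assume p: "p \<in> M"
      then obtain q where "q \<in> I" "p \<in> O' q" using I(3) by blast
      moreover from this h have "q \<in> h ` {0..<?m}" by (simp add: bij_betw_def)
      ultimately have "\<exists>i. i < ?m \<and> p \<in> O' (h i)" by auto
      then obtain i where i: "i < ?m \<and> p \<in> O' (h i)" "\<And>j. j < i \<Longrightarrow> \<not> (j < ?m \<and> p \<in> O' (h j))"
        using exists_least_iff[of "\<lambda>i. i < ?m \<and> p \<in> O' (h i)"] by blast
      then have "p \<in> \<phi> (h i) ` ?B i" using img[of i] p by auto
      then show "p \<in> (\<Union>i<?m. \<phi> (h i) ` ?B i)" using i(1) by blast
    qed
  qed
  then show thesis by (rule that) (use c(2) hI in auto)
qed

text \<open>The condition under the \<open>THE\<close> in \<open>area_measure\<close>, named so that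
  existence and uniqueness can be treated separately.\<close>

definition is_area_measure :: "('n::finite) minkowski set \<Rightarrow> 'n minkowski measure \<Rightarrow> bool" where
  "is_area_measure M \<mu> \<longleftrightarrow> sets \<mu> = sets (restrict_space borel M) \<and>
     (\<forall>U \<phi> B. local_param M U \<phi> \<longrightarrow> B \<in> sets borel \<longrightarrow> B \<subseteq> U \<longrightarrow>
        emeasure \<mu> (\<phi> ` B) = (\<integral>\<^sup>+u\<in>B. ennreal (vol_density \<phi> u) \<partial>lborel))"

lemma nn_integral_disjoint_union:
  fixes f :: "'a \<Rightarrow> ennreal"
  assumes "finite I" "\<And>i. i \<in> I \<Longrightarrow> A i \<in> sets N" "disjoint_family_on A I"
    and f: "\<And>i. i \<in> I \<Longrightarrow> (\<lambda>x. f x * indicator (A i) x) \<in> borel_measurable N"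
  shows "(\<integral>\<^sup>+x\<in>(\<Union>i\<in>I. A i). f x \<partial>N) = (\<Sum>i\<in>I. \<integral>\<^sup>+x\<in>A i. f x \<partial>N)"
proof -
  have "indicator (\<Union>i\<in>I. A i) x = (\<Sum>i\<in>I. indicator (A i) x :: ennreal)" for x
    using indicator_UN_disjoint[OF assms(1,3), of x] by simp
  then have "(\<integral>\<^sup>+x\<in>(\<Union>i\<in>I. A i). f x \<partial>N) = (\<integral>\<^sup>+x. (\<Sum>i\<in>I. f x * indicator (A i) x) \<partial>N)"
    by (simp add: sum_distrib_left)
  also have "\<dots> = (\<Sum>i\<in>I. \<integral>\<^sup>+x\<in>A i. f x \<partial>N)"
    using f by (intro nn_integral_sum) auto
  finally show ?thesis .
qed

lemma vol_density_indicator_measurable: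
  fixes \<phi> :: "real^'n \<Rightarrow> ('n::finite) minkowski"
  assumes lp: "local_param M U \<phi>" and B: "B \<in> sets borel" "B \<subseteq> U"
  shows "(\<lambda>u. ennreal (vol_density \<phi> u) * indicator B u) \<in> borel_measurable borel"
proof -
  have "(\<lambda>u. indicator B u *\<^sub>R vol_density \<phi> u) \<in> borel_measurable borel"
    using continuous_on_subset[OF continuous_on_vol_density[OF local_paramD(1,2)[OF lp]] B(2)] B(1)
    by (intro borel_measurable_continuous_on_indicator)
  then have "(\<lambda>u. ennreal (indicator B u *\<^sub>R vol_density \<phi> u)) \<in> borel_measurable borel" by measurable
  moreover have "ennreal (indicator B u *\<^sub>R vol_density \<phi> u) = ennreal (vol_density \<phi> u) * indicator B u" for u
    by (simp add: indicator_def)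
  ultimately show ?thesis by simp
qed

text \<open>The measure is built on the disjoint union of \<open>m\<close> copies of
  \<open>real^'n\<close>, with the volume density cut off to the Borel pieces, and pushed forward by
  the charts. Cutting off \<open>h\<close> as well makes it Borel; its default value 0 outside the
  pieces carries density 0.\<close>

lemma nn_integral_glued_measure:
  fixes M :: "('n::finite) minkowski set"
  assumes cp: "chart_partition M m U \<phi> B" and "closed M"
  obtains \<mu> where "sets \<mu> = sets (restrict_space borel M)"
    "\<And>g. g \<in> borel_measurable (restrict_space borel M) \<Longrightarrow>
      (\<integral>\<^sup>+p. g p \<partial>\<mu>) = (\<Sum>i<m. \<integral>\<^sup>+u\<in>B i. ennreal (vol_density (\<phi> i) u) * g (\<phi> i u) \<partial>lborel)"
proof -
  note cpD = chart_partitionD[OF cp]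
  let ?N = "count_space {..<m} \<Otimes>\<^sub>M (lborel :: (real^'n) measure)"
  define d where "d = (\<lambda>(i, u). ennreal (vol_density (\<phi> i) u) * indicator (B i) u)"
  define h where "h = (\<lambda>(i, u). indicator (B i) u *\<^sub>R \<phi> i u)"
  have d: "d \<in> borel_measurable ?N"
    unfolding d_def
    by (rule measurable_pair_measure_countable1)
      (use vol_density_indicator_measurable[OF cpD(1-3)] in auto)
  have h: "h \<in> borel_measurable ?N"
    unfolding h_def
  proof (rule measurable_pair_measure_countable1)
    fix i assume "i \<in> {..<m}"
    then have i: "i < m" by simp
    have "(\<lambda>u. indicator (B i) u *\<^sub>R \<phi> i u) \<in> borel_measurable borel"
      using continuous_on_subset[OF smooth_on_continuous[OF local_paramD(2)[OF cpD(1)[OF i]]] cpD(3)[OF i]] cpD(2)[OF i]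
      by (intro borel_measurable_continuous_on_indicator)
    then show "(\<lambda>u. case (i, u) of (i, u) \<Rightarrow> indicator (B i) u *\<^sub>R \<phi> i u) \<in> borel_measurable lborel" by simp
  qed simp
  let ?\<mu>' = "distr (density ?N d) borel h"
  let ?\<mu> = "restrict_space ?\<mu>' M"
  have Mb: "M \<in> sets borel" using \<open>closed M\<close> by simp
  show thesis
  proof (rule that[of ?\<mu>])
    show "sets ?\<mu> = sets (restrict_space borel M)"
      by (intro sets_restrict_space_cong) simp
    fix g :: "'n minkowski \<Rightarrow> ennreal" assume "g \<in> borel_measurable (restrict_space borel M)"
    then have g: "(\<lambda>p. g p * indicator M p) \<in> borel_measurable borel"
      using Mb by (simp add: borel_measurable_restrict_space_iff_ennreal)
    have meas: "(\<lambda>z. g (h z) * indicator M (h z)) \<in> borel_measurable ?N"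
      using measurable_compose[OF h g] by simp
    have "(\<integral>\<^sup>+p. g p \<partial>?\<mu>) = (\<integral>\<^sup>+p. g p * indicator M p \<partial>?\<mu>')"
      using Mb by (intro nn_integral_restrict_space) simp
    also have "\<dots> = (\<integral>\<^sup>+z. g (h z) * indicator M (h z) \<partial>density ?N d)"
      using g h by (intro nn_integral_distr) auto
    also have "\<dots> = (\<integral>\<^sup>+z. d z * (g (h z) * indicator M (h z)) \<partial>?N)"
      using meas d by (intro nn_integral_density) auto
    also have "\<dots> = (\<integral>\<^sup>+i. \<integral>\<^sup>+u. d (i, u) * (g (h (i, u)) * indicator M (h (i, u))) \<partial>lborel \<partial>count_space {..<m})"
      using d meas by (intro lborel.nn_integral_fst[symmetric] borel_measurable_times) auto
    also have "\<dots> = (\<Sum>i<m. \<integral>\<^sup>+u. d (i, u) * (g (h (i, u)) * indicator M (h (i, u))) \<partial>lborel)"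
      by (simp add: nn_integral_count_space_finite)
    also have "\<dots> = (\<Sum>i<m. \<integral>\<^sup>+u\<in>B i. ennreal (vol_density (\<phi> i) u) * g (\<phi> i u) \<partial>lborel)"
    proof (intro sum.cong refl nn_integral_cong)
      fix i u assume "i \<in> {..<m}"
      then have "\<phi> i u \<in> M" if "u \<in> B i" using cpD(6) that by blast
      then show "d (i, u) * (g (h (i, u)) * indicator M (h (i, u))) =
          ennreal (vol_density (\<phi> i) u) * g (\<phi> i u) * indicator (B i) u"
        by (cases "u \<in> B i") (auto simp: d_def h_def)
    qed
    finally show "(\<integral>\<^sup>+p. g p \<partial>?\<mu>) = (\<Sum>i<m. \<integral>\<^sup>+u\<in>B i. ennreal (vol_density (\<phi> i) u) * g (\<phi> i u) \<partial>lborel)" .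
  qed
qed

lemma chart_partition_vimage_Borel:
  assumes cp: "chart_partition M m U \<phi> B" and "i < m" and A: "A \<in> sets (restrict_space borel M)" and "closed M"
  shows "{u \<in> B i. \<phi> i u \<in> A} \<in> sets borel"
proof -
  have "A \<in> sets borel" using A \<open>closed M\<close> by (simp add: sets_restrict_space_iff)
  then show ?thesis using local_param_Borel_vimage chart_partitionD(1-3)[OF cp \<open>i < m\<close>] by blast
qed

text \<open>Uniqueness: a measure with the chart property is determined by cutting \<open>A\<close>
  into its parts in the disjoint chart pieces.\<close>

lemma is_area_measure_emeasure:
  assumes cp: "chart_partition M m U \<phi> B" and "closed M" and \<mu>: "is_area_measure M \<mu>"
    and A: "A \<in> sets (restrict_space borel M)"
  shows "emeasure \<mu> A = (\<Sum>i<m. \<integral>\<^sup>+u\<in>{u \<in> B i. \<phi> i u \<in> A}. ennreal (vol_density (\<phi> i) u) \<partial>lborel)"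
proof -
  note cpD = chart_partitionD[OF cp]
  let ?C = "\<lambda>i. {u \<in> B i. \<phi> i u \<in> A}"
  have AM: "A \<subseteq> M" using A sets.sets_into_space by (fastforce simp: space_restrict_space)
  have C: "?C i \<in> sets borel" if "i < m" for i
    using chart_partition_vimage_Borel[OF cp that A \<open>closed M\<close>] .
  have "A = (\<Union>i<m. \<phi> i ` ?C i)" using cpD(6) AM by blast
  moreover have "emeasure \<mu> (\<Union>i<m. \<phi> i ` ?C i) = (\<Sum>i<m. emeasure \<mu> (\<phi> i ` ?C i))"
  proof (rule sum_emeasure[symmetric])
    show "(\<lambda>i. \<phi> i ` ?C i) ` {..<m} \<subseteq> sets \<mu>"
    proof (rule image_subsetI)
      fix i assume "i \<in> {..<m}"
      then have i: "i < m" by simp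
      have sub: "?C i \<subseteq> U i" using cpD(3)[OF i] by auto
      have "\<phi> i ` ?C i \<in> sets borel"
        by (rule local_param_Borel_image[OF cpD(1)[OF i] \<open>closed M\<close> C[OF i] sub])
      moreover have "\<phi> i ` ?C i \<subseteq> M" using AM by auto
      ultimately show "\<phi> i ` ?C i \<in> sets \<mu>"
        using \<mu> \<open>closed M\<close> by (simp add: is_area_measure_def sets_restrict_space_iff)
    qed
    show "disjoint_family_on (\<lambda>i. \<phi> i ` ?C i) {..<m}"
      using cpD(5) unfolding disjoint_family_on_def by blast
  qed simp
  moreover have "emeasure \<mu> (\<phi> i ` ?C i) = (\<integral>\<^sup>+u\<in>?C i. ennreal (vol_density (\<phi> i) u) \<partial>lborel)" if i: "i < m" for i
  proof -
    have "?C i \<subseteq> U i" using cpD(3)[OF i] by auto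
    then show ?thesis using \<mu> cpD(1)[OF i] C[OF i] unfolding is_area_measure_def by blast
  qed
  ultimately show ?thesis by simp
qed

text \<open>The glued measure has the chart property for an arbitrary further chart because, piece
  by piece, \<open>area_chart_transition\<close> equates the two area integrals. Together with
  uniqueness this resolves the \<open>THE\<close> and makes \<open>area_measure\<close> computable
  in any chart partition.\<close>

theorem area_measure_nn_integral:
  fixes M :: "('n::finite) minkowski set"
  assumes cp: "chart_partition M m U \<phi> B" and "closed M" "M \<subseteq> hyp"
  shows "sets (area_measure M) = sets (restrict_space borel M)"
    and "g \<in> borel_measurable (restrict_space borel M) \<Longrightarrow>
      (\<integral>\<^sup>+p. g p \<partial>area_measure M) = (\<Sum>i<m. \<integral>\<^sup>+u\<in>B i. ennreal (vol_density (\<phi> i) u) * g (\<phi> i u) \<partial>lborel)"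
proof -
  note cpD = chart_partitionD[OF cp]
  obtain \<mu> where s\<mu>: "sets \<mu> = sets (restrict_space borel M)"
    and int: "\<And>g. g \<in> borel_measurable (restrict_space borel M) \<Longrightarrow>
      (\<integral>\<^sup>+p. g p \<partial>\<mu>) = (\<Sum>i<m. \<integral>\<^sup>+u\<in>B i. ennreal (vol_density (\<phi> i) u) * g (\<phi> i u) \<partial>lborel)"
    using nn_integral_glued_measure[OF cp \<open>closed M\<close>] by blast
  have "is_area_measure M \<mu>"
    unfolding is_area_measure_def
  proof (intro conjI allI impI s\<mu>)
    fix V \<psi> C assume lp: "local_param M V \<psi>" and C: "C \<in> sets borel" "C \<subseteq> V"
    have "\<psi> ` C \<subseteq> M" using local_paramD(3)[OF lp] C(2) by blast
    then have in\<mu>: "\<psi> ` C \<in> sets (restrict_space borel M)"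
      using local_param_Borel_image[OF lp \<open>closed M\<close> C] \<open>closed M\<close> by (simp add: sets_restrict_space_iff)
    let ?A = "\<lambda>i. {v \<in> C. \<psi> v \<in> \<phi> i ` B i}"
    have A: "?A i \<in> sets borel" if "i < m" for i
      using local_param_Borel_vimage[OF lp C] local_param_Borel_image[OF cpD(1)[OF that] \<open>closed M\<close> cpD(2,3)[OF that]]
      by blast
    have "emeasure \<mu> (\<psi> ` C) = (\<integral>\<^sup>+p. indicator (\<psi> ` C) p \<partial>\<mu>)"
      using in\<mu> s\<mu> by simp
    also have "\<dots> = (\<Sum>i<m. \<integral>\<^sup>+u\<in>B i. ennreal (vol_density (\<phi> i) u) * indicator (\<psi> ` C) (\<phi> i u) \<partial>lborel)"
      using in\<mu> by (intro int borel_measurable_indicator)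
    also have "\<dots> = (\<Sum>i<m. \<integral>\<^sup>+u\<in>{u \<in> B i. \<phi> i u \<in> \<psi> ` C}. ennreal (vol_density (\<phi> i) u) \<partial>lborel)"
      by (intro sum.cong refl nn_integral_cong) (auto simp: indicator_def)
    also have "\<dots> = (\<Sum>i<m. \<integral>\<^sup>+v\<in>?A i. ennreal (vol_density \<psi> v) \<partial>lborel)"
      by (intro sum.cong refl area_chart_transition[OF _ lp \<open>M \<subseteq> hyp\<close> \<open>closed M\<close> _ _ C])
        (use cpD(1-3) in auto)
    also have "\<dots> = (\<integral>\<^sup>+v\<in>(\<Union>i<m. ?A i). ennreal (vol_density \<psi> v) \<partial>lborel)"
    proof (rule nn_integral_disjoint_union[symmetric])
      show "disjoint_family_on ?A {..<m}"
        using cpD(5) unfolding disjoint_family_on_def by blast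
      show "(\<lambda>v. ennreal (vol_density \<psi> v) * indicator (?A i) v) \<in> borel_measurable lborel" if "i \<in> {..<m}" for i
        using vol_density_indicator_measurable[OF lp A] that C(2) by auto
    qed (use A in auto)
    also have "(\<Union>i<m. ?A i) = C" using cpD(6) \<open>\<psi> ` C \<subseteq> M\<close> by blast
    finally show "emeasure \<mu> (\<psi> ` C) = (\<integral>\<^sup>+v\<in>C. ennreal (vol_density \<psi> v) \<partial>lborel)" .
  qed
  moreover have "\<nu> = \<mu>" if "is_area_measure M \<nu>" for \<nu>
  proof (rule measure_eqI)
    show "sets \<nu> = sets \<mu>" using that s\<mu> by (simp add: is_area_measure_def)
    fix A assume "A \<in> sets \<nu>"
    then have "A \<in> sets (restrict_space borel M)" using that by (simp add: is_area_measure_def)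
    then show "emeasure \<nu> A = emeasure \<mu> A"
      using is_area_measure_emeasure[OF cp \<open>closed M\<close>] that \<open>is_area_measure M \<mu>\<close> by simp
  qed
  ultimately have "area_measure M = \<mu>"
    unfolding area_measure_def is_area_measure_def[symmetric] by (intro the_equality)
  then show "sets (area_measure M) = sets (restrict_space borel M)"
    "g \<in> borel_measurable (restrict_space borel M) \<Longrightarrow>
      (\<integral>\<^sup>+p. g p \<partial>area_measure M) = (\<Sum>i<m. \<integral>\<^sup>+u\<in>B i. ennreal (vol_density (\<phi> i) u) * g (\<phi> i u) \<partial>lborel)"
    using s\<mu> int by auto
qed

text \<open>Preimages are finite unions of chart images of Borel sets. Measurability along charts
  therefore suffices, and curvature functions are accessible only along charts.\<close>

lemma chart_partition_measurable:
  fixes M :: "('n::finite) minkowski set" and f :: "'n minkowski \<Rightarrow> 'b::topological_space"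
  assumes cp: "chart_partition M m U \<phi> B" and "closed M"
    and f: "\<And>i. i < m \<Longrightarrow> (\<lambda>u. f (\<phi> i u)) \<in> borel_measurable (restrict_space borel (U i))"
  shows "f \<in> borel_measurable (restrict_space borel M)"
proof (rule measurableI)
  note cpD = chart_partitionD[OF cp]
  fix A :: "'b set" assume A: "A \<in> sets borel"
  have "f -` A \<inter> space (restrict_space borel M) = (\<Union>i<m. \<phi> i ` {u \<in> B i. f (\<phi> i u) \<in> A})"
    using cpD(6) by (auto simp: space_restrict_space)
  moreover have "\<phi> i ` {u \<in> B i. f (\<phi> i u) \<in> A} \<in> sets borel" if i: "i < m" for i
  proof (rule local_param_Borel_image[OF cpD(1)[OF i] \<open>closed M\<close>])
    have "(\<lambda>u. f (\<phi> i u)) -` A \<inter> space (restrict_space borel (U i)) \<in> sets (restrict_space borel (U i))"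
      by (rule measurable_sets[OF f[OF i] A])
    then have "(\<lambda>u. f (\<phi> i u)) -` A \<inter> U i \<in> sets borel"
      using local_paramD(1)[OF cpD(1)[OF i]] by (simp add: space_restrict_space sets_restrict_space_iff)
    moreover have "{u \<in> B i. f (\<phi> i u) \<in> A} = B i \<inter> ((\<lambda>u. f (\<phi> i u)) -` A \<inter> U i)"
      using cpD(3)[OF i] by auto
    ultimately show "{u \<in> B i. f (\<phi> i u) \<in> A} \<in> sets borel" using cpD(2)[OF i] by auto
    show "{u \<in> B i. f (\<phi> i u) \<in> A} \<subseteq> U i" using cpD(3)[OF i] by auto
  qed
  ultimately show "f -` A \<inter> space (restrict_space borel M) \<in> sets (restrict_space borel M)"
    using \<open>closed M\<close> cpD(6) by (auto simp: sets_restrict_space_iff intro!: sets.finite_UN)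
qed simp

text \<open>The density is continuous, hence bounded on the compact set that encloses the
  piece.\<close>

lemma chart_partition_finite:
  fixes M :: "('n::finite) minkowski set"
  assumes cp: "chart_partition M m U \<phi> B" and "i < m"
  shows "(\<integral>\<^sup>+u\<in>B i. ennreal (vol_density (\<phi> i) u) \<partial>lborel) < \<infinity>"
proof -
  note cpD = chart_partitionD[OF cp]
  obtain K where K: "compact K" "B i \<subseteq> K" "K \<subseteq> U i" using cpD(4)[OF \<open>i < m\<close>] by blast
  have "continuous_on K (vol_density (\<phi> i))"
    using continuous_on_subset[OF continuous_on_vol_density[OF local_paramD(1,2)[OF cpD(1)[OF \<open>i < m\<close>]]] K(3)] .
  then have "bounded (vol_density (\<phi> i) ` K)"
    using compact_imp_bounded compact_continuous_image K(1) by blast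
  then obtain c where c: "\<And>v. v \<in> K \<Longrightarrow> vol_density (\<phi> i) v \<le> c"
    unfolding bounded_iff by (metis abs_le_D1 imageI real_norm_def)
  have "(\<integral>\<^sup>+v\<in>B i. ennreal (vol_density (\<phi> i) v) \<partial>lborel) \<le> (\<integral>\<^sup>+v. ennreal c * indicator K v \<partial>lborel)"
    using c K(2) by (intro nn_integral_mono) (auto simp: indicator_def intro!: ennreal_leI)
  also have "\<dots> < \<infinity>"
    using emeasure_bounded_finite[OF compact_imp_bounded[OF K(1)]] K(1)
    by (simp add: nn_integral_cmult_indicator ennreal_mult_less_top borel_compact)
  finally show ?thesis .
qed

section \<open>Unit normals and principal curvatures\<close>

text \<open>The vector representing the differential with respect to \<open>lor\<close>; the time
  component changes sign because \<open>lor\<close> is negative in that direction.\<close>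

definition lor_gradient :: "(('n::finite) minkowski \<Rightarrow> real) \<Rightarrow> 'n minkowski \<Rightarrow> 'n minkowski" where
  "lor_gradient f X = (\<Sum>b\<in>Basis. frechet_derivative f (at X) (b, 0) *\<^sub>R b, - frechet_derivative f (at X) (0, 1))"

lemma lor_gradient:
  assumes "(f has_derivative D) (at X)"
  shows "lor (lor_gradient f X) w = D w"
proof -
  have lD: "linear D" using assms has_derivative_linear by blast
  have "w = (\<Sum>b\<in>Basis. (fst w \<bullet> b) *\<^sub>R (b, 0)) + snd w *\<^sub>R (0, 1)"
    by (simp add: prod_eq_iff fst_sum snd_sum euclidean_representation)
  then have "D w = D ((\<Sum>b\<in>Basis. (fst w \<bullet> b) *\<^sub>R (b, 0)) + snd w *\<^sub>R (0, 1))" by simp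
  also have "\<dots> = (\<Sum>b\<in>Basis. (fst w \<bullet> b) * D (b, 0)) + snd w * D (0, 1)"
    by (simp only: linear_add[OF lD] linear_sum[OF lD] linear_scale[OF lD] real_scaleR_def)
  finally show ?thesis
    unfolding lor_gradient_def frechet_derivative_eq[OF assms] lor_def
    by (simp add: inner_sum_left inner_sum_right mult.commute inner_commute)
qed

lemma smooth_lor_gradient:
  assumes "open V" "smooth_on V f"
  shows "smooth_on V (lor_gradient f)"
  unfolding smooth_on_def lor_gradient_def[abs_def]
  using smooth_on_Ck[OF smooth_on_deriv[OF assms(2)]]
  by (intro allI Ck_on_Pair Ck_on_sum Ck_on_scaleR Ck_on_minus Ck_on_const assms(1) finite_Basis) auto

text \<open>\<open>N\<close> is the tangential part of the Lorentz gradient, and nonzero tangent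
  vectors are spacelike, so it can be normalized wherever the differential is nonzero on the tangent
  space. \<open>V'\<close> is the ambient open set where the normalization makes sense, so that
  \<open>\<nu>\<close> is smooth there in the ambient variables.\<close>

lemma unit_normal_field:
  fixes f :: "('n::finite) minkowski \<Rightarrow> real"
  assumes V: "open V" and f: "smooth_on V f"
    and df: "\<And>X. X \<in> hyp \<inter> V \<Longrightarrow> \<exists>v\<in>hyp_tangent X. frechet_derivative f (at X) v \<noteq> 0"
  obtains V' \<nu> where "open V'" "hyp \<inter> V \<subseteq> V'" "V' \<subseteq> V" "smooth_on V' \<nu>"
    "\<And>X. X \<in> hyp \<inter> V \<Longrightarrow> lor (\<nu> X) X = 0" "\<And>X. X \<in> hyp \<inter> V \<Longrightarrow> lor (\<nu> X) (\<nu> X) = 1"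
    "\<And>X. X \<in> hyp \<inter> V \<Longrightarrow> \<exists>c>0. \<forall>v. lor v X = 0 \<longrightarrow> frechet_derivative f (at X) v = c * lor (\<nu> X) v"
proof -
  let ?G = "lor_gradient f"
  define N where "N X = ?G X + lor (?G X) X *\<^sub>R X" for X
  define q where "q X = lor (N X) (N X)" for X
  define \<nu> where "\<nu> X = inverse (sqrt (q X)) *\<^sub>R N X" for X
  note Clor = bounded_bilinear.Ck_on[OF bounded_bilinear_lor]
  have CG: "Ck_on k V ?G" for k using smooth_on_Ck[OF smooth_lor_gradient[OF V f]] .
  have CN: "Ck_on k V N" for k unfolding N_def[abs_def]
    by (intro Ck_on_add Ck_on_scaleR Clor CG Ck_on_id V)
  have Cq: "Ck_on k V q" for k unfolding q_def[abs_def] by (intro Clor CN V)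
  let ?V' = "V \<inter> q -` {0<..}"
  have opV': "open ?V'" using continuous_open_preimage[OF Ck_on_continuous[OF Cq[of 0]] V] by simp
  have sub: "?V' \<subseteq> V" by blast
  have "Ck_on k ?V' \<nu>" for k unfolding \<nu>_def[abs_def]
    by (intro Ck_on_scaleR Ck_on_inverse Ck_on_sqrt opV' Ck_on_subset[OF Cq sub] Ck_on_subset[OF CN sub]) auto
  then have sm: "smooth_on ?V' \<nu>" by (simp add: smooth_on_def)
  have G: "lor (?G X) v = frechet_derivative f (at X) v" if "X \<in> V" for X v
    using lor_gradient[OF smooth_on_has_derivative[OF f that]] .
  have NX: "lor (N X) X = 0" if "X \<in> hyp" for X
    unfolding N_def using hypD(1)[OF that] by simp
  have Nv: "lor (N X) v = frechet_derivative f (at X) v" if "X \<in> V" "lor v X = 0" for X v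
    unfolding N_def using G[OF that(1)] that(2) by (simp add: lor_sym[of X v])
  have qpos: "q X > 0" if X: "X \<in> hyp \<inter> V" for X
  proof -
    obtain v where v: "v \<in> hyp_tangent X" "frechet_derivative f (at X) v \<noteq> 0" using df[OF X] by blast
    then have "lor (N X) v \<noteq> 0" using Nv[of X v] X by (simp add: hyp_tangent_def)
    then have "N X \<noteq> 0" by auto
    then show ?thesis unfolding q_def using lor_pos_tangent[of X "N X"] NX X by blast
  qed
  show thesis
  proof (rule that[OF opV' _ sub sm])
    show "hyp \<inter> V \<subseteq> ?V'" using qpos by auto
    fix X assume X: "X \<in> hyp \<inter> V"
    show "lor (\<nu> X) X = 0" unfolding \<nu>_def using NX X by simp
    have "inverse (sqrt (q X)) * (inverse (sqrt (q X)) * q X) = 1"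
      using qpos[OF X] by (simp add: field_simps)
    then show "lor (\<nu> X) (\<nu> X) = 1" unfolding \<nu>_def by (simp add: q_def)
    have "frechet_derivative f (at X) v = sqrt (q X) * lor (\<nu> X) v" if "lor v X = 0" for v
      unfolding \<nu>_def using Nv[of X v] X that qpos[OF X] by simp
    moreover have "sqrt (q X) > 0" using qpos[OF X] by simp
    ultimately show "\<exists>c>0. \<forall>v. lor v X = 0 \<longrightarrow> frechet_derivative f (at X) v = c * lor (\<nu> X) v" by blast
  qed
qed

text \<open>The range of \<open>A\<close>, the normal \<open>n\<close> and the point
  \<open>p\<close> are mutually orthogonal, and their dimensions add up to that of Minkowski
  space.\<close>

lemma tangent_decomposition:
  fixes A :: "real^'n \<Rightarrow> ('n::finite) minkowski"
  assumes "linear A" and pos: "\<And>x. x \<noteq> 0 \<Longrightarrow> 0 < lor (A x) (A x)" and p: "lor p p = -1"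
    and Ap: "\<And>x. lor (A x) p = 0" and n: "lor n p = 0" "lor n n = 1" "\<And>x. lor n (A x) = 0"
    and v: "lor v p = 0"
  obtains x where "v = A x + lor v n *\<^sub>R n"
proof -
  let ?L = "\<lambda>(x, s, t). A x + s *\<^sub>R n + t *\<^sub>R p"
  have lin: "linear ?L"
    using assms(1) by (intro linearI) (auto simp: linear_add linear_scale algebra_simps)
  have Lp: "lor (A x + s *\<^sub>R n + t *\<^sub>R p) p = - t" for x s t using p Ap n by simp
  have Ln: "lor (A x + s *\<^sub>R n + t *\<^sub>R p) n = s" for x s t
    using n by (simp add: lor_sym[of "A x" n] lor_sym[of p n])
  have "inj ?L"
  proof (rule linear_injective_0[OF lin, THEN iffD2], intro allI impI)
    fix z assume z0: "?L z = 0"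
    obtain x s t where z: "z = (x, s, t)" by (cases z)
    have e: "A x + s *\<^sub>R n + t *\<^sub>R p = 0" using z0 z by simp
    have "t = 0" using Lp[of x s t] unfolding e by simp
    moreover have "s = 0" using Ln[of x s t] unfolding e by simp
    ultimately have "A x = 0" using e by simp
    then have "x = 0" using pos[of x] by auto
    then show "z = 0" using z \<open>t = 0\<close> \<open>s = 0\<close> by (simp add: zero_prod_def)
  qed
  then have "surj ?L" by (intro linear_injective_imp_surjective[OF lin]) auto
  then obtain z where z1: "v = ?L z" by (blast dest: surjD)
  obtain x s t where z: "z = (x, s, t)" by (cases z)
  have vz: "v = A x + s *\<^sub>R n + t *\<^sub>R p" using z1 z by simp
  have "t = 0" using Lp[of x s t] v vz by simp
  moreover have "lor v n = s" using Ln[of x s t] vz by simp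
  ultimately show thesis using that[of x] vz by simp
qed

text \<open>Two unit normals agree up to sign. Short geodesics along \<open>- n\<close> run inside
  \<open>\<Omega>\<close> and those along \<open>v\<close> outside, so \<open>v = - n\<close> is
  impossible.\<close>

lemma unit_normal_char:
  fixes \<Omega> :: "('n::finite) minkowski set"
  assumes lp: "local_param (hbd \<Omega>) U \<phi>" and u: "u \<in> U" and "hbd \<Omega> \<subseteq> hyp"
    and n: "lor n (\<phi> u) = 0" "lor n n = 1" "\<And>w. lor n (frechet_derivative \<phi> (at u) w) = 0"
    and inner: "\<exists>\<epsilon>>0. \<forall>t\<in>{0<..<\<epsilon>}. hyp_geodesic (\<phi> u) (- n) t \<in> \<Omega>"
    and v: "lor v (\<phi> u) = 0" "lor v v = 1" "\<And>w. lor v (frechet_derivative \<phi> (at u) w) = 0"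
    and outer: "\<exists>\<epsilon>>0. \<forall>t\<in>{0<..<\<epsilon>}. hyp_geodesic (\<phi> u) v t \<notin> \<Omega>"
  shows "v = n"
proof -
  note t = local_param_tangent[OF lp \<open>hbd \<Omega> \<subseteq> hyp\<close> u]
  obtain x where x: "v = frechet_derivative \<phi> (at u) x + lor v n *\<^sub>R n"
    using tangent_decomposition[OF local_paramD(7)[OF lp u] t(3) hypD(1)[OF t(2)] t(1) n v(1)] by blast
  let ?A = "frechet_derivative \<phi> (at u) x" and ?c = "lor v n"
  have "lor v ?A = lor ?A ?A + ?c * lor n ?A"
    by (subst x) simp
  then have "lor ?A ?A = 0" using v(3) n(3) by simp
  then have "x = 0" using t(3)[of x] by auto
  then have vc: "v = ?c *\<^sub>R n" using x linear_0[OF local_paramD(7)[OF lp u]] by simp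
  have "lor v v = ?c * (?c * lor n n)" by (subst (1 2) vc) simp
  then have "?c * ?c = 1" using v(2) n(2) by simp
  then have "?c = 1 \<or> ?c = -1" by (simp add: square_eq_1_iff)
  moreover have "?c \<noteq> -1"
  proof
    assume "?c = -1"
    then have "v = - n" using vc by simp
    obtain e1 where e1: "e1 > 0" "\<forall>t\<in>{0<..<e1}. hyp_geodesic (\<phi> u) (- n) t \<in> \<Omega>" using inner by blast
    obtain e2 where e2: "e2 > 0" "\<forall>t\<in>{0<..<e2}. hyp_geodesic (\<phi> u) v t \<notin> \<Omega>" using outer by blast
    have "min e1 e2 / 2 \<in> {0<..<e1}" "min e1 e2 / 2 \<in> {0<..<e2}" using e1(1) e2(1) by (auto simp: min_def)
    then show False using e1(2) e2(2) \<open>v = - n\<close> by blast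
  qed
  ultimately show ?thesis using vc by simp
qed

lemma outward_normal_eqI:
  fixes \<Omega> :: "('n::finite) minkowski set"
  assumes lp: "local_param (hbd \<Omega>) U \<phi>" and u: "u \<in> U" and M: "hbd \<Omega> \<subseteq> hyp"
    and n: "lor n (\<phi> u) = 0" "lor n n = 1" "\<And>w. lor n (frechet_derivative \<phi> (at u) w) = 0"
    and inner: "\<exists>\<epsilon>>0. \<forall>t\<in>{0<..<\<epsilon>}. hyp_geodesic (\<phi> u) (- n) t \<in> \<Omega>"
    and outer: "\<exists>\<epsilon>>0. \<forall>t\<in>{0<..<\<epsilon>}. hyp_geodesic (\<phi> u) n t \<notin> \<Omega>"
  shows "outward_normal \<Omega> (\<phi> u) = n"
  unfolding outward_normal_def
proof (rule the_equality)
  have ts: "tangent_space (hbd \<Omega>) (\<phi> u) = range (frechet_derivative \<phi> (at u))"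
    by (rule tangent_space_eq_range[OF lp u])
  show "n \<in> hyp_tangent (\<phi> u) \<and> lor n n = 1 \<and> (\<forall>v\<in>tangent_space (hbd \<Omega>) (\<phi> u). lor n v = 0) \<and>
      (\<exists>\<epsilon>>0. \<forall>t\<in>{0<..<\<epsilon>}. hyp_geodesic (\<phi> u) n t \<notin> \<Omega>)"
    using n outer unfolding ts by (auto simp: hyp_tangent_def)
  fix v assume "v \<in> hyp_tangent (\<phi> u) \<and> lor v v = 1 \<and> (\<forall>w\<in>tangent_space (hbd \<Omega>) (\<phi> u). lor v w = 0) \<and>
      (\<exists>\<epsilon>>0. \<forall>t\<in>{0<..<\<epsilon>}. hyp_geodesic (\<phi> u) v t \<notin> \<Omega>)"
  then have "lor v (\<phi> u) = 0" "lor v v = 1" "\<And>w. lor v (frechet_derivative \<phi> (at u) w) = 0"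
    "\<exists>\<epsilon>>0. \<forall>t\<in>{0<..<\<epsilon>}. hyp_geodesic (\<phi> u) v t \<notin> \<Omega>"
    unfolding ts by (auto simp: hyp_tangent_def)
  then show "v = n" by (rule unit_normal_char[OF lp u M n inner])
qed

text \<open>A chart bundled with a smooth formula \<open>n\<close> for the outward normal along it.
  The curvature theory is developed from this alone, so it applies to parallel bodies once their
  normals are identified.\<close>

definition normal_chart :: "('n::finite) minkowski set \<Rightarrow> (real^'n) set \<Rightarrow> (real^'n \<Rightarrow> 'n minkowski) \<Rightarrow>
    (real^'n \<Rightarrow> 'n minkowski) \<Rightarrow> bool" where
  "normal_chart \<Omega> U \<phi> n \<longleftrightarrow> hbd \<Omega> \<subseteq> hyp \<and> local_param (hbd \<Omega>) U \<phi> \<and> smooth_on U n \<and>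
     (\<forall>u\<in>U. outward_normal \<Omega> (\<phi> u) = n u \<and> lor (n u) (\<phi> u) = 0 \<and> lor (n u) (n u) = 1 \<and>
        (\<forall>w. lor (n u) (frechet_derivative \<phi> (at u) w) = 0))"

lemma normal_chartD:
  assumes "normal_chart \<Omega> U \<phi> n"
  shows "hbd \<Omega> \<subseteq> hyp" "local_param (hbd \<Omega>) U \<phi>" "smooth_on U n"
    "u \<in> U \<Longrightarrow> outward_normal \<Omega> (\<phi> u) = n u" "u \<in> U \<Longrightarrow> lor (n u) (\<phi> u) = 0" "u \<in> U \<Longrightarrow> lor (n u) (n u) = 1"
    "u \<in> U \<Longrightarrow> lor (n u) (frechet_derivative \<phi> (at u) w) = 0"
  using assms unfolding normal_chart_def by auto

lemma lor_has_derivative: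
  assumes "(f has_derivative f') (at x)" "(g has_derivative g') (at x)"
  shows "((\<lambda>x. lor (f x) (g x)) has_derivative (\<lambda>h. lor (f x) (g' h) + lor (f' h) (g x))) (at x)"
  by (rule bounded_bilinear.FDERIV[OF bounded_bilinear_lor assms])

lemma constant_on_open_derivative:
  assumes "(f has_derivative D) (at x)" "open U" "x \<in> U" "\<And>y. y \<in> U \<Longrightarrow> f y = c"
  shows "D h = 0"
proof -
  have "(f has_derivative (\<lambda>h. 0)) (at x)"
    by (rule has_derivative_transform_within_open[OF has_derivative_const assms(2,3)]) (simp add: assms(4))
  then show ?thesis using has_derivative_unique[OF assms(1)] by metis
qed

text \<open>Everything comes from differentiating constants. The equations
  \<open>lor n \<phi> = 0\<close> and \<open>lor n n = 1\<close> make the derivative of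
  \<open>n\<close> tangent to the boundary, so that \<open>hyp_proj\<close> leaves it unchanged;
  orthogonality of \<open>n\<close> to the derivative of \<open>\<phi>\<close> expresses the second
  fundamental form by second derivatives of \<open>\<phi>\<close>, which are symmetric.\<close>

lemma normal_chart_shape:
  fixes \<Omega> :: "('n::finite) minkowski set"
  assumes nc: "normal_chart \<Omega> U \<phi> n" and u: "u \<in> U"
  defines "A \<equiv> frechet_derivative \<phi> (at u)" and "D \<equiv> frechet_derivative n (at u)"
  shows "linear A" "linear D" "(\<phi> has_derivative A) (at u)" "(n has_derivative D) (at u)" "inj A"
    "\<And>x. x \<noteq> 0 \<Longrightarrow> 0 < lor (A x) (A x)" "range D \<subseteq> range A" "\<And>x y. lor (D x) (A y) = lor (A x) (D y)"
    "\<And>x. shape_operator \<Omega> (\<phi> u) (A x) = D x" "tangent_space (hbd \<Omega>) (\<phi> u) = range A"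
proof -
  note ncD = normal_chartD[OF nc]
  note lpD = local_paramD[OF ncD(2)]
  note t = local_param_tangent[OF ncD(2,1) u]
  show dA: "(\<phi> has_derivative A) (at u)" unfolding A_def using lpD(6)[OF u] .
  show dD: "(n has_derivative D) (at u)" unfolding D_def using smooth_on_has_derivative[OF ncD(3) u] .
  show lA: "linear A" and lD: "linear D" using dA dD has_derivative_linear by auto
  show "inj A" unfolding A_def using lpD(5)[OF u] .
  show pos: "0 < lor (A x) (A x)" if "x \<noteq> 0" for x unfolding A_def using t(3)[OF that] .
  have nA: "lor (n u) (A x) = 0" for x unfolding A_def using ncD(7)[OF u] .
  have Dp: "lor (D x) (\<phi> u) = 0" for x
    using constant_on_open_derivative[OF lor_has_derivative[OF dD dA] lpD(1) u, of 0 x] ncD(5) nA by simp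
  have Dn: "lor (D x) (n u) = 0" for x
    using constant_on_open_derivative[OF lor_has_derivative[OF dD dD] lpD(1) u, of 1 x] ncD(6)
    by (simp add: lor_sym[of "n u" "D x"])
  show "range D \<subseteq> range A"
  proof (rule image_subsetI)
    fix x
    obtain y where "D x = A y + lor (D x) (n u) *\<^sub>R n u"
      using tangent_decomposition[OF lA pos hypD(1)[OF t(2)] _ ncD(5)[OF u] ncD(6)[OF u] nA Dp]
        t(1) unfolding A_def by blast
    then show "D x \<in> range A" using Dn by simp
  qed
  have dA2: "((\<lambda>w. frechet_derivative \<phi> (at w) y) has_derivative
      frechet_derivative (\<lambda>w. frechet_derivative \<phi> (at w) y) (at u)) (at u)" for y
    using smooth_on_has_derivative[OF smooth_on_deriv[OF lpD(2)] u] .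
  have DA: "lor (D x) (A y) = - lor (n u) (frechet_derivative (\<lambda>w. frechet_derivative \<phi> (at w) y) (at u) x)" for x y
    using constant_on_open_derivative[OF lor_has_derivative[OF dD dA2[of y]] lpD(1) u, of 0 x] ncD(7)
    unfolding A_def by simp
  show "lor (D x) (A y) = lor (A x) (D y)" for x y
    using DA[of x y] DA[of y x] smooth_on_second_derivative_symmetric[OF lpD(1) u lpD(2), of y x]
    by (simp add: lor_sym[of "A x" "D y"])
  have "((\<lambda>w. outward_normal \<Omega> (\<phi> w)) has_derivative D) (at u)"
    by (rule has_derivative_transform_within_open[OF dD lpD(1) u]) (simp add: ncD(4))
  from derivative_along_hypersurface(2)[OF ncD(2) u this]
  show "shape_operator \<Omega> (\<phi> u) (A x) = D x" for x
    unfolding shape_operator_def hyp_proj_def A_def using Dp by simp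
  show "tangent_space (hbd \<Omega>) (\<phi> u) = range A"
    unfolding A_def by (rule tangent_space_eq_range[OF ncD(2) u])
qed

text \<open>The spectral theorem shows that the \<open>SOME\<close> in
  \<open>principal_curvatures\<close> has a witness, so the chosen value does come with an
  orthonormal eigenbasis.\<close>

lemma principal_curvatures_eigenbasis:
  fixes \<Omega> :: "('n::finite) minkowski set"
  assumes nc: "normal_chart \<Omega> U \<phi> n" and u: "u \<in> U"
  obtains a :: "'n \<Rightarrow> real^'n"
  where "\<And>i j. lor (frechet_derivative \<phi> (at u) (a i)) (frechet_derivative \<phi> (at u) (a j)) = (if i = j then 1 else 0)"
    "\<And>i. frechet_derivative n (at u) (a i) =
       principal_curvatures \<Omega> (\<phi> u) $ i *\<^sub>R frechet_derivative \<phi> (at u) (a i)"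
proof -
  let ?A = "frechet_derivative \<phi> (at u)" and ?D = "frechet_derivative n (at u)"
  note sh = normal_chart_shape[OF nc u]
  define Q where "Q \<kappa> e \<longleftrightarrow> (\<forall>i. e i \<in> tangent_space (hbd \<Omega>) (\<phi> u)) \<and>
        (\<forall>i j. lor (e i) (e j) = (if i = j then 1 else 0)) \<and>
        (\<forall>i. shape_operator \<Omega> (\<phi> u) (e i) = (\<kappa> $ i) *\<^sub>R e i)" for \<kappa> :: "real^'n" and e :: "'n \<Rightarrow> 'n minkowski"
  obtain a0 :: "'n \<Rightarrow> real^'n" and \<kappa>0 where a0: "\<And>i j. lor (?A (a0 i)) (?A (a0 j)) = (if i = j then 1 else 0)"
    "\<And>i. ?D (a0 i) = \<kappa>0 i *\<^sub>R ?A (a0 i)"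
    using lor_self_adjoint_eigenbasis[OF sh(1,6,2,7,8)] by blast
  have "Q (\<chi> i. \<kappa>0 i) (\<lambda>i. ?A (a0 i))"
    unfolding Q_def using a0 by (simp add: sh(9) sh(10))
  then have "\<exists>\<kappa> e. Q \<kappa> e" by blast
  then have "\<exists>e. Q (SOME \<kappa>. \<exists>e. Q \<kappa> e) e" by (rule someI_ex)
  moreover have "(SOME \<kappa>. \<exists>e. Q \<kappa> e) = principal_curvatures \<Omega> (\<phi> u)"
    unfolding principal_curvatures_def Q_def ..
  ultimately obtain e where e: "Q (principal_curvatures \<Omega> (\<phi> u)) e" by auto
  then have "\<forall>i. \<exists>x. e i = ?A x" unfolding Q_def sh(10) by blast
  from choice[OF this] obtain a where a: "\<forall>i. e i = ?A (a i)" by blast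
  show thesis
    using that[of a] e a unfolding Q_def by (simp add: sh(9))
qed

lemma prod_principal_curvatures:
  fixes \<Omega> :: "('n::finite) minkowski set" and a :: "'n \<Rightarrow> real^'n"
  assumes nc: "normal_chart \<Omega> U \<phi> n" and u: "u \<in> U"
    and a: "\<And>i j. lor (frechet_derivative \<phi> (at u) (a i)) (frechet_derivative \<phi> (at u) (a j)) = (if i = j then 1 else 0)"
      "\<And>i. frechet_derivative n (at u) (a i) = \<kappa> i *\<^sub>R frechet_derivative \<phi> (at u) (a i)"
  shows "(\<Prod>i\<in>UNIV. c + s * principal_curvatures \<Omega> (\<phi> u) $ i) = (\<Prod>i\<in>UNIV. c + s * \<kappa> i)"
proof -
  note sh = normal_chart_shape[OF nc u]
  obtain b :: "'n \<Rightarrow> real^'n" where b: "\<And>i j. lor (frechet_derivative \<phi> (at u) (b i)) (frechet_derivative \<phi> (at u) (b j)) = (if i = j then 1 else 0)"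
    "\<And>i. frechet_derivative n (at u) (b i) =
       principal_curvatures \<Omega> (\<phi> u) $ i *\<^sub>R frechet_derivative \<phi> (at u) (b i)"
    using principal_curvatures_eigenbasis[OF nc u] by blast
  show ?thesis by (rule prod_eigenvalues_unique[OF sh(1,2) b(1) a(1) b(2) a(2) sh(5)])
qed

text \<open>The time component is never 0 along the curve. Were it negative, \<open>- ?Y\<close>
  would lie in \<open>hyp\<close> with \<open>lor (- ?Y) p = cosh t\<close>, against
  \<open>lor_hyp_le\<close>.\<close>

lemma hyp_geodesic_in_hyp:
  assumes "p \<in> hyp" "lor v p = 0" "lor v v = 1"
  shows "hyp_geodesic p v t \<in> hyp"
proof -
  let ?Y = "hyp_geodesic p v t"
  have 1: "lor ?Y ?Y = -1"
    using hypD(1)[OF assms(1)] assms(2,3) cosh_square_eq[of t]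
    by (simp add: hyp_geodesic_def lor_sym[of p v] power2_eq_square)
  have 2: "lor ?Y p = - cosh t" using hypD(1)[OF assms(1)] assms(2) by (simp add: hyp_geodesic_def)
  have "snd ?Y \<noteq> 0"
  proof
    assume "snd ?Y = 0"
    then have "lor ?Y ?Y \<ge> 0" by (simp add: lor_def)
    with 1 show False by simp
  qed
  moreover have "\<not> snd ?Y < 0"
  proof
    assume "snd ?Y < 0"
    then have "- ?Y \<in> hyp" using 1 by (simp add: hyp_def)
    from lor_hyp_le(1)[OF this assms(1)] show False using 2 cosh_real_ge_1[of t] by simp
  qed
  ultimately show ?thesis using 1 by (simp add: hyp_def)
qed

lemma hyp_geodesic_has_derivative:
  "((\<lambda>t. hyp_geodesic p v t) has_derivative (\<lambda>h. h *\<^sub>R (sinh t *\<^sub>R p + cosh t *\<^sub>R v))) (at t)"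
  unfolding hyp_geodesic_def by (auto intro!: derivative_eq_intros simp: algebra_simps)

lemma DERIV_along_geodesic:
  fixes f :: "('n::finite) minkowski \<Rightarrow> real"
  assumes "(f has_derivative D) (at (hyp_geodesic p v t))"
  shows "((\<lambda>t. f (hyp_geodesic p v t)) has_real_derivative D (sinh t *\<^sub>R p + cosh t *\<^sub>R v)) (at t)"
proof -
  have "linear D" using assms has_derivative_linear by blast
  then show ?thesis
    using has_derivative_compose[OF hyp_geodesic_has_derivative assms]
    unfolding has_field_derivative_def by (auto simp: linear_scale mult.commute elim!: has_derivative_eq_rhs)
qed

lemma hyp_geodesic_eventually:
  assumes "open V" "p \<in> V"
  obtains \<epsilon> where "\<epsilon> > 0" "\<And>t. \<bar>t\<bar> < \<epsilon> \<Longrightarrow> hyp_geodesic p v t \<in> V"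
proof -
  have "isCont (\<lambda>t. hyp_geodesic p v t) 0"
    using has_derivative_continuous[OF hyp_geodesic_has_derivative] .
  moreover have "hyp_geodesic p v 0 = p" by (simp add: hyp_geodesic_def)
  ultimately have "((\<lambda>t. hyp_geodesic p v t) \<longlongrightarrow> p) (at 0)" by (simp add: isCont_def)
  from topological_tendstoD[OF this assms]
  obtain d where d: "d > 0" "\<And>t. t \<noteq> 0 \<Longrightarrow> dist t 0 < d \<Longrightarrow> hyp_geodesic p v t \<in> V"
    unfolding eventually_at by blast
  then have "hyp_geodesic p v t \<in> V" if "\<bar>t\<bar> < d" for t
    using that assms(2) \<open>hyp_geodesic p v 0 = p\<close> by (cases "t = 0") auto
  then show thesis using that d(1) by blast
qed

text \<open>The normalized tangential gradient of the defining function is the outward normal: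
  \<open>f\<close> increases along it to first order, so short geodesics along it leave
  \<open>\<Omega>\<close> and those in the opposite direction enter it. The ambient field
  \<open>\<nu>\<close> and its relation to \<open>f\<close> are kept for the convexity
  argument.\<close>

lemma boundary_normal_chart:
  fixes \<Omega> :: "('n::finite) minkowski set"
  assumes \<Omega>: "smooth_bounded_domain \<Omega>" and p: "p \<in> hbd \<Omega>"
  obtains V V' U \<phi> \<nu> and f :: "'n minkowski \<Rightarrow> real"
  where "open V" "p \<in> V" "smooth_on V f" "\<And>X. X \<in> hyp \<inter> V \<Longrightarrow> X \<in> \<Omega> \<longleftrightarrow> f X \<le> 0"
    "\<And>X. X \<in> hyp \<inter> V \<Longrightarrow> X \<in> hbd \<Omega> \<longleftrightarrow> f X = 0"
    "open V'" "hyp \<inter> V \<subseteq> V'" "V' \<subseteq> V" "smooth_on V' \<nu>"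
    "\<And>X. X \<in> hyp \<inter> V \<Longrightarrow> lor (\<nu> X) X = 0"
    "\<And>X. X \<in> hyp \<inter> V \<Longrightarrow> \<exists>c>0. \<forall>v. lor v X = 0 \<longrightarrow> frechet_derivative f (at X) v = c * lor (\<nu> X) v"
    "normal_chart \<Omega> U \<phi> (\<lambda>u. \<nu> (\<phi> u))" "p \<in> \<phi> ` U" "\<phi> ` U \<subseteq> V"
    "\<And>u. u \<in> U \<Longrightarrow> \<exists>\<epsilon>>0. \<forall>t\<in>{0<..<\<epsilon>}. hyp_geodesic (\<phi> u) (- \<nu> (\<phi> u)) t \<in> \<Omega>"
proof -
  note dom = smooth_bounded_domainD[OF \<Omega>]
  have M: "hbd \<Omega> \<subseteq> hyp" using hbd_iff[OF dom(1,4)] dom(1) by blast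
  obtain V U \<phi> and f :: "'n minkowski \<Rightarrow> real" where V: "open V" "p \<in> V" and f: "smooth_on V f"
    and lev: "\<And>X. X \<in> hyp \<inter> V \<Longrightarrow> X \<in> \<Omega> \<longleftrightarrow> f X \<le> 0"
    and bd: "\<And>X. X \<in> hyp \<inter> V \<Longrightarrow> X \<in> hbd \<Omega> \<longleftrightarrow> f X = 0"
    and df: "\<And>X. X \<in> hyp \<inter> V \<Longrightarrow> \<exists>v\<in>hyp_tangent X. frechet_derivative f (at X) v \<noteq> 0"
    and lp: "local_param (hbd \<Omega>) U \<phi>" and p\<phi>: "p \<in> \<phi> ` U" and sub: "\<phi> ` U \<subseteq> V"
    by (rule boundary_chart[OF \<Omega> p open_UNIV UNIV_I]) (rule that)
  obtain V' \<nu> where V': "open V'" "hyp \<inter> V \<subseteq> V'" "V' \<subseteq> V" and \<nu>: "smooth_on V' \<nu>"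
    and \<nu>p: "\<And>X. X \<in> hyp \<inter> V \<Longrightarrow> lor (\<nu> X) X = 0" and \<nu>1: "\<And>X. X \<in> hyp \<inter> V \<Longrightarrow> lor (\<nu> X) (\<nu> X) = 1"
    and \<nu>f: "\<And>X. X \<in> hyp \<inter> V \<Longrightarrow> \<exists>c>0. \<forall>v. lor v X = 0 \<longrightarrow> frechet_derivative f (at X) v = c * lor (\<nu> X) v"
    by (rule unit_normal_field[OF V(1) f df]) (assumption, rule that)
  note lpD = local_paramD[OF lp]
  have \<phi>V: "\<phi> u \<in> hyp \<inter> V" "\<phi> u \<in> hbd \<Omega>" if "u \<in> U" for u using that sub lpD(3) M by auto
  have sgn: "(\<exists>\<epsilon>>0. \<forall>t\<in>{0<..<\<epsilon>}. hyp_geodesic (\<phi> u) (\<nu> (\<phi> u)) t \<notin> \<Omega>) \<and>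
     (\<exists>\<epsilon>>0. \<forall>t\<in>{0<..<\<epsilon>}. hyp_geodesic (\<phi> u) (- \<nu> (\<phi> u)) t \<in> \<Omega>)" if u: "u \<in> U" for u
  proof -
    let ?q = "\<phi> u" and ?n = "\<nu> (\<phi> u)"
    note q = \<phi>V[OF u]
    have q': "?q \<in> hyp" "?q \<in> V" using q by auto
    have f0: "f ?q = 0" using bd[OF q(1)] q(2) by blast
    obtain c where c: "c > 0" "\<And>v. lor v ?q = 0 \<Longrightarrow> frechet_derivative f (at ?q) v = c * lor ?n v"
      using \<nu>f[OF q(1)] by blast
    have g0: "hyp_geodesic ?q v 0 = ?q" for v by (simp add: hyp_geodesic_def)
    have d: "((\<lambda>t. f (hyp_geodesic ?q v t)) has_real_derivative frechet_derivative f (at ?q) v) (at 0)" for v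
      using DERIV_along_geodesic[of f _ ?q v 0] smooth_on_has_derivative[OF f q'(2)] by (simp add: g0)
    have dn: "frechet_derivative f (at ?q) ?n = c" "frechet_derivative f (at ?q) (- ?n) = - c"
      using c(2)[of ?n] c(2)[of "- ?n"] \<nu>p[OF q(1)] \<nu>1[OF q(1)] by auto
    obtain d1 where d1: "d1 > 0" "\<And>h. h > 0 \<Longrightarrow> h < d1 \<Longrightarrow> f (hyp_geodesic ?q ?n 0) < f (hyp_geodesic ?q ?n (0 + h))"
      using DERIV_pos_inc_right[OF d[of ?n]] dn c(1) by auto
    obtain d2 where d2: "d2 > 0" "\<And>h. h > 0 \<Longrightarrow> h < d2 \<Longrightarrow> f (hyp_geodesic ?q (- ?n) (0 + h)) < f (hyp_geodesic ?q (- ?n) 0)"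
      using DERIV_neg_dec_right[OF d[of "- ?n"]] dn c(1) by auto
    obtain e1 where e1: "e1 > 0" "\<And>t. \<bar>t\<bar> < e1 \<Longrightarrow> hyp_geodesic ?q ?n t \<in> V"
      using hyp_geodesic_eventually[OF V(1) q'(2)] by blast
    obtain e2 where e2: "e2 > 0" "\<And>t. \<bar>t\<bar> < e2 \<Longrightarrow> hyp_geodesic ?q (- ?n) t \<in> V"
      using hyp_geodesic_eventually[OF V(1) q'(2)] by blast
    have h1: "hyp_geodesic ?q ?n t \<in> hyp" "hyp_geodesic ?q (- ?n) t \<in> hyp" for t
      using hyp_geodesic_in_hyp[OF q'(1)] \<nu>p[OF q(1)] \<nu>1[OF q(1)] by auto
    have "hyp_geodesic ?q ?n t \<notin> \<Omega>" if "t \<in> {0<..<min d1 e1}" for t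
    proof -
      have "hyp_geodesic ?q ?n t \<in> hyp \<inter> V" using e1(2)[of t] h1(1) that by auto
      moreover have "f (hyp_geodesic ?q ?n t) > 0" using d1(2)[of t] that f0 g0 by simp
      ultimately show ?thesis using lev by fastforce
    qed
    moreover have "hyp_geodesic ?q (- ?n) t \<in> \<Omega>" if "t \<in> {0<..<min d2 e2}" for t
    proof -
      have "hyp_geodesic ?q (- ?n) t \<in> hyp \<inter> V" using e2(2)[of t] h1(2) that by auto
      moreover have "f (hyp_geodesic ?q (- ?n) t) < 0" using d2(2)[of t] that f0 g0 by simp
      ultimately show ?thesis using lev by fastforce
    qed
    ultimately show ?thesis
      using d1(1) d2(1) e1(1) e2(1) by (intro conjI exI[of _ "min d1 e1"] exI[of _ "min d2 e2"]) auto
  qed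
  have tan: "lor (\<nu> (\<phi> u)) (frechet_derivative \<phi> (at u) w) = 0" if u: "u \<in> U" for u w
  proof -
    have q: "\<phi> u \<in> hyp \<inter> V" using \<phi>V[OF u] by blast
    obtain c where c: "c > 0" "\<And>v. lor v (\<phi> u) = 0 \<Longrightarrow> frechet_derivative f (at (\<phi> u)) v = c * lor (\<nu> (\<phi> u)) v"
      using \<nu>f[OF q] by blast
    have "((\<lambda>u. f (\<phi> u)) has_derivative (\<lambda>w. frechet_derivative f (at (\<phi> u)) (frechet_derivative \<phi> (at u) w))) (at u)"
      using has_derivative_compose[OF lpD(6)[OF u]] smooth_on_has_derivative[OF f] q by blast
    from constant_on_open_derivative[OF this lpD(1) u, of 0 w]
    have "frechet_derivative f (at (\<phi> u)) (frechet_derivative \<phi> (at u) w) = 0" using bd \<phi>V by blast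
    then show ?thesis using c(1) c(2)[OF local_param_tangent(1)[OF lp M u]] by simp
  qed
  have "normal_chart \<Omega> U \<phi> (\<lambda>u. \<nu> (\<phi> u))"
    unfolding normal_chart_def
  proof (intro conjI ballI allI M lp)
    show "smooth_on U (\<lambda>u. \<nu> (\<phi> u))"
      by (rule smooth_on_compose[OF lpD(1) V'(1) _ \<nu> lpD(2)]) (use \<phi>V V'(2) in blast)
    fix u assume u: "u \<in> U"
    show "lor (\<nu> (\<phi> u)) (\<phi> u) = 0" "lor (\<nu> (\<phi> u)) (\<nu> (\<phi> u)) = 1" using \<nu>p \<nu>1 \<phi>V[OF u] by auto
    show "lor (\<nu> (\<phi> u)) (frechet_derivative \<phi> (at u) w) = 0" for w using tan[OF u] .
    show "outward_normal \<Omega> (\<phi> u) = \<nu> (\<phi> u)"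
      using sgn[OF u] \<nu>p \<nu>1 \<phi>V[OF u] by (intro outward_normal_eqI[OF lp u M _ _ tan[OF u]]) auto
  qed
  then show thesis
    using sgn by (intro that[OF V f lev bd V' \<nu> \<nu>p \<nu>f _ p\<phi> sub]) auto
qed

section \<open>Convexity\<close>

text \<open>A geodesic inside \<open>\<Omega>\<close> cannot touch the boundary: along it a defining function would be strictly
  increasing after the point of tangency because the second fundamental form is positive.\<close>

lemma geodesic_not_tangent_from_inside:
  fixes \<Omega> :: "('n::finite) minkowski set"
  assumes \<Omega>: "smooth_bounded_domain \<Omega>" and hc: "uniformly_h_convex \<Omega>" and p: "p \<in> hbd \<Omega>"
    and v: "lor v p = 0" "lor v v = 1" and "\<epsilon> > 0"
    and inside: "\<And>t. \<bar>t\<bar> < \<epsilon> \<Longrightarrow> hyp_geodesic p v t \<in> \<Omega>"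
  shows False
proof -
  obtain V V' U \<phi> \<nu> and f :: "'n minkowski \<Rightarrow> real"
    where V: "open V" "p \<in> V" and f: "smooth_on V f" and lev: "\<And>X. X \<in> hyp \<inter> V \<Longrightarrow> X \<in> \<Omega> \<longleftrightarrow> f X \<le> 0"
    and bd: "\<And>X. X \<in> hyp \<inter> V \<Longrightarrow> X \<in> hbd \<Omega> \<longleftrightarrow> f X = 0"
    and V': "open V'" "hyp \<inter> V \<subseteq> V'" "V' \<subseteq> V" and \<nu>: "smooth_on V' \<nu>"
    and \<nu>p: "\<And>X. X \<in> hyp \<inter> V \<Longrightarrow> lor (\<nu> X) X = 0"
    and \<nu>f: "\<And>X. X \<in> hyp \<inter> V \<Longrightarrow> \<exists>c>0. \<forall>v. lor v X = 0 \<longrightarrow> frechet_derivative f (at X) v = c * lor (\<nu> X) v"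
    and nc: "normal_chart \<Omega> U \<phi> (\<lambda>u. \<nu> (\<phi> u))" and p\<phi>: "p \<in> \<phi> ` U"
    by (rule boundary_normal_chart[OF \<Omega> p]) (rule that)
  note ncD = normal_chartD[OF nc]
  have ph: "p \<in> hyp" using p ncD(1) by blast
  have pV: "p \<in> hyp \<inter> V" using ph V by blast
  have pV': "p \<in> V'" using V'(2) pV by blast
  obtain u where u: "u \<in> U" "p = \<phi> u" using p\<phi> by blast
  note sh = normal_chart_shape[OF nc u(1)]
  let ?c = "hyp_geodesic p v" and ?c' = "\<lambda>t. sinh t *\<^sub>R p + cosh t *\<^sub>R v"
  have c0: "?c 0 = p" "?c' 0 = v" by (auto simp: hyp_geodesic_def)
  have ch: "?c t \<in> hyp" for t by (rule hyp_geodesic_in_hyp[OF ph v])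
  have c'c: "lor (?c' t) (?c t) = 0" for t
    using hypD(1)[OF ph] v by (simp add: hyp_geodesic_def lor_sym[of p v])
  have f0: "f p = 0" using bd[OF pV] p by blast
  obtain e where e: "e > 0" "\<And>t. \<bar>t\<bar> < e \<Longrightarrow> ?c t \<in> V" using hyp_geodesic_eventually[OF V] by blast
  define d where "d = min e \<epsilon>"
  have d: "d > 0" "\<And>t. \<bar>t\<bar> < d \<Longrightarrow> ?c t \<in> hyp \<inter> V" "\<And>t. \<bar>t\<bar> < d \<Longrightarrow> f (?c t) \<le> 0"
  proof -
    show "d > 0" using e(1) \<open>\<epsilon> > 0\<close> by (simp add: d_def)
    show 1: "?c t \<in> hyp \<inter> V" if "\<bar>t\<bar> < d" for t using e(2)[of t] ch[of t] that by (simp add: d_def)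
    show "f (?c t) \<le> 0" if "\<bar>t\<bar> < d" for t using lev[OF 1[OF that]] inside[of t] that by (simp add: d_def)
  qed
  have df: "((\<lambda>t. f (?c t)) has_real_derivative frechet_derivative f (at (?c t)) (?c' t)) (at t)" if "\<bar>t\<bar> < d" for t
    using DERIV_along_geodesic[OF smooth_on_has_derivative[OF f]] d(2)[OF that] by blast
  \<comment> \<open>Along the geodesic \<open>f\<close> is at most 0 and equals 0 at
    \<open>p\<close>, so it has a local maximum there; hence \<open>v\<close> is tangent to the
    boundary.\<close>
  have "frechet_derivative f (at p) v = 0"
    by (rule DERIV_local_max[of "\<lambda>t. f (?c t)" _ 0 d]) (use df[of 0] d c0 f0 in auto)
  moreover obtain k where k: "k > 0" "\<And>v. lor v p = 0 \<Longrightarrow> frechet_derivative f (at p) v = k * lor (\<nu> p) v"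
    using \<nu>f[OF pV] by blast
  ultimately have \<nu>v: "lor (\<nu> p) v = 0" using v(1) by simp
  obtain x where x: "v = frechet_derivative \<phi> (at u) x"
  proof -
    have "lor v (\<nu> (\<phi> u)) = 0" using \<nu>v u(2) by (simp add: lor_sym)
    moreover have "lor (frechet_derivative \<phi> (at u) x) p = 0" for x
      using local_param_tangent(1)[OF ncD(2,1) u(1)] u(2) by simp
    moreover have "lor (\<nu> (\<phi> u)) p = 0" using ncD(5)[OF u(1)] u(2) by simp
    moreover obtain x where "v = frechet_derivative \<phi> (at u) x + lor v (\<nu> (\<phi> u)) *\<^sub>R \<nu> (\<phi> u)"
      using tangent_decomposition[OF sh(1,6) hypD(1)[OF ph] calculation(2,3) ncD(6,7)[OF u(1)] v(1)] by blast
    ultimately show thesis using that by simp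
  qed
  let ?A = "frechet_derivative \<phi> (at u)" and ?D = "frechet_derivative (\<lambda>u. \<nu> (\<phi> u)) (at u)"
  have dD: "?D x = frechet_derivative \<nu> (at p) v"
  proof -
    have "((\<lambda>u. \<nu> (\<phi> u)) has_derivative (\<lambda>h. frechet_derivative \<nu> (at p) (?A h))) (at u)"
      by (rule has_derivative_compose[OF sh(3)]) (use smooth_on_has_derivative[OF \<nu> pV'] u(2) in simp)
    from fun_cong[OF frechet_derivative_eq[OF this], of x] show ?thesis unfolding x .
  qed
  \<comment> \<open>In an orthonormal eigenbasis the second fundamental form at a unit vector is a
    weighted mean of the curvatures, with weights \<open>(?y i)^2\<close>; it is at least 1 because
    the curvatures exceed 1.\<close>
  have pos: "lor (?D x) (?A x) > 0"
  proof -
    obtain a :: "'n \<Rightarrow> real^'n" where a: "\<And>i j. lor (?A (a i)) (?A (a j)) = (if i = j then 1 else 0)"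
      "\<And>i. ?D (a i) = principal_curvatures \<Omega> (\<phi> u) $ i *\<^sub>R ?A (a i)"
      using principal_curvatures_eigenbasis[OF nc u(1)] by blast
    let ?k = "\<lambda>i. principal_curvatures \<Omega> (\<phi> u) $ i" and ?y = "\<lambda>i. lor (?A x) (?A (a i))"
    have Ax: "?A x = (\<Sum>i\<in>UNIV. ?y i *\<^sub>R ?A (a i))" by (rule lor_orthonormal_expansion[OF sh(1) a(1)])
    then have "?A x = ?A (\<Sum>i\<in>UNIV. ?y i *\<^sub>R a i)" by (simp only: linear_sum[OF sh(1)] linear_scale[OF sh(1)])
    then have xa: "x = (\<Sum>i\<in>UNIV. ?y i *\<^sub>R a i)" by (rule injD[OF sh(5)])
    have "?D x = (\<Sum>i\<in>UNIV. ?y i *\<^sub>R ?D (a i))"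
      using arg_cong[OF xa, of ?D] by (simp only: linear_sum[OF sh(2)] linear_scale[OF sh(2)])
    then have "lor (?D x) (?A x) = (\<Sum>i\<in>UNIV. ?y i * (?k i * lor (?A (a i)) (?A x)))"
      by (simp only: a(2) lor_sum_left lor_simps)
    then have 1: "lor (?D x) (?A x) = (\<Sum>i\<in>UNIV. ?k i * (?y i)\<^sup>2)"
      by (simp add: lor_sym[of "?A (a _)" "?A x"] power2_eq_square mult_ac)
    have "lor (?A x) (?A x) = (\<Sum>i\<in>UNIV. ?y i * lor (?A (a i)) (?A x))"
      using arg_cong[OF Ax, of "\<lambda>z. lor z (?A x)"] by (simp only: lor_sum_left lor_simps)
    then have 2: "1 = (\<Sum>i\<in>UNIV. (?y i)\<^sup>2)"
      using v(2) x by (simp add: lor_sym[of "?A (a _)" "?A x"] power2_eq_square)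
    obtain \<delta> where \<delta>: "\<delta> > 0" "\<And>i. ?k i > 1 + \<delta>" using hc p u(2) unfolding uniformly_h_convex_def by blast
    have k1: "1 \<le> ?k i" for i using \<delta>(1) \<delta>(2)[of i] by linarith
    have "(\<Sum>i\<in>UNIV. 1 * (?y i)\<^sup>2) \<le> (\<Sum>i\<in>UNIV. ?k i * (?y i)\<^sup>2)"
      by (intro sum_mono mult_right_mono) (use k1 in auto)
    then show ?thesis using 1 2 by simp
  qed
  \<comment> \<open>\<open>?b\<close> is, up to a positive factor, the derivative of
    \<open>f\<close> along the geodesic. It vanishes at 0, and its derivative there is the second
    fundamental form, since the acceleration of the geodesic at 0 is \<open>p\<close>, orthogonal to
    the normal.\<close>
  let ?b = "\<lambda>t. lor (\<nu> (?c t)) (?c' t)"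
  have "((\<lambda>t. \<nu> (?c t)) has_derivative (\<lambda>h. frechet_derivative \<nu> (at p) (h *\<^sub>R (sinh 0 *\<^sub>R p + cosh 0 *\<^sub>R v)))) (at 0)"
    by (rule has_derivative_compose[OF hyp_geodesic_has_derivative]) (use smooth_on_has_derivative[OF \<nu> pV'] c0 in simp)
  moreover have "(?c' has_derivative (\<lambda>h. h *\<^sub>R p)) (at 0)"
    by (auto intro!: derivative_eq_intros)
  ultimately have "(?b has_derivative (\<lambda>h. lor (\<nu> (?c 0)) (h *\<^sub>R p) +
      lor (frechet_derivative \<nu> (at p) (h *\<^sub>R (sinh 0 *\<^sub>R p + cosh 0 *\<^sub>R v))) (?c' 0))) (at 0)"
    by (rule lor_has_derivative)
  moreover have "linear (frechet_derivative \<nu> (at p))"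
    using smooth_on_has_derivative[OF \<nu> pV'] has_derivative_linear by blast
  ultimately have "(?b has_derivative (\<lambda>h. h * lor (?D x) (?A x))) (at 0)"
    using \<nu>p[OF pV] c0 x dD by (simp add: linear_scale)
  then have "(?b has_real_derivative lor (?D x) (?A x)) (at 0)"
    unfolding has_field_derivative_def by (auto simp: mult.commute elim!: has_derivative_eq_rhs)
  from DERIV_pos_inc_right[OF this pos]
  obtain d' where d': "d' > 0" "\<And>h. h > 0 \<Longrightarrow> h < d' \<Longrightarrow> ?b 0 < ?b (0 + h)" by blast
  have b0: "?b 0 = 0" using \<nu>v c0 by simp
  define s where "s = min d d' / 2"
  have s: "0 < s" "s < d" "s < d'" using d(1) d'(1) by (auto simp: s_def min_def)
  have "?c 0 \<in> V" using c0 V by simp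
  have "f (?c 0) < f (?c s)"
  proof (rule DERIV_pos_imp_increasing_open[OF s(1)])
    fix t assume t: "0 < t" "t < s"
    then have td: "\<bar>t\<bar> < d" using s by simp
    obtain k where k: "k > 0" "\<And>v. lor v (?c t) = 0 \<Longrightarrow> frechet_derivative f (at (?c t)) v = k * lor (\<nu> (?c t)) v"
      using \<nu>f[OF d(2)[OF td]] by blast
    have "?b t > 0" using d'(2)[of t] t s b0 by simp
    then have "frechet_derivative f (at (?c t)) (?c' t) > 0" using k(1) k(2)[OF c'c[of t]] by simp
    then show "\<exists>y. ((\<lambda>t. f (?c t)) has_real_derivative y) (at t) \<and> 0 < y" using df[OF td] by blast
  next
    show "continuous_on {0..s} (\<lambda>t. f (?c t))"
    proof (intro continuous_at_imp_continuous_on ballI)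
      fix t assume "t \<in> {0..s}"
      then have "\<bar>t\<bar> < d" using s by auto
      from DERIV_isCont[OF df[OF this]] show "isCont (\<lambda>t. f (?c t)) t" .
    qed
  qed
  then show False using d(3)[of s] s f0 c0 by simp
qed

text \<open>Density is local at boundary points. For connectedness, the two parts of a splitting of
  the interior would have closures meeting in \<open>\<Omega>\<close>, necessarily at a boundary
  point; near it the interior is connected, like a half ball, yet meets both parts.\<close>

lemma domain_interior_facts:
  fixes \<Omega> :: "('n::finite) minkowski set"
  assumes \<Omega>: "smooth_bounded_domain \<Omega>"
  shows "\<Omega> \<subseteq> closure ((top_of_set hyp) interior_of \<Omega>)" "connected ((top_of_set hyp) interior_of \<Omega>)"
proof -
  let ?I = "(top_of_set hyp) interior_of \<Omega>"
  note dom = smooth_bounded_domainD[OF \<Omega>]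
  have loc: "\<exists>V. open V \<and> p \<in> V \<and> connected (V \<inter> ?I) \<and> p \<in> closure (V \<inter> ?I)" if p: "p \<in> hbd \<Omega>" for p
    by (rule boundary_chart[OF \<Omega> p open_UNIV UNIV_I]) blast
  have bd: "p \<in> hbd \<Omega>" if "p \<in> \<Omega>" "p \<notin> ?I" for p using hbd_iff[OF dom(1,4)] that by blast
  show cl: "\<Omega> \<subseteq> closure ?I"
  proof
    fix p assume p: "p \<in> \<Omega>"
    show "p \<in> closure ?I"
    proof (cases "p \<in> ?I")
      case True
      then show ?thesis using closure_subset by blast
    next
      case False
      then obtain V where "p \<in> closure (V \<inter> ?I)" using loc bd p by blast
      then show ?thesis using closure_mono[of "V \<inter> ?I" ?I] by blast
    qed
  qed
  have op: "openin (top_of_set hyp) ?I" by simp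
  have sub: "?I \<subseteq> \<Omega>" by (rule interior_of_subset)
  show "connected ?I"
  proof (rule ccontr)
    assume "\<not> connected ?I"
    then obtain A B where AB: "openin (top_of_set ?I) A" "openin (top_of_set ?I) B" "?I \<subseteq> A \<union> B" "A \<inter> B = {}" "A \<noteq> {}" "B \<noteq> {}"
      unfolding connected_openin by blast
    have AI: "A \<subseteq> ?I" "B \<subseteq> ?I" using openin_imp_subset[OF AB(1)] openin_imp_subset[OF AB(2)] by auto
    have "?I = A \<union> B" using AB(3) AI by blast
    then have "\<Omega> \<subseteq> closure A \<union> closure B" using cl by (simp add: closure_Un)
    moreover have "closure A \<inter> \<Omega> \<noteq> {}" "closure B \<inter> \<Omega> \<noteq> {}" using AB(5,6) AI sub closure_subset by blast+
    ultimately have "closure A \<inter> closure B \<inter> \<Omega> \<noteq> {}"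
      using dom(3) unfolding connected_closed by (metis closed_closure inf_commute)
    then obtain p where p: "p \<in> closure A" "p \<in> closure B" "p \<in> \<Omega>" by blast
    have AO: "\<exists>T. open T \<and> A = ?I \<inter> T" "\<exists>T. open T \<and> B = ?I \<inter> T" using AB(1,2) by (auto simp: openin_open)
    then obtain TA TB where T: "open TA" "A = ?I \<inter> TA" "open TB" "B = ?I \<inter> TB" by blast
    have pI: "p \<notin> ?I"
    proof
      assume "p \<in> ?I"
      then have "p \<in> A \<or> p \<in> B" using AB(3) by blast
      then show False
      proof
        assume "p \<in> A"
        then have "p \<in> TA" using T by blast
        then have "TA \<inter> B \<noteq> {}" using p(2) T(1) by (metis closure_iff_nhds_not_empty dual_order.refl inf_commute)
        then show False using AB(4) T AI(2) by blast
      next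
        assume "p \<in> B"
        then have "p \<in> TB" using T by blast
        then have "TB \<inter> A \<noteq> {}" using p(1) T(3) by (metis closure_iff_nhds_not_empty dual_order.refl inf_commute)
        then show False using AB(4) T AI(1) by blast
      qed
    qed
    obtain V where V: "open V" "p \<in> V" "connected (V \<inter> ?I)" using loc[OF bd[OF p(3) pI]] by blast
    have "V \<inter> A \<noteq> {}" "V \<inter> B \<noteq> {}"
      using p V(2) open_Int_closure_eq_empty[OF V(1), of A] open_Int_closure_eq_empty[OF V(1), of B] by blast+
    moreover have "V \<inter> ?I \<inter> A = V \<inter> A" "V \<inter> ?I \<inter> B = V \<inter> B" using AI by auto
    moreover have "TA \<inter> TB \<inter> (V \<inter> ?I) = {}" using AB(4) T by blast
    moreover have "V \<inter> ?I \<subseteq> TA \<union> TB" using AB(3) T by blast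
    ultimately show False
      using V(3) T unfolding connected_def by blast
  qed
qed

section \<open>Geodesic segments as central projections of chords\<close>

definition hyp_normalize :: "('n::finite) minkowski \<Rightarrow> 'n minkowski" where
  "hyp_normalize Z = Z /\<^sub>R sqrt (- lor Z Z)"

lemma lor_combination_neg:
  assumes "x \<in> hyp" "y \<in> hyp" "0 \<le> a" "0 \<le> b" "0 < a + b"
  shows "lor (a *\<^sub>R x + b *\<^sub>R y) (a *\<^sub>R x + b *\<^sub>R y) < 0"
proof -
  let ?c = "- lor x y"
  have "lor (a *\<^sub>R x + b *\<^sub>R y) (a *\<^sub>R x + b *\<^sub>R y) = - (a * a + b * b + 2 * (a * b * ?c))"
    using hypD(1)[OF assms(1)] hypD(1)[OF assms(2)] by (simp add: lor_sym[of y x] algebra_simps)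
  moreover have "a * b * 1 \<le> a * b * ?c"
    using lor_hyp_le(1)[OF assms(1,2)] assms(3,4) by (intro mult_left_mono) auto
  moreover have "0 < (a + b) * (a + b)" using assms(5) by simp
  ultimately show ?thesis by (simp add: algebra_simps)
qed

lemma hyp_normalize_combination:
  assumes "x \<in> hyp" "y \<in> hyp" "0 \<le> a" "0 \<le> b" "0 < a + b"
  shows "hyp_normalize (a *\<^sub>R x + b *\<^sub>R y) \<in> hyp"
proof -
  let ?Z = "a *\<^sub>R x + b *\<^sub>R y"
  have q: "- lor ?Z ?Z > 0" using lor_combination_neg[OF assms] by simp
  have "snd ?Z = a * snd x + b * snd y" by simp
  also have "\<dots> > 0"
    using assms(3-5) hypD(2)[OF assms(1)] hypD(2)[OF assms(2)]
    by (cases "a = 0") (auto intro: add_pos_nonneg)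
  finally have "snd ?Z > 0" .
  moreover have "inverse (sqrt q) * (inverse (sqrt q) * - q) = - 1" if "q > 0" for q :: real
    using that by (simp add: field_simps)
  from this[OF q] have "lor (hyp_normalize ?Z) (hyp_normalize ?Z) = -1"
    by (simp only: hyp_normalize_def lor_simps(5,6) minus_minus)
  moreover have "sqrt (- lor ?Z ?Z) > 0" using q by (simp only: real_sqrt_gt_0_iff)
  then have "inverse (sqrt (- lor ?Z ?Z)) * snd ?Z > 0"
    using \<open>snd ?Z > 0\<close> by (intro mult_pos_pos) (auto simp only: inverse_positive_iff_positive)
  ultimately show ?thesis unfolding hyp_def by (simp only: hyp_normalize_def mem_Collect_eq snd_scaleR real_scaleR_def)
qed

lemma hyp_normalize_hyp: "Z \<in> hyp \<Longrightarrow> hyp_normalize Z = Z"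
  by (simp add: hyp_normalize_def hypD)

lemma hyp_normalize_scale: "c > 0 \<Longrightarrow> hyp_normalize (c *\<^sub>R Z) = hyp_normalize Z"
proof -
  assume c: "c > 0"
  have "sqrt (- (c * (c * lor Z Z))) = c * sqrt (- lor Z Z)"
  proof -
    have "- (c * (c * lor Z Z)) = c\<^sup>2 * (- lor Z Z)" by (simp add: power2_eq_square)
    then show ?thesis unfolding real_sqrt_mult using c by (simp only: real_sqrt_mult) simp
  qed
  then show ?thesis using c by (simp add: hyp_normalize_def)
qed

lemma continuous_on_hyp_normalize:
  assumes "continuous_on S g" "\<And>x. x \<in> S \<Longrightarrow> lor (g x) (g x) < 0"
  shows "continuous_on S (\<lambda>x. hyp_normalize (g x))"
proof -
  have "continuous_on S (\<lambda>x. lor (g x) (g x))"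
    by (rule bounded_bilinear.continuous_on[OF bounded_bilinear_lor assms(1) assms(1)])
  moreover have "sqrt (- lor (g x) (g x)) \<noteq> 0" if "x \<in> S" for x
    using assms(2)[OF that] by simp
  ultimately show ?thesis
    unfolding hyp_normalize_def by (intro continuous_intros assms(1)) auto
qed

text \<open>The chord from \<open>x\<close> to \<open>y\<close>, projected from the origin to the
  hyperboloid; the parameter \<open>s\<close> is in general not proportional to arc length.\<close>

definition hyp_seg :: "('n::finite) minkowski \<Rightarrow> 'n minkowski \<Rightarrow> real \<Rightarrow> 'n minkowski" where
  "hyp_seg x y s = hyp_normalize ((1 - s) *\<^sub>R x + s *\<^sub>R y)"

lemma hyp_seg_in_hyp: "x \<in> hyp \<Longrightarrow> y \<in> hyp \<Longrightarrow> s \<in> {0..1} \<Longrightarrow> hyp_seg x y s \<in> hyp"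
  unfolding hyp_seg_def by (intro hyp_normalize_combination) auto

lemma continuous_on_hyp_seg:
  assumes "continuous_on S g" "continuous_on S h" "continuous_on S r"
    "\<And>z. z \<in> S \<Longrightarrow> g z \<in> hyp" "\<And>z. z \<in> S \<Longrightarrow> h z \<in> hyp" "\<And>z. z \<in> S \<Longrightarrow> r z \<in> {0..1}"
  shows "continuous_on S (\<lambda>z. hyp_seg (g z) (h z) (r z))"
  unfolding hyp_seg_def
proof (rule continuous_on_hyp_normalize)
  show "continuous_on S (\<lambda>z. (1 - r z) *\<^sub>R g z + r z *\<^sub>R h z)" by (intro continuous_intros assms)
  fix z assume "z \<in> S"
  then show "lor ((1 - r z) *\<^sub>R g z + r z *\<^sub>R h z) ((1 - r z) *\<^sub>R g z + r z *\<^sub>R h z) < 0"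
    using assms(4-6) by (intro lor_combination_neg) auto
qed

text \<open>Recognizes pieces of unit speed geodesics, written as combinations of two points, as
  parts of the segment between these points.\<close>

lemma hyp_combination_eq_seg:
  assumes "a *\<^sub>R x + b *\<^sub>R y \<in> hyp" "0 \<le> a" "0 \<le> b" "0 < a + b"
  shows "a *\<^sub>R x + b *\<^sub>R y = hyp_seg x y (b / (a + b))"
proof -
  have "1 - b / (a + b) = a / (a + b)" using assms(4) by (simp add: field_simps)
  then have eq: "(1 - b / (a + b)) *\<^sub>R x + (b / (a + b)) *\<^sub>R y = inverse (a + b) *\<^sub>R (a *\<^sub>R x + b *\<^sub>R y)"
    by (simp add: scaleR_add_right divide_inverse mult.commute)
  have "0 < inverse (a + b)" using assms(4) by simp
  from trans[OF hyp_normalize_scale[OF this] hyp_normalize_hyp[OF assms(1)]]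
  show ?thesis unfolding hyp_seg_def eq by (rule sym)
qed

text \<open>The direction is the tangential part of \<open>X\<close> at \<open>p\<close>,
  normalized; its length \<open>r\<close> is the hyperbolic sine of the distance. The last formula
  exhibits the geodesic as a combination of \<open>p\<close> and \<open>X\<close>, to be compared
  with segments.\<close>

lemma geodesic_towards:
  assumes "p \<in> hyp" "X \<in> hyp" "X \<noteq> p"
  obtains v r where "r > 0" "lor v p = 0" "lor v v = 1" "v = (X + lor X p *\<^sub>R p) /\<^sub>R r"
    "\<And>t. hyp_geodesic p v t = (cosh t + sinh t * lor X p / r) *\<^sub>R p + (sinh t / r) *\<^sub>R X"
proof -
  let ?w = "X + lor X p *\<^sub>R p"
  have wp: "lor ?w p = 0" using hypD(1)[OF assms(1)] by simp
  have ww: "lor ?w ?w = (lor X p)\<^sup>2 - 1"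
    using hypD(1)[OF assms(1)] hypD(1)[OF assms(2)] by (simp add: lor_sym[of p X] power2_eq_square)
  have "lor X p < -1"
    using lor_hyp_le(1)[OF assms(2,1)] lor_hyp_le(2)[OF assms(2,1)] assms(3) by fastforce
  then have "1 * 1 < (- lor X p) * (- lor X p)" by (intro mult_strict_mono) auto
  then have pos: "lor ?w ?w > 0" unfolding ww by (simp add: power2_eq_square)
  let ?r = "sqrt (lor ?w ?w)"
  have r: "?r > 0" using pos by (simp only: real_sqrt_gt_0_iff)
  have "inverse (sqrt q) * (inverse (sqrt q) * q) = 1" if "q > 0" for q :: real
    using that by (simp add: field_simps)
  from this[OF pos] have v1: "lor (?w /\<^sub>R ?r) (?w /\<^sub>R ?r) = 1" by (simp only: lor_simps(5,6))
  have vp: "lor (?w /\<^sub>R ?r) p = 0" using wp by (simp only: lor_simps(5) mult_zero_right)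
  have "hyp_geodesic p (?w /\<^sub>R r) t = (cosh t + sinh t * lor X p / r) *\<^sub>R p + (sinh t / r) *\<^sub>R X" for r t :: real
    unfolding hyp_geodesic_def by (simp add: algebra_simps divide_inverse)
  then show thesis using that[OF r vp v1 refl] by blast
qed

lemma geodesic_eventually_combination:
  assumes p: "p \<in> hyp" and X: "X \<in> hyp" "X \<noteq> p" and r: "r > (0::real)"
  obtains d where "d > 0" "\<And>t. \<bar>t\<bar> < d \<Longrightarrow> 0 < cosh t + sinh t * lor X p / r"
proof -
  have "((\<lambda>t. cosh t + sinh t * lor X p / r) \<longlongrightarrow> cosh 0 + sinh 0 * lor X p / r) (at 0)"
    using r by (intro tendsto_intros) auto
  from order_tendstoD(1)[OF this, of 0]
  obtain d where d: "d > 0" "\<And>t. t \<noteq> 0 \<Longrightarrow> dist t 0 < d \<Longrightarrow> 0 < cosh t + sinh t * lor X p / r"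
    unfolding eventually_at by auto
  then have "0 < cosh t + sinh t * lor X p / r" if "\<bar>t\<bar> < d" for t
    using that by (cases "t = 0") auto
  with d(1) that show thesis by blast
qed

text \<open>At a boundary point \<open>?z\<close> in the relative interior of the segment, the
  geodesic through \<open>?z\<close> stays on the segment for small times of both signs, hence in
  \<open>\<Omega>\<close>, which \<open>geodesic_not_tangent_from_inside\<close> excludes.\<close>

lemma segment_no_boundary_point:
  fixes \<Omega> :: "('n::finite) minkowski set"
  assumes \<Omega>: "smooth_bounded_domain \<Omega>" and hc: "uniformly_h_convex \<Omega>"
    and xy: "x \<in> (top_of_set hyp) interior_of \<Omega>" "y \<in> (top_of_set hyp) interior_of \<Omega>"
    and seg: "\<And>s. s \<in> {0..1} \<Longrightarrow> hyp_seg x y s \<in> \<Omega>" and s: "s \<in> {0..1}"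
  shows "hyp_seg x y s \<in> (top_of_set hyp) interior_of \<Omega>"
proof (rule ccontr)
  let ?I = "(top_of_set hyp) interior_of \<Omega>"
  note dom = smooth_bounded_domainD[OF \<Omega>]
  let ?z = "hyp_seg x y s" and ?Z = "(1 - s) *\<^sub>R x + s *\<^sub>R y"
  assume nI: "?z \<notin> ?I"
  have h: "x \<in> hyp" "y \<in> hyp" using xy interior_of_subset[of "top_of_set hyp" \<Omega>] dom(1) by auto
  have z: "?z \<in> hbd \<Omega>" using hbd_iff[OF dom(1,4)] seg[OF s] nI by blast
  have zh: "?z \<in> hyp" using hyp_seg_in_hyp[OF h s] .
  have "s \<noteq> 0" "s \<noteq> 1" using nI xy h by (auto simp: hyp_seg_def hyp_normalize_hyp)
  then have s01: "0 < s" "s < 1" using s by auto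
  have xz: "x \<noteq> ?z" using nI xy(1) by metis
  define \<zeta> where "\<zeta> = inverse (sqrt (- lor ?Z ?Z))"
  have "lor ?Z ?Z < 0" by (rule lor_combination_neg[OF h]) (use s01 in auto)
  then have \<zeta>: "\<zeta> > 0" unfolding \<zeta>_def
    by (simp only: inverse_positive_iff_positive real_sqrt_gt_0_iff neg_0_less_iff_less)
  have zZ: "?z = \<zeta> *\<^sub>R ?Z" unfolding hyp_seg_def hyp_normalize_def \<zeta>_def ..
  obtain v r where v: "r > 0" "lor v ?z = 0" "lor v v = 1"
    "\<And>t. hyp_geodesic ?z v t = (cosh t + sinh t * lor x ?z / r) *\<^sub>R ?z + (sinh t / r) *\<^sub>R x"
    using geodesic_towards[OF zh h(1) xz] by metis
  let ?k = "\<lambda>t. cosh t + sinh t * lor x ?z / r"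
  have gen: "K *\<^sub>R ?z = (K * (\<zeta> * (1 - s))) *\<^sub>R x + (K * (\<zeta> * s)) *\<^sub>R y" for K
    by (subst zZ) (simp add: scaleR_add_right)
  obtain d where d: "d > 0" "\<And>t. \<bar>t\<bar> < d \<Longrightarrow> 0 < ?k t"
    using geodesic_eventually_combination[OF zh h(1) xz v(1)] by blast
  \<comment> \<open>Coefficients of the geodesic with respect to \<open>x\<close> and
    \<open>y\<close>. At time 0 both are positive because \<open>s\<close> lies strictly between 0
    and 1, and they remain so for small times of either sign.\<close>
  let ?a = "\<lambda>t. ?k t * (\<zeta> * (1 - s)) + sinh t / r" and ?b = "\<lambda>t. ?k t * (\<zeta> * s)"
  have "(?a \<longlongrightarrow> ?a 0) (at 0)"
    using v(1) by (intro tendsto_intros) auto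
  then have "\<forall>\<^sub>F t in at 0. 0 < ?a t"
    by (rule order_tendstoD(1)) (use \<zeta> s01 in simp)
  then obtain d' where d': "d' > 0" "\<And>t. t \<noteq> 0 \<Longrightarrow> dist t 0 < d' \<Longrightarrow> 0 < ?a t"
    unfolding eventually_at by auto
  have geo: "hyp_geodesic ?z v t \<in> \<Omega>" if t: "\<bar>t\<bar> < min d d'" for t
  proof -
    have "?a t > 0" using d'(2)[of t] t \<zeta> s01 by (cases "t = 0") auto
    moreover have "?b t > 0" using d(2)[of t] t \<zeta> s01 by simp
    moreover have eq: "hyp_geodesic ?z v t = ?a t *\<^sub>R x + ?b t *\<^sub>R y"
      unfolding v(4) gen by (simp add: scaleR_add_left)
    moreover have "hyp_geodesic ?z v t \<in> hyp" by (rule hyp_geodesic_in_hyp[OF zh v(2,3)])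
    ultimately have "hyp_geodesic ?z v t = hyp_seg x y (?b t / (?a t + ?b t))" "?b t / (?a t + ?b t) \<in> {0..1}"
      using hyp_combination_eq_seg[of "?a t" x "?b t" y] by simp_all
    then show ?thesis using seg by metis
  qed
  have "min d d' > 0" using d(1) d'(1) by simp
  from geodesic_not_tangent_from_inside[OF \<Omega> hc z v(2,3) this geo] show False .
qed

text \<open>Continuity method with \<open>x\<close> fixed: the set \<open>C\<close> of those
  \<open>y\<close> that \<open>x\<close> sees within \<open>\<Omega>\<close> is closed because
  \<open>\<Omega>\<close> is, and open because a segment in \<open>\<Omega>\<close> with interior
  ends avoids the boundary entirely. The interior is connected and \<open>C\<close> contains
  \<open>x\<close>.\<close>

lemma interior_geodesically_convex:
  fixes \<Omega> :: "('n::finite) minkowski set"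
  assumes \<Omega>: "smooth_bounded_domain \<Omega>" and hc: "uniformly_h_convex \<Omega>"
    and x: "x \<in> (top_of_set hyp) interior_of \<Omega>" and y: "y \<in> (top_of_set hyp) interior_of \<Omega>"
    and s: "s \<in> {0..1}"
  shows "hyp_seg x y s \<in> \<Omega>"
proof -
  let ?I = "(top_of_set hyp) interior_of \<Omega>"
  note dom = smooth_bounded_domainD[OF \<Omega>]
  have sub: "?I \<subseteq> hyp" "?I \<subseteq> \<Omega>" using interior_of_subset[of "top_of_set hyp" \<Omega>] dom(1) by auto
  have xh: "x \<in> hyp" using x sub by blast
  define C where "C = {y \<in> ?I. \<forall>s\<in>{0..1}. hyp_seg x y s \<in> \<Omega>}"
  have C': "C = {y \<in> ?I. \<forall>s\<in>{0..1}. hyp_seg x y s \<in> ?I}"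
    unfolding C_def using segment_no_boundary_point[OF \<Omega> hc x] sub(2) by blast
  have "closedin (top_of_set ?I) C"
  proof -
    have eq: "C = (\<Inter>s\<in>{0..1}. ?I \<inter> (\<lambda>y. hyp_seg x y s) -` \<Omega>)" unfolding C_def by auto
    have cl: "closedin (top_of_set ?I) (?I \<inter> (\<lambda>y. hyp_seg x y s) -` \<Omega>)" if "s \<in> {0..1}" for s
      using that xh sub by (intro continuous_closedin_preimage continuous_on_hyp_seg continuous_intros dom(4)) auto
    show ?thesis unfolding eq
    proof (rule closedin_Inter)
      fix S assume "S \<in> (\<lambda>s. ?I \<inter> (\<lambda>y. hyp_seg x y s) -` \<Omega>) ` {0..1}"
      then show "closedin (top_of_set ?I) S" using cl by blast
    qed simp
  qed
  moreover have "openin (top_of_set ?I) C"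
  proof -
    let ?g = "\<lambda>z. hyp_seg x (snd z) (fst z)"
    obtain O' where O': "open O'" "?I = hyp \<inter> O'" using openin_interior_of[of "top_of_set hyp" \<Omega>, unfolded openin_open] by blast
    have "continuous_on ({0..1} \<times> ?I) ?g"
      using xh sub by (intro continuous_on_hyp_seg continuous_intros) auto
    then have "closedin (top_of_set ({0..1} \<times> ?I)) (({0..1} \<times> ?I) \<inter> ?g -` (- O'))"
      by (rule continuous_closedin_preimage) (use O' in auto)
    \<comment> \<open>The parameter interval is compact, so the ends whose segment leaves the
      interior somewhere form a relatively closed set.\<close>
    then have "closedin (top_of_set ?I) {y. \<exists>s. s \<in> {0..1} \<and> (s, y) \<in> ({0..1} \<times> ?I) \<inter> ?g -` (- O')}"
      by (rule closedin_compact_projection[rotated]) simp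
    moreover have "{y. \<exists>s. s \<in> {0..1} \<and> (s, y) \<in> ({0..1} \<times> ?I) \<inter> ?g -` (- O')} = ?I - C"
    proof -
      have "hyp_seg x y s \<in> O' \<longleftrightarrow> hyp_seg x y s \<in> ?I" if "y \<in> ?I" "s \<in> {0..1}" for y s
        using hyp_seg_in_hyp[OF xh _ that(2), of y] that(1) sub(1) O'(2) by blast
      then show ?thesis unfolding C' by auto
    qed
    ultimately have "closedin (top_of_set ?I) (?I - C)" by simp
    moreover have "C \<subseteq> ?I" unfolding C_def by blast
    ultimately show ?thesis by (simp add: openin_closedin_eq)
  qed
  ultimately have "C = {} \<or> C = ?I"
    using domain_interior_facts(2)[OF \<Omega>] unfolding connected_clopen by blast
  moreover have "x \<in> C"
  proof -
    have "hyp_seg x x s = x" for s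
      unfolding hyp_seg_def using hyp_normalize_hyp[OF xh] by (simp flip: scaleR_add_left)
    then show ?thesis using x sub by (auto simp: C_def)
  qed
  ultimately show ?thesis using y s unfolding C_def by blast
qed

text \<open>Segments from an interior point to \<open>p\<close> lie in \<open>\<Omega>\<close> by
  closedness. If \<open>X\<close> were strictly on the outer side, the geodesic from
  \<open>p\<close> towards \<open>X\<close> would start with increasing \<open>f\<close> and leave
  \<open>\<Omega>\<close>. Interior points being dense, the inequality extends to all of
  \<open>\<Omega>\<close>.\<close>

theorem h_convex_supporting:
  fixes \<Omega> :: "('n::finite) minkowski set"
  assumes \<Omega>: "smooth_bounded_domain \<Omega>" and hc: "uniformly_h_convex \<Omega>"
    and p: "p \<in> hbd \<Omega>" and X: "X \<in> \<Omega>"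
  shows "lor X (outward_normal \<Omega> p) \<le> 0"
proof -
  let ?I = "(top_of_set hyp) interior_of \<Omega>"
  note dom = smooth_bounded_domainD[OF \<Omega>]
  have sub: "?I \<subseteq> hyp" "?I \<subseteq> \<Omega>" using interior_of_subset[of "top_of_set hyp" \<Omega>] dom(1) by auto
  obtain V V' U \<phi> \<nu> and f :: "'n minkowski \<Rightarrow> real"
    where V: "open V" "p \<in> V" and f: "smooth_on V f" and lev: "\<And>X. X \<in> hyp \<inter> V \<Longrightarrow> X \<in> \<Omega> \<longleftrightarrow> f X \<le> 0"
    and bd: "\<And>X. X \<in> hyp \<inter> V \<Longrightarrow> X \<in> hbd \<Omega> \<longleftrightarrow> f X = 0"
    and \<nu>p: "\<And>X. X \<in> hyp \<inter> V \<Longrightarrow> lor (\<nu> X) X = 0"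
    and \<nu>f: "\<And>X. X \<in> hyp \<inter> V \<Longrightarrow> \<exists>c>0. \<forall>v. lor v X = 0 \<longrightarrow> frechet_derivative f (at X) v = c * lor (\<nu> X) v"
    and nc: "normal_chart \<Omega> U \<phi> (\<lambda>u. \<nu> (\<phi> u))" and p\<phi>: "p \<in> \<phi> ` U"
    by (rule boundary_normal_chart[OF \<Omega> p]) (rule that)
  note ncD = normal_chartD[OF nc]
  have on: "outward_normal \<Omega> p = \<nu> p" using ncD(4) p\<phi> by blast
  have pO: "p \<in> \<Omega>" "p \<notin> ?I" using hbd_iff[OF dom(1,4)] p by auto
  have ph: "p \<in> hyp" using pO dom(1) by blast
  have pV: "p \<in> hyp \<inter> V" using ph V by blast
  have f0: "f p = 0" using bd[OF pV] p by blast
  have int: "lor X (\<nu> p) \<le> 0" if X: "X \<in> ?I" for X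
  proof (rule ccontr)
    assume "\<not> lor X (\<nu> p) \<le> 0"
    then have pos: "lor X (\<nu> p) > 0" by simp
    have Xh: "X \<in> hyp" and Xp: "X \<noteq> p" using X sub pO by auto
    have seg: "hyp_seg X p s \<in> \<Omega>" if s: "s \<in> {0..1}" for s
    proof -
      have "closedin (top_of_set hyp) (hyp \<inter> (\<lambda>y. hyp_seg X y s) -` \<Omega>)"
        using s Xh by (intro continuous_closedin_preimage continuous_on_hyp_seg continuous_intros dom(4)) auto
      then have "closed (hyp \<inter> (\<lambda>y. hyp_seg X y s) -` \<Omega>)" using closed_hyp closedin_closed_eq by blast
      moreover have "?I \<subseteq> hyp \<inter> (\<lambda>y. hyp_seg X y s) -` \<Omega>"
        using interior_geodesically_convex[OF \<Omega> hc X _ s] sub(1) by auto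
      ultimately have "closure ?I \<subseteq> hyp \<inter> (\<lambda>y. hyp_seg X y s) -` \<Omega>" by (rule closure_minimal[rotated])
      then show ?thesis using domain_interior_facts(1)[OF \<Omega>] pO(1) by blast
    qed
    obtain v r where v: "r > 0" "lor v p = 0" "lor v v = 1" "v = (X + lor X p *\<^sub>R p) /\<^sub>R r"
      "\<And>t. hyp_geodesic p v t = (cosh t + sinh t * lor X p / r) *\<^sub>R p + (sinh t / r) *\<^sub>R X"
      using geodesic_towards[OF ph Xh Xp] by metis
    let ?k = "\<lambda>t. cosh t + sinh t * lor X p / r"
    obtain d where d: "d > 0" "\<And>t. \<bar>t\<bar> < d \<Longrightarrow> 0 < ?k t"
      using geodesic_eventually_combination[OF ph Xh Xp v(1)] by blast
    have inO: "hyp_geodesic p v t \<in> \<Omega>" if t: "0 < t" "t < d" for t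
    proof -
      have a: "?k t > 0" "sinh t / r > 0" using d(2)[of t] t v(1) by auto
      have h: "hyp_geodesic p v t \<in> hyp" by (rule hyp_geodesic_in_hyp[OF ph v(2,3)])
      have eq: "hyp_geodesic p v t = (sinh t / r) *\<^sub>R X + ?k t *\<^sub>R p" unfolding v(5) by simp
      have "(sinh t / r) *\<^sub>R X + ?k t *\<^sub>R p = hyp_seg X p (?k t / (sinh t / r + ?k t))"
        by (rule hyp_combination_eq_seg) (use a h eq in auto)
      moreover have "?k t / (sinh t / r + ?k t) \<in> {0..1}" using a by simp
      ultimately show ?thesis using seg eq by metis
    qed
    obtain c where c: "c > 0" "\<And>v. lor v p = 0 \<Longrightarrow> frechet_derivative f (at p) v = c * lor (\<nu> p) v"
      using \<nu>f[OF pV] by blast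
    have "lor (\<nu> p) v = inverse r * lor X (\<nu> p)"
      unfolding v(4) using \<nu>p[OF pV] by (simp add: lor_sym[of "\<nu> p" X])
    then have dpos: "frechet_derivative f (at p) v > 0" using c(1) c(2)[OF v(2)] v(1) pos by simp
    have g0: "hyp_geodesic p v 0 = p" by (simp add: hyp_geodesic_def)
    have "((\<lambda>t. f (hyp_geodesic p v t)) has_real_derivative frechet_derivative f (at p) v) (at 0)"
      using DERIV_along_geodesic[of f _ p v 0] smooth_on_has_derivative[OF f V(2)] by (simp add: g0)
    from DERIV_pos_inc_right[OF this dpos]
    obtain d' where d': "d' > 0" "\<And>h. h > 0 \<Longrightarrow> h < d' \<Longrightarrow> f (hyp_geodesic p v 0) < f (hyp_geodesic p v (0 + h))" by blast
    obtain e where e: "e > 0" "\<And>t. \<bar>t\<bar> < e \<Longrightarrow> hyp_geodesic p v t \<in> V"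
      using hyp_geodesic_eventually[OF V] by blast
    define t where "t = min d (min d' e) / 2"
    have t: "0 < t" "t < d" "t < d'" "t < e" using d(1) d'(1) e(1) by (auto simp: t_def min_def)
    have "hyp_geodesic p v t \<in> hyp \<inter> V" using e(2)[of t] t hyp_geodesic_in_hyp[OF ph v(2,3)] by auto
    then have "f (hyp_geodesic p v t) \<le> 0" using lev inO[OF t(1,2)] by blast
    then show False using d'(2)[OF t(1,3)] f0 g0 by simp
  qed
  have "continuous_on UNIV (\<lambda>X. lor X (\<nu> p))"
    by (intro bounded_bilinear.continuous_on[OF bounded_bilinear_lor] continuous_intros)
  then have "closed {X. lor X (\<nu> p) \<le> 0}" by (intro closed_Collect_le) (auto intro: continuous_intros)
  then have "closure ?I \<subseteq> {X. lor X (\<nu> p) \<le> 0}" using int by (intro closure_minimal) auto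
  then show ?thesis using domain_interior_facts(1)[OF \<Omega>] X on by auto
qed

section \<open>Parallel bodies\<close>

text \<open>Tube lemma: projection along the compact \<open>K\<close> maps closed sets to closed
  sets.\<close>

lemma open_Collect_all_compact:
  fixes g :: "'a::euclidean_space \<Rightarrow> 'b::euclidean_space \<Rightarrow> real"
  assumes "compact K" and g: "continuous_on UNIV (\<lambda>z. g (fst z) (snd z))"
  shows "open {x. \<forall>y\<in>K. c < g x y}"
proof -
  let ?U = "{z \<in> K \<times> (UNIV :: 'a set). g (snd z) (fst z) \<le> c}"
  have c: "continuous_on (K \<times> (UNIV :: 'a set)) (\<lambda>z. g (snd z) (fst z))"
    by (rule continuous_on_compose2[OF g, of _ "\<lambda>z. (snd z, fst z)", simplified]) (intro continuous_intros)
  have "?U = (K \<times> UNIV) \<inter> (\<lambda>z. g (snd z) (fst z)) -` {..c}" by auto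
  then have "closedin (top_of_set (K \<times> UNIV)) ?U"
    using continuous_closedin_preimage[OF c, of "{..c}"] by simp
  from closedin_compact_projection[OF \<open>compact K\<close> this]
  have "closed {x. \<exists>y. y \<in> K \<and> (y, x) \<in> ?U}" by (simp only: subtopology_UNIV closed_closedin[symmetric])
  moreover have "{x. \<exists>y. y \<in> K \<and> (y, x) \<in> ?U} = - {x. \<forall>y\<in>K. c < g x y}" by auto
  ultimately show ?thesis by (simp add: closed_def)
qed

lemma arcosh_le_iff_cosh:
  fixes x t :: real
  assumes "1 \<le> x" "0 \<le> t"
  shows "arcosh x \<le> t \<longleftrightarrow> x \<le> cosh t"
proof -
  have "cosh (arcosh x) = x" using assms(1) by simp
  moreover have "0 \<le> arcosh x" using assms(1) by simp
  ultimately show ?thesis using cosh_real_nonneg_le_iff[of "arcosh x" t] assms(2) by simp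
qed

lemma lor_geodesics:
  assumes "lor p p = -1" "lor v p = 0" "lor v v = 1"
  shows "lor (hyp_geodesic p v s) (hyp_geodesic p v t) = - cosh (s - t)"
  using assms by (simp add: hyp_geodesic_def lor_sym[of p v] cosh_diff)

text \<open>The velocity at time \<open>t\<close> continues the same geodesic; it will be the normal
  of the parallel hypersurface.\<close>

lemma hyp_geodesic_shift:
  "hyp_geodesic (hyp_geodesic p v t) (sinh t *\<^sub>R p + cosh t *\<^sub>R v) s = hyp_geodesic p v (t + s)"
  by (simp add: hyp_geodesic_def cosh_add sinh_add algebra_simps)

lemma hyp_geodesic_minus: "hyp_geodesic p (- v) s = hyp_geodesic p v (- s)"
  by (simp add: hyp_geodesic_def)

section \<open>Normal geodesics and nearest points\<close>

locale h_convex_domain =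
  fixes \<Omega> :: "('n::finite) minkowski set"
  assumes dom: "smooth_bounded_domain \<Omega>" and hconv: "uniformly_h_convex \<Omega>"
begin

abbreviation M where "M \<equiv> hbd \<Omega>"
abbreviation \<nu> where "\<nu> \<equiv> outward_normal \<Omega>"
abbreviation \<kappa> where "\<kappa> p \<equiv> principal_curvatures \<Omega> p"
abbreviation \<Phi> where "\<Phi> t p \<equiv> hyp_geodesic p (\<nu> p) t"
abbreviation nchart where "nchart U \<phi> \<equiv> normal_chart \<Omega> U \<phi> (\<lambda>u. \<nu> (\<phi> u))"

lemmas domD = smooth_bounded_domainD[OF dom]

lemma M_iff: "p \<in> M \<longleftrightarrow> p \<in> \<Omega> \<and> p \<notin> (top_of_set hyp) interior_of \<Omega>"
  by (rule hbd_iff[OF domD(1,4)])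

lemma M_hyp: "M \<subseteq> hyp" and M_sub: "M \<subseteq> \<Omega>"
  using M_iff domD(1) by auto

lemma \<Omega>_nonempty: "\<Omega> \<noteq> {}"
  using domD(5) interior_of_subset[of "top_of_set hyp" \<Omega>] by auto

lemma compact_M: "compact M"
proof -
  have "closedin (top_of_set hyp) M" by (rule closedin_frontier_of)
  then have "closed M" using closed_hyp closedin_closed_eq by blast
  then have "compact (\<Omega> \<inter> M)" using compact_Int_closed[OF domD(2)] by blast
  moreover have "\<Omega> \<inter> M = M" using M_sub by blast
  ultimately show ?thesis by simp
qed

lemma closed_M: "closed M" using compact_M compact_imp_closed by blast

lemma nchart_exists:
  assumes "p \<in> M"
  obtains U \<phi> where "nchart U \<phi>" "p \<in> \<phi> ` U"
    "\<And>u. u \<in> U \<Longrightarrow> \<exists>\<epsilon>>0. \<forall>t\<in>{0<..<\<epsilon>}. hyp_geodesic (\<phi> u) (- \<nu> (\<phi> u)) t \<in> \<Omega>"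
proof -
  obtain V V' U \<phi> n and f :: "'n minkowski \<Rightarrow> real"
    where nc: "normal_chart \<Omega> U \<phi> (\<lambda>u. n (\<phi> u))" and p\<phi>: "p \<in> \<phi> ` U"
    and inner: "\<And>u. u \<in> U \<Longrightarrow> \<exists>\<epsilon>>0. \<forall>t\<in>{0<..<\<epsilon>}. hyp_geodesic (\<phi> u) (- n (\<phi> u)) t \<in> \<Omega>"
    by (rule boundary_normal_chart[OF dom assms]) (rule that)
  note ncD = normal_chartD[OF nc]
  have "smooth_on U (\<lambda>u. \<nu> (\<phi> u))"
    unfolding smooth_on_def
    by (intro allI Ck_on_cong_imp[OF local_paramD(1)[OF ncD(2)] _ smooth_on_Ck[OF ncD(3)]]) (simp add: ncD(4))
  then have "nchart U \<phi>" using nc unfolding normal_chart_def by auto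
  then show thesis using that[of U \<phi>] p\<phi> inner ncD(4) by simp
qed

lemma nchart_at:
  assumes "p \<in> M"
  obtains U \<phi> where "nchart U \<phi>" "p \<in> \<phi> ` U"
  by (rule nchart_exists[OF assms]) (rule that)

lemma normal:
  assumes "p \<in> M"
  shows "lor (\<nu> p) p = 0" "lor (\<nu> p) (\<nu> p) = 1" "lor p p = -1"
    "\<exists>\<epsilon>>0. \<forall>t\<in>{0<..<\<epsilon>}. hyp_geodesic p (- \<nu> p) t \<in> \<Omega>"
proof -
  obtain U \<phi> where nc: "nchart U \<phi>" "p \<in> \<phi> ` U"
    "\<And>u. u \<in> U \<Longrightarrow> \<exists>\<epsilon>>0. \<forall>t\<in>{0<..<\<epsilon>}. hyp_geodesic (\<phi> u) (- \<nu> (\<phi> u)) t \<in> \<Omega>"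
    using nchart_exists[OF assms] by blast
  obtain u where u: "u \<in> U" "p = \<phi> u" using nc(2) by blast
  show "lor (\<nu> p) p = 0" "lor (\<nu> p) (\<nu> p) = 1" using normal_chartD(5,6)[OF nc(1) u(1)] u(2) by auto
  show "\<exists>\<epsilon>>0. \<forall>t\<in>{0<..<\<epsilon>}. hyp_geodesic p (- \<nu> p) t \<in> \<Omega>" using nc(3)[OF u(1)] u(2) by simp
  show "lor p p = -1" using assms M_hyp hypD by blast
qed

lemma \<Phi>_hyp: "p \<in> M \<Longrightarrow> \<Phi> t p \<in> hyp"
  using hyp_geodesic_in_hyp normal M_hyp by blast

lemma supporting: "p \<in> M \<Longrightarrow> X \<in> \<Omega> \<Longrightarrow> lor X (\<nu> p) \<le> 0"
  by (rule h_convex_supporting[OF dom hconv])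

text \<open>In \<open>- lor (\<Phi> t p) X = cosh t * (- lor X p) - sinh t * lor X (\<nu> p)\<close>
  the supporting inequality makes the last term work in the right direction, and
  \<open>- lor X p\<close> is at least 1. So \<open>p\<close> is the unique nearest point of
  \<open>\<Omega>\<close> to \<open>\<Phi> t p\<close>, at distance \<open>t\<close>.\<close>

lemma \<Phi>_distance:
  assumes p: "p \<in> M" and X: "X \<in> \<Omega>" and t: "0 \<le> t"
  shows "cosh t \<le> - lor (\<Phi> t p) X" and "lor (\<Phi> t p) X = - cosh t \<Longrightarrow> X = p"
proof -
  have h: "X \<in> hyp" "p \<in> hyp" using X p domD(1) M_hyp by auto
  have e: "- lor (\<Phi> t p) X = cosh t * (- lor X p) - sinh t * lor X (\<nu> p)"
    by (simp add: hyp_geodesic_def lor_sym[of p X] lor_sym[of "\<nu> p" X])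
  have "sinh t * lor X (\<nu> p) \<le> 0" using supporting[OF p X] t by (simp add: mult_nonneg_nonpos)
  then have a: "cosh t * (- lor X p) \<le> - lor (\<Phi> t p) X" using e by linarith
  have b: "cosh t * 1 \<le> cosh t * (- lor X p)"
    by (rule mult_left_mono[OF lor_hyp_le(1)[OF h]]) (simp add: cosh_real_nonneg)
  show "cosh t \<le> - lor (\<Phi> t p) X" using a b by linarith
  assume "lor (\<Phi> t p) X = - cosh t"
  then have "cosh t * (- lor X p) = cosh t * 1" using a b by linarith
  moreover have "cosh t \<noteq> 0" using cosh_real_pos[of t] by simp
  ultimately have "lor X p = -1" by (simp only: mult_cancel_left) simp
  then show "X = p" by (rule lor_hyp_le(2)[OF h])
qed

lemma \<Phi>_foot: "p \<in> M \<Longrightarrow> lor (\<Phi> t p) p = - cosh t"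
  using normal by (simp add: hyp_geodesic_def)

lemma \<Phi>_notin: "p \<in> M \<Longrightarrow> 0 < t \<Longrightarrow> \<Phi> t p \<notin> \<Omega>"
proof
  assume p: "p \<in> M" and t: "0 < t" and X: "\<Phi> t p \<in> \<Omega>"
  have "cosh t \<le> - lor (\<Phi> t p) (\<Phi> t p)" using \<Phi>_distance(1)[OF p X] t by simp
  then have "cosh t \<le> cosh 0" using hypD(1)[OF \<Phi>_hyp[OF p]] by simp
  then show False using cosh_real_nonneg_le_iff[of t 0] t by simp
qed

text \<open>Each foot point is a competitor for the other, which forces equal distances; uniqueness
  of the nearest point does the rest.\<close>

lemma \<Phi>_inj:
  assumes p: "p \<in> M" "q \<in> M" and t: "0 \<le> t" "0 \<le> s" and eq: "\<Phi> t p = \<Phi> s q"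
  shows "t = s" "p = q"
proof -
  have pq: "p \<in> \<Omega>" "q \<in> \<Omega>" using p M_sub by auto
  have 1: "cosh t \<le> cosh s" using \<Phi>_distance(1)[OF p(1) pq(2) t(1)] unfolding eq \<Phi>_foot[OF p(2)] by simp
  have 2: "cosh s \<le> cosh t" using \<Phi>_distance(1)[OF p(2) pq(1) t(2)] unfolding eq[symmetric] \<Phi>_foot[OF p(1)] by simp
  show ts: "t = s" using 1 2 t by (simp add: cosh_real_nonneg_le_iff)
  show "p = q" using \<Phi>_distance(2)[OF p(2) _ t(2), of p] \<Phi>_foot[OF p(1), of t] M_sub p(1) eq ts by auto
qed

text \<open>\<open>- lor X Y\<close> is the hyperbolic cosine of the distance, so a minimizer
  \<open>p\<close> over the compact \<open>\<Omega>\<close> is a nearest point. First variation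
  along the boundary makes the direction from \<open>p\<close> to \<open>X\<close> normal, and
  minimality makes it point outward.\<close>

lemma nearest_point:
  assumes X: "X \<in> hyp" "X \<notin> \<Omega>"
  obtains p t where "p \<in> M" "t > 0" "X = \<Phi> t p"
proof -
  have "continuous_on \<Omega> (\<lambda>Y. - lor X Y)"
    by (intro continuous_intros bounded_bilinear.continuous_on[OF bounded_bilinear_lor])
  then obtain p where p: "p \<in> \<Omega>" "\<And>Y. Y \<in> \<Omega> \<Longrightarrow> - lor X p \<le> - lor X Y"
    using continuous_attains_inf[OF domD(2) \<Omega>_nonempty] by blast
  have ph: "p \<in> hyp" and Xp: "X \<noteq> p" using p X domD(1) by auto
  obtain v r where v: "r > 0" "lor v p = 0" "lor v v = 1" "v = (X + lor X p *\<^sub>R p) /\<^sub>R r"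
    using geodesic_towards[OF ph X(1) Xp] by metis
  define d where "d = arcosh (- lor X p)"
  have c1: "1 \<le> - lor X p" by (rule lor_hyp_le(1)[OF X(1) ph])
  have cd: "cosh d = - lor X p" and d0: "0 \<le> d" unfolding d_def using c1 by simp_all
  have rv: "r *\<^sub>R v = X + lor X p *\<^sub>R p" using v(1,4) by simp
  have "lor (r *\<^sub>R v) (r *\<^sub>R v) = (lor X p)\<^sup>2 - 1"
    unfolding rv using hypD(1)[OF ph] hypD(1)[OF X(1)] by (simp add: lor_sym[of p X] power2_eq_square)
  then have "r\<^sup>2 = (cosh d)\<^sup>2 - 1" unfolding cd using v(3) by (simp add: power2_eq_square)
  then have "r\<^sup>2 = (sinh d)\<^sup>2" by (simp add: cosh_square_eq)
  \<comment> \<open>The tangential part of \<open>X\<close> at \<open>p\<close> has length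
    \<open>sinh d\<close>, which identifies \<open>X\<close> as the point at time \<open>d\<close>
    on the geodesic.\<close>
  then have rs: "r = sinh d" using v(1) d0 by (simp add: power2_eq_iff_nonneg)
  have Xg: "X = hyp_geodesic p v d"
    using rv rs unfolding hyp_geodesic_def cd by (simp add: algebra_simps)
  have dpos: "d > 0" using rs v(1) by simp
  \<comment> \<open>A point of \<open>\<Omega>\<close> earlier on the geodesic would be nearer to
    \<open>X\<close> than \<open>p\<close>.\<close>
  have out: "hyp_geodesic p v s \<notin> \<Omega>" if s: "s \<in> {0<..<d}" for s
  proof
    assume "hyp_geodesic p v s \<in> \<Omega>"
    from p(2)[OF this] have "cosh d \<le> cosh (d - s)"
      unfolding cd[symmetric] using lor_geodesics[OF hypD(1)[OF ph] v(2,3), of d s] Xg by simp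
    then show False using cosh_real_nonneg_le_iff[of d "d - s"] s d0 by auto
  qed
  \<comment> \<open>From an interior point one could move towards \<open>X\<close> without leaving
    \<open>\<Omega>\<close>.\<close>
  have pM: "p \<in> M"
  proof (rule ccontr)
    assume "p \<notin> M"
    then have "p \<in> (top_of_set hyp) interior_of \<Omega>" using M_iff p(1) by blast
    then obtain V where V: "open V" "p \<in> V" "hyp \<inter> V \<subseteq> \<Omega>" unfolding interior_of_hyp_iff by blast
    obtain e where e: "e > 0" "\<And>t. \<bar>t\<bar> < e \<Longrightarrow> hyp_geodesic p v t \<in> V"
      using hyp_geodesic_eventually[OF V(1,2)] by blast
    define s where "s = min d e / 2"
    have s: "s \<in> {0<..<d}" "\<bar>s\<bar> < e" using dpos e(1) by (auto simp: s_def min_def)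
    then have "hyp_geodesic p v s \<in> \<Omega>" using V(3) e(2) hyp_geodesic_in_hyp[OF ph v(2,3)] by blast
    then show False using out s(1) by blast
  qed
  obtain U \<phi> where nc: "nchart U \<phi>" "p \<in> \<phi> ` U" by (rule nchart_at[OF pM]) (rule that)
  obtain u where u: "u \<in> U" "p = \<phi> u" using nc(2) by blast
  note ncD = normal_chartD[OF nc(1)]
  note lpD = local_paramD[OF ncD(2)]
  have perp: "lor v (frechet_derivative \<phi> (at u) w) = 0" for w
  proof -
    have "((\<lambda>y. - lor X (\<phi> y)) has_derivative (\<lambda>h. - (lor X (frechet_derivative \<phi> (at u) h) + lor 0 (\<phi> u)))) (at u)"
      by (intro has_derivative_minus lor_has_derivative has_derivative_const lpD(6)[OF u(1)])
    moreover have "(\<forall>y\<in>U. - lor X (\<phi> y) \<le> - lor X (\<phi> u)) \<or> (\<forall>y\<in>U. - lor X (\<phi> u) \<le> - lor X (\<phi> y))"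
      using p(2) lpD(3) M_sub u(2) by blast
    ultimately have "(\<lambda>h. - (lor X (frechet_derivative \<phi> (at u) h) + lor 0 (\<phi> u))) = (\<lambda>h. 0)"
      using differential_zero_maxmin[OF u(1) lpD(1)] by blast
    from fun_cong[OF this, of w] have "lor X (frechet_derivative \<phi> (at u) w) = 0" by simp
    moreover have "lor p (frechet_derivative \<phi> (at u) w) = 0"
      using local_param_tangent(1)[OF ncD(2,1) u(1)] u(2) by (simp add: lor_sym)
    ultimately have "sinh d * lor v (frechet_derivative \<phi> (at u) w) = 0" unfolding Xg hyp_geodesic_def by simp
    then show ?thesis using rs v(1) by simp
  qed
  have "v = \<nu> (\<phi> u)"
  proof (rule unit_normal_char[OF ncD(2) u(1) ncD(1)])
    show "\<exists>\<epsilon>>0. \<forall>t\<in>{0<..<\<epsilon>}. hyp_geodesic (\<phi> u) v t \<notin> \<Omega>" using out dpos u(2) by blast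
    show "\<exists>\<epsilon>>0. \<forall>t\<in>{0<..<\<epsilon>}. hyp_geodesic (\<phi> u) (- \<nu> (\<phi> u)) t \<in> \<Omega>" using normal(4)[OF pM] u(2) by simp
  qed (use ncD(5-7)[OF u(1)] v(2,3) u(2) perp in auto)
  then show thesis using that[OF pM dpos] Xg u(2) by simp
qed

text \<open>Compactness: the infimum in \<open>hdist_set\<close> is attained, so the distance
  condition becomes a statement about a single point and can be handled without
  \<open>arcosh\<close>.\<close>

lemma parallel_body_iff:
  assumes "0 \<le> \<rho>"
  shows "X \<in> parallel_body \<Omega> \<rho> \<longleftrightarrow> X \<in> hyp \<and> (\<exists>Y\<in>\<Omega>. - lor X Y \<le> cosh \<rho>)"
proof -
  have "hdist_set X \<Omega> \<le> \<rho> \<longleftrightarrow> (\<exists>Y\<in>\<Omega>. - lor X Y \<le> cosh \<rho>)" if X: "X \<in> hyp"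
  proof -
    have "continuous_on \<Omega> (\<lambda>Y. - lor X Y)"
      by (intro continuous_intros bounded_bilinear.continuous_on[OF bounded_bilinear_lor])
    then obtain p where p: "p \<in> \<Omega>" "\<And>Y. Y \<in> \<Omega> \<Longrightarrow> - lor X p \<le> - lor X Y"
      using continuous_attains_inf[OF domD(2) \<Omega>_nonempty] by blast
    have 1: "1 \<le> - lor X Y" if "Y \<in> \<Omega>" for Y using lor_hyp_le(1)[OF X] that domD(1) by blast
    have "hdist X p \<le> hdist X Y" if "Y \<in> \<Omega>" for Y
      unfolding hdist_def
      using arcosh_le_iff_cosh[of "- lor X p" "arcosh (- lor X Y)"] 1[OF p(1)] 1[OF that] p(2)[OF that] by simp
    then have "hdist_set X \<Omega> = hdist X p"
      unfolding hdist_set_def using p(1) by (intro cInf_eq_minimum) auto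
    then have "hdist_set X \<Omega> \<le> \<rho> \<longleftrightarrow> - lor X p \<le> cosh \<rho>"
      unfolding hdist_def using arcosh_le_iff_cosh[OF 1[OF p(1)] assms] by simp
    then show ?thesis using p order.trans by blast
  qed
  then show ?thesis unfolding parallel_body_def by blast
qed

lemma sub_parallel_body: "0 \<le> \<rho> \<Longrightarrow> \<Omega> \<subseteq> parallel_body \<Omega> \<rho>"
  using parallel_body_iff hypD(1) domD(1) cosh_real_ge_1[of \<rho>] by fastforce

lemma \<Phi>_parallel_body_iff:
  assumes "p \<in> M" "0 \<le> \<rho>" "0 \<le> t"
  shows "\<Phi> t p \<in> parallel_body \<Omega> \<rho> \<longleftrightarrow> t \<le> \<rho>"
proof
  assume "\<Phi> t p \<in> parallel_body \<Omega> \<rho>"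
  then obtain Y where Y: "Y \<in> \<Omega>" "- lor (\<Phi> t p) Y \<le> cosh \<rho>" using parallel_body_iff[OF assms(2)] by blast
  have "cosh t \<le> cosh \<rho>" using \<Phi>_distance(1)[OF assms(1) Y(1) assms(3)] Y(2) by linarith
  then show "t \<le> \<rho>" using assms cosh_real_nonneg_le_iff by blast
next
  assume "t \<le> \<rho>"
  then have "- lor (\<Phi> t p) p \<le> cosh \<rho>" using \<Phi>_foot[OF assms(1)] assms cosh_real_nonneg_le_iff by simp
  then show "\<Phi> t p \<in> parallel_body \<Omega> \<rho>"
    using parallel_body_iff[OF assms(2)] \<Phi>_hyp[OF assms(1)] assms(1) M_sub by blast
qed

lemma parallel_body_decomposition:
  assumes "0 \<le> \<rho>"
  shows "parallel_body \<Omega> \<rho> - \<Omega> = (\<lambda>(t, p). \<Phi> t p) ` ({0<..\<rho>} \<times> M)"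
proof (intro equalityI subsetI)
  fix X assume X: "X \<in> parallel_body \<Omega> \<rho> - \<Omega>"
  then have "X \<in> hyp" "X \<notin> \<Omega>" using parallel_body_iff[OF assms] by auto
  then obtain p t where pt: "p \<in> M" "t > 0" "X = \<Phi> t p" by (rule nearest_point)
  then have "t \<le> \<rho>" using X \<Phi>_parallel_body_iff[OF pt(1) assms, of t] by simp
  then show "X \<in> (\<lambda>(t, p). \<Phi> t p) ` ({0<..\<rho>} \<times> M)" using pt by force
next
  fix X assume "X \<in> (\<lambda>(t, p). \<Phi> t p) ` ({0<..\<rho>} \<times> M)"
  then obtain t p where pt: "p \<in> M" "0 < t" "t \<le> \<rho>" "X = \<Phi> t p" by auto
  then show "X \<in> parallel_body \<Omega> \<rho> - \<Omega>" using \<Phi>_parallel_body_iff[OF pt(1) assms, of t] \<Phi>_notin[OF pt(1,2)] by simp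
qed

lemma parallel_body_0: "parallel_body \<Omega> 0 = \<Omega>"
  using parallel_body_decomposition[of 0] sub_parallel_body[of 0] by auto

lemma closed_parallel_body:
  assumes "0 \<le> \<rho>"
  shows "closed (parallel_body \<Omega> \<rho>)"
proof -
  have "continuous_on UNIV (\<lambda>z :: 'n minkowski \<times> 'n minkowski. - lor (fst z) (snd z))"
    by (intro continuous_intros bounded_bilinear.continuous_on[OF bounded_bilinear_lor])
  from open_Collect_all_compact[OF domD(2), of "\<lambda>X Y. - lor X Y", OF this, of "cosh \<rho>"]
  have "closed (- {X. \<forall>Y\<in>\<Omega>. cosh \<rho> < - lor X Y})" by (simp only: closed_Compl)
  moreover have "parallel_body \<Omega> \<rho> = hyp \<inter> - {X. \<forall>Y\<in>\<Omega>. cosh \<rho> < - lor X Y}"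
    by (rule set_eqI) (simp add: parallel_body_iff[OF assms] not_less)
  ultimately show ?thesis using closed_hyp by auto
qed

text \<open>A strict distance inequality is an open condition, so points nearer than
  \<open>\<rho>\<close> are interior; a point at distance \<open>\<rho>\<close> can be pushed
  further out along its normal geodesic and is not.\<close>

lemma hbd_parallel_body:
  assumes "0 < \<rho>"
  shows "hbd (parallel_body \<Omega> \<rho>) = \<Phi> \<rho> ` M"
proof -
  have \<rho>: "0 \<le> \<rho>" using assms by simp
  have sub: "parallel_body \<Omega> \<rho> \<subseteq> hyp" by (auto simp: parallel_body_def)
  note hb = hbd_iff[OF sub closed_parallel_body[OF \<rho>]]
  have int: "X \<in> (top_of_set hyp) interior_of (parallel_body \<Omega> \<rho>)"
    if X: "X \<in> hyp" and Y: "Y \<in> \<Omega>" "- lor X Y < cosh \<rho>" for X Y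
  proof (rule in_interior_of_hyp[of "{X. - lor X Y < cosh \<rho>}"])
    show "open {X. - lor X Y < cosh \<rho>}"
      by (intro open_Collect_less continuous_intros bounded_bilinear.continuous_on[OF bounded_bilinear_lor])
    fix Z assume "Z \<in> hyp \<inter> {X. - lor X Y < cosh \<rho>}"
    then have "Z \<in> hyp" "- lor Z Y \<le> cosh \<rho>" by auto
    then show "Z \<in> parallel_body \<Omega> \<rho>" using parallel_body_iff[OF \<rho>] Y(1) by blast
  qed (use that in auto)
  show ?thesis
  proof (intro equalityI subsetI)
    fix X assume "X \<in> hbd (parallel_body \<Omega> \<rho>)"
    then have X: "X \<in> parallel_body \<Omega> \<rho>" "X \<notin> (top_of_set hyp) interior_of (parallel_body \<Omega> \<rho>)" using hb by auto
    have Xh: "X \<in> hyp" using X sub by blast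
    have c1: "1 < cosh \<rho>" using cosh_real_nonneg_less_iff[of 0 \<rho>] assms by simp
    have "X \<notin> \<Omega>"
    proof
      assume "X \<in> \<Omega>"
      then show False using int[OF Xh, of X] X(2) hypD(1)[OF Xh] c1 by simp
    qed
    then obtain p t where pt: "p \<in> M" "t > 0" "X = \<Phi> t p" using nearest_point[OF Xh] by blast
    have "t \<le> \<rho>" using X(1) \<Phi>_parallel_body_iff[OF pt(1) \<rho>, of t] pt by simp
    moreover have "\<not> t < \<rho>"
    proof
      assume "t < \<rho>"
      then have "- lor X p < cosh \<rho>" using \<Phi>_foot[OF pt(1)] pt cosh_real_nonneg_less_iff[of t \<rho>] by simp
      moreover have "p \<in> \<Omega>" using pt(1) M_sub by blast
      ultimately show False using int[OF Xh] X(2) by blast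
    qed
    ultimately show "X \<in> \<Phi> \<rho> ` M" using pt by force
  next
    fix X assume "X \<in> \<Phi> \<rho> ` M"
    then obtain p where p: "p \<in> M" "X = \<Phi> \<rho> p" by blast
    have in1: "X \<in> parallel_body \<Omega> \<rho>" using \<Phi>_parallel_body_iff[OF p(1) \<rho> \<rho>] p(2) by simp
    moreover have "X \<notin> (top_of_set hyp) interior_of (parallel_body \<Omega> \<rho>)"
    proof
      assume "X \<in> (top_of_set hyp) interior_of (parallel_body \<Omega> \<rho>)"
      then obtain V where V: "open V" "X \<in> V" "hyp \<inter> V \<subseteq> parallel_body \<Omega> \<rho>" unfolding interior_of_hyp_iff by blast
      obtain e where e: "e > 0" "\<And>s. \<bar>s\<bar> < e \<Longrightarrow> hyp_geodesic X (sinh \<rho> *\<^sub>R p + cosh \<rho> *\<^sub>R \<nu> p) s \<in> V"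
        using hyp_geodesic_eventually[OF V(1,2)] by blast
      have "\<Phi> (\<rho> + e / 2) p \<in> V" using e(2)[of "e / 2"] e(1) unfolding p(2) hyp_geodesic_shift by simp
      then have "\<Phi> (\<rho> + e / 2) p \<in> parallel_body \<Omega> \<rho>" using V(3) \<Phi>_hyp[OF p(1)] by blast
      then show False using \<Phi>_parallel_body_iff[OF p(1) \<rho>, of "\<rho> + e / 2"] e(1) \<rho> by simp
    qed
    ultimately show "X \<in> hbd (parallel_body \<Omega> \<rho>)" using hb by blast
  qed
qed

lemma continuous_on_\<nu>: "continuous_on M \<nu>"
  unfolding continuous_on_eq_continuous_within
proof
  fix p assume p: "p \<in> M"
  obtain U \<phi> where nc: "nchart U \<phi>" "p \<in> \<phi> ` U" by (rule nchart_at[OF p]) (rule that)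
  obtain u where u: "u \<in> U" "p = \<phi> u" using nc(2) by blast
  have "\<nu> differentiable (at p within M)"
    using derivative_along_hypersurface(1)[OF normal_chartD(2)[OF nc(1)] u(1)
        smooth_on_has_derivative[OF normal_chartD(3)[OF nc(1)] u(1)]] u(2) by simp
  then show "continuous (at p within M) \<nu>" by (rule differentiable_imp_continuous_within)
qed

lemma homeomorphism_\<Phi>:
  assumes "0 \<le> \<rho>"
  obtains \<Psi> where "homeomorphism M (\<Phi> \<rho> ` M) (\<Phi> \<rho>) \<Psi>"
proof -
  have "continuous_on M (\<Phi> \<rho>)" unfolding hyp_geodesic_def by (intro continuous_intros continuous_on_\<nu>)
  moreover have "inj_on (\<Phi> \<rho>) M" using \<Phi>_inj(2) assms by (intro inj_onI) blast
  ultimately have "\<exists>g. homeomorphism M (\<Phi> \<rho> ` M) (\<Phi> \<rho>) g"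
    using homeomorphism_compact[OF compact_M] by blast
  then show thesis using that by blast
qed

end

text \<open>Both sides of the hypothesis are polynomials in \<open>s\<close>; the coefficients of
  \<open>s ^ m\<close> are compared after expanding the product and then each power of
  \<open>b + s * c\<close>. In the application \<open>J\<close> is the Jacobian and
  \<open>a\<close>, \<open>b\<close>, \<open>c\<close> are \<open>exp \<rho>\<close>,
  \<open>sinh \<rho>\<close>, \<open>exp (- \<rho>)\<close>.\<close>

lemma elem_sym_coefficients:
  fixes x x' :: "real^'n"
  assumes eq: "\<And>s. J * (\<Prod>i\<in>UNIV. 1 + s * x' $ i) = (\<Prod>i\<in>UNIV. a + (b + s * c) * x $ i)"
    and m: "m \<le> CARD('n)"
  shows "J * elem_sym m x' =
    (\<Sum>i\<le>CARD('n). elem_sym i x * a ^ (CARD('n) - i) * (real (i choose m) * c ^ m * b ^ (i - m)))"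
proof -
  let ?n = "CARD('n)"
  have "(\<Sum>m\<le>?n. (J * elem_sym m x') * s ^ m) =
    (\<Sum>m\<le>?n. (\<Sum>i\<le>?n. elem_sym i x * a ^ (?n - i) * (real (i choose m) * c ^ m * b ^ (i - m))) * s ^ m)" for s
  proof -
    have bin: "(b + s * c) ^ i = (\<Sum>m\<le>?n. real (i choose m) * c ^ m * b ^ (i - m) * s ^ m)" if "i \<le> ?n" for i
    proof -
      have "(b + s * c) ^ i = (s * c + b) ^ i" by (simp add: add.commute)
      also have "\<dots> = (\<Sum>m\<le>i. real (i choose m) * (s * c) ^ m * b ^ (i - m))" by (rule binomial_ring)
      also have "\<dots> = (\<Sum>m\<le>?n. real (i choose m) * (s * c) ^ m * b ^ (i - m))"
        by (rule sum.mono_neutral_left) (use that in \<open>auto simp: binomial_eq_0\<close>)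
      finally show ?thesis by (simp add: power_mult_distrib mult_ac)
    qed
    have "(\<Sum>m\<le>?n. (J * elem_sym m x') * s ^ m) = J * (\<Prod>i\<in>UNIV. 1 + s * x' $ i)"
      unfolding prod_linear_elem_sym by (simp add: sum_distrib_left mult_ac)
    also have "\<dots> = (\<Sum>i\<le>?n. elem_sym i x * (b + s * c) ^ i * a ^ (?n - i))"
      by (subst eq) (rule prod_linear_elem_sym)
    also have "\<dots> = (\<Sum>i\<le>?n. \<Sum>m\<le>?n. elem_sym i x * a ^ (?n - i) * (real (i choose m) * c ^ m * b ^ (i - m)) * s ^ m)"
    proof (rule sum.cong[OF refl])
      fix i assume "i \<in> {..?n}"
      then have i: "i \<le> ?n" by simp
      show "elem_sym i x * (b + s * c) ^ i * a ^ (?n - i) =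
        (\<Sum>m\<le>?n. elem_sym i x * a ^ (?n - i) * (real (i choose m) * c ^ m * b ^ (i - m)) * s ^ m)"
        unfolding bin[OF i] sum_distrib_left sum_distrib_right by (simp only: mult_ac)
    qed
    also have "\<dots> = (\<Sum>m\<le>?n. \<Sum>i\<le>?n. elem_sym i x * a ^ (?n - i) * (real (i choose m) * c ^ m * b ^ (i - m)) * s ^ m)"
      by (rule sum.swap)
    finally show ?thesis by (simp add: sum_distrib_right)
  qed
  then have "\<forall>s. (\<Sum>m\<le>?n. (J * elem_sym m x') * s ^ m) =
      (\<Sum>m\<le>?n. (\<Sum>i\<le>?n. elem_sym i x * a ^ (?n - i) * (real (i choose m) * c ^ m * b ^ (i - m))) * s ^ m)"
    by (rule allI)
  from this[unfolded polyfun_eq_coeffs] m show ?thesis by (elim allE impE)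
qed

text \<open>With \<open>?C\<close> the matrix of the coordinate vectors in the orthonormal frame,
  one Gram matrix is \<open>?C\<close> times its transpose and the other has \<open>?C\<close>
  replaced by \<open>?C\<close> times the diagonal matrix of the \<open>\<mu> i\<close>. The roots
  of the determinants then differ by the product of the \<open>\<mu> i\<close>.\<close>

lemma vol_density_diagonal:
  fixes A A' :: "real^'d \<Rightarrow> ('n::finite) minkowski" and a :: "'d \<Rightarrow> real^'d"
  assumes \<phi>: "(\<phi> has_derivative A) (at u)" and \<phi>': "(\<phi>' has_derivative A') (at u)" and "inj A"
    and on: "\<And>i j. lor (A (a i)) (A (a j)) = (if i = j then 1 else 0)"
    and A': "\<And>i. A' (a i) = \<mu> i *\<^sub>R A (a i)" and \<mu>: "\<And>i. 0 \<le> \<mu> i"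
  shows "vol_density \<phi>' u = (\<Prod>i\<in>UNIV. \<mu> i) * vol_density \<phi> u"
proof -
  have lA: "linear A" and lA': "linear A'" using \<phi> \<phi>' has_derivative_linear by auto
  let ?C = "\<chi> i j. lor (A (axis i 1)) (A (a j))"
  have Ax: "A (axis i 1) = (\<Sum>j\<in>UNIV. ?C $ i $ j *\<^sub>R A (a j))" for i
    using lor_orthonormal_expansion[OF lA on, of "axis i 1"] by simp
  have "A (axis i 1) = A (\<Sum>j\<in>UNIV. ?C $ i $ j *\<^sub>R a j)" for i
    unfolding linear_sum[OF lA] linear_scale[OF lA] by (rule Ax)
  then have ax: "axis i 1 = (\<Sum>j\<in>UNIV. ?C $ i $ j *\<^sub>R a j)" for i by (rule injD[OF \<open>inj A\<close>])
  have A'x: "A' (axis i 1) = (\<Sum>j\<in>UNIV. (?C $ i $ j * \<mu> j) *\<^sub>R A (a j))" for i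
    using arg_cong[OF ax[of i], of A'] by (simp only: linear_sum[OF lA'] linear_scale[OF lA'] A' scaleR_scaleR)
  have ip: "lor (\<Sum>j\<in>UNIV. f j *\<^sub>R A (a j)) (\<Sum>j\<in>UNIV. g j *\<^sub>R A (a j)) = (\<Sum>j\<in>UNIV. f j * g j)" for f g
    unfolding lor_sum_left lor_sum_right lor_simps on by (simp add: if_distrib mult.commute cong: if_cong)
  have 1: "gram \<phi> u = ?C ** transpose ?C"
  proof -
    have "gram \<phi> u $ i $ j = (\<Sum>k\<in>UNIV. ?C $ i $ k * ?C $ j $ k)" for i j
      unfolding gram_eq[OF \<phi>] vec_lambda_beta by (subst Ax, subst (2) Ax, subst ip) simp
    then show ?thesis by (simp add: vec_eq_iff matrix_matrix_mult_def transpose_def)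
  qed
  have 2: "gram \<phi>' u = (?C ** (\<chi> i j. if i = j then \<mu> i else 0)) ** transpose (?C ** (\<chi> i j. if i = j then \<mu> i else 0))"
  proof -
    have "gram \<phi>' u $ i $ j = (\<Sum>k\<in>UNIV. (?C $ i $ k * \<mu> k) * (?C $ j $ k * \<mu> k))" for i j
      unfolding gram_eq[OF \<phi>'] vec_lambda_beta A'x ip ..
    then show ?thesis
      by (simp add: vec_eq_iff matrix_matrix_mult_def transpose_def if_distrib cong: if_cong)
  qed
  have sq: "sqrt (d * d) = \<bar>d\<bar>" for d :: real by simp
  have "vol_density \<phi> u = \<bar>det ?C\<bar>" unfolding vol_density_def 1 det_mul det_transpose sq ..
  moreover have "vol_density \<phi>' u = \<bar>det ?C * (\<Prod>i\<in>UNIV. \<mu> i)\<bar>"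
    unfolding vol_density_def 2 det_mul det_transpose sq det_diagonal_matrix ..
  moreover have "0 \<le> (\<Prod>i\<in>UNIV. \<mu> i)" using \<mu> by (intro prod_nonneg) auto
  ultimately show ?thesis by (simp add: abs_mult)
qed

section \<open>Charts and curvatures of the parallel hypersurfaces\<close>

context h_convex_domain
begin

definition jac :: "real \<Rightarrow> 'n minkowski \<Rightarrow> real" where
  "jac t p = (\<Prod>i\<in>UNIV. cosh t + \<kappa> p $ i * sinh t)"

lemma curvature_gt_1: "p \<in> M \<Longrightarrow> 1 < \<kappa> p $ i"
  using hconv unfolding uniformly_h_convex_def by (metis add_strict_increasing less_add_same_cancel1 less_trans order_less_imp_le)

lemma factor_pos: "p \<in> M \<Longrightarrow> 0 \<le> t \<Longrightarrow> 0 < cosh t + \<kappa> p $ i * sinh t"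
proof -
  assume "p \<in> M" "0 \<le> t"
  then have "0 \<le> \<kappa> p $ i * sinh t" using curvature_gt_1[of p i] by (intro mult_nonneg_nonneg) auto
  then show ?thesis using cosh_real_pos[of t] by linarith
qed

lemma jac_pos: "p \<in> M \<Longrightarrow> 0 \<le> t \<Longrightarrow> 0 < jac t p"
  unfolding jac_def using factor_pos by (intro prod_pos) auto

lemma nchart_image: "nchart U \<phi> \<Longrightarrow> u \<in> U \<Longrightarrow> \<phi> u \<in> M"
  using local_paramD(3)[OF normal_chartD(2)] by blast

lemma nchart_derivative:
  assumes "nchart U \<phi>" "u \<in> U"
  shows "((\<lambda>u. \<Phi> t (\<phi> u)) has_derivative (\<lambda>w. cosh t *\<^sub>R frechet_derivative \<phi> (at u) w +
      sinh t *\<^sub>R frechet_derivative (\<lambda>u. \<nu> (\<phi> u)) (at u) w)) (at u)"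
    "((\<lambda>u. sinh t *\<^sub>R \<phi> u + cosh t *\<^sub>R \<nu> (\<phi> u)) has_derivative
      (\<lambda>w. sinh t *\<^sub>R frechet_derivative \<phi> (at u) w +
      cosh t *\<^sub>R frechet_derivative (\<lambda>u. \<nu> (\<phi> u)) (at u) w)) (at u)"
  unfolding hyp_geodesic_def
  by (intro has_derivative_add has_derivative_scaleR_right normal_chart_shape(3,4)[OF assms])+

text \<open>The derivative of \<open>\<Phi> t \<circ> \<phi>\<close> is \<open>cosh t\<close> times
  that of \<open>\<phi>\<close> plus \<open>sinh t\<close> times that of the normal, so principal
  directions are merely scaled. Positivity of the scale factors gives injectivity.\<close>

lemma nchart_eigenbasis:
  assumes nc: "nchart U \<phi>" and u: "u \<in> U" and t: "0 \<le> t"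
  obtains a :: "'n \<Rightarrow> real^'n" where
    "\<And>i j. lor (frechet_derivative \<phi> (at u) (a i)) (frechet_derivative \<phi> (at u) (a j)) = (if i = j then 1 else 0)"
    "\<And>i. frechet_derivative (\<lambda>u. \<nu> (\<phi> u)) (at u) (a i) = \<kappa> (\<phi> u) $ i *\<^sub>R frechet_derivative \<phi> (at u) (a i)"
    "\<And>i. frechet_derivative (\<lambda>u. \<Phi> t (\<phi> u)) (at u) (a i) =
      (cosh t + \<kappa> (\<phi> u) $ i * sinh t) *\<^sub>R frechet_derivative \<phi> (at u) (a i)"
    "inj (frechet_derivative (\<lambda>u. \<Phi> t (\<phi> u)) (at u))"
proof -
  let ?A = "frechet_derivative \<phi> (at u)" and ?D = "frechet_derivative (\<lambda>u. \<nu> (\<phi> u)) (at u)"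
  let ?At = "frechet_derivative (\<lambda>u. \<Phi> t (\<phi> u)) (at u)" and ?m = "\<lambda>i. cosh t + \<kappa> (\<phi> u) $ i * sinh t"
  note sh = normal_chart_shape[OF nc u]
  obtain a :: "'n \<Rightarrow> real^'n" where a: "\<And>i j. lor (?A (a i)) (?A (a j)) = (if i = j then 1 else 0)"
    "\<And>i. ?D (a i) = \<kappa> (\<phi> u) $ i *\<^sub>R ?A (a i)"
    using principal_curvatures_eigenbasis[OF nc u] by blast
  have At: "?At = (\<lambda>w. cosh t *\<^sub>R ?A w + sinh t *\<^sub>R ?D w)"
    by (rule frechet_derivative_eq[OF nchart_derivative(1)[OF nc u]])
  have Ata: "?At (a i) = ?m i *\<^sub>R ?A (a i)" for i
    unfolding At a(2) by (simp add: scaleR_add_left mult.commute)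
  have lin: "linear ?At" using nchart_derivative(1)[OF nc u] has_derivative_linear unfolding At by blast
  have "inj ?At"
  proof (rule linear_injective_0[OF lin, THEN iffD2], intro allI impI)
    fix x assume 0: "?At x = 0"
    have "lor (?A x) (?A (a i)) = 0" for i
    proof -
      have "lor (?At x) (?A (a i)) = cosh t * lor (?A x) (?A (a i)) + sinh t * lor (?A x) (?D (a i))"
        unfolding At by (simp add: sh(8))
      also have "\<dots> = ?m i * lor (?A x) (?A (a i))" unfolding a(2) by (simp add: algebra_simps)
      finally show ?thesis using 0 factor_pos[OF nchart_image[OF nc u] t, of i] by simp
    qed
    then have "?A x = 0" using lor_orthonormal_expansion[OF sh(1) a(1), of x] by simp
    then show "x = 0" using sh(6)[of x] by auto
  qed
  then show thesis using that a Ata by blast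
qed

lemma vol_density_parallel:
  assumes nc: "nchart U \<phi>" and u: "u \<in> U" and t: "0 \<le> t"
  shows "vol_density (\<lambda>u. \<Phi> t (\<phi> u)) u = jac t (\<phi> u) * vol_density \<phi> u"
proof -
  note sh = normal_chart_shape[OF nc u]
  obtain a :: "'n \<Rightarrow> real^'n" where a:
    "\<And>i j. lor (frechet_derivative \<phi> (at u) (a i)) (frechet_derivative \<phi> (at u) (a j)) = (if i = j then 1 else 0)"
    "\<And>i. frechet_derivative (\<lambda>u. \<Phi> t (\<phi> u)) (at u) (a i) =
      (cosh t + \<kappa> (\<phi> u) $ i * sinh t) *\<^sub>R frechet_derivative \<phi> (at u) (a i)"
    by (rule nchart_eigenbasis[OF nc u t]) (rule that)
  have d: "((\<lambda>u. \<Phi> t (\<phi> u)) has_derivative frechet_derivative (\<lambda>u. \<Phi> t (\<phi> u)) (at u)) (at u)"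
    using nchart_derivative(1)[OF nc u, of t] unfolding frechet_derivative_eq[OF nchart_derivative(1)[OF nc u, of t]] .
  show ?thesis unfolding jac_def
    by (rule vol_density_diagonal[OF sh(3) d sh(5) a]) (use factor_pos[OF nchart_image[OF nc u] t] less_imp_le in blast)
qed

lemma smooth_nchart_parallel:
  assumes "nchart U \<phi>"
  shows "smooth_on U (\<lambda>u. \<Phi> t (\<phi> u))" "smooth_on U (\<lambda>u. sinh t *\<^sub>R \<phi> u + cosh t *\<^sub>R \<nu> (\<phi> u))"
  unfolding smooth_on_def hyp_geodesic_def
  using smooth_on_Ck[OF local_paramD(2)[OF normal_chartD(2)[OF assms]]] smooth_on_Ck[OF normal_chartD(3)[OF assms]]
    local_paramD(1)[OF normal_chartD(2)[OF assms]]
  by (auto intro!: Ck_on_add Ck_on_scaleR Ck_on_const)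

text \<open>The velocity of the normal geodesic at time \<open>\<rho>\<close> is a unit normal of
  the parallel hypersurface. Its geodesics run along the old ones, to
  \<open>\<Phi> (\<rho> + t)\<close> outward and \<open>\<Phi> (\<rho> - t)\<close> inward, and
  \<open>\<Phi>_parallel_body_iff\<close> tells on which side these lie.\<close>

lemma normal_chart_parallel:
  assumes nc: "nchart U \<phi>" and \<rho>: "0 < \<rho>"
  shows "normal_chart (parallel_body \<Omega> \<rho>) U (\<lambda>u. \<Phi> \<rho> (\<phi> u)) (\<lambda>u. sinh \<rho> *\<^sub>R \<phi> u + cosh \<rho> *\<^sub>R \<nu> (\<phi> u))"
proof -
  have \<rho>0: "0 \<le> \<rho>" using \<rho> by simp
  note ncD = normal_chartD[OF nc]
  note lpD = local_paramD[OF ncD(2)]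
  note hb = hbd_parallel_body[OF \<rho>]
  have hyp: "hbd (parallel_body \<Omega> \<rho>) \<subseteq> hyp" unfolding hb using \<Phi>_hyp by blast
  obtain \<psi> where \<psi>: "homeomorphism U (\<phi> ` U) \<phi> \<psi>" "openin (top_of_set M) (\<phi> ` U)"
    using ncD(2) by (auto simp: local_param_def)
  obtain \<Psi> where \<Psi>: "homeomorphism M (\<Phi> \<rho> ` M) (\<Phi> \<rho>) \<Psi>" by (rule homeomorphism_\<Phi>[OF \<rho>0])
  have img: "(\<lambda>u. \<Phi> \<rho> (\<phi> u)) ` U = \<Phi> \<rho> ` \<phi> ` U" by (simp add: image_image)
  have "homeomorphism (\<phi> ` U) (\<Phi> \<rho> ` \<phi> ` U) (\<Phi> \<rho>) \<Psi>"
    by (rule homeomorphism_of_subsets[OF \<Psi>]) (use lpD(3) in auto)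
  from homeomorphism_compose[OF \<psi>(1) this]
  have hom: "homeomorphism U ((\<lambda>u. \<Phi> \<rho> (\<phi> u)) ` U) (\<lambda>u. \<Phi> \<rho> (\<phi> u)) (\<psi> \<circ> \<Psi>)"
    unfolding img by (simp add: o_def)
  have opn: "openin (top_of_set (hbd (parallel_body \<Omega> \<rho>))) ((\<lambda>u. \<Phi> \<rho> (\<phi> u)) ` U)"
    unfolding img hb by (rule homeomorphism_imp_open_map[OF \<Psi> \<psi>(2)])
  have lp: "local_param (hbd (parallel_body \<Omega> \<rho>)) U (\<lambda>u. \<Phi> \<rho> (\<phi> u))"
    unfolding local_param_def
  proof (intro conjI ballI)
    show "\<exists>\<psi>. homeomorphism U ((\<lambda>u. \<Phi> \<rho> (\<phi> u)) ` U) (\<lambda>u. \<Phi> \<rho> (\<phi> u)) \<psi>" using hom by blast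
    fix u assume u: "u \<in> U"
    show "inj (frechet_derivative (\<lambda>u. \<Phi> \<rho> (\<phi> u)) (at u))"
      by (rule nchart_eigenbasis[OF nc u \<rho>0])
  qed (use lpD(1) smooth_nchart_parallel[OF nc] opn in auto)
  show ?thesis unfolding normal_chart_def
  proof (intro conjI ballI hyp lp smooth_nchart_parallel[OF nc])
    fix u assume u: "u \<in> U"
    let ?p = "\<phi> u" and ?A = "frechet_derivative \<phi> (at u)" and ?D = "frechet_derivative (\<lambda>u. \<nu> (\<phi> u)) (at u)"
    let ?n = "sinh \<rho> *\<^sub>R ?p + cosh \<rho> *\<^sub>R \<nu> ?p"
    have p: "?p \<in> M" by (rule nchart_image[OF nc u])
    note np = normal[OF p]
    note sh = normal_chart_shape[OF nc u]
    have A: "lor (?A w) ?p = 0" "lor (\<nu> ?p) (?A w) = 0" for w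
      using local_param_tangent(1)[OF ncD(2,1) u] ncD(7)[OF u] by auto
    have D: "lor ?p (?D w) = 0" "lor (\<nu> ?p) (?D w) = 0" for w
    proof -
      obtain x where "?D w = ?A x" using sh(7) by blast
      then show "lor ?p (?D w) = 0" "lor (\<nu> ?p) (?D w) = 0" using A by (auto simp: lor_sym[of ?p])
    qed
    have At: "frechet_derivative (\<lambda>u. \<Phi> \<rho> (\<phi> u)) (at u) w = cosh \<rho> *\<^sub>R ?A w + sinh \<rho> *\<^sub>R ?D w" for w
      using frechet_derivative_eq[OF nchart_derivative(1)[OF nc u]] by simp
    show 1: "lor ?n (\<Phi> \<rho> ?p) = 0"
      using np by (simp add: hyp_geodesic_def lor_sym[of ?p "\<nu> ?p"])
    show 2: "lor ?n ?n = 1"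
      using np cosh_square_eq[of \<rho>] by (simp add: lor_sym[of ?p "\<nu> ?p"] power2_eq_square)
    have 3: "lor ?n (frechet_derivative (\<lambda>u. \<Phi> \<rho> (\<phi> u)) (at u) w) = 0" for w
      unfolding At using A D by (simp add: lor_sym[of ?p "?A w"])
    then show "\<forall>w. lor ?n (frechet_derivative (\<lambda>u. \<Phi> \<rho> (\<phi> u)) (at u) w) = 0" by blast
    show "outward_normal (parallel_body \<Omega> \<rho>) (\<Phi> \<rho> ?p) = ?n"
    proof (rule outward_normal_eqI[OF lp u hyp 1 2 3])
      have "hyp_geodesic (\<Phi> \<rho> ?p) (- ?n) t \<in> parallel_body \<Omega> \<rho>" if "t \<in> {0<..<\<rho>}" for t
        unfolding hyp_geodesic_minus hyp_geodesic_shift using \<Phi>_parallel_body_iff[OF p \<rho>0, of "\<rho> + - t"] that by simp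
      then show "\<exists>\<epsilon>>0. \<forall>t\<in>{0<..<\<epsilon>}. hyp_geodesic (\<Phi> \<rho> ?p) (- ?n) t \<in> parallel_body \<Omega> \<rho>"
        using \<rho> by (intro exI[of _ \<rho>]) auto
      have "hyp_geodesic (\<Phi> \<rho> ?p) ?n t \<notin> parallel_body \<Omega> \<rho>" if "t \<in> {0<..<1}" for t
        unfolding hyp_geodesic_shift using \<Phi>_parallel_body_iff[OF p \<rho>0, of "\<rho> + t"] that \<rho> by simp
      then show "\<exists>\<epsilon>>0. \<forall>t\<in>{0<..<\<epsilon>}. hyp_geodesic (\<Phi> \<rho> ?p) ?n t \<notin> parallel_body \<Omega> \<rho>"
        by (intro exI[of _ 1]) auto
    qed
  qed
qed

text \<open>In the old principal directions the new curvatures are the quotients of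
  \<open>sinh \<rho> + \<kappa> cosh \<rho>\<close> by
  \<open>cosh \<rho> + \<kappa> sinh \<rho>\<close>. Multiplying by \<open>jac\<close>, the product
  of the denominators, leaves factors that are linear in the old shifted curvatures.\<close>

lemma elem_sym_parallel:
  assumes p: "p \<in> M" and \<rho>: "0 < \<rho>" and m: "m \<le> CARD('n)"
  shows "jac \<rho> p * elem_sym m (shifted_curvatures (parallel_body \<Omega> \<rho>) (\<Phi> \<rho> p)) =
    (\<Sum>i\<le>CARD('n). elem_sym i (shifted_curvatures \<Omega> p) * exp \<rho> ^ (CARD('n) - i) *
       (real (i choose m) * exp (- \<rho>) ^ m * sinh \<rho> ^ (i - m)))"
proof (rule elem_sym_coefficients[OF _ m])
  have \<rho>0: "0 \<le> \<rho>" using \<rho> by simp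
  obtain U \<phi> where nc: "nchart U \<phi>" "p \<in> \<phi> ` U" by (rule nchart_at[OF p]) (rule that)
  obtain u where u: "u \<in> U" "p = \<phi> u" using nc(2) by blast
  note nct = normal_chart_parallel[OF nc(1) \<rho>]
  let ?A = "frechet_derivative \<phi> (at u)" and ?D = "frechet_derivative (\<lambda>u. \<nu> (\<phi> u)) (at u)"
  let ?At = "frechet_derivative (\<lambda>u. \<Phi> \<rho> (\<phi> u)) (at u)"
  let ?Dt = "frechet_derivative (\<lambda>u. sinh \<rho> *\<^sub>R \<phi> u + cosh \<rho> *\<^sub>R \<nu> (\<phi> u)) (at u)"
  let ?m = "\<lambda>i. cosh \<rho> + \<kappa> p $ i * sinh \<rho>" and ?k = "\<lambda>i. sinh \<rho> + \<kappa> p $ i * cosh \<rho>"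
  obtain a :: "'n \<Rightarrow> real^'n" where a:
    "\<And>i j. lor (?A (a i)) (?A (a j)) = (if i = j then 1 else 0)"
    "\<And>i. ?D (a i) = \<kappa> (\<phi> u) $ i *\<^sub>R ?A (a i)"
    "\<And>i. ?At (a i) = (cosh \<rho> + \<kappa> (\<phi> u) $ i * sinh \<rho>) *\<^sub>R ?A (a i)"
    by (rule nchart_eigenbasis[OF nc(1) u(1) \<rho>0]) (rule that)
  have mpos: "?m i > 0" for i by (rule factor_pos[OF p \<rho>0])
  have lt: "linear ?At" "linear ?Dt" using normal_chart_shape(1,2)[OF nct u(1)] by auto
  have Dt: "?Dt (a i) = ?k i *\<^sub>R ?A (a i)" for i
    unfolding frechet_derivative_eq[OF nchart_derivative(2)[OF nc(1) u(1)]] a(2) u(2)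
    by (simp add: scaleR_add_left mult.commute)
  have At: "?At (a i) = ?m i *\<^sub>R ?A (a i)" for i unfolding a(3) u(2) ..
  \<comment> \<open>Rescaled so that the images under the derivative of the parallel chart are
    orthonormal again.\<close>
  let ?b = "\<lambda>i. inverse (?m i) *\<^sub>R a i"
  have Atb: "?At (?b i) = ?A (a i)" for i
    unfolding linear_scale[OF lt(1)] At using mpos[of i] by simp
  have b1: "lor (?At (?b i)) (?At (?b j)) = (if i = j then 1 else 0)" for i j
    unfolding Atb by (rule a(1))
  have b2: "?Dt (?b i) = (?k i / ?m i) *\<^sub>R ?At (?b i)" for i
    unfolding Atb linear_scale[OF lt(2)] Dt by (simp add: divide_inverse mult.commute)
  fix s
  \<comment> \<open>Undoing the shift by 1 gives the form \<open>c + s * \<kappa> i\<close> for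
    which \<open>prod_principal_curvatures\<close> allows any eigenbasis.\<close>
  have "(\<Prod>i\<in>UNIV. 1 + s * shifted_curvatures (parallel_body \<Omega> \<rho>) (\<Phi> \<rho> p) $ i) =
    (\<Prod>i\<in>UNIV. (1 - s) + s * principal_curvatures (parallel_body \<Omega> \<rho>) (\<Phi> \<rho> p) $ i)"
    unfolding shifted_curvatures_def by (simp add: algebra_simps)
  also have "\<dots> = (\<Prod>i\<in>UNIV. (1 - s) + s * (?k i / ?m i))"
    using prod_principal_curvatures[OF nct u(1) b1 b2, of "1 - s" s] u(2) by simp
  finally have "jac \<rho> p * (\<Prod>i\<in>UNIV. 1 + s * shifted_curvatures (parallel_body \<Omega> \<rho>) (\<Phi> \<rho> p) $ i) =
    (\<Prod>i\<in>UNIV. ?m i * ((1 - s) + s * (?k i / ?m i)))"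
    unfolding jac_def by (simp only: prod.distrib)
  also have "\<dots> = (\<Prod>i\<in>UNIV. exp \<rho> + (sinh \<rho> + s * exp (- \<rho>)) * shifted_curvatures \<Omega> p $ i)"
  proof (rule prod.cong[OF refl])
    fix i
    have e: "exp \<rho> = cosh \<rho> + sinh \<rho>" "exp (- \<rho>) = cosh \<rho> - sinh \<rho>"
      by (simp_all add: cosh_plus_sinh cosh_minus_sinh)
    have "?m i * ((1 - s) + s * (?k i / ?m i)) = ?m i * (1 - s) + s * ?k i"
      using mpos[of i] by (simp add: field_simps)
    also have "\<dots> = exp \<rho> + (sinh \<rho> + s * exp (- \<rho>)) * (\<kappa> p $ i - 1)"
      unfolding e by (simp add: algebra_simps)
    finally show "?m i * ((1 - s) + s * (?k i / ?m i)) =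
      exp \<rho> + (sinh \<rho> + s * exp (- \<rho>)) * shifted_curvatures \<Omega> p $ i"
      unfolding shifted_curvatures_def by simp
  qed
  finally show "jac \<rho> p * (\<Prod>i\<in>UNIV. 1 + s * shifted_curvatures (parallel_body \<Omega> \<rho>) (\<Phi> \<rho> p) $ i) =
    (\<Prod>i\<in>UNIV. exp \<rho> + (sinh \<rho> + s * exp (- \<rho>)) * shifted_curvatures \<Omega> p $ i)" .
qed

lemma jac_elem_sym:
  "jac t p = (\<Sum>i\<le>CARD('n). elem_sym i (shifted_curvatures \<Omega> p) * sinh t ^ i * exp t ^ (CARD('n) - i))"
proof -
  have "jac t p = (\<Prod>i\<in>UNIV. exp t + sinh t * shifted_curvatures \<Omega> p $ i)"
    unfolding jac_def shifted_curvatures_def cosh_plus_sinh[symmetric] by (simp add: algebra_simps)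
  then show ?thesis unfolding prod_linear_elem_sym .
qed

end

section \<open>Curvature integrals of parallel bodies\<close>

text \<open>The constant coefficient is the limit of the polynomial as \<open>s\<close> tends to 0;
  subtracting it and dividing by \<open>s\<close> lowers the degree. Small positive \<open>s\<close>
  are what the positive distances provide.\<close>

lemma polynomial_coefficients_measurable:
  fixes f :: "nat \<Rightarrow> 'a \<Rightarrow> real"
  assumes "0 < (\<delta>::real)"
    and "\<And>s. 0 < s \<Longrightarrow> s < \<delta> \<Longrightarrow> (\<lambda>u. \<Sum>j\<le>n. f j u * s ^ j) \<in> borel_measurable N" "j \<le> n"
  shows "f j \<in> borel_measurable N"
  using assms(2,3)
proof (induction n arbitrary: f j)
  case 0
  then show ?case using assms(1) by (force dest: dense)
next
  case (Suc n)
  \<comment> \<open>The shift by 2 keeps the whole sequence strictly below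
    \<open>\<delta>\<close>.\<close>
  define s where "s k = \<delta> / real (k + 2)" for k
  have s: "0 < s k" "s k < \<delta>" for k using assms(1) by (auto simp: s_def field_simps intro: add_pos_nonneg)
  have s0: "s \<longlonglongrightarrow> 0"
    unfolding s_def[abs_def] by (intro LIMSEQ_ignore_initial_segment[OF lim_const_over_n])
  have f0: "f 0 \<in> borel_measurable N"
  proof (rule borel_measurable_LIMSEQ_real)
    show "(\<lambda>u. \<Sum>j\<le>Suc n. f j u * s k ^ j) \<in> borel_measurable N" for k using Suc.prems(1) s by blast
    fix u
    have "(\<lambda>k. \<Sum>j\<le>Suc n. f j u * s k ^ j) \<longlonglongrightarrow> (\<Sum>j\<le>Suc n. f j u * 0 ^ j)"
      by (intro tendsto_intros s0)
    then show "(\<lambda>k. \<Sum>j\<le>Suc n. f j u * s k ^ j) \<longlonglongrightarrow> f 0 u"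
      by (simp only: sum.atMost_Suc_shift power_0 power_0_Suc mult_zero_right mult_1_right sum.neutral_const add_0_right)
  qed
  have "f (Suc i) \<in> borel_measurable N" if "i \<le> n" for i
  proof (rule Suc.IH[of "\<lambda>j. f (Suc j)", OF _ that])
    fix t assume t: "0 < t" "t < \<delta>"
    have "(\<lambda>u. ((\<Sum>j\<le>Suc n. f j u * t ^ j) - f 0 u) / t) \<in> borel_measurable N"
      using Suc.prems(1)[OF t] f0 by measurable
    moreover have "((\<Sum>j\<le>Suc n. f j u * t ^ j) - f 0 u) / t = (\<Sum>j\<le>n. f (Suc j) u * t ^ j)" for u
      unfolding sum.atMost_Suc_shift using t(1) by (simp add: sum_divide_distrib)
    ultimately show "(\<lambda>u. \<Sum>j\<le>n. f (Suc j) u * t ^ j) \<in> borel_measurable N" by simp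
  qed
  then show ?case using f0 Suc.prems(2) by (cases j) auto
qed

lemma elem_sym_0: "elem_sym 0 x = 1"
proof -
  have "{S :: 'a set. card S = 0} = {{}}" by auto
  then show ?thesis by (simp add: elem_sym_def)
qed

lemma elem_sym_nonneg: "(\<And>i. 0 \<le> x $ i) \<Longrightarrow> 0 \<le> elem_sym m x"
  unfolding elem_sym_def by (intro sum_nonneg prod_nonneg) auto

lemma exp_power_diff: "j \<le> n \<Longrightarrow> exp t ^ (n - j) = exp (t::real) ^ n * exp (- t) ^ j"
proof -
  assume "j \<le> n"
  then have "exp t ^ n = exp t ^ (n - j) * exp t ^ j" by (simp flip: power_add)
  moreover have "exp t ^ j * exp (- t) ^ j = 1" by (simp flip: power_mult_distrib exp_add)
  ultimately show ?thesis by simp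
qed

context h_convex_domain
begin

abbreviation \<sigma> where "\<sigma> j p \<equiv> elem_sym j (shifted_curvatures \<Omega> p)"

definition charts where
  "charts m U \<phi> B \<longleftrightarrow> chart_partition M m U \<phi> B \<and> (\<forall>i<m. nchart (U i) (\<phi> i))"

lemma charts_exist: obtains m U \<phi> B where "charts m U \<phi> B"
proof -
  have "\<exists>U \<phi>. local_param M U \<phi> \<and> p \<in> \<phi> ` U \<and> nchart U \<phi>" if p: "p \<in> M" for p
    by (rule nchart_at[OF p]) (use normal_chartD(2) in blast)
  from chart_partition_exists[OF compact_M M_hyp this]
  show thesis using that unfolding charts_def by metis
qed

lemma \<sigma>_nonneg: "p \<in> M \<Longrightarrow> 0 \<le> \<sigma> j p"
  by (intro elem_sym_nonneg) (simp add: shifted_curvatures_def less_imp_le[OF curvature_gt_1])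

text \<open>The principal curvatures are only given by a choice, so that their symmetric functions are obtained
  as the coefficients of the polynomial by which \<open>\<Phi> t\<close> multiplies the density.\<close>

lemma \<sigma>_measurable:
  assumes nc: "nchart U \<phi>" and j: "j \<le> CARD('n)"
  shows "(\<lambda>u. \<sigma> j (\<phi> u)) \<in> borel_measurable (restrict_space borel U)"
proof (rule polynomial_coefficients_measurable[where \<delta> = "1/2" and f = "\<lambda>j u. \<sigma> j (\<phi> u)", OF _ _ j])
  note ncD = normal_chartD[OF nc]
  note lpD = local_paramD[OF ncD(2)]
  fix s :: real assume s: "0 < s" "s < 1/2"
  \<comment> \<open>Solves \<open>sinh t * exp (- t) = s\<close>, that is
    \<open>1 - exp (- 2 t) = 2 s\<close>; the quotient of densities divided by
    \<open>exp t ^ n\<close> is then a polynomial in \<open>s\<close>. The values reached for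
    positive \<open>t\<close> are those between 0 and 1/2.\<close>
  define t where "t = - ln (1 - 2 * s) / 2"
  have e: "exp (- t) * exp (- t) = 1 - 2 * s" using s by (simp add: t_def flip: exp_add)
  have t: "0 \<le> t" using s by (simp add: t_def)
  have ts: "sinh t * exp (- t) = s"
  proof -
    have "sinh t * exp (- t) = (exp t * exp (- t) - exp (- t) * exp (- t)) / 2"
      by (simp add: sinh_def algebra_simps)
    also have "exp t * exp (- t) = 1" by (simp flip: exp_add)
    finally show ?thesis unfolding e by simp
  qed
  have pos: "0 < vol_density \<phi> u" if "u \<in> U" for u by (rule local_param_vol_density_pos[OF ncD(2,1) that])
  have "continuous_on U (\<lambda>u. vol_density (\<lambda>u. \<Phi> t (\<phi> u)) u / vol_density \<phi> u / exp t ^ CARD('n))"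
    using pos by (intro continuous_intros continuous_on_vol_density lpD(1,2) smooth_nchart_parallel[OF nc]) force+
  moreover have "vol_density (\<lambda>u. \<Phi> t (\<phi> u)) u / vol_density \<phi> u / exp t ^ CARD('n) = (\<Sum>j\<le>CARD('n). \<sigma> j (\<phi> u) * s ^ j)"
    if u: "u \<in> U" for u
  proof -
    have "vol_density (\<lambda>u. \<Phi> t (\<phi> u)) u / vol_density \<phi> u = jac t (\<phi> u)"
      using vol_density_parallel[OF nc u t] pos[OF u] by simp
    also have "\<dots> = (\<Sum>j\<le>CARD('n). exp t ^ CARD('n) * (\<sigma> j (\<phi> u) * s ^ j))"
      unfolding jac_elem_sym ts[symmetric]
      by (intro sum.cong refl) (simp add: exp_power_diff power_mult_distrib)
    finally show ?thesis by (simp add: sum_distrib_left[symmetric])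
  qed
  ultimately have "continuous_on U (\<lambda>u. \<Sum>j\<le>CARD('n). \<sigma> j (\<phi> u) * s ^ j)"
    by (rule continuous_on_eq)
  then show "(\<lambda>u. \<Sum>j\<le>CARD('n). \<sigma> j (\<phi> u) * s ^ j) \<in> borel_measurable (restrict_space borel U)"
    by (rule borel_measurable_continuous_on_restrict)
qed simp

lemma weighted_\<sigma>_measurable:
  assumes nc: "nchart U \<phi>" and j: "j \<le> CARD('n)" and B: "B \<in> sets borel" "B \<subseteq> U"
  shows "(\<lambda>u. ennreal (vol_density \<phi> u) * ennreal (\<sigma> j (\<phi> u)) * indicator B u) \<in> borel_measurable borel"
proof -
  note lp = normal_chartD(2)[OF nc]
  have "(\<lambda>u. ennreal (\<sigma> j (\<phi> u))) \<in> borel_measurable (restrict_space borel B)"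
    using measurable_restrict_mono[OF \<sigma>_measurable[OF nc j] B(2)] by measurable
  then have "(\<lambda>u. ennreal (\<sigma> j (\<phi> u)) * indicator B u) \<in> borel_measurable borel"
    using B(1) by (simp add: borel_measurable_restrict_space_iff_ennreal)
  with vol_density_indicator_measurable[OF lp B]
  have "(\<lambda>u. (ennreal (vol_density \<phi> u) * indicator B u) * (ennreal (\<sigma> j (\<phi> u)) * indicator B u)) \<in> borel_measurable borel"
    by (rule borel_measurable_times_ennreal)
  moreover have "(ennreal (vol_density \<phi> u) * indicator B u) * (ennreal (\<sigma> j (\<phi> u)) * indicator B u) =
     ennreal (vol_density \<phi> u) * ennreal (\<sigma> j (\<phi> u)) * indicator B u" for u
    by (cases "u \<in> B") auto
  ultimately show ?thesis by simp
qed

text \<open>Unnormalized curvature integrals, with values in \<open>ennreal\<close>: nonnegativity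
  of the shifted curvatures makes them meaningful before finiteness is known.\<close>

definition A\<sigma> :: "nat \<Rightarrow> ennreal" where
  "A\<sigma> j = (\<integral>\<^sup>+p. ennreal (\<sigma> j p) \<partial>area_measure M)"

lemma A\<sigma>_charts:
  assumes ch: "charts m U \<phi> B" and j: "j \<le> CARD('n)"
  shows "A\<sigma> j = (\<Sum>i<m. \<integral>\<^sup>+u\<in>B i. ennreal (vol_density (\<phi> i) u) * ennreal (\<sigma> j (\<phi> i u)) \<partial>lborel)"
    and "(\<lambda>p. \<sigma> j p) \<in> borel_measurable (area_measure M)"
proof -
  have cp: "chart_partition M m U \<phi> B" and nc: "\<And>i. i < m \<Longrightarrow> nchart (U i) (\<phi> i)"
    using ch by (auto simp: charts_def)
  note area = area_measure_nn_integral[OF cp closed_M M_hyp]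
  have meas: "(\<lambda>p. \<sigma> j p) \<in> borel_measurable (restrict_space borel M)"
    by (rule chart_partition_measurable[OF cp closed_M]) (rule \<sigma>_measurable[OF nc j])
  show "A\<sigma> j = (\<Sum>i<m. \<integral>\<^sup>+u\<in>B i. ennreal (vol_density (\<phi> i) u) * ennreal (\<sigma> j (\<phi> i u)) \<partial>lborel)"
    unfolding A\<sigma>_def using meas by (intro area(2)) measurable
  show "(\<lambda>p. \<sigma> j p) \<in> borel_measurable (area_measure M)"
    using meas measurable_cong_sets[OF area(1) refl] by blast
qed

text \<open>The Borel pieces and chart domains stay the same for every \<open>\<rho>\<close>, so
  integrals over different parallel hypersurfaces are compared under the integral sign.\<close>

lemma chart_partition_parallel:
  assumes ch: "charts m U \<phi> B" and \<rho>: "0 < \<rho>"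
  shows "chart_partition (hbd (parallel_body \<Omega> \<rho>)) m U (\<lambda>i u. \<Phi> \<rho> (\<phi> i u)) B"
proof -
  have cp: "chart_partition M m U \<phi> B" and nc: "\<And>i. i < m \<Longrightarrow> nchart (U i) (\<phi> i)"
    using ch by (auto simp: charts_def)
  note cpD = chart_partitionD[OF cp]
  have img: "(\<lambda>u. \<Phi> \<rho> (\<phi> i u)) ` B i = \<Phi> \<rho> ` \<phi> i ` B i" for i by (simp add: image_image)
  have sub: "\<phi> i ` B i \<subseteq> M" if "i < m" for i using cpD(6) that by blast
  have inj: "inj_on (\<Phi> \<rho>) M" using \<Phi>_inj(2) \<rho> by (intro inj_onI) (blast intro: less_imp_le)
  have "disjoint_family_on (\<lambda>i. \<Phi> \<rho> ` \<phi> i ` B i) {..<m}"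
    unfolding disjoint_family_on_def
  proof (intro ballI impI)
    fix i j assume ij: "i \<in> {..<m}" "j \<in> {..<m}" "i \<noteq> j"
    then have "\<phi> i ` B i \<inter> \<phi> j ` B j = {}" using cpD(5) unfolding disjoint_family_on_def by blast
    moreover have "\<Phi> \<rho> ` \<phi> i ` B i \<inter> \<Phi> \<rho> ` \<phi> j ` B j = \<Phi> \<rho> ` (\<phi> i ` B i \<inter> \<phi> j ` B j)"
      using ij sub by (intro inj_on_image_Int[OF inj, symmetric]) auto
    ultimately show "\<Phi> \<rho> ` \<phi> i ` B i \<inter> \<Phi> \<rho> ` \<phi> j ` B j = {}" by simp
  qed
  moreover have "(\<Union>i<m. \<Phi> \<rho> ` \<phi> i ` B i) = hbd (parallel_body \<Omega> \<rho>)"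
    unfolding hbd_parallel_body[OF \<rho>] cpD(6)[symmetric] by blast
  ultimately show ?thesis
    unfolding chart_partition_def img
    using normal_chartD(2)[OF normal_chart_parallel[OF nc \<rho>]] cpD(2-4) by auto
qed

lemma closed_hbd_parallel_body: "0 < \<rho> \<Longrightarrow> closed (hbd (parallel_body \<Omega> \<rho>))"
proof -
  have "closedin (top_of_set hyp) (hbd (parallel_body \<Omega> \<rho>))" by (rule closedin_frontier_of)
  then show ?thesis using closed_hyp closedin_closed_eq by blast
qed

lemma hbd_parallel_body_hyp: "0 < \<rho> \<Longrightarrow> hbd (parallel_body \<Omega> \<rho>) \<subseteq> hyp"
  unfolding hbd_parallel_body using \<Phi>_hyp by blast

text \<open>The factor \<open>jac\<close> in the density cancels the one in
  \<open>elem_sym_parallel\<close>, leaving a combination of the \<open>\<sigma> j\<close> with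
  constants \<open>c j\<close> that do not depend on the point. The other three claims are what
  passing from nonnegative to real integrals requires.\<close>

lemma elem_sym_integral_parallel:
  assumes \<rho>: "0 < \<rho>" and k: "k \<le> CARD('n)"
  defines "c \<equiv> \<lambda>j. exp \<rho> ^ (CARD('n) - j) * (real (j choose k) * exp (- \<rho>) ^ k * sinh \<rho> ^ (j - k))"
  shows "(\<integral>\<^sup>+q. ennreal (elem_sym k (shifted_curvatures (parallel_body \<Omega> \<rho>) q)) \<partial>area_measure (hbd (parallel_body \<Omega> \<rho>))) =
      (\<Sum>j\<le>CARD('n). A\<sigma> j * ennreal (c j))"
    and "(\<lambda>q. elem_sym k (shifted_curvatures (parallel_body \<Omega> \<rho>) q)) \<in>
      borel_measurable (area_measure (hbd (parallel_body \<Omega> \<rho>)))"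
    and "\<And>q. q \<in> hbd (parallel_body \<Omega> \<rho>) \<Longrightarrow> 0 \<le> elem_sym k (shifted_curvatures (parallel_body \<Omega> \<rho>) q)"
    and "space (area_measure (hbd (parallel_body \<Omega> \<rho>))) = hbd (parallel_body \<Omega> \<rho>)"
proof -
  let ?n = "CARD('n)" and ?M = "hbd (parallel_body \<Omega> \<rho>)"
  let ?e = "\<lambda>q. elem_sym k (shifted_curvatures (parallel_body \<Omega> \<rho>) q)"
  have \<rho>0: "0 \<le> \<rho>" using \<rho> by simp
  obtain m U \<phi> B where ch: "charts m U \<phi> B" by (rule charts_exist)
  have cp: "chart_partition M m U \<phi> B" and nc: "\<And>i. i < m \<Longrightarrow> nchart (U i) (\<phi> i)"
    using ch by (auto simp: charts_def)
  note cpD = chart_partitionD[OF cp]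
  note cp' = chart_partition_parallel[OF ch \<rho>]
  note area = area_measure_nn_integral[OF cp' closed_hbd_parallel_body[OF \<rho>] hbd_parallel_body_hyp[OF \<rho>]]
  have c: "0 \<le> c j" for j unfolding c_def using \<rho> by simp
  have e: "?e (\<Phi> \<rho> p) = (\<Sum>j\<le>?n. \<sigma> j p * c j) / jac \<rho> p" if p: "p \<in> M" for p
    using elem_sym_parallel[OF p \<rho> k] jac_pos[OF p \<rho>0] unfolding c_def by (simp add: field_simps)
  have e0: "0 \<le> ?e (\<Phi> \<rho> p)" if p: "p \<in> M" for p
    unfolding e[OF p] using \<sigma>_nonneg[OF p] c jac_pos[OF p \<rho>0]
    by (intro divide_nonneg_pos sum_nonneg mult_nonneg_nonneg) auto
  show "0 \<le> ?e q" if "q \<in> ?M" for q using that e0 unfolding hbd_parallel_body[OF \<rho>] by blast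
  have meas: "?e \<in> borel_measurable (restrict_space borel ?M)"
  proof (rule chart_partition_measurable[OF cp' closed_hbd_parallel_body[OF \<rho>]])
    fix i assume i: "i < m"
    have "(\<lambda>u. (\<Sum>j\<le>?n. \<sigma> j (\<phi> i u) * c j) / jac \<rho> (\<phi> i u)) \<in> borel_measurable (restrict_space borel (U i))"
      unfolding jac_elem_sym
      by (intro borel_measurable_divide borel_measurable_sum borel_measurable_times borel_measurable_const
          \<sigma>_measurable[OF nc[OF i]]) auto
    moreover have "?e (\<Phi> \<rho> (\<phi> i u)) = (\<Sum>j\<le>?n. \<sigma> j (\<phi> i u) * c j) / jac \<rho> (\<phi> i u)" if "u \<in> U i" for u
      by (rule e[OF nchart_image[OF nc[OF i] that]])
    ultimately show "(\<lambda>u. ?e (\<Phi> \<rho> (\<phi> i u))) \<in> borel_measurable (restrict_space borel (U i))"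
      by (subst measurable_cong[where g = "\<lambda>u. (\<Sum>j\<le>?n. \<sigma> j (\<phi> i u) * c j) / jac \<rho> (\<phi> i u)"])
        (simp_all add: space_restrict_space)
  qed
  then show "?e \<in> borel_measurable (area_measure ?M)" using measurable_cong_sets[OF area(1) refl] by blast
  show "space (area_measure ?M) = ?M"
    using sets_eq_imp_space_eq[OF area(1)] by (simp add: space_restrict_space)
  have "(\<integral>\<^sup>+q. ennreal (?e q) \<partial>area_measure ?M) =
    (\<Sum>i<m. \<integral>\<^sup>+u\<in>B i. ennreal (vol_density (\<lambda>u. \<Phi> \<rho> (\<phi> i u)) u) * ennreal (?e (\<Phi> \<rho> (\<phi> i u))) \<partial>lborel)"
    using meas by (intro area(2)) measurable
  also have "\<dots> = (\<Sum>i<m. \<integral>\<^sup>+u. (\<Sum>j\<le>?n. ennreal (vol_density (\<phi> i) u) * ennreal (\<sigma> j (\<phi> i u)) * indicator (B i) u * ennreal (c j)) \<partial>lborel)"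
  proof (intro sum.cong refl nn_integral_cong)
    fix i u assume "i \<in> {..<m}"
    then have i: "i < m" by simp
    show "ennreal (vol_density (\<lambda>u. \<Phi> \<rho> (\<phi> i u)) u) * ennreal (?e (\<Phi> \<rho> (\<phi> i u))) * indicator (B i) u =
      (\<Sum>j\<le>?n. ennreal (vol_density (\<phi> i) u) * ennreal (\<sigma> j (\<phi> i u)) * indicator (B i) u * ennreal (c j))"
    proof (cases "u \<in> B i")
      case True
      then have u: "u \<in> U i" using cpD(3)[OF i] by blast
      let ?p = "\<phi> i u"
      have p: "?p \<in> M" by (rule nchart_image[OF nc[OF i] u])
      note lp = normal_chartD(1,2)[OF nc[OF i]]
      have v0: "0 \<le> vol_density (\<phi> i) u" using local_param_vol_density_pos[OF lp(2,1) u] by simp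
      have "vol_density (\<lambda>u. \<Phi> \<rho> (\<phi> i u)) u * ?e (\<Phi> \<rho> ?p) = vol_density (\<phi> i) u * (\<Sum>j\<le>?n. \<sigma> j ?p * c j)"
        unfolding vol_density_parallel[OF nc[OF i] u \<rho>0] e[OF p] using jac_pos[OF p \<rho>0] by simp
      also have "\<dots> = (\<Sum>j\<le>?n. vol_density (\<phi> i) u * \<sigma> j ?p * c j)" by (simp add: sum_distrib_left mult.assoc)
      finally have "ennreal (vol_density (\<lambda>u. \<Phi> \<rho> (\<phi> i u)) u * ?e (\<Phi> \<rho> ?p)) = (\<Sum>j\<le>?n. ennreal (vol_density (\<phi> i) u * \<sigma> j ?p * c j))"
        using v0 \<sigma>_nonneg[OF p] c by (simp add: sum_ennreal)
      then show ?thesis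
        using True v0 \<sigma>_nonneg[OF p] c
        by (simp only: indicator_simps mult_1_right ennreal_mult''[OF e0[OF p], symmetric] ennreal_mult''[OF \<sigma>_nonneg[OF p], symmetric]
            ennreal_mult''[OF c, symmetric])
    qed simp
  qed
  also have "\<dots> = (\<Sum>i<m. \<Sum>j\<le>?n. (\<integral>\<^sup>+u\<in>B i. ennreal (vol_density (\<phi> i) u) * ennreal (\<sigma> j (\<phi> i u)) \<partial>lborel) * ennreal (c j))"
  proof (intro sum.cong refl)
    fix i assume "i \<in> {..<m}"
    then have i: "i < m" by simp
    have wm: "(\<lambda>u. ennreal (vol_density (\<phi> i) u) * ennreal (\<sigma> j (\<phi> i u)) * indicator (B i) u) \<in> borel_measurable lborel"
      if "j \<le> ?n" for j
      using weighted_\<sigma>_measurable[OF nc[OF i] that cpD(2,3)[OF i]] by simp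
    have "(\<integral>\<^sup>+u. (\<Sum>j\<le>?n. ennreal (vol_density (\<phi> i) u) * ennreal (\<sigma> j (\<phi> i u)) * indicator (B i) u * ennreal (c j)) \<partial>lborel)
      = (\<Sum>j\<le>?n. \<integral>\<^sup>+u. ennreal (vol_density (\<phi> i) u) * ennreal (\<sigma> j (\<phi> i u)) * indicator (B i) u * ennreal (c j) \<partial>lborel)"
      by (intro nn_integral_sum borel_measurable_times_ennreal[OF wm borel_measurable_const]) simp
    also have "\<dots> = (\<Sum>j\<le>?n. (\<integral>\<^sup>+u\<in>B i. ennreal (vol_density (\<phi> i) u) * ennreal (\<sigma> j (\<phi> i u)) \<partial>lborel) * ennreal (c j))"
      by (intro sum.cong refl nn_integral_multc wm) simp
    finally show "(\<integral>\<^sup>+u. (\<Sum>j\<le>?n. ennreal (vol_density (\<phi> i) u) * ennreal (\<sigma> j (\<phi> i u)) * indicator (B i) u * ennreal (c j)) \<partial>lborel)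
      = (\<Sum>j\<le>?n. (\<integral>\<^sup>+u\<in>B i. ennreal (vol_density (\<phi> i) u) * ennreal (\<sigma> j (\<phi> i u)) \<partial>lborel) * ennreal (c j))" .
  qed
  also have "\<dots> = (\<Sum>j\<le>?n. A\<sigma> j * ennreal (c j))"
    by (subst sum.swap) (intro sum.cong refl, simp add: A\<sigma>_charts(1)[OF ch] sum_distrib_right)
  finally show "(\<integral>\<^sup>+q. ennreal (?e q) \<partial>area_measure ?M) = (\<Sum>j\<le>?n. A\<sigma> j * ennreal (c j))" .
qed

text \<open>For order 0 and distance 1 the expansion equates the area of a parallel hypersurface
  with a sum in which every \<open>A\<sigma> j\<close> has a positive coefficient; that area is
  finite because each chart piece lies in a compact part of its chart domain.\<close>

lemma A\<sigma>_finite: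
  assumes j: "j \<le> CARD('n)"
  shows "A\<sigma> j < \<infinity>"
proof -
  let ?c = "\<lambda>j. exp 1 ^ (CARD('n) - j) * (real (j choose 0) * exp (- 1) ^ 0 * sinh 1 ^ (j - 0)) :: real"
  let ?M = "hbd (parallel_body \<Omega> 1)"
  obtain m U \<phi> B where ch: "charts m U \<phi> B" by (rule charts_exist)
  have one: "(0::real) < 1" by simp
  note cp' = chart_partition_parallel[OF ch one]
  note area = area_measure_nn_integral[OF cp' closed_hbd_parallel_body[OF one] hbd_parallel_body_hyp[OF one]]
  have "(\<Sum>j\<le>CARD('n). A\<sigma> j * ennreal (?c j)) = (\<integral>\<^sup>+q. 1 \<partial>area_measure ?M)"
    using elem_sym_integral_parallel(1)[OF one, of 0] by (simp add: elem_sym_0)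
  also have "\<dots> = (\<Sum>i<m. \<integral>\<^sup>+u\<in>B i. ennreal (vol_density (\<lambda>u. \<Phi> 1 (\<phi> i u)) u) * 1 \<partial>lborel)"
    by (rule area(2)) simp
  also have "\<dots> < \<infinity>"
    using chart_partition_finite[OF cp'] by (simp add: less_top[symmetric])
  finally have "(\<Sum>j\<le>CARD('n). A\<sigma> j * ennreal (?c j)) < \<infinity>" .
  then have "A\<sigma> j * ennreal (?c j) < \<infinity>" using j by (simp add: less_top[symmetric])
  moreover have "0 < ?c j" by simp
  then have "ennreal (?c j) \<noteq> 0" by (simp only: ennreal_eq_0_iff not_le)
  ultimately show ?thesis by (auto simp: ennreal_mult_less_top less_top[symmetric] ennreal_mult_eq_top_iff)
qed

lemma norm_elem_sym_integral:
  assumes "f \<in> borel_measurable N" "\<And>q. q \<in> space N \<Longrightarrow> 0 \<le> f q" "(\<integral>\<^sup>+q. ennreal (f q) \<partial>N) = ennreal r" "0 \<le> r"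
  shows "(\<integral>q. f q / c \<partial>N) = r / c"
proof -
  have "(\<integral>q. f q \<partial>N) = r"
    using integral_eq_nn_integral[OF assms(1)] assms(2-4) by (simp add: AE_I2)
  then show ?thesis by simp
qed

lemma curv_integral_eq: "k \<le> CARD('n) \<Longrightarrow> curv_integral k \<Omega> = enn2real (A\<sigma> k) / real (CARD('n) choose k)"
proof -
  assume k: "k \<le> CARD('n)"
  obtain m U \<phi> B where ch: "charts m U \<phi> B" by (rule charts_exist)
  then have cp: "chart_partition M m U \<phi> B" by (simp add: charts_def)
  have sp: "space (area_measure M) = M"
    using sets_eq_imp_space_eq[OF area_measure_nn_integral(1)[OF cp closed_M M_hyp]] by (simp add: space_restrict_space)
  show ?thesis unfolding curv_integral_def norm_elem_sym_def
  proof (rule norm_elem_sym_integral)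
    show "(\<lambda>p. \<sigma> k p) \<in> borel_measurable (area_measure M)" by (rule A\<sigma>_charts(2)[OF ch k])
    show "0 \<le> \<sigma> k q" if "q \<in> space (area_measure M)" for q using \<sigma>_nonneg that sp by simp
    show "(\<integral>\<^sup>+q. ennreal (\<sigma> k q) \<partial>area_measure M) = ennreal (enn2real (A\<sigma> k))"
      using A\<sigma>_finite[OF k] by (simp add: A\<sigma>_def)
  qed simp
qed

definition steiner :: "nat \<Rightarrow> real \<Rightarrow> real" where
  "steiner k t = (\<Sum>i=k..CARD('n). real ((CARD('n) - k) choose (i - k)) * curv_integral i \<Omega> *
     (exp ((real CARD('n) - real k - real i) * t) * sinh t ^ (i - k)))"

text \<open>The exponentials from the density and from the curvatures combine to the exponent
  \<open>n - k - i\<close>, and \<open>choose_mult\<close> trades the binomials of the expansion for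
  those of the normalized functions. Distance 0 is separate, since the charts of parallel
  hypersurfaces are set up for positive \<open>\<rho>\<close>.\<close>

lemma curv_integral_parallel:
  assumes \<rho>: "0 \<le> \<rho>" and k: "k \<le> CARD('n)"
  shows "curv_integral k (parallel_body \<Omega> \<rho>) = steiner k \<rho>"
proof (cases "\<rho> = 0")
  case True
  have "steiner k 0 = (\<Sum>i=k..CARD('n). if i = k then curv_integral k \<Omega> else 0)"
    unfolding steiner_def by (intro sum.cong refl) auto
  then show ?thesis using True parallel_body_0 k by simp
next
  case False
  then have \<rho>: "0 < \<rho>" using \<rho> by simp
  let ?n = "CARD('n)"
  let ?c = "\<lambda>j. exp \<rho> ^ (?n - j) * (real (j choose k) * exp (- \<rho>) ^ k * sinh \<rho> ^ (j - k))"
  note es = elem_sym_integral_parallel[OF \<rho> k]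
  let ?a = "\<lambda>j. enn2real (A\<sigma> j)"
  have a: "A\<sigma> j = ennreal (?a j)" if "j \<le> ?n" for j using A\<sigma>_finite[OF that] by simp
  have c: "0 \<le> ?c j" for j using \<rho> by simp
  have "(\<Sum>j\<le>?n. A\<sigma> j * ennreal (?c j)) = (\<Sum>j\<le>?n. ennreal (?a j * ?c j))"
    using c a by (intro sum.cong refl) (simp only: atMost_iff ennreal_mult[OF enn2real_nonneg c])
  also have "\<dots> = ennreal (\<Sum>j\<le>?n. ?a j * ?c j)"
    by (rule sum_ennreal) (rule mult_nonneg_nonneg[OF enn2real_nonneg c])
  finally have nn: "(\<integral>\<^sup>+q. ennreal (elem_sym k (shifted_curvatures (parallel_body \<Omega> \<rho>) q)) \<partial>area_measure (hbd (parallel_body \<Omega> \<rho>))) =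
      ennreal (\<Sum>j\<le>?n. ?a j * ?c j)" using es(1) by simp
  have "curv_integral k (parallel_body \<Omega> \<rho>) = (\<Sum>j\<le>?n. ?a j * ?c j) / real (?n choose k)"
    unfolding curv_integral_def norm_elem_sym_def
    by (rule norm_elem_sym_integral[OF es(2) _ nn])
      (simp only: es(3,4), intro sum_nonneg mult_nonneg_nonneg[OF enn2real_nonneg c])
  also have "(\<Sum>j\<le>?n. ?a j * ?c j) = (\<Sum>j=k..?n. ?a j * ?c j)"
    by (rule sum.mono_neutral_right) auto
  also have "\<dots> / real (?n choose k) = (\<Sum>j=k..?n. ?a j * ?c j / real (?n choose k))"
    by (rule sum_divide_distrib)
  also have "\<dots> = steiner k \<rho>" unfolding steiner_def
  proof (rule sum.cong[OF refl])
    fix j assume "j \<in> {k..?n}"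
    then have j: "k \<le> j" "j \<le> ?n" by auto
    have "(?n choose j) * (j choose k) = (?n choose k) * ((?n - k) choose (j - k))"
      by (rule choose_mult[OF j])
    then have "real (?n choose j) * real (j choose k) = real (?n choose k) * real ((?n - k) choose (j - k))"
      by (metis of_nat_mult)
    moreover have "?n choose k > 0" "?n choose j > 0" using k j by simp_all
    moreover have "exp \<rho> ^ (?n - j) * exp (- \<rho>) ^ k = exp ((real ?n - real k - real j) * \<rho>)"
      using j by (simp add: exp_of_nat_mult[symmetric] exp_add[symmetric] of_nat_diff algebra_simps)
    ultimately have bin: "real (j choose k) / real (?n choose k) = real ((?n - k) choose (j - k)) / real (?n choose j)"
      and ex: "exp \<rho> ^ (?n - j) * exp (- \<rho>) ^ k = exp ((real ?n - real k - real j) * \<rho>)"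
      by (simp_all add: field_simps)
    have "?a j * ?c j / real (?n choose k) =
      ?a j * (real (j choose k) / real (?n choose k)) * (exp \<rho> ^ (?n - j) * exp (- \<rho>) ^ k) * sinh \<rho> ^ (j - k)"
      by simp
    also have "\<dots> = real ((?n - k) choose (j - k)) * (?a j / real (?n choose j)) *
        (exp ((real ?n - real k - real j) * \<rho>) * sinh \<rho> ^ (j - k))"
      unfolding bin ex by simp
    finally show "?a j * ?c j / real (?n choose k) = real ((?n - k) choose (j - k)) * curv_integral j \<Omega> *
        (exp ((real ?n - real k - real j) * \<rho>) * sinh \<rho> ^ (j - k))"
      unfolding curv_integral_eq[OF j(2)] .
  qed
  finally show ?thesis .
qed

lemma area_eq_curv_integral_0:
  assumes "space (area_measure N) = N" "N = hbd \<Omega>'"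
  shows "measure (area_measure N) N = curv_integral 0 \<Omega>'"
  unfolding curv_integral_def norm_elem_sym_def elem_sym_0 using assms by simp

text \<open>With \<open>cosh t = sinh t + exp (- t)\<close> the derivative of each summand splits:
  the \<open>sinh\<close> parts collect the factor \<open>(n - k - i) + (i - k) = n - 2 k\<close>,
  and the \<open>exp (- t)\<close> part is a summand of index \<open>k + 1\<close>, with binomials
  matched by \<open>(i - k) * (n - k choose i - k) = (n - k) * (n - k - 1 choose i - k -
  1)\<close>.\<close>

lemma steiner_derivative:
  assumes k: "k < CARD('n)"
  shows "(steiner k has_real_derivative
    (real CARD('n) - 2 * real k) * steiner k t + (real CARD('n) - real k) * steiner (Suc k) t) (at t)"
proof -
  let ?n = "CARD('n)"
  let ?T = "\<lambda>k i t. exp ((real ?n - real k - real i) * t) * sinh t ^ (i - k) :: real"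
  have T: "((\<lambda>t. ?T k i t) has_real_derivative (real ?n - 2 * real k) * ?T k i t + real (i - k) * ?T (Suc k) i t) (at t)"
    if i: "k \<le> i" for i
  proof -
    have d: "((\<lambda>t. ?T k i t) has_real_derivative
      (real ?n - real k - real i) * ?T k i t +
      exp ((real ?n - real k - real i) * t) * (real (i - k) * sinh t ^ (i - k - 1) * cosh t)) (at t)"
      by (auto intro!: derivative_eq_intros simp: algebra_simps)
    have "(real ?n - real k - real i) * ?T k i t + exp ((real ?n - real k - real i) * t) * (real (i - k) * sinh t ^ (i - k - 1) * cosh t)
      = (real ?n - 2 * real k) * ?T k i t + real (i - k) * ?T (Suc k) i t"
    proof (cases "i = k")
      case False
      define d where "d = i - Suc k"
      have d: "i = Suc k + d" "i - k = Suc d" "i - Suc k = d" using False i by (auto simp: d_def)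
      have c: "cosh t = sinh t + exp (- t)" using cosh_minus_sinh[of t] by simp
      have e: "exp ((real ?n - real (Suc k) - real i) * t) = exp ((real ?n - real k - real i) * t) * exp (- t)"
        by (simp add: exp_add[symmetric] algebra_simps)
      have r: "real i = real k + 1 + real d" using d(1) by simp
      show ?thesis unfolding e c d(2,3) by (simp add: r algebra_simps)
    qed (simp add: algebra_simps)
    then show ?thesis using d by simp
  qed
  let ?b = "\<lambda>k i. real ((?n - k) choose (i - k)) * curv_integral i \<Omega>"
  have "(steiner k has_real_derivative (\<Sum>i=k..?n. ?b k i * ((real ?n - 2 * real k) * ?T k i t + real (i - k) * ?T (Suc k) i t))) (at t)"
    unfolding steiner_def[abs_def] by (intro DERIV_sum DERIV_cmult T) simp
  moreover have "(\<Sum>i=k..?n. ?b k i * ((real ?n - 2 * real k) * ?T k i t + real (i - k) * ?T (Suc k) i t)) =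
      (real ?n - 2 * real k) * steiner k t + (\<Sum>i=k..?n. ?b k i * (real (i - k) * ?T (Suc k) i t))"
    unfolding steiner_def sum_distrib_left sum.distrib[symmetric]
    by (intro sum.cong refl) (simp only: distrib_left mult_ac)
  moreover have "(\<Sum>i=k..?n. ?b k i * (real (i - k) * ?T (Suc k) i t)) = (real ?n - real k) * steiner (Suc k) t"
  proof -
    have "(\<Sum>i=k..?n. ?b k i * (real (i - k) * ?T (Suc k) i t)) = (\<Sum>i=Suc k..?n. ?b k i * (real (i - k) * ?T (Suc k) i t))"
      using k by (simp add: sum.atLeast_Suc_atMost)
    also have "\<dots> = (\<Sum>i=Suc k..?n. (real ?n - real k) * (?b (Suc k) i * ?T (Suc k) i t))"
    proof (rule sum.cong[OF refl])
      fix i assume "i \<in> {Suc k..?n}"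
      then obtain d where d: "i = Suc k + d" by (auto dest!: le_Suc_ex)
      have "Suc d * ((?n - k) choose Suc d) = (?n - k) * ((?n - k - 1) choose d)" by (rule binomial_absorption)
      then have "real (Suc d) * real ((?n - k) choose Suc d) = real (?n - k) * real ((?n - Suc k) choose d)"
        by (metis of_nat_mult diff_Suc_eq_diff_pred diff_commute diff_diff_left plus_1_eq_Suc add.commute)
      moreover have "real (?n - k) = real ?n - real k" using k by simp
      moreover have "i - k = Suc d" "i - Suc k = d" using d by auto
      ultimately have "real ((?n - k) choose (i - k)) * real (i - k) = (real ?n - real k) * real ((?n - Suc k) choose (i - Suc k))"
        by (simp add: mult.commute)
      moreover have "a * c * (r * T) = m * (b * c * T)" if "a * r = m * b" for a b c m r T :: real
        using that by algebra
      ultimately show "?b k i * (real (i - k) * ?T (Suc k) i t) = (real ?n - real k) * (?b (Suc k) i * ?T (Suc k) i t)"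
        by blast
    qed
    finally show ?thesis unfolding steiner_def by (simp add: sum_distrib_left)
  qed
  ultimately show ?thesis by simp
qed

end

section \<open>Volume of parallel bodies\<close>

lemma continuous_on_hyp_chart_density: "continuous_on S (vol_density hyp_chart)"
  using continuous_on_vol_density[OF open_UNIV smooth_hyp_chart] continuous_on_subset by blast

lemma hyp_chart_density_nonneg: "0 \<le> vol_density hyp_chart x"
proof -
  have d: "(hyp_chart has_derivative frechet_derivative hyp_chart (at x)) (at x)"
    by (rule smooth_on_has_derivative[OF smooth_hyp_chart]) simp
  show ?thesis
    by (rule vol_density_pos(2)[OF d], rule lor_tangent_nonneg[OF hyp_chart_in_hyp],
      rule derivative_in_hyp_tangent[OF d open_UNIV UNIV_I hyp_chart_in_hyp])
qed

lemma closed_hyp_chart_vimage: "closed A \<Longrightarrow> closed {x. hyp_chart x \<in> A}"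
  using closed_vimage[OF _ continuous_on_hyp_chart, of A] by (simp add: vimage_def)

lemma hvol_eq_nn_integral:
  assumes "closed A"
  shows "hvol A = enn2real (\<integral>\<^sup>+x\<in>{x. hyp_chart x \<in> A}. ennreal (vol_density hyp_chart x) \<partial>lborel)"
proof -
  let ?W = "{x. hyp_chart x \<in> A}"
  have W: "?W \<in> sets borel" using closed_hyp_chart_vimage[OF assms] by (rule borel_closed)
  have v: "vol_density hyp_chart \<in> borel_measurable borel"
    by (intro borel_measurable_continuous_onI continuous_on_hyp_chart_density)
  have "hvol A = enn2real (\<integral>\<^sup>+x. ennreal (indicator ?W x *\<^sub>R vol_density hyp_chart x) \<partial>lborel)"
    unfolding hvol_def set_lebesgue_integral_def
    using borel_measurable_scaleR[OF borel_measurable_indicator[OF W] v]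
    by (intro integral_eq_nn_integral AE_I2) (simp_all add: hyp_chart_density_nonneg)
  also have "(\<integral>\<^sup>+x. ennreal (indicator ?W x *\<^sub>R vol_density hyp_chart x) \<partial>lborel)
      = (\<integral>\<^sup>+x\<in>?W. ennreal (vol_density hyp_chart x) \<partial>lborel)"
    by (intro nn_integral_cong) (simp add: indicator_def)
  finally show ?thesis .
qed

text \<open>The vertical projection maps compact sets to compact sets, and the density is
  continuous.\<close>

lemma hvol_compact_finite:
  assumes "compact A" "A \<subseteq> hyp"
  shows "(\<integral>\<^sup>+x\<in>{x. hyp_chart x \<in> A}. ennreal (vol_density hyp_chart x) \<partial>lborel) < \<infinity>"
proof -
  let ?W = "{x. hyp_chart x \<in> A}"
  have "?W = fst ` A"
  proof (intro set_eqI iffI)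
    fix x assume "x \<in> ?W"
    then show "x \<in> fst ` A" using fst_hyp_chart[of x] by (metis image_eqI mem_Collect_eq)
  next
    fix x assume "x \<in> fst ` A"
    then obtain y where "y \<in> A" "x = fst y" by blast
    then show "x \<in> ?W" using hyp_chart_fst[of y] assms(2) by auto
  qed
  then have "compact ?W" using compact_continuous_image[OF continuous_on_fst[OF continuous_on_id] assms(1)] by (simp only:)
  from borel_integrable_compact[OF this continuous_on_hyp_chart_density]
  have "(\<integral>\<^sup>+x. norm (indicator ?W x *\<^sub>R vol_density hyp_chart x) \<partial>lborel) < \<infinity>"
    by (simp only: integrable_iff_bounded)
  moreover have "ennreal (norm (indicator ?W x *\<^sub>R vol_density hyp_chart x)) = ennreal (vol_density hyp_chart x) * indicator ?W x" for x
    using hyp_chart_density_nonneg[of x] by (simp add: indicator_def)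
  ultimately show ?thesis by simp
qed

section \<open>Collar coordinates and the volume of the collar\<close>

abbreviation drop_coord :: "real^('n option) \<Rightarrow> real^'n" where
  "drop_coord z \<equiv> \<chi> j. z $ Some j"

lemma linear_drop_coord: "linear drop_coord"
  by (rule linearI) (auto simp: vec_eq_iff)

lemma drop_coord_axis: "drop_coord (axis None 1) = 0" "drop_coord (axis (Some i) 1) = axis i 1"
  by (auto simp: vec_eq_iff axis_def)

text \<open>Tonelli in collar coordinates; the product form is what the expansion of
  \<open>jac\<close> produces.\<close>

lemma nn_integral_append_coord:
  fixes w :: "real^('n::finite) \<Rightarrow> ennreal" and e :: "real \<Rightarrow> ennreal"
  assumes w: "w \<in> borel_measurable borel" and e: "e \<in> borel_measurable borel"
  shows "(\<integral>\<^sup>+z. w (drop_coord z) * e (z $ None) \<partial>lborel) = (\<integral>\<^sup>+u. w u \<partial>lborel) * (\<integral>\<^sup>+t. e t \<partial>lborel)"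
    and "(\<lambda>z. w (drop_coord z) * e (z $ None)) \<in> borel_measurable borel"
proof -
  have d: "(drop_coord :: real^('n option) \<Rightarrow> real^'n) \<in> borel_measurable borel"
    by (intro borel_measurable_continuous_onI linear_continuous_on linear_linear[THEN iffD2] linear_drop_coord)
  have N: "(\<lambda>z :: real^('n option). z $ None) \<in> borel_measurable borel"
    by (intro borel_measurable_continuous_onI continuous_intros)
  show m: "(\<lambda>z. w (drop_coord z) * e (z $ None)) \<in> borel_measurable borel"
    using measurable_compose[OF d w] measurable_compose[OF N e] by (rule borel_measurable_times_ennreal)
  have a: "append_coord \<in> (lborel :: (real^'n) measure) \<Otimes>\<^sub>M (lborel :: real measure) \<rightarrow>\<^sub>M borel"
    unfolding lborel_prod measurable_lborel2
    by (intro borel_measurable_continuous_onI linear_continuous_on linear_linear[THEN iffD2] linear_append_coord)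
  have we: "(\<lambda>p. w (fst p) * e (snd p)) \<in> borel_measurable ((lborel :: (real^'n) measure) \<Otimes>\<^sub>M (lborel :: real measure))"
    by (rule borel_measurable_times_ennreal; rule measurable_compose[OF measurable_fst] measurable_compose[OF measurable_snd])
      (use w e in simp_all)
  have "(\<integral>\<^sup>+z. w (drop_coord z) * e (z $ None) \<partial>lborel) =
      (\<integral>\<^sup>+z. w (drop_coord z) * e (z $ None) \<partial>distr (lborel \<Otimes>\<^sub>M lborel) borel append_coord)"
    by (simp only: distr_append_coord)
  also have "\<dots> = (\<integral>\<^sup>+p. w (drop_coord (append_coord p)) * e (append_coord p $ None) \<partial>(lborel \<Otimes>\<^sub>M lborel))"
    by (rule nn_integral_distr[OF a]) (use m in simp)
  also have "\<dots> = (\<integral>\<^sup>+p. w (fst p) * e (snd p) \<partial>(lborel \<Otimes>\<^sub>M lborel))"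
    by (simp only: append_coord_simps vec_nth_inverse)
  also have "\<dots> = (\<integral>\<^sup>+u. \<integral>\<^sup>+t. w u * e t \<partial>lborel \<partial>lborel)"
    using lborel.nn_integral_fst[OF we] by simp
  also have "\<dots> = (\<integral>\<^sup>+u. w u * (\<integral>\<^sup>+t. e t \<partial>lborel) \<partial>lborel)"
    by (intro nn_integral_cong nn_integral_cmult) (use e in simp)
  also have "\<dots> = (\<integral>\<^sup>+u. w u \<partial>lborel) * (\<integral>\<^sup>+t. e t \<partial>lborel)"
    by (rule nn_integral_multc) (use w in simp)
  finally show "(\<integral>\<^sup>+z. w (drop_coord z) * e (z $ None) \<partial>lborel) = (\<integral>\<^sup>+u. w u \<partial>lborel) * (\<integral>\<^sup>+t. e t \<partial>lborel)" .
qed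

text \<open>A unit direction orthogonal to the remaining ones borders the Gram matrix by a row and
  column of the identity, which does not change the determinant.\<close>

lemma vol_density_orthogonal_line:
  fixes X :: "real^('n option) \<Rightarrow> ('n::finite) minkowski" and Y :: "real^'n \<Rightarrow> 'n minkowski"
  assumes X: "(X has_derivative (\<lambda>h. h $ None *\<^sub>R N + A (drop_coord h))) (at z)" and Y: "(Y has_derivative A) (at u)"
    and N: "lor N N = 1" "\<And>w. lor N (A w) = 0"
  shows "vol_density X z = vol_density Y u"
proof -
  have A0: "A 0 = 0" using Y has_derivative_linear linear_0 by blast
  have N': "lor (A w) N = 0" for w using N(2) lor_sym by metis
  have a: "axis (Some j) 1 $ None = (0::real)" "axis None 1 $ None = (1::real)" for j :: 'n by (simp_all add: axis_def)
  have "det (gram X z) = det (\<chi> i j. gram X z $ Some i $ Some j)"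
    unfolding gram_eq[OF X]
    by (rule det_option_block) (simp_all add: drop_coord_axis a A0 N)
  also have "(\<chi> i j. gram X z $ Some i $ Some j) = gram Y u"
    unfolding gram_eq[OF X] gram_eq[OF Y] by (simp add: drop_coord_axis a)
  finally show ?thesis by (simp add: vol_density_def)
qed

lemma nn_integral_Ioc_eq_integral:
  fixes f :: "real \<Rightarrow> real"
  assumes f: "continuous_on {0..\<rho>} f" "\<And>t. t \<in> {0..\<rho>} \<Longrightarrow> 0 \<le> f t"
  shows "(\<integral>\<^sup>+t\<in>{0<..\<rho>}. ennreal (f t) \<partial>lborel) = ennreal (integral {0..\<rho>} f)"
proof -
  have "(\<integral>\<^sup>+t\<in>{0<..\<rho>}. ennreal (f t) \<partial>lborel) = (\<integral>\<^sup>+t\<in>{0..\<rho>}. ennreal (f t) \<partial>lborel)"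
  proof (rule nn_integral_cong_AE)
    show "AE t in lborel. ennreal (f t) * indicator {0<..\<rho>} t = ennreal (f t) * indicator {0..\<rho>} t"
      using AE_lborel_singleton[of "0::real"] by eventually_elim (auto simp: indicator_def)
  qed
  also have "\<dots> = ennreal (integral {0..\<rho>} f)"
    using f
    by (intro absolutely_integrable_iff_nn_integral(2)[symmetric] absolutely_integrable_continuous_real
        continuous_imp_measurable_on_sets_lebesgue) auto
  finally show ?thesis .
qed

context h_convex_domain
begin

lemma collar_derivative:
  assumes nc: "nchart U \<phi>" and u: "drop_coord z \<in> U"
  defines "t \<equiv> z $ None" and "u \<equiv> drop_coord z"
  shows "((\<lambda>z. \<Phi> (z $ None) (\<phi> (drop_coord z))) has_derivative
    (\<lambda>h. h $ None *\<^sub>R (sinh t *\<^sub>R \<phi> u + cosh t *\<^sub>R \<nu> (\<phi> u)) +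
      (cosh t *\<^sub>R frechet_derivative \<phi> (at u) (drop_coord h) +
       sinh t *\<^sub>R frechet_derivative (\<lambda>u. \<nu> (\<phi> u)) (at u) (drop_coord h)))) (at z)"
proof -
  have uU: "u \<in> U" using u by (simp add: u_def)
  note sh = normal_chart_shape(3,4)[OF nc uU]
  have R: "(drop_coord has_derivative drop_coord) (at z)"
    by (rule linear_imp_has_derivative[OF linear_drop_coord])
  have N: "((\<lambda>z :: real^('n option). z $ None) has_derivative (\<lambda>h. h $ None)) (at z)"
    by (rule bounded_linear_imp_has_derivative[OF bounded_linear_vec_nth])
  have c: "((\<lambda>z :: real^('n option). cosh (z $ None)) has_derivative (\<lambda>h. sinh t * h $ None)) (at z)"
    "((\<lambda>z :: real^('n option). sinh (z $ None)) has_derivative (\<lambda>h. cosh t * h $ None)) (at z)"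
    unfolding t_def
    by (rule has_derivative_compose[OF N], fold has_field_derivative_def, auto intro!: derivative_eq_intros)+
  have p: "((\<lambda>z. \<phi> (drop_coord z)) has_derivative (\<lambda>h. frechet_derivative \<phi> (at u) (drop_coord h))) (at z)"
    using sh(1) unfolding u_def by (rule has_derivative_compose[OF R])
  have n: "((\<lambda>z. \<nu> (\<phi> (drop_coord z))) has_derivative (\<lambda>h. frechet_derivative (\<lambda>u. \<nu> (\<phi> u)) (at u) (drop_coord h))) (at z)"
    using sh(2) unfolding u_def by (rule has_derivative_compose[OF R])
  show ?thesis unfolding hyp_geodesic_def
    by (rule has_derivative_eq_rhs[OF has_derivative_add[OF has_derivative_scaleR[OF c(1) p] has_derivative_scaleR[OF c(2) n]]])
      (simp add: t_def u_def fun_eq_iff scaleR_add_right mult.commute)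
qed

text \<open>A Gauss lemma: the derivative of the collar map in the distance is the unit normal of
  the parallel hypersurface through the point.\<close>

lemma collar_vol_density:
  assumes nc: "nchart U \<phi>" and u: "drop_coord z \<in> U" and t: "0 < z $ None"
  shows "vol_density (\<lambda>z. \<Phi> (z $ None) (\<phi> (drop_coord z))) z =
    jac (z $ None) (\<phi> (drop_coord z)) * vol_density \<phi> (drop_coord z)"
proof -
  note ncD = normal_chartD(6,7)[OF normal_chart_parallel[OF nc t] u]
  have "vol_density (\<lambda>z. \<Phi> (z $ None) (\<phi> (drop_coord z))) z = vol_density (\<lambda>u. \<Phi> (z $ None) (\<phi> u)) (drop_coord z)"
    by (rule vol_density_orthogonal_line[OF collar_derivative[OF nc u] nchart_derivative(1)[OF nc u] ncD(1)])
      (rule ncD(2)[unfolded frechet_derivative_eq[OF nchart_derivative(1)[OF nc u]]])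
  then show ?thesis using vol_density_parallel[OF nc u] t by simp
qed

text \<open>\<open>\<psi>\<close> is the collar map followed by the vertical projection, a map
  between Euclidean spaces of equal dimension, so the change of variables applies. The expansion of
  \<open>jac\<close> separates the variables \<open>u\<close> and \<open>t\<close>.\<close>

lemma collar_volume:
  fixes \<rho> :: real
  assumes nc: "nchart U \<phi>" and B: "B \<in> sets borel" "B \<subseteq> U"
  defines "\<psi> \<equiv> \<lambda>z. fst (\<Phi> (z $ None) (\<phi> (drop_coord z)))"
    and "S \<equiv> {z. drop_coord z \<in> B \<and> z $ None \<in> {0<..\<rho>}}"
  shows "\<psi> ` S \<in> sets borel"
    and "(\<integral>\<^sup>+x\<in>\<psi> ` S. ennreal (vol_density hyp_chart x) \<partial>lborel) =
      (\<Sum>j\<le>CARD('n). (\<integral>\<^sup>+u\<in>B. ennreal (vol_density \<phi> u) * ennreal (\<sigma> j (\<phi> u)) \<partial>lborel) *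
        (\<integral>\<^sup>+t\<in>{0<..\<rho>}. ennreal (sinh t ^ j * exp t ^ (CARD('n) - j)) \<partial>lborel))"
proof -
  let ?O = "{z :: real^('n option). drop_coord z \<in> U \<and> 0 < z $ None}"
  let ?X = "\<lambda>z. \<Phi> (z $ None) (\<phi> (drop_coord z))"
  let ?A = "\<lambda>z h. h $ None *\<^sub>R (sinh (z $ None) *\<^sub>R \<phi> (drop_coord z) + cosh (z $ None) *\<^sub>R \<nu> (\<phi> (drop_coord z))) +
      (cosh (z $ None) *\<^sub>R frechet_derivative \<phi> (at (drop_coord z)) (drop_coord h) +
       sinh (z $ None) *\<^sub>R frechet_derivative (\<lambda>u. \<nu> (\<phi> u)) (at (drop_coord z)) (drop_coord h))"
  note lpD = local_paramD[OF normal_chartD(2)[OF nc]]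
  note hyp = normal_chartD(1)[OF nc]
  have cR: "continuous_on UNIV (drop_coord :: real^('n option) \<Rightarrow> _)"
    by (intro linear_continuous_on linear_linear[THEN iffD2] linear_drop_coord)
  have cN: "continuous_on UNIV (\<lambda>z :: real^('n option). z $ None)" by (intro continuous_intros)
  have "open (drop_coord -` U \<inter> (\<lambda>z :: real^('n option). z $ None) -` {0<..})"
    by (intro open_Int open_vimage lpD(1) cR cN open_greaterThan)
  moreover have "drop_coord -` U \<inter> (\<lambda>z :: real^('n option). z $ None) -` {0<..} = ?O" by auto
  ultimately have O: "open ?O" by simp
  have "drop_coord -` B \<inter> (\<lambda>z :: real^('n option). z $ None) -` {0<..\<rho>} \<in> sets borel"
    using measurable_sets[OF borel_measurable_continuous_onI[OF cR] B(1)]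
      measurable_sets[OF borel_measurable_continuous_onI[OF cN], of "{0<..\<rho>}"] by (intro sets.Int) auto
  moreover have "drop_coord -` B \<inter> (\<lambda>z :: real^('n option). z $ None) -` {0<..\<rho>} = S" by (auto simp: S_def)
  ultimately have S: "S \<in> sets borel" by simp
  have SO: "S \<subseteq> ?O" using B(2) by (auto simp: S_def)
  have inM: "\<phi> (drop_coord z) \<in> M" if "z \<in> ?O" for z using nchart_image[OF nc] that by simp
  have ch: "hyp_chart (\<psi> z) = ?X z" if "z \<in> ?O" for z
    unfolding \<psi>_def by (rule hyp_chart_fst[OF \<Phi>_hyp[OF inM[OF that]]])
  have der: "(\<psi> has_derivative (\<lambda>h. fst (?A z h))) (at z)" if "z \<in> ?O" for z
    unfolding \<psi>_def by (rule has_derivative_fst[OF collar_derivative[OF nc]]) (use that in simp)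
  \<comment> \<open>The vertical projection loses nothing on \<open>hyp\<close>, so this is
    \<open>\<Phi>_inj\<close> together with injectivity of the chart.\<close>
  have inj: "inj_on \<psi> ?O"
  proof (rule inj_onI)
    fix z z' assume z: "z \<in> ?O" "z' \<in> ?O" and eq': "\<psi> z = \<psi> z'"
    from arg_cong[OF eq', of hyp_chart] have eq: "?X z = ?X z'" unfolding ch[OF z(1)] ch[OF z(2)] .
    have p: "0 \<le> z $ None" "0 \<le> z' $ None" using z by auto
    note \<Phi>_inj[OF inM[OF z(1)] inM[OF z(2)] p eq]
    then have e: "z $ None = z' $ None" "drop_coord z = drop_coord z'"
      using lpD(4) z unfolding inj_on_def by blast+
    have "z $ i = z' $ i" for i
      using e(1) arg_cong[OF e(2), of "\<lambda>x. x $ the i"] by (cases i) simp_all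
    then show "z = z'" by (simp add: vec_eq_iff)
  qed
  note cov = nn_integral_change_of_variables_open[OF O der inj open_UNIV subset_UNIV continuous_on_hyp_chart_density
      hyp_chart_density_nonneg S SO]
  show "\<psi> ` S \<in> sets borel" by (rule cov(1))
  \<comment> \<open>The Jacobian of \<open>\<psi>\<close> times the density of
    \<open>hyp_chart\<close> is the density of the composite, which is the collar map
    itself.\<close>
  have dens: "\<bar>det (matrix (\<lambda>h. fst (?A z h)))\<bar> * vol_density hyp_chart (\<psi> z) =
      jac (z $ None) (\<phi> (drop_coord z)) * vol_density \<phi> (drop_coord z)" if z: "z \<in> ?O" for z
  proof -
    have d: "(hyp_chart has_derivative frechet_derivative hyp_chart (at (\<psi> z))) (at (\<psi> z))"
      by (rule smooth_on_has_derivative[OF smooth_hyp_chart]) simp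
    have "\<bar>det (matrix (\<lambda>h. fst (?A z h)))\<bar> * vol_density hyp_chart (\<psi> z) = vol_density (\<lambda>w. hyp_chart (\<psi> w)) z"
      by (rule vol_density_compose[OF d der[OF z], symmetric])
    also have "\<dots> = vol_density ?X z" by (rule vol_density_cong[OF O z ch])
    also have "\<dots> = jac (z $ None) (\<phi> (drop_coord z)) * vol_density \<phi> (drop_coord z)"
      by (rule collar_vol_density[OF nc]) (use z in auto)
    finally show ?thesis .
  qed
  let ?w = "\<lambda>j u. ennreal (vol_density \<phi> u) * ennreal (\<sigma> j (\<phi> u)) * indicator B u"
  let ?e = "\<lambda>j t. ennreal (sinh t ^ j * exp t ^ (CARD('n) - j)) * indicator {0<..\<rho>} t"
  have w: "?w j \<in> borel_measurable borel" if "j \<le> CARD('n)" for j by (rule weighted_\<sigma>_measurable[OF nc that B])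
  have e: "?e j \<in> borel_measurable borel" for j
  proof -
    have "(\<lambda>t::real. sinh t ^ j * exp t ^ (CARD('n) - j)) \<in> borel_measurable borel"
      by (intro borel_measurable_continuous_onI continuous_intros)
    then show ?thesis by measurable
  qed
  have "(\<integral>\<^sup>+x\<in>\<psi> ` S. ennreal (vol_density hyp_chart x) \<partial>lborel) =
      (\<integral>\<^sup>+z\<in>S. ennreal (\<bar>det (matrix (\<lambda>h. fst (?A z h)))\<bar> * vol_density hyp_chart (\<psi> z)) \<partial>lborel)"
    by (rule cov(2))
  also have "\<dots> = (\<integral>\<^sup>+z. (\<Sum>j\<le>CARD('n). ?w j (drop_coord z) * ?e j (z $ None)) \<partial>lborel)"
  proof (rule nn_integral_cong)
    fix z :: "real^('n option)"
    let ?t = "z $ None" and ?u = "drop_coord z"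
    show "ennreal (\<bar>det (matrix (\<lambda>h. fst (?A z h)))\<bar> * vol_density hyp_chart (\<psi> z)) * indicator S z =
      (\<Sum>j\<le>CARD('n). ?w j ?u * ?e j ?t)"
    proof (cases "z \<in> S")
      case True
      then have z: "z \<in> ?O" using SO by blast
      then have t: "0 \<le> ?t" and uU: "?u \<in> U" by auto
      have v0: "0 \<le> vol_density \<phi> ?u" using local_param_vol_density_pos[OF normal_chartD(2)[OF nc] hyp uU] by simp
      have s0: "0 \<le> \<sigma> j (\<phi> ?u)" for j by (rule \<sigma>_nonneg[OF inM[OF z]])
      have e0: "0 \<le> sinh ?t ^ j * exp ?t ^ (CARD('n) - j)" for j using t by simp
      have "ennreal (jac ?t (\<phi> ?u) * vol_density \<phi> ?u) =
        ennreal (\<Sum>j\<le>CARD('n). vol_density \<phi> ?u * \<sigma> j (\<phi> ?u) * (sinh ?t ^ j * exp ?t ^ (CARD('n) - j)))"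
        unfolding jac_elem_sym sum_distrib_right by (simp only: mult_ac)
      also have "\<dots> = (\<Sum>j\<le>CARD('n). ennreal (vol_density \<phi> ?u * \<sigma> j (\<phi> ?u) * (sinh ?t ^ j * exp ?t ^ (CARD('n) - j))))"
        by (rule sum_ennreal[symmetric]) (rule mult_nonneg_nonneg[OF mult_nonneg_nonneg[OF v0 s0] e0])
      also have "\<dots> = (\<Sum>j\<le>CARD('n). ennreal (vol_density \<phi> ?u) * ennreal (\<sigma> j (\<phi> ?u)) * ennreal (sinh ?t ^ j * exp ?t ^ (CARD('n) - j)))"
        by (simp only: ennreal_mult''[OF s0] ennreal_mult''[OF e0])
      finally show ?thesis
        using True unfolding dens[OF z] by (simp add: S_def)
    next
      case False
      then have "?u \<notin> B \<or> ?t \<notin> {0<..\<rho>}" by (auto simp: S_def)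
      then show ?thesis using False by (auto simp: indicator_def)
    qed
  qed
  also have "\<dots> = (\<Sum>j\<le>CARD('n). \<integral>\<^sup>+z. ?w j (drop_coord z) * ?e j (z $ None) \<partial>lborel)"
    by (rule nn_integral_sum) (use nn_integral_append_coord(2)[OF w e] in simp)
  also have "\<dots> = (\<Sum>j\<le>CARD('n). (\<integral>\<^sup>+u. ?w j u \<partial>lborel) * (\<integral>\<^sup>+t. ?e j t \<partial>lborel))"
    by (intro sum.cong refl nn_integral_append_coord(1) w e) simp
  finally show "(\<integral>\<^sup>+x\<in>\<psi> ` S. ennreal (vol_density hyp_chart x) \<partial>lborel) =
    (\<Sum>j\<le>CARD('n). (\<integral>\<^sup>+u. ?w j u \<partial>lborel) * (\<integral>\<^sup>+t. ?e j t \<partial>lborel))" .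
qed

lemma integral_steiner:
  "integral {0..\<rho>} (steiner k) = (\<Sum>i=k..CARD('n). real ((CARD('n) - k) choose (i - k)) * curv_integral i \<Omega> *
     integral {0..\<rho>} (\<lambda>t. exp ((real CARD('n) - real k - real i) * t) * sinh t ^ (i - k)))"
proof -
  have "(\<lambda>t. exp ((real CARD('n) - real k - real i) * t) * sinh t ^ (i - k)) integrable_on {0..\<rho>}" for i
    by (intro integrable_continuous_real continuous_intros)
  then show ?thesis
    unfolding steiner_def[abs_def]
    by (subst integral_sum) (auto simp: integrable_on_mult_right)
qed

text \<open>The chart pieces cut the collar into disjoint images of products, whose volumes
  \<open>collar_volume\<close> computes. Volumes may be subtracted because that of
  \<open>\<Omega>\<close> is finite.\<close>

lemma volume_parallel_body:
  assumes \<rho>: "0 \<le> \<rho>"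
  shows "hvol (parallel_body \<Omega> \<rho>) - hvol \<Omega> = integral {0..\<rho>} (steiner 0)"
proof -
  let ?n = "CARD('n)"
  let ?W = "\<lambda>A. {x. hyp_chart x \<in> A}"
  let ?I = "\<lambda>A. \<integral>\<^sup>+x\<in>A. ennreal (vol_density hyp_chart x) \<partial>lborel"
  let ?f = "\<lambda>j t. sinh t ^ j * exp t ^ (?n - j) :: real"
  let ?a = "\<lambda>j. enn2real (A\<sigma> j)"
  let ?E = "\<lambda>j. integral {0..\<rho>} (?f j)"
  obtain m U \<phi> B where ch: "charts m U \<phi> B" by (rule charts_exist)
  then have cp: "chart_partition M m U \<phi> B" and nc: "\<And>i. i < m \<Longrightarrow> nchart (U i) (\<phi> i)"
    by (auto simp: charts_def)
  note cpD = chart_partitionD[OF cp]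
  define \<psi> where "\<psi> i z = fst (\<Phi> (z $ None) (\<phi> i (drop_coord z)))" for i z
  define S where "S i = {z. drop_coord z \<in> B i \<and> z $ None \<in> {0<..\<rho>}}" for i
  note vol = collar_volume[OF nc cpD(2,3), where \<rho> = \<rho>, folded \<psi>_def S_def]
  have inM: "\<phi> i u \<in> M" if "i < m" "u \<in> B i" for i u using cpD(6) that by blast
  have chart: "hyp_chart (\<psi> i z) = \<Phi> (z $ None) (\<phi> i (drop_coord z))" if "i < m" "z \<in> S i" for i z
    unfolding \<psi>_def by (rule hyp_chart_fst[OF \<Phi>_hyp[OF inM[OF that(1)]]]) (use that(2) in \<open>simp add: S_def\<close>)
  have dec: "?W (parallel_body \<Omega> \<rho>) - ?W \<Omega> = (\<Union>i<m. \<psi> i ` S i)"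
  proof (intro set_eqI iffI)
    fix x assume "x \<in> ?W (parallel_body \<Omega> \<rho>) - ?W \<Omega>"
    then have "hyp_chart x \<in> (\<lambda>(t, p). \<Phi> t p) ` ({0<..\<rho>} \<times> M)"
      unfolding parallel_body_decomposition[OF \<rho>, symmetric] by simp
    then obtain t p where tp: "t \<in> {0<..\<rho>}" "p \<in> M" "hyp_chart x = \<Phi> t p" by auto
    then obtain i u where u: "i < m" "u \<in> B i" "p = \<phi> i u" using cpD(6) by blast
    have z: "drop_coord (append_coord (u, t)) = u" "append_coord (u, t) $ None = t" by (simp_all add: vec_eq_iff)
    have "x = fst (hyp_chart x)" by simp
    then have "x = \<psi> i (append_coord (u, t))" unfolding \<psi>_def z tp(3) u(3) .
    moreover have "append_coord (u, t) \<in> S i" unfolding S_def using u tp by (simp add: z del: append_coord_simps)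
    ultimately show "x \<in> (\<Union>i<m. \<psi> i ` S i)" using u(1) by blast
  next
    fix x assume "x \<in> (\<Union>i<m. \<psi> i ` S i)"
    then obtain i z where z: "i < m" "z \<in> S i" "x = \<psi> i z" by blast
    then have "hyp_chart x = (\<lambda>(t, p). \<Phi> t p) (z $ None, \<phi> i (drop_coord z))" using chart by simp
    moreover have "(z $ None, \<phi> i (drop_coord z)) \<in> {0<..\<rho>} \<times> M" using z inM by (auto simp: S_def)
    ultimately have "hyp_chart x \<in> parallel_body \<Omega> \<rho> - \<Omega>"
      unfolding parallel_body_decomposition[OF \<rho>] by (rule image_eqI)
    then show "x \<in> ?W (parallel_body \<Omega> \<rho>) - ?W \<Omega>" by simp
  qed
  have disj: "disjoint_family_on (\<lambda>i. \<psi> i ` S i) {..<m}"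
    unfolding disjoint_family_on_def
  proof (intro ballI impI)
    fix i k assume ik: "i \<in> {..<m}" "k \<in> {..<m}" "i \<noteq> k"
    then have d: "\<phi> i ` B i \<inter> \<phi> k ` B k = {}" using cpD(5) unfolding disjoint_family_on_def by blast
    have False if z: "z \<in> S i" "z' \<in> S k" and eq: "\<psi> i z = \<psi> k z'" for z z'
    proof -
      have B: "drop_coord z \<in> B i" "0 \<le> z $ None" "drop_coord z' \<in> B k" "0 \<le> z' $ None" using z by (auto simp: S_def)
      have i: "i < m" "k < m" using ik by auto
      have "\<Phi> (z $ None) (\<phi> i (drop_coord z)) = \<Phi> (z' $ None) (\<phi> k (drop_coord z'))"
        using chart[OF i(1) z(1)] chart[OF i(2) z(2)] eq by simp
      from \<Phi>_inj(2)[OF inM[OF i(1) B(1)] inM[OF i(2) B(3)] B(2,4) this] show False using d B by blast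
    qed
    then show "\<psi> i ` S i \<inter> \<psi> k ` S k = {}" by blast
  qed
  have v: "(\<lambda>x. ennreal (vol_density hyp_chart x)) \<in> borel_measurable lborel"
  proof -
    have "vol_density hyp_chart \<in> borel_measurable lborel"
      unfolding measurable_lborel2 by (intro borel_measurable_continuous_onI continuous_on_hyp_chart_density)
    then show ?thesis by measurable
  qed
  have sets: "\<psi> i ` S i \<in> sets lborel" if "i < m" for i using vol(1)[OF that that that] by simp
  have "?I (\<Union>i<m. \<psi> i ` S i) = (\<Sum>i<m. ?I (\<psi> i ` S i))"
    by (rule nn_integral_disjoint_union[OF _ _ disj]) (use sets v in \<open>auto intro!: borel_measurable_times_ennreal\<close>)
  also have "\<dots> = (\<Sum>i<m. \<Sum>j\<le>?n. (\<integral>\<^sup>+u\<in>B i. ennreal (vol_density (\<phi> i) u) * ennreal (\<sigma> j (\<phi> i u)) \<partial>lborel) *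
        (\<integral>\<^sup>+t\<in>{0<..\<rho>}. ennreal (?f j t) \<partial>lborel))"
    by (intro sum.cong refl vol(2)) auto
  also have "\<dots> = (\<Sum>j\<le>?n. A\<sigma> j * (\<integral>\<^sup>+t\<in>{0<..\<rho>}. ennreal (?f j t) \<partial>lborel))"
    by (subst sum.swap) (intro sum.cong refl, simp add: A\<sigma>_charts(1)[OF ch] sum_distrib_right)
  also have "\<dots> = (\<Sum>j\<le>?n. ennreal (?a j * ?E j))"
  proof (rule sum.cong[OF refl])
    fix j assume "j \<in> {..?n}"
    then have "A\<sigma> j = ennreal (?a j)" using A\<sigma>_finite by simp
    moreover have "(\<integral>\<^sup>+t\<in>{0<..\<rho>}. ennreal (?f j t) \<partial>lborel) = ennreal (?E j)"
      by (rule nn_integral_Ioc_eq_integral) (auto intro!: continuous_intros)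
    ultimately show "A\<sigma> j * (\<integral>\<^sup>+t\<in>{0<..\<rho>}. ennreal (?f j t) \<partial>lborel) = ennreal (?a j * ?E j)"
      by (simp add: ennreal_mult'[OF enn2real_nonneg])
  qed
  also have "\<dots> = ennreal (\<Sum>j\<le>?n. ?a j * ?E j)"
    by (intro sum_ennreal mult_nonneg_nonneg enn2real_nonneg integral_nonneg integrable_continuous_real continuous_intros) simp_all
  finally have diff: "?I (?W (parallel_body \<Omega> \<rho>) - ?W \<Omega>) = ennreal (\<Sum>j\<le>?n. ?a j * ?E j)" unfolding dec .
  have nonneg: "0 \<le> (\<Sum>j\<le>?n. ?a j * ?E j)"
    by (intro sum_nonneg mult_nonneg_nonneg enn2real_nonneg integral_nonneg integrable_continuous_real continuous_intros) simp_all
  have cl: "?W \<Omega> \<in> sets lborel" "?W (parallel_body \<Omega> \<rho>) \<in> sets lborel"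
    using closed_hyp_chart_vimage[OF domD(4)] closed_hyp_chart_vimage[OF closed_parallel_body[OF \<rho>]]
    by (simp_all add: borel_closed)
  have un: "?W (parallel_body \<Omega> \<rho>) = ?W \<Omega> \<union> (?W (parallel_body \<Omega> \<rho>) - ?W \<Omega>)"
    using sub_parallel_body[OF \<rho>] by blast
  have "?I (?W (parallel_body \<Omega> \<rho>)) = ?I (?W \<Omega>) + ?I (?W (parallel_body \<Omega> \<rho>) - ?W \<Omega>)"
    by (subst un) (rule nn_integral_disjoint_pair[OF v cl(1) sets.Diff[OF cl(2,1)]], blast)
  then have "hvol (parallel_body \<Omega> \<rho>) = enn2real (?I (?W \<Omega>) + ennreal (\<Sum>j\<le>?n. ?a j * ?E j))"
    unfolding hvol_eq_nn_integral[OF closed_parallel_body[OF \<rho>]] diff by simp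
  also have "\<dots> = hvol \<Omega> + (\<Sum>j\<le>?n. ?a j * ?E j)"
    using hvol_compact_finite[OF domD(2,1)] nonneg
    by (subst enn2real_plus) (simp_all add: hvol_eq_nn_integral[OF domD(4)])
  also have "(\<Sum>j\<le>?n. ?a j * ?E j) = integral {0..\<rho>} (steiner 0)"
  proof -
    have "?a j * ?E j = real (?n choose j) * curv_integral j \<Omega> *
      integral {0..\<rho>} (\<lambda>t. exp ((real ?n - real j) * t) * sinh t ^ j)" if j: "j \<le> ?n" for j
    proof -
      have f: "(\<lambda>t. exp ((real ?n - real j) * t) * sinh t ^ j) = ?f j"
        using j by (intro ext) (simp add: exp_of_nat_mult[symmetric] of_nat_diff)
      have a: "?a j = real (?n choose j) * curv_integral j \<Omega>"
        using j by (simp add: curv_integral_eq[OF j])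
      show ?thesis unfolding f a ..
    qed
    then show ?thesis unfolding integral_steiner atMost_atLeast0 by (intro sum.cong) auto
  qed
  finally show ?thesis by simp
qed

section \<open>Modified quermassintegrals of parallel bodies\<close>

text \<open>Both ends are evaluated through \<open>curv_integral_parallel\<close>; integrating
  \<open>steiner_derivative\<close> replaces the evolution of the hypersurfaces by a one-variable
  computation.\<close>

lemma steiner_fundamental_theorem:
  assumes k: "k < CARD('n)" and \<rho>: "0 \<le> \<rho>"
  shows "curv_integral k (parallel_body \<Omega> \<rho>) - curv_integral k \<Omega> =
    (real CARD('n) - 2 * real k) * integral {0..\<rho>} (steiner k) +
    (real CARD('n) - real k) * integral {0..\<rho>} (steiner (Suc k))"
proof -
  let ?D = "\<lambda>t. (real CARD('n) - 2 * real k) * steiner k t + (real CARD('n) - real k) * steiner (Suc k) t"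
  have c: "steiner j integrable_on {0..\<rho>}" for j
    unfolding steiner_def[abs_def] by (intro integrable_continuous_real continuous_intros)
  have "(?D has_integral steiner k \<rho> - steiner k 0) {0..\<rho>}"
    using steiner_derivative[OF k] \<rho>
    by (intro fundamental_theorem_of_calculus)
      (auto simp: has_real_derivative_iff_has_vector_derivative intro: has_vector_derivative_at_within)
  then have "steiner k \<rho> - steiner k 0 = integral {0..\<rho>} ?D" by (simp add: integral_unique)
  also have "\<dots> = (real CARD('n) - 2 * real k) * integral {0..\<rho>} (steiner k) +
    (real CARD('n) - real k) * integral {0..\<rho>} (steiner (Suc k))"
    using c by (subst integral_add) (auto simp: integrable_on_mult_right)
  finally show ?thesis
    using curv_integral_parallel[OF \<rho>, of k] curv_integral_parallel[of 0 k] k by (simp add: parallel_body_0)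
qed

lemma area_parallel_body:
  assumes "0 \<le> \<rho>"
  shows "measure (area_measure (hbd (parallel_body \<Omega> \<rho>))) (hbd (parallel_body \<Omega> \<rho>)) = curv_integral 0 (parallel_body \<Omega> \<rho>)"
proof (cases "\<rho> = 0")
  case True
  obtain m U \<phi> B where "charts m U \<phi> B" by (rule charts_exist)
  then have cp: "chart_partition M m U \<phi> B" by (simp add: charts_def)
  have "space (area_measure M) = M"
    using sets_eq_imp_space_eq[OF area_measure_nn_integral(1)[OF cp closed_M M_hyp]] by (simp add: space_restrict_space)
  then show ?thesis unfolding True parallel_body_0 by (rule area_eq_curv_integral_0[OF _ refl])
next
  case False
  then have "0 < \<rho>" using assms by simp
  from elem_sym_integral_parallel(4)[OF this le0] show ?thesis by (rule area_eq_curv_integral_0[OF _ refl])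
qed

text \<open>Dividing the integrated identity by \<open>n - k\<close> and subtracting
  \<open>(n - 2 k) / (n - k)\<close> times the formula of order \<open>k\<close> leaves exactly the
  integral of \<open>steiner (k + 1)\<close>.\<close>

lemma quermass_parallel_body:
  assumes \<rho>: "0 \<le> \<rho>" and k: "k \<le> CARD('n)"
  shows "quermass k (parallel_body \<Omega> \<rho>) - quermass k \<Omega> = integral {0..\<rho>} (steiner k)"
  using k
proof (induction k)
  case 0
  then show ?case using volume_parallel_body[OF \<rho>] by simp
next
  case (Suc k)
  let ?n = "real CARD('n)"
  have k: "k < CARD('n)" using Suc.prems by simp
  then have n: "?n - real k \<noteq> 0" "?n \<noteq> 0" by auto
  note FT = steiner_fundamental_theorem[OF k \<rho>]
  note IH = Suc.IH[OF less_imp_le[OF k]]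
  show ?case
  proof (cases k)
    case 0
    \<comment> \<open>The case of \<open>quermass 1\<close> has its own defining equation; it is the
      recursion at \<open>k = 0\<close>, with the area as curvature integral of order 0 and the
      factor \<open>(n - 2 k) / (n - k)\<close> equal to 1.\<close>
    have "measure (area_measure M) M = curv_integral 0 \<Omega>"
      using area_parallel_body[of 0] by (simp add: parallel_body_0)
    then have "quermass (Suc k) (parallel_body \<Omega> \<rho>) - quermass (Suc k) \<Omega> =
      (curv_integral 0 (parallel_body \<Omega> \<rho>) - curv_integral 0 \<Omega>) / ?n - integral {0..\<rho>} (steiner 0)"
      using area_parallel_body[OF \<rho>] IH 0 by (simp add: diff_divide_distrib)
    also have "\<dots> = (?n * integral {0..\<rho>} (steiner 0) + ?n * integral {0..\<rho>} (steiner (Suc 0))) / ?n - integral {0..\<rho>} (steiner 0)"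
      using FT 0 by simp
    also have "\<dots> = integral {0..\<rho>} (steiner (Suc 0))" using n(2) by (simp add: add_divide_distrib)
    finally show ?thesis using 0 by simp
  next
    case (Suc j)
    have "quermass (Suc k) (parallel_body \<Omega> \<rho>) - quermass (Suc k) \<Omega> =
      (curv_integral k (parallel_body \<Omega> \<rho>) - curv_integral k \<Omega>) / (?n - real k) -
      (?n - 2 * real k) / (?n - real k) * (quermass k (parallel_body \<Omega> \<rho>) - quermass k \<Omega>)"
      unfolding Suc quermass.simps(3) Let_def by (simp only: diff_divide_distrib right_diff_distrib)
    also have "\<dots> = ((?n - 2 * real k) * integral {0..\<rho>} (steiner k) + (?n - real k) * integral {0..\<rho>} (steiner (Suc k))) / (?n - real k) -
      (?n - 2 * real k) / (?n - real k) * integral {0..\<rho>} (steiner k)"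
      unfolding FT IH ..
    also have "\<dots> = integral {0..\<rho>} (steiner (Suc k))" using n(1) by (simp add: add_divide_distrib)
    finally show ?thesis .
  qed
qed

end

theorem theorem6p3:
  fixes \<Omega> :: "('n::finite) minkowski set" and \<rho> :: real and n k :: nat
  assumes "n = CARD('n)"
    and "smooth_bounded_domain \<Omega>"
    and "uniformly_h_convex \<Omega>"
    and "0 \<le> \<rho>"
    and "k \<le> n"
  shows "quermass k (parallel_body \<Omega> \<rho>) - quermass k \<Omega> =
    (\<Sum>i=k..n. real ((n - k) choose (i - k)) * curv_integral i \<Omega> *
       integral {0..\<rho>} (\<lambda>t. exp ((real n - real k - real i) * t) * sinh t ^ (i - k)))"
proof -
  interpret h_convex_domain \<Omega> by (unfold_locales) fact+
  show ?thesis using quermass_parallel_body[OF assms(4)] assms(1,5) integral_steiner by simp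
qed

end
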